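(* Let $\mathcal{E}$ be a vector bundle of rank two on the projective space $\mathbb{P}^n$ over $\mathbb{C}$. Let $m$ be an integer such that $H^0(\mathbb{P}^n,\mathcal{E}(m-1))=0$ and $H^0(\mathbb{P}^n,\mathcal{E}(m))\neq 0$. Then $\mathcal{E}$ splits as a direct sum of line bundles if and only if $H^i(\mathbb{P}^n,\mathcal{E}(m-1-i))=0$ for all integers $i$ with $0<i<n$.
   Context: Varieties are over $\mathbb{C}$; $\mathcal{E}(t)=\mathcal{E}\otimes\mathcal{O}_{\mathbb{P}^n}(t)$. *)

theory Defs
  imports
    "HOL-Analysis.Abstract_Topology"
    "HOL-Algebra.Module"
    "HOL-Algebra.Free_Abelian_Groups"
begin

section \<open>Projective space as a classical variety\<close>

text \<open>
  Vectors of \<open>\<complex>\<^sup>n\<^sup>+\<^sup>1\<close> are functions \<open>v :: nat \<Rightarrow> complex\<close> with \<open>v i = 0\<close> for \<open>i > n\<close>.  A point of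
  \<open>\<P>\<^sup>n\<close> is a line through the origin with the origin removed, so that the affine cone over a
  set \<open>U\<close> of points is \<open>\<Union>U\<close>.
\<close>

type_synonym point = "(nat \<Rightarrow> complex) set"

definition line_through :: "(nat \<Rightarrow> complex) \<Rightarrow> point" where
  "line_through v = {(\<lambda>i. c * v i) | c. c \<noteq> 0}"

definition proj_space :: "nat \<Rightarrow> point set" where
  "proj_space n = {line_through v | v. (\<exists>i. v i \<noteq> 0) \<and> (\<forall>i>n. v i = 0)}"

text \<open>
  Homogeneous polynomials of degree \<open>d\<close> in the coordinates \<open>v 0, \<dots>, v n\<close>, as polynomial
  functions (which determine the polynomial, \<open>\<complex>\<close> being infinite).  The zero polynomial is
  homogeneous of every degree.
\<close>

definition hom_poly :: "nat \<Rightarrow> nat \<Rightarrow> ((nat \<Rightarrow> complex) \<Rightarrow> complex) \<Rightarrow> bool" where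
  "hom_poly n d f \<longleftrightarrow>
     (\<exists>(A :: (nat \<Rightarrow> nat) set) c. finite A \<and> (\<forall>a\<in>A. (\<Sum>i\<le>n. a i) = d) \<and>
        f = (\<lambda>v. \<Sum>a\<in>A. c a * (\<Prod>i\<le>n. v i ^ a i)))"

definition zariski_open :: "nat \<Rightarrow> point set \<Rightarrow> bool" where
  "zariski_open n U \<longleftrightarrow>
     (\<exists>S. (\<forall>f\<in>S. \<exists>d. hom_poly n d f) \<and>
        U = proj_space n - {p \<in> proj_space n. \<forall>f\<in>S. \<forall>v\<in>p. f v = 0})"

definition zariski :: "nat \<Rightarrow> point topology" where
  "zariski n = topology (zariski_open n)"

lemma hom_poly_mult:
  assumes "hom_poly n d f" "hom_poly n e g"
  shows "hom_poly n (d + e) (\<lambda>v. f v * g v)"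
proof -
  obtain A c where A: "finite A" "\<forall>a\<in>A. (\<Sum>i\<le>n. a i) = d"
    and f: "f = (\<lambda>v. \<Sum>a\<in>A. c a * (\<Prod>i\<le>n. v i ^ a i))"
    using assms(1) unfolding hom_poly_def by blast
  obtain B b where B: "finite B" "\<forall>a\<in>B. (\<Sum>i\<le>n. a i) = e"
    and g: "g = (\<lambda>v. \<Sum>a\<in>B. b a * (\<Prod>i\<le>n. v i ^ a i))"
    using assms(2) unfolding hom_poly_def by blast
  define h :: "(nat \<Rightarrow> nat) \<times> (nat \<Rightarrow> nat) \<Rightarrow> nat \<Rightarrow> nat"
    where "h = (\<lambda>p i. fst p i + snd p i)"
  define k where "k = (\<lambda>y. \<Sum>p\<in>{p \<in> A \<times> B. h p = y}. c (fst p) * b (snd p))"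
  have fin: "finite (A \<times> B)"
    using A B by simp
  have "f v * g v = (\<Sum>y\<in>h ` (A \<times> B). k y * (\<Prod>i\<le>n. v i ^ y i))" for v
  proof -
    have "f v * g v =
        (\<Sum>p\<in>A \<times> B. c (fst p) * b (snd p) * (\<Prod>i\<le>n. v i ^ h p i))"
      unfolding f g sum_product sum.cartesian_product
      by (rule sum.cong) (auto simp: h_def power_add prod.distrib)
    also have "\<dots> = (\<Sum>y\<in>h ` (A \<times> B). \<Sum>p\<in>{p \<in> A \<times> B. h p = y}.
        c (fst p) * b (snd p) * (\<Prod>i\<le>n. v i ^ h p i))"
      by (rule sum.image_gen[OF fin])
    also have "\<dots> = (\<Sum>y\<in>h ` (A \<times> B). k y * (\<Prod>i\<le>n. v i ^ y i))"
      unfolding k_def sum_distrib_right by (intro sum.cong) auto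
    finally show ?thesis .
  qed
  moreover have "\<forall>y\<in>h ` (A \<times> B). (\<Sum>i\<le>n. y i) = d + e"
    using A B by (auto simp: h_def sum.distrib)
  ultimately show ?thesis
    unfolding hom_poly_def using fin by blast
qed

lemma hom_poly_scale:
  assumes "hom_poly n d f"
  shows "f (\<lambda>i. c * v i) = c ^ d * f v"
proof -
  obtain A b where A: "\<forall>a\<in>A. (\<Sum>i\<le>n. a i) = d"
    and f: "f = (\<lambda>v. \<Sum>a\<in>A. b a * (\<Prod>i\<le>n. v i ^ a i))"
    using assms unfolding hom_poly_def by blast
  have "b a * (\<Prod>i\<le>n. (c * v i) ^ a i) = c ^ d * (b a * (\<Prod>i\<le>n. v i ^ a i))" if "a \<in> A" for a
    using A that by (simp add: power_mult_distrib prod.distrib flip: power_sum)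
  then show ?thesis
    unfolding f sum_distrib_left by (intro sum.cong) auto
qed

lemma istopology_zariski_open: "istopology (zariski_open n)"
proof -
  define D where "D S = proj_space n - {p \<in> proj_space n. \<forall>f\<in>S. \<forall>v\<in>p. f v = 0}"
    for S :: "((nat \<Rightarrow> complex) \<Rightarrow> complex) set"
  define homog where "homog S \<longleftrightarrow> (\<forall>f\<in>S. \<exists>d. hom_poly n d f)" for S
  have open_iff: "zariski_open n U \<longleftrightarrow> (\<exists>S. homog S \<and> U = D S)" for U
    unfolding zariski_open_def D_def homog_def ..
  have mem: "p \<in> D S \<longleftrightarrow> p \<in> proj_space n \<and> (\<exists>f\<in>S. \<exists>v\<in>p. f v \<noteq> 0)" for p S
    unfolding D_def by blast
  have inter: "zariski_open n (D S \<inter> D T)" if S: "homog S" and T: "homog T" for S T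
  proof -
    define P where "P = {(\<lambda>v. f v * g v) | f g. f \<in> S \<and> g \<in> T}"
    have "homog P"
      unfolding homog_def
    proof
      fix k assume "k \<in> P"
      then obtain f g where k: "k = (\<lambda>v. f v * g v)" "f \<in> S" "g \<in> T"
        unfolding P_def by blast
      then obtain d e where "hom_poly n d f" "hom_poly n e g"
        using S T unfolding homog_def by blast
      then show "\<exists>d. hom_poly n d k"
        unfolding k(1) by (intro exI[of _ "d + e"] hom_poly_mult)
    qed
    moreover have "p \<in> D S \<inter> D T \<longleftrightarrow> p \<in> D P" for p
    proof
      assume "p \<in> D S \<inter> D T"
      then obtain f v g w where P: "p \<in> proj_space n"
        and fg: "f \<in> S" "v \<in> p" "f v \<noteq> 0" "g \<in> T" "w \<in> p" "g w \<noteq> 0"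
        unfolding Int_iff mem by blast
      obtain u where u: "p = line_through u"
        using P unfolding proj_space_def by blast
      obtain a b where ab: "v = (\<lambda>i. a * u i)" "w = (\<lambda>i. b * u i)"
        using fg(2,5) unfolding u line_through_def by blast
      obtain d e where de: "hom_poly n d f" "hom_poly n e g"
        using S T fg(1,4) unfolding homog_def by blast
      have "f u \<noteq> 0" "g u \<noteq> 0"
        using fg(3,6) hom_poly_scale[OF de(1), of a u] hom_poly_scale[OF de(2), of b u]
        unfolding ab by auto
      then have "f u * g u \<noteq> 0"
        by simp
      moreover have "u \<in> p"
        unfolding u line_through_def by (auto intro!: exI[of _ 1])
      moreover have "(\<lambda>v. f v * g v) \<in> P"
        using fg(1,4) unfolding P_def by blast
      ultimately show "p \<in> D P"
        unfolding mem using P by (intro conjI bexI[of _ "\<lambda>v. f v * g v"] bexI[of _ u])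
    next
      assume "p \<in> D P"
      then obtain f g v where p: "p \<in> proj_space n" "f \<in> S" "g \<in> T" "v \<in> p" "f v * g v \<noteq> 0"
        unfolding mem P_def by blast
      then have "f v \<noteq> 0" "g v \<noteq> 0"
        by auto
      with p(1-4) show "p \<in> D S \<inter> D T"
        unfolding Int_iff mem by blast
    qed
    ultimately show ?thesis
      unfolding open_iff by blast
  qed
  have union: "zariski_open n (\<Union>K)" if K: "\<And>U. U \<in> K \<Longrightarrow> \<exists>S. homog S \<and> U = D S" for K
  proof -
    define T where "T = \<Union>{S. homog S \<and> D S \<in> K}"
    have "homog T"
      unfolding T_def homog_def by blast
    moreover have "p \<in> \<Union>K \<longleftrightarrow> p \<in> D T" for p
    proof
      assume "p \<in> \<Union>K"
      then obtain U where U: "U \<in> K" "p \<in> U"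
        by blast
      then obtain S where S: "homog S" "U = D S"
        using K by blast
      then have "S \<subseteq> T"
        using U(1) unfolding T_def by blast
      then show "p \<in> D T"
        using U(2) unfolding S(2) mem by blast
    next
      assume "p \<in> D T"
      then obtain S where "homog S" "D S \<in> K" "p \<in> D S"
        unfolding mem T_def by blast
      then show "p \<in> \<Union>K"
        by blast
    qed
    ultimately show ?thesis
      unfolding open_iff by blast
  qed
  show ?thesis
    unfolding istopology_def
  proof (intro conjI allI impI)
    fix U V assume "zariski_open n U" "zariski_open n V"
    then obtain S T where "homog S" "U = D S" "homog T" "V = D T"
      unfolding open_iff by metis
    then show "zariski_open n (U \<inter> V)"
      by (simp only: inter)
  next
    fix K assume K: "\<forall>U\<in>K. zariski_open n U"
    show "zariski_open n (\<Union>K)"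
      by (rule union) (use K in \<open>simp only: open_iff\<close>)
  qed
qed

lemma openin_zariski [simp]: "openin (zariski n) = zariski_open n"
  unfolding zariski_def by (rule topology_inverse'[OF istopology_zariski_open])


section \<open>Sheaves of modules\<close>

definition regular_fun :: "nat \<Rightarrow> point set \<Rightarrow> (point \<Rightarrow> complex) \<Rightarrow> bool" where
  "regular_fun n U f \<longleftrightarrow>
     (\<forall>p\<in>U. \<exists>V d g h. openin (zariski n) V \<and> p \<in> V \<and> V \<subseteq> U \<and> hom_poly n d g \<and> hom_poly n d h \<and>
        (\<forall>q\<in>V. \<forall>v\<in>q. h v \<noteq> 0 \<and> f q = g v / h v))"

text \<open>The ring \<open>\<O>(U)\<close>; restriction to \<open>V\<close> is \<open>\<lambda>f. restrict f V\<close>.\<close>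

definition reg_ring :: "nat \<Rightarrow> point set \<Rightarrow> (point \<Rightarrow> complex) ring" where
  "reg_ring n U =
     \<lparr>carrier = {f \<in> extensional U. regular_fun n U f},
      monoid.mult = (\<lambda>f g. \<lambda>p\<in>U. f p * g p), one = (\<lambda>p\<in>U. 1),
      ring.zero = (\<lambda>p\<in>U. 0), add = (\<lambda>f g. \<lambda>p\<in>U. f p + g p)\<rparr>"

text \<open>
  Sections and restriction maps \<open>res F U V :: F(U) \<rightarrow> F(V)\<close>; only open \<open>V \<subseteq> U\<close> matter.  The fields
  \<open>mult\<close> and \<open>one\<close>, which the library's module record inherits from rings, play no role for
  modules and are left \<open>undefined\<close> throughout.
\<close>

record 'a presheaf =
  sec :: "point set \<Rightarrow> (point \<Rightarrow> complex, 'a) module"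
  res :: "point set \<Rightarrow> point set \<Rightarrow> 'a \<Rightarrow> 'a"

definition presheaf_of_modules :: "nat \<Rightarrow> 'a presheaf \<Rightarrow> bool" where
  "presheaf_of_modules n F \<longleftrightarrow>
     (\<forall>U. openin (zariski n) U \<longrightarrow>
        Module.module (reg_ring n U) (sec F U) \<and>
        (\<forall>s\<in>carrier (sec F U). res F U U s = s)) \<and>
     (\<forall>U V. openin (zariski n) U \<longrightarrow> openin (zariski n) V \<longrightarrow> V \<subseteq> U \<longrightarrow>
        (\<forall>s\<in>carrier (sec F U). res F U V s \<in> carrier (sec F V)) \<and>
        (\<forall>s\<in>carrier (sec F U). \<forall>t\<in>carrier (sec F U).
           res F U V (s \<oplus>\<^bsub>sec F U\<^esub> t) = res F U V s \<oplus>\<^bsub>sec F V\<^esub> res F U V t) \<and>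
        (\<forall>a\<in>carrier (reg_ring n U). \<forall>s\<in>carrier (sec F U).
           res F U V (a \<odot>\<^bsub>sec F U\<^esub> s) = restrict a V \<odot>\<^bsub>sec F V\<^esub> res F U V s) \<and>
        (\<forall>W. openin (zariski n) W \<longrightarrow> W \<subseteq> V \<longrightarrow>
           (\<forall>s\<in>carrier (sec F U). res F V W (res F U V s) = res F U W s)))"

definition sheaf_of_modules :: "nat \<Rightarrow> 'a presheaf \<Rightarrow> bool" where
  "sheaf_of_modules n F \<longleftrightarrow>
     presheaf_of_modules n F \<and>
     (\<forall>K. (\<forall>U\<in>K. openin (zariski n) U) \<longrightarrow>
        (\<forall>s\<in>carrier (sec F (\<Union>K)). \<forall>t\<in>carrier (sec F (\<Union>K)).
           (\<forall>U\<in>K. res F (\<Union>K) U s = res F (\<Union>K) U t) \<longrightarrow> s = t) \<and>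
        (\<forall>s. (\<forall>U\<in>K. s U \<in> carrier (sec F U)) \<longrightarrow>
             (\<forall>U\<in>K. \<forall>V\<in>K. res F U (U \<inter> V) (s U) = res F V (U \<inter> V) (s V)) \<longrightarrow>
             (\<exists>t\<in>carrier (sec F (\<Union>K)). \<forall>U\<in>K. res F (\<Union>K) U t = s U)))"

text \<open>\<open>\<phi>\<close> is an isomorphism between the restrictions of \<open>F\<close> and \<open>G\<close> to the open set \<open>X\<close>.\<close>

definition is_iso_on ::
  "nat \<Rightarrow> point set \<Rightarrow> 'a presheaf \<Rightarrow> 'b presheaf \<Rightarrow> (point set \<Rightarrow> 'a \<Rightarrow> 'b) \<Rightarrow> bool" where
  "is_iso_on n X F G \<phi> \<longleftrightarrow>
     (\<forall>U. openin (zariski n) U \<longrightarrow> U \<subseteq> X \<longrightarrow>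
        bij_betw (\<phi> U) (carrier (sec F U)) (carrier (sec G U)) \<and>
        (\<forall>s\<in>carrier (sec F U). \<forall>t\<in>carrier (sec F U).
           \<phi> U (s \<oplus>\<^bsub>sec F U\<^esub> t) = \<phi> U s \<oplus>\<^bsub>sec G U\<^esub> \<phi> U t) \<and>
        (\<forall>a\<in>carrier (reg_ring n U). \<forall>s\<in>carrier (sec F U).
           \<phi> U (a \<odot>\<^bsub>sec F U\<^esub> s) = a \<odot>\<^bsub>sec G U\<^esub> \<phi> U s) \<and>
        (\<forall>V. openin (zariski n) V \<longrightarrow> V \<subseteq> U \<longrightarrow>
           (\<forall>s\<in>carrier (sec F U). \<phi> V (res F U V s) = res G U V (\<phi> U s))))"

definition isomorphic_on :: "nat \<Rightarrow> point set \<Rightarrow> 'a presheaf \<Rightarrow> 'b presheaf \<Rightarrow> bool" where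
  "isomorphic_on n X F G \<longleftrightarrow> (\<exists>\<phi>. is_iso_on n X F G \<phi>)"

definition direct_sum :: "'a presheaf \<Rightarrow> 'b presheaf \<Rightarrow> ('a \<times> 'b) presheaf" where
  "direct_sum F G =
     \<lparr>sec = (\<lambda>U. \<lparr>carrier = carrier (sec F U) \<times> carrier (sec G U),
        monoid.mult = undefined, one = undefined,
        ring.zero = (\<zero>\<^bsub>sec F U\<^esub>, \<zero>\<^bsub>sec G U\<^esub>),
        add = (\<lambda>(s, t) (s', t'). (s \<oplus>\<^bsub>sec F U\<^esub> s', t \<oplus>\<^bsub>sec G U\<^esub> t')),
        smult = (\<lambda>a (s, t). (a \<odot>\<^bsub>sec F U\<^esub> s, a \<odot>\<^bsub>sec G U\<^esub> t))\<rparr>),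
      res = (\<lambda>U V (s, t). (res F U V s, res G U V t))\<rparr>"

text \<open>The free sheaf \<open>\<O>\<^sup>r\<close>.\<close>

definition free_sheaf :: "nat \<Rightarrow> nat \<Rightarrow> (nat \<Rightarrow> point \<Rightarrow> complex) presheaf" where
  "free_sheaf n r =
     \<lparr>sec = (\<lambda>U. \<lparr>carrier = {..<r} \<rightarrow>\<^sub>E carrier (reg_ring n U),
        monoid.mult = undefined, one = undefined,
        ring.zero = (\<lambda>j\<in>{..<r}. \<zero>\<^bsub>reg_ring n U\<^esub>),
        add = (\<lambda>s t. \<lambda>j\<in>{..<r}. s j \<oplus>\<^bsub>reg_ring n U\<^esub> t j),
        smult = (\<lambda>a s. \<lambda>j\<in>{..<r}. a \<otimes>\<^bsub>reg_ring n U\<^esub> s j)\<rparr>),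
      res = (\<lambda>U V s. \<lambda>j\<in>{..<r}. restrict (s j) V)\<rparr>"

text \<open>A vector bundle of rank \<open>r\<close> on \<open>\<P>\<^sup>n\<close>, as the locally free sheaf of its sections.\<close>

definition vector_bundle :: "nat \<Rightarrow> nat \<Rightarrow> 'a presheaf \<Rightarrow> bool" where
  "vector_bundle n r E \<longleftrightarrow>
     sheaf_of_modules n E \<and>
     (\<forall>p\<in>proj_space n. \<exists>U. openin (zariski n) U \<and> p \<in> U \<and> isomorphic_on n U E (free_sheaf n r))"

abbreviation line_bundle :: "nat \<Rightarrow> 'a presheaf \<Rightarrow> bool" where
  "line_bundle n \<equiv> vector_bundle n 1"

text \<open>
  The summands may be taken with sections of the same type \<open>'a\<close> as those of \<open>E\<close>: a summand of
  \<open>E\<close> is isomorphic to a subsheaf of \<open>E\<close>.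
\<close>

definition splits :: "nat \<Rightarrow> 'a presheaf \<Rightarrow> bool" where
  "splits n E \<longleftrightarrow>
     (\<exists>(L :: 'a presheaf) (M :: 'a presheaf). line_bundle n L \<and> line_bundle n M \<and>
        isomorphic_on n (proj_space n) E (direct_sum L M))"


section \<open>Sheafification\<close>

text \<open>The germ at \<open>p\<close> of a section \<open>s\<close> over \<open>U\<close>, as an equivalence class of pairs \<open>(V, t)\<close>.\<close>

definition germ :: "nat \<Rightarrow> 'a presheaf \<Rightarrow> point \<Rightarrow> point set \<Rightarrow> 'a \<Rightarrow> (point set \<times> 'a) set" where
  "germ n F p U s =
     {(V, t). openin (zariski n) V \<and> p \<in> V \<and> t \<in> carrier (sec F V) \<and>
        (\<exists>W. openin (zariski n) W \<and> p \<in> W \<and> W \<subseteq> U \<inter> V \<and> res F U W s = res F V W t)}"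

text \<open>
  Operations on germs, via representatives: the unions are over all representatives, and all
  members of the union are equal.
\<close>

definition germ_add ::
  "nat \<Rightarrow> 'a presheaf \<Rightarrow> point \<Rightarrow> (point set \<times> 'a) set \<Rightarrow> (point set \<times> 'a) set \<Rightarrow>
     (point set \<times> 'a) set" where
  "germ_add n F p x y =
     (\<Union>(U, s)\<in>x. \<Union>(V, t)\<in>y.
        germ n F p (U \<inter> V) (res F U (U \<inter> V) s \<oplus>\<^bsub>sec F (U \<inter> V)\<^esub> res F V (U \<inter> V) t))"

definition germ_smult ::
  "nat \<Rightarrow> 'a presheaf \<Rightarrow> point \<Rightarrow> point set \<Rightarrow> (point \<Rightarrow> complex) \<Rightarrow> (point set \<times> 'a) set \<Rightarrow>
     (point set \<times> 'a) set" where
  "germ_smult n F p U a x =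
     (\<Union>(V, t)\<in>x.
        germ n F p (U \<inter> V) (restrict a (U \<inter> V) \<odot>\<^bsub>sec F (U \<inter> V)\<^esub> res F V (U \<inter> V) t))"

text \<open>
  The sheaf associated to \<open>F\<close>: a section over \<open>U\<close> assigns to each \<open>p \<in> U\<close> a germ at \<open>p\<close>, locally
  the germs of a single section of \<open>F\<close>.
\<close>

definition sheafify :: "nat \<Rightarrow> 'a presheaf \<Rightarrow> (point \<Rightarrow> (point set \<times> 'a) set) presheaf" where
  "sheafify n F =
     \<lparr>sec = (\<lambda>U. \<lparr>carrier = {\<sigma> \<in> extensional U. \<forall>p\<in>U. \<exists>V. openin (zariski n) V \<and> p \<in> V \<and> V \<subseteq> U \<and>
          (\<exists>s\<in>carrier (sec F V). \<forall>q\<in>V. \<sigma> q = germ n F q V s)},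
        monoid.mult = undefined, one = undefined,
        ring.zero = (\<lambda>p\<in>U. germ n F p U \<zero>\<^bsub>sec F U\<^esub>),
        add = (\<lambda>\<sigma> \<tau>. \<lambda>p\<in>U. germ_add n F p (\<sigma> p) (\<tau> p)),
        smult = (\<lambda>a \<sigma>. \<lambda>p\<in>U. germ_smult n F p U a (\<sigma> p))\<rparr>),
      res = (\<lambda>U V \<sigma>. restrict \<sigma> V)\<rparr>"


section \<open>Tensor products and twists\<close>

text \<open>
  \<open>M \<otimes>\<^sub>R N\<close> is the quotient of the free abelian group on \<open>M \<times> N\<close> by the subgroup generated by the
  bilinearity relations.
\<close>

definition tensor_rel ::
  "'r ring \<Rightarrow> ('r, 'a) module \<Rightarrow> ('r, 'b) module \<Rightarrow> ('a \<times> 'b \<Rightarrow>\<^sub>0 int) set" where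
  "tensor_rel R M N =
     generate (free_Abelian_group (carrier M \<times> carrier N))
       ({frag_of (x \<oplus>\<^bsub>M\<^esub> x', y) - frag_of (x, y) - frag_of (x', y) | x x' y.
           x \<in> carrier M \<and> x' \<in> carrier M \<and> y \<in> carrier N} \<union>
        {frag_of (x, y \<oplus>\<^bsub>N\<^esub> y') - frag_of (x, y) - frag_of (x, y') | x y y'.
           x \<in> carrier M \<and> y \<in> carrier N \<and> y' \<in> carrier N} \<union>
        {frag_of (a \<odot>\<^bsub>M\<^esub> x, y) - frag_of (x, a \<odot>\<^bsub>N\<^esub> y) | a x y.
           a \<in> carrier R \<and> x \<in> carrier M \<and> y \<in> carrier N})"

text \<open>
  The map of tensor products that sends the class of \<open>(x, y)\<close> to the class of \<open>(f x, g y)\<close>, where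
  \<open>M\<close>, \<open>N\<close> belong to the target: the image of a coset \<open>C\<close> is the coset of the image of any of its
  members.
\<close>

definition tensor_map ::
  "'r ring \<Rightarrow> ('r, 'a) module \<Rightarrow> ('r, 'b) module \<Rightarrow> ('c \<Rightarrow> 'a) \<Rightarrow> ('d \<Rightarrow> 'b) \<Rightarrow>
     ('c \<times> 'd \<Rightarrow>\<^sub>0 int) set \<Rightarrow> ('a \<times> 'b \<Rightarrow>\<^sub>0 int) set" where
  "tensor_map R M N f g C =
     (\<Union>z\<in>C. tensor_rel R M N #>\<^bsub>free_Abelian_group (carrier M \<times> carrier N)\<^esub>
        frag_extend (\<lambda>(x, y). frag_of (f x, g y)) z)"

definition tensor_module ::
  "'r ring \<Rightarrow> ('r, 'a) module \<Rightarrow> ('r, 'b) module \<Rightarrow> ('r, ('a \<times> 'b \<Rightarrow>\<^sub>0 int) set) module" where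
  "tensor_module R M N =
     (let Q = free_Abelian_group (carrier M \<times> carrier N) Mod tensor_rel R M N in
      \<lparr>carrier = carrier Q, monoid.mult = undefined, one = undefined,
       ring.zero = \<one>\<^bsub>Q\<^esub>, add = (\<otimes>\<^bsub>Q\<^esub>),
       smult = (\<lambda>a. tensor_map R M N (\<lambda>x. a \<odot>\<^bsub>M\<^esub> x) (\<lambda>y. y))\<rparr>)"

definition tensor_presheaf ::
  "nat \<Rightarrow> 'a presheaf \<Rightarrow> 'b presheaf \<Rightarrow> ('a \<times> 'b \<Rightarrow>\<^sub>0 int) set presheaf" where
  "tensor_presheaf n F G =
     \<lparr>sec = (\<lambda>U. tensor_module (reg_ring n U) (sec F U) (sec G U)),
      res = (\<lambda>U V. tensor_map (reg_ring n V) (sec F V) (sec G V) (res F U V) (res G U V))\<rparr>"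

definition tensor_sheaf ::
  "nat \<Rightarrow> 'a presheaf \<Rightarrow> 'b presheaf \<Rightarrow>
     (point \<Rightarrow> (point set \<times> ('a \<times> 'b \<Rightarrow>\<^sub>0 int) set) set) presheaf" where
  "tensor_sheaf n F G = sheafify n (tensor_presheaf n F G)"

text \<open>
  \<open>\<O>(t)\<close>: its sections over \<open>U\<close> are the functions on the cone over \<open>U\<close> that are locally quotients
  \<open>g / h\<close> of homogeneous polynomials with \<open>deg g - deg h = t\<close>.
\<close>

definition O_twist :: "nat \<Rightarrow> int \<Rightarrow> ((nat \<Rightarrow> complex) \<Rightarrow> complex) presheaf" where
  "O_twist n t =
     \<lparr>sec = (\<lambda>U. \<lparr>carrier = {f \<in> extensional (\<Union>U). \<forall>p\<in>U. \<exists>V d e g h.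
          openin (zariski n) V \<and> p \<in> V \<and> V \<subseteq> U \<and>
          hom_poly n d g \<and> hom_poly n e h \<and> int d - int e = t \<and>
          (\<forall>v\<in>\<Union>V. h v \<noteq> 0 \<and> f v = g v / h v)},
        monoid.mult = undefined, one = undefined,
        ring.zero = (\<lambda>v\<in>\<Union>U. 0),
        add = (\<lambda>f g. \<lambda>v\<in>\<Union>U. f v + g v),
        smult = (\<lambda>a f. \<lambda>v\<in>\<Union>U. a (line_through v) * f v)\<rparr>),
      res = (\<lambda>U V f. restrict f (\<Union>V))\<rparr>"

definition twist ::
  "nat \<Rightarrow> 'a presheaf \<Rightarrow> int \<Rightarrow>
     (point \<Rightarrow> (point set \<times> ('a \<times> ((nat \<Rightarrow> complex) \<Rightarrow> complex) \<Rightarrow>\<^sub>0 int) set) set) presheaf" where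
  "twist n E t = tensor_sheaf n E (O_twist n t)"


section \<open>Cohomology\<close>

text \<open>
  \<open>H\<^sup>i(\<P>\<^sup>n, F)\<close> is Cech cohomology, the direct limit over all open covers of the cohomology of
  the covers, as in Serre's FAC; for the coherent sheaves considered here it is canonically
  the derived functor cohomology.  As usual, covers are indexed by the points,
  with \<open>p \<in> U p\<close>: these are cofinal among all open covers, and \<open>W\<close> refines \<open>U\<close> when
  \<open>W p \<subseteq> U p\<close> for all \<open>p\<close>, with a canonical refinement map.
\<close>

definition point_cover :: "nat \<Rightarrow> (point \<Rightarrow> point set) \<Rightarrow> bool" where
  "point_cover n U \<longleftrightarrow> (\<forall>p\<in>proj_space n. openin (zariski n) (U p) \<and> p \<in> U p)"

text \<open>An \<open>i\<close>-simplex is a list of \<open>i + 1\<close> points, not necessarily distinct.\<close>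

definition simplices :: "nat \<Rightarrow> nat \<Rightarrow> point list set" where
  "simplices n i = {l. length l = Suc i \<and> set l \<subseteq> proj_space n}"

definition inters :: "(point \<Rightarrow> point set) \<Rightarrow> point list \<Rightarrow> point set" where
  "inters U l = (\<Inter>p\<in>set l. U p)"

definition cochains ::
  "nat \<Rightarrow> 'a presheaf \<Rightarrow> (point \<Rightarrow> point set) \<Rightarrow> nat \<Rightarrow> (point list \<Rightarrow> 'a) set" where
  "cochains n F U i = (\<Pi>\<^sub>E l\<in>simplices n i. carrier (sec F (inters U l)))"

definition coboundary ::
  "nat \<Rightarrow> 'a presheaf \<Rightarrow> (point \<Rightarrow> point set) \<Rightarrow> nat \<Rightarrow> (point list \<Rightarrow> 'a) \<Rightarrow> point list \<Rightarrow> 'a" where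
  "coboundary n F U i c =
     (\<lambda>l\<in>simplices n (Suc i).
        \<Oplus>\<^bsub>sec F (inters U l)\<^esub>j\<in>{..Suc i}.
          (let l' = take j l @ drop (Suc j) l;
               s = res F (inters U l') (inters U l) (c l')
           in if even j then s else \<ominus>\<^bsub>sec F (inters U l)\<^esub> s))"

definition cocycles ::
  "nat \<Rightarrow> 'a presheaf \<Rightarrow> (point \<Rightarrow> point set) \<Rightarrow> nat \<Rightarrow> (point list \<Rightarrow> 'a) set" where
  "cocycles n F U i =
     {c \<in> cochains n F U i.
        coboundary n F U i c = (\<lambda>l\<in>simplices n (Suc i). \<zero>\<^bsub>sec F (inters U l)\<^esub>)}"

definition coboundaries ::
  "nat \<Rightarrow> 'a presheaf \<Rightarrow> (point \<Rightarrow> point set) \<Rightarrow> nat \<Rightarrow> (point list \<Rightarrow> 'a) set" where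
  "coboundaries n F U i =
     (case i of
        0 \<Rightarrow> {\<lambda>l\<in>simplices n 0. \<zero>\<^bsub>sec F (inters U l)\<^esub>}
      | Suc j \<Rightarrow> coboundary n F U j ` cochains n F U j)"

definition refine ::
  "nat \<Rightarrow> 'a presheaf \<Rightarrow> (point \<Rightarrow> point set) \<Rightarrow> (point \<Rightarrow> point set) \<Rightarrow> nat \<Rightarrow>
     (point list \<Rightarrow> 'a) \<Rightarrow> point list \<Rightarrow> 'a" where
  "refine n F U W i c = (\<lambda>l\<in>simplices n i. res F (inters U l) (inters W l) (c l))"

definition cochain_add ::
  "nat \<Rightarrow> 'a presheaf \<Rightarrow> (point \<Rightarrow> point set) \<Rightarrow> nat \<Rightarrow>
     (point list \<Rightarrow> 'a) \<Rightarrow> (point list \<Rightarrow> 'a) \<Rightarrow> point list \<Rightarrow> 'a" where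
  "cochain_add n F U i a b = (\<lambda>l\<in>simplices n i. a l \<oplus>\<^bsub>sec F (inters U l)\<^esub> b l)"

text \<open>Cocycles on two covers are identified if they are cohomologous on a common refinement.\<close>

definition cohomologous ::
  "nat \<Rightarrow> 'a presheaf \<Rightarrow> nat \<Rightarrow>
     (((point \<Rightarrow> point set) \<times> (point list \<Rightarrow> 'a)) \<times> ((point \<Rightarrow> point set) \<times> (point list \<Rightarrow> 'a))) set"
  where
  "cohomologous n F i =
     {((U, a), (V, b)).
        point_cover n U \<and> a \<in> cocycles n F U i \<and> point_cover n V \<and> b \<in> cocycles n F V i \<and>
        (\<exists>W. point_cover n W \<and> (\<forall>p\<in>proj_space n. W p \<subseteq> U p \<inter> V p) \<and>
           (\<exists>z\<in>coboundaries n F W i.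
              refine n F U W i a = cochain_add n F W i (refine n F V W i b) z))}"

definition cohomology ::
  "nat \<Rightarrow> 'a presheaf \<Rightarrow> nat \<Rightarrow> ((point \<Rightarrow> point set) \<times> (point list \<Rightarrow> 'a)) set monoid" where
  "cohomology n F i =
     \<lparr>carrier = {(U, a). point_cover n U \<and> a \<in> cocycles n F U i} // cohomologous n F i,
      monoid.mult = (\<lambda>x y. \<Union>(U, a)\<in>x. \<Union>(V, b)\<in>y.
        let W = (\<lambda>p. U p \<inter> V p)
        in cohomologous n F i ``
             {(W, cochain_add n F W i (refine n F U W i a) (refine n F V W i b))}),
      one = cohomologous n F i ``
        {(\<lambda>_. proj_space n, \<lambda>l\<in>simplices n i. \<zero>\<^bsub>sec F (proj_space n)\<^esub>)}\<rparr>"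

definition cohomology_vanishes :: "nat \<Rightarrow> 'a presheaf \<Rightarrow> nat \<Rightarrow> bool" where
  "cohomology_vanishes n F i \<longleftrightarrow> carrier (cohomology n F i) = {\<one>\<^bsub>cohomology n F i\<^esub>}"

end

theory Submission
  imports
    Defs
    "HOL-Computational_Algebra.Computational_Algebra"
    "HOL-Analysis.Continuum_Not_Denumerable"
    "HOL-Library.Product_Plus"
begin

text \<open>
  Since \<open>\<P>\<^sup>n\<close> is irreducible, everything takes place in the field \<open>K\<close> of fractions of the polynomial ring:
  charts of \<open>E\<close> embed its sections into \<open>K\<^sup>2\<close>, and the sections of \<open>E(t)\<close> over \<open>U\<close> become the elements that
  lie in a lattice \<open>lat t z\<close> for all \<open>z \<in> U\<close>.

  If a nonzero global section \<open>s\<close> of \<open>E(m)\<close> vanished at a point \<open>p\<close>, it would be in the image of the Koszul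
  complex on \<open>n\<close> linear forms that cut out \<open>p\<close>.  Since \<open>H\<^sup>i(E(m - 1 - i)) = 0\<close> for \<open>i < n\<close>, a diagram chase through
  the Cech and Koszul complexes then gives \<open>s = 0\<close>.  So \<open>s\<close> vanishes nowhere and \<open>E(m)/s\<close> is a line bundle; by
  unique factorisation it is some \<open>\<O>(k)\<close>, and the extension splits because the relevant \<open>H\<^sup>1\<close> of a line bundle
  vanishes.  The converse is \<open>H\<^sup>i(\<O>(k)) = 0\<close> for \<open>0 < i < n\<close>, again by Koszul complexes.
\<close>

text \<open>The twist \<open>m - 1 - i\<close> is the one that meets Cech degree \<open>i\<close> in
  the chase: every Koszul step divides by a linear form and lowers the twist by one, every Cech step
  raises the degree by one. There are \<open>n\<close> forms at \<open>p\<close>, so the chase stops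
  after \<open>n\<close> steps and meets only degrees \<open>i < n\<close>. In degree zero the last
  correction is a section of \<open>E(m - 1)\<close>, hence zero. On the projective line nothing is
  assumed about higher cohomology, while the extension class lies in \<open>H\<^sup>1\<close> of
  some \<open>O(c - m)\<close>, which need not vanish. The bound \<open>c - m \<ge> - 1\<close> is
  extracted from \<open>H\<^sup>0(E(m - 1)) = 0\<close>. For line bundles the covers are arbitrary.
  Only powers of the coordinates need lie in the ideal of a given cover, so the second Koszul
  complex is the one on the \<open>v j ^ N\<close>. In the field picture restriction is inclusion: a
  cochain is a function on lists of points with values in a fixed group, and only membership in
  stalks has to be checked. The empty open set has no place in this picture and is treated
  apart.\<close>

abbreviation Sec :: "'a presheaf => point set => 'a set" where
 "Sec F U == carrier (sec F U)"

abbreviation Reg :: "nat => point set => (point => complex) set" where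
 "Reg n U == carrier (reg_ring n U)"

section \<open>Homogeneous polynomial functions\<close>

inductive poly_fun :: "((nat => complex) => complex) => bool" where
 const: "poly_fun (%v. c)"
| coord: "poly_fun (%v. v i)"
| add: "poly_fun f ==> poly_fun g ==> poly_fun (%v. f v + g v)"
| mult: "poly_fun f ==> poly_fun g ==> poly_fun (%v. f v * g v)"

lemma poly_fun_uminus: "poly_fun f ==> poly_fun (%v. - f v)"
 using poly_fun.mult[OF poly_fun.const[of "-1"], of f] by simp

text \<open>One ring in countably many variables serves all \<open>n\<close>;
  \<open>dep (Suc n)\<close> later singles out the polynomials in \<open>v 0, .., v n\<close>. Since
  the elements are functions, identities can be checked by evaluation.\<close>

typedef mpol = "{f. poly_fun f}" morphisms ev Abs_mpol using poly_fun.const by blast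

setup_lifting type_definition_mpol

instantiation mpol :: comm_ring_1
begin
lift_definition zero_mpol :: mpol is "%v. 0" by (rule poly_fun.const)
lift_definition one_mpol :: mpol is "%v. 1" by (rule poly_fun.const)
lift_definition plus_mpol :: "mpol => mpol => mpol" is "%f g v. f v + g v" by (rule poly_fun.add)
lift_definition times_mpol :: "mpol => mpol => mpol" is "%f g v. f v * g v" by (rule poly_fun.mult)
lift_definition uminus_mpol :: "mpol => mpol" is "%f v. - f v" by (rule poly_fun_uminus)
lift_definition minus_mpol :: "mpol => mpol => mpol" is "%f g v. f v - g v"
 using poly_fun.add[OF _ poly_fun_uminus] by simp
instance by standard (transfer; simp add: algebra_simps fun_eq_iff)+
end

lift_definition mC :: "complex => mpol" is "%c v. c" by (rule poly_fun.const)
lift_definition mX :: "nat => mpol" is "%i v. v i" by (rule poly_fun.coord)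

lemma ev_simps [simp]:
 "ev 0 v = 0" "ev 1 v = 1" "ev (f + g) v = ev f v + ev g v" "ev (f - g) v = ev f v - ev g v"
 "ev (- f) v = - ev f v" "ev (f * g) v = ev f v * ev g v" "ev (mC c) v = c" "ev (mX i) v = v i" by (transfer; simp)+

lemma ev_power [simp]: "ev (f ^ n) v = ev f v ^ n" by (induction n) auto

lemma ev_sum [simp]: "ev (sum f A) v = (\<Sum>x\<in>A. ev (f x) v)" by (induction A rule: infinite_finite_induct) auto

lemma ev_prod [simp]: "ev (prod f A) v = (\<Prod>x\<in>A. ev (f x) v)" by (induction A rule: infinite_finite_induct) auto

lemma mpol_eqI: "(!!v. ev f v = ev g v) ==> f = g" by (metis ev_inject ext)

lemma mpol_induct [case_names mC mX add mult]:
 assumes "!!c. P (mC c)" "!!i. P (mX i)"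
  and "!!f g. P f ==> P g ==> P (f + g)" and "!!f g. P f ==> P g ==> P (f * g)"
 shows "P f"
proof -
 have "P (Abs_mpol F)" if "poly_fun F" for F using that
 proof induction
  case (const c)
  thus ?case using assms(1)[of c] by (simp add: mC_def)
 next
  case (coord i)
  thus ?case using assms(2)[of i] by (simp add: mX_def)
 next
  case (add f g)
  thus ?case using assms(3)[OF add.IH] by (simp add: plus_mpol.abs_eq eq_onp_def)
 next
  case (mult f g)
  thus ?case using assms(4)[OF mult.IH] by (simp add: times_mpol.abs_eq eq_onp_def)
 qed
 from this[of "ev f"] show ?thesis using ev[of f] by (simp add: ev_inverse)
qed

text \<open>Restriction to a line reduces questions about several variables to univariate
  polynomials; integrality, the homogeneous components and the lemmas about factors start from
  it.\<close>

lemma ev_line_poly: "EX p. ALL t. ev f (%i. v i + t * w i) = poly p t"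
proof (induction f rule: mpol_induct)
 case (mC c)
 show ?case by (rule exI[of _ "[:c:]"]) simp
next
 case (mX i)
 show ?case by (rule exI[of _ "[:v i, w i:]"]) simp
next
 case (add f g)
 then obtain p q where "ALL t. ev f (%i. v i + t * w i) = poly p t" "ALL t. ev g (%i. v i + t * w i) = poly q t"
  by blast
 thus ?case by (intro exI[of _ "p + q"]) simp
next
 case (mult f g)
 then obtain p q where "ALL t. ev f (%i. v i + t * w i) = poly p t" "ALL t. ev g (%i. v i + t * w i) = poly q t"
  by blast
 thus ?case by (intro exI[of _ "p * q"]) simp
qed

text \<open>On the line through a point where \<open>f\<close> does not vanish and one where
  \<open>g\<close> does not, both become non-zero univariate polynomials, whose product has a
  non-zero value.\<close>

instance mpol :: idom
proof
 fix f g :: mpol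
 assume "f ~= 0" "g ~= 0"
 then obtain v w where v: "ev f v ~= 0" and w: "ev g w ~= 0" by (metis mpol_eqI ev_simps(1))
 obtain p where p: "ALL t. ev f (%i. v i + t * (w i - v i)) = poly p t"
  using ev_line_poly[of f v "%i. w i - v i"] by auto
 obtain q where q: "ALL t. ev g (%i. v i + t * (w i - v i)) = poly q t"
  using ev_line_poly[of g v "%i. w i - v i"] by auto
 have "poly p 0 ~= 0" "poly q 1 ~= 0"
  using p[rule_format, of 0, symmetric] q[rule_format, of 1, symmetric] v w by auto
 hence "p * q ~= 0" by auto
 then obtain t where "poly (p * q) t ~= 0" using poly_all_0_iff_0 by blast
 hence "ev (f * g) (%i. v i + t * (w i - v i)) ~= 0" using p q by simp
 thus "f * g ~= 0" by (metis ev_simps(1))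
qed

lemma mC_simps [simp]: "mC 0 = 0" "mC 1 = 1" "mC a * mC b = mC (a * b)" "mC a + mC b = mC (a + b)" by (rule mpol_eqI; simp)+

lemma mC_eq_0_iff [simp]: "mC a = 0 \<longleftrightarrow> a = 0"
proof
 assume "mC a = 0"
 hence "ev (mC a) (%_. 0) = ev 0 (%_. 0)" by (rule arg_cong)
 thus "a = 0" by simp
qed simp

lemma mX_neq_0 [simp]: "mX i ~= 0"
proof
 assume "mX i = 0"
 hence "ev (mX i) (%_. 1) = ev 0 (%_. 1)" by (rule arg_cong)
 thus False by simp
qed

lemma ev_neq_0: "f ~= 0 ==> EX v. ev f v ~= 0" by (metis mpol_eqI ev_simps(1))

section \<open>Homogeneous components and total degree\<close>

definition vscale :: "complex => (nat => complex) => nat => complex" where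
 "vscale c v = (%i. c * v i)"

text \<open>The polynomial \<open>t \<mapsto> f (t v)\<close>; its coefficients are the values at \<open>v\<close> of the homogeneous
 components of \<open>f\<close>.\<close>

definition hp :: "mpol => (nat => complex) => complex poly" where
 "hp f v = (THE p. ALL t. poly p t = ev f (vscale t v))"

lemma hp_eqI: "(!!t. poly p t = ev f (vscale t v)) ==> hp f v = p" unfolding hp_def
 by (rule the_equality) (auto simp: poly_eq_poly_eq_iff[symmetric] fun_eq_iff)

lemma poly_hp [simp]: "poly (hp f v) t = ev f (vscale t v)"
proof -
 obtain p where p: "!!t. ev f (vscale t v) = poly p t" using ev_line_poly[of f "%_. 0" v] by (auto simp: vscale_def)
 hence "hp f v = p" by (intro hp_eqI) simp
 with p show ?thesis by simp
qed

lemma hp_simps [simp]: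
 "hp 0 v = 0" "hp (f + g) v = hp f v + hp g v" "hp (f * g) v = hp f v * hp g v" "hp (mC c) v = [:c:]"
 "hp (mX i) v = monom (v i) 1" "hp (- f) v = - hp f v" "hp (f - g) v = hp f v - hp g v"
 by (rule hp_eqI; simp add: vscale_def poly_monom)+

text \<open>For a product, the Cauchy formula expresses the coefficients on a line by those of the
  factors, which are polynomials in \<open>v\<close> by induction.\<close>

lemma hcomp_ex: "EX g. ALL v. ev g v = coeff (hp f v) e"
proof (induction f arbitrary: e rule: mpol_induct)
 case (mC c)
 show ?case by (rule exI[of _ "mC (coeff [:c:] e)"]) simp
next
 case (mX i)
 show ?case by (rule exI[of _ "if e = 1 then mX i else 0"]) auto
next
 case (add f g)
 obtain a b where "ALL v. ev a v = coeff (hp f v) e" "ALL v. ev b v = coeff (hp g v) e" using add by blast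
 thus ?case by (intro exI[of _ "a + b"]) simp
next
 case (mult f g)
 obtain a where a: "!!e v. ev (a e) v = coeff (hp f v) e" using mult(1) by metis
 obtain b where b: "!!e v. ev (b e) v = coeff (hp g v) e" using mult(2) by metis
 show ?case by (rule exI[of _ "\<Sum>i\<le>e. a i * b (e - i)"]) (simp add: coeff_mult a b)
qed

definition hcomp :: "nat => mpol => mpol" where
 "hcomp e f = (SOME g. ALL v. ev g v = coeff (hp f v) e)"

lemma ev_hcomp [simp]: "ev (hcomp e f) v = coeff (hp f v) e" unfolding hcomp_def using someI_ex[OF hcomp_ex[of f e]] by simp

lemma hp_degree_bound: "EX N. ALL v. degree (hp f v) <= N"
proof (induction f rule: mpol_induct)
 case (mC c)
 show ?case by simp
next
 case (mX i)
 show ?case using degree_monom_le by (auto intro!: exI[of _ 1])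
next
 case (add f g)
 then obtain N M where "ALL v. degree (hp f v) <= N" "ALL v. degree (hp g v) <= M" by blast
 thus ?case by (intro exI[of _ "N + M"]) (auto intro!: degree_add_le simp: trans_le_add1 trans_le_add2)
next
 case (mult f g)
 then obtain N M where "ALL v. degree (hp f v) <= N" "ALL v. degree (hp g v) <= M" by blast
 thus ?case by (intro exI[of _ "N + M"]) (auto intro: order_trans[OF degree_mult_le] add_mono)
qed

text \<open>The total degree, read off on the lines through the origin. It is the measure of the
  inductions over factors.\<close>

definition tdeg :: "mpol => nat" where
 "tdeg f = (LEAST N. ALL v. degree (hp f v) <= N)"

lemma tdeg_ge: "degree (hp f v) <= tdeg f" unfolding tdeg_def using LeastI_ex[OF hp_degree_bound[of f]] by blast

text \<open>If the top component were zero, the bound \<open>tdeg f\<close> could be lowered by one;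
  in degree zero \<open>f\<close> itself would vanish.\<close>

lemma hcomp_tdeg: "f ~= 0 ==> hcomp (tdeg f) f ~= 0"
proof
 assume f: "f ~= 0" and h: "hcomp (tdeg f) f = 0"
 have c: "coeff (hp f v) (tdeg f) = 0" for v using h ev_hcomp[of "tdeg f" f v] by simp
 have "tdeg f ~= 0"
 proof
  assume "tdeg f = 0"
  hence "degree (hp f v) = 0" for v using tdeg_ge[of f v] by simp
  hence "hp f v = 0" for v using c[of v] \<open>tdeg f = 0\<close> by (metis leading_coeff_0_iff)
  hence "ev f v = 0" for v using poly_hp[of f v 1] by (simp add: vscale_def)
  with f show False by (metis mpol_eqI ev_simps(1))
 qed
 moreover have "degree (hp f v) <= tdeg f - 1" for v
 proof (rule degree_le, intro allI impI)
  fix i assume "tdeg f - 1 < i"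
  then consider "i = tdeg f" | "i > tdeg f" by linarith
  thus "coeff (hp f v) i = 0" by cases (use c tdeg_ge[of f v] in \<open>auto intro: coeff_eq_0\<close>)
 qed
 hence "tdeg f <= tdeg f - 1" unfolding tdeg_def[of f] by (intro Least_le) (simp add: tdeg_def)
 ultimately show False by simp
qed

text \<open>At a point where the top components of both factors are non-zero, both degrees are
  attained simultaneously and add up.\<close>

lemma tdeg_mult: "f ~= 0 ==> g ~= 0 ==> tdeg (f * g) = tdeg f + tdeg g"
proof (rule antisym)
 assume f: "f ~= 0" and g: "g ~= 0"
 show "tdeg (f * g) <= tdeg f + tdeg g" unfolding tdeg_def[of "f * g"]
  by (rule Least_le) (auto intro!: order_trans[OF degree_mult_le] add_mono tdeg_ge)
 have "hcomp (tdeg f) f * hcomp (tdeg g) g ~= 0" using hcomp_tdeg f g by simp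
 then obtain v where "ev (hcomp (tdeg f) f * hcomp (tdeg g) g) v ~= 0" using ev_neq_0 by blast
 hence nz: "coeff (hp f v) (tdeg f) ~= 0" "coeff (hp g v) (tdeg g) ~= 0" by auto
 hence "tdeg f <= degree (hp f v)" "tdeg g <= degree (hp g v)" by (auto intro: le_degree)
 moreover have "hp f v ~= 0" "hp g v ~= 0" using nz by auto
 ultimately have "tdeg f + tdeg g <= degree (hp (f * g) v)" by (simp add: degree_mult_eq)
 thus "tdeg f + tdeg g <= tdeg (f * g)" using tdeg_ge order_trans by blast
qed

lemma tdeg_0_const: "tdeg f = 0 ==> EX c. f = mC c"
proof
 assume "tdeg f = 0"
 have "ev f v = ev f (%_. 0)" for v
 proof -
  have "degree (hp f v) = 0" using tdeg_ge[of f v] \<open>tdeg f = 0\<close> by simp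
  then obtain a where "hp f v = [:a:]" by (auto elim: degree_eq_zeroE)
  thus ?thesis using poly_hp[of f v 0] poly_hp[of f v 1] by (simp add: vscale_def)
 qed
 thus "f = mC (ev f (%_. 0))" by (intro mpol_eqI) simp
qed

lemma mC_unit: "c ~= 0 ==> mC c dvd 1" by (rule dvdI[of _ _ "mC (inverse c)"]) simp

lemma tdeg_0_unit: "f ~= 0 ==> tdeg f = 0 ==> f dvd 1"
 using tdeg_0_const mC_unit by (metis mC_eq_0_iff)

lemma mpol_unit_const: "f dvd 1 ==> EX c. c ~= 0 & f = mC c"
proof -
 assume "f dvd 1"
 then obtain g where g: "1 = f * g" by (elim dvdE)
 hence nz: "f ~= 0" "g ~= 0" by auto
 have "tdeg (1 :: mpol) = 0" unfolding tdeg_def by (rule Least_eq_0) (use hp_simps(4)[of 1] in simp)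
 hence "tdeg f = 0" using tdeg_mult[OF nz] g by simp
 thus ?thesis using tdeg_0_const nz by (metis mC_eq_0_iff)
qed

lemma exists_irreducible_factor:
 fixes f :: mpol
 assumes "f ~= 0" "~ f dvd 1"
 shows "EX p. irreducible p & p dvd f" using assms
proof (induction "tdeg f" arbitrary: f rule: less_induct)
 case less
 show ?case
 proof (cases "irreducible f")
  case False
  then obtain a b where ab: "f = a * b" "~ a dvd 1" "~ b dvd 1" using less.prems by (auto simp: irreducible_def)
  hence nz: "a ~= 0" "b ~= 0" using less.prems by auto
  have "tdeg b ~= 0" using ab nz tdeg_0_unit by blast
  hence "tdeg a < tdeg f" using ab nz by (simp add: tdeg_mult)
  then obtain p where "irreducible p" "p dvd a" using less.hyps nz ab by blast
  thus ?thesis using ab by auto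
 qed auto
qed

section \<open>Polynomials in the first variables\<close>

definition dep :: "nat => mpol => bool" where
 "dep k f \<longleftrightarrow> (ALL v w. (ALL i<k. v i = w i) --> ev f v = ev f w)"

lemma depI: "(!!v w. ALL i<k. v i = w i ==> ev f v = ev f w) ==> dep k f"
 unfolding dep_def by blast

lemma depD: "dep k f ==> ALL i<k. v i = w i ==> ev f v = ev f w" unfolding dep_def by blast

lemma dep_simps [simp, intro]:
 "dep k 0" "dep k 1" "dep k (mC c)" "i < k ==> dep k (mX i)" by (auto intro: depI)

lemma dep_ring [simp, intro]:
 assumes "dep k f" "dep k g"
 shows "dep k (f + g)" "dep k (f - g)" "dep k (f * g)"
proof -
 have "ev f v = ev f w & ev g v = ev g w" if "ALL i<k. v i = w i" for v w using assms that depD by blast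
 thus "dep k (f + g)" "dep k (f - g)" "dep k (f * g)" by (auto intro!: depI simp only: ev_simps)
qed

lemma dep_uminus [simp, intro]: "dep k f ==> dep k (- f)" using dep_ring(2)[of k 0 f] by simp

lemma dep_power [simp, intro]: "dep k f ==> dep k (f ^ m)" by (induction m) auto

lemma dep_sum [intro]: "(!!x. x : A ==> dep k (f x)) ==> dep k (sum f A)"
 by (induction A rule: infinite_finite_induct) auto

lemma dep_prod [intro]: "(!!x. x : A ==> dep k (f x)) ==> dep k (prod f A)"
 by (induction A rule: infinite_finite_induct) auto

lemma dep_mono: "dep k f ==> k <= l ==> dep l f" unfolding dep_def by (meson order_less_le_trans)

lemma ex_dep: "EX k. dep k f"
proof (induction f rule: mpol_induct)
 case (mX i)
 thus ?case by (intro exI[of _ "Suc i"]) auto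
next
 case (add f g)
 then obtain k l where "dep k f" "dep l g" by blast
 hence "dep (max k l) f" "dep (max k l) g" by (auto intro: dep_mono)
 thus ?case by blast
next
 case (mult f g)
 then obtain k l where "dep k f" "dep l g" by blast
 hence "dep (max k l) f" "dep (max k l) g" by (auto intro: dep_mono)
 thus ?case by blast
qed auto

lemma ev_shift: "EX g. ALL v. ev g v = ev f (%i. v i + u i)"
proof (induction f rule: mpol_induct)
 case (mC c)
 show ?case by (rule exI[of _ "mC c"]) simp
next
 case (mX i)
 show ?case by (rule exI[of _ "mX i + mC (u i)"]) simp
next
 case (add f g)
 then obtain a b where "ALL v. ev a v = ev f (%i. v i + u i)" "ALL v. ev b v = ev g (%i. v i + u i)" by blast
 thus ?case by (intro exI[of _ "a + b"]) simp
next
 case (mult f g)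
 then obtain a b where "ALL v. ev a v = ev f (%i. v i + u i)" "ALL v. ev b v = ev g (%i. v i + u i)" by blast
 thus ?case by (intro exI[of _ "a * b"]) simp
qed

text \<open>Along a direction \<open>u\<close> that changes only the other variables the product is
  constant. On a line where this constant is not zero both factors are constant, by degree. Hence
  \<open>f\<close> and its translate agree off the zero set of \<open>f * g\<close>, and so
  everywhere.\<close>

lemma dep_factor:
 assumes "dep k (f * g)" "f * g ~= 0"
 shows "dep k f" unfolding dep_def
proof (intro allI impI)
 fix v w :: "nat => complex"
 assume vw: "ALL i<k. v i = w i"
 define u where "u = (%i. w i - v i)"
 have u: "u i = 0" if "i < k" for i using vw that by (simp add: u_def)
 obtain f' where f': "!!v. ev f' v = ev f (%i. v i + u i)" using ev_shift by blast
 have "ev ((f' - f) * (f * g)) x = 0" for x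
 proof (cases "ev (f * g) x = 0")
  case False
  obtain p where p: "!!t. ev f (%i. x i + t * u i) = poly p t" using ev_line_poly by blast
  obtain q where q: "!!t. ev g (%i. x i + t * u i) = poly q t" using ev_line_poly by blast
  have "poly (p * q) t = poly [:ev (f * g) x:] t" for t
  proof -
   have "ev (f * g) (%i. x i + t * u i) = ev (f * g) x" by (rule depD[OF assms(1)]) (simp add: u)
   thus ?thesis by (simp add: p q)
  qed
  hence pq: "p * q = [:ev (f * g) x:]" by (simp add: poly_eq_poly_eq_iff[symmetric] fun_eq_iff)
  hence "p * q ~= 0" using False by simp
  moreover have "degree (p * q) = 0" using pq by simp
  ultimately have "degree p = 0" by (simp add: degree_mult_eq)
  then obtain a where "p = [:a:]" by (auto elim: degree_eq_zeroE)
  hence "ev f (%i. x i + u i) = ev f x" using p[of 0] p[of 1] by simp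
  thus ?thesis by (simp add: f')
 qed auto
 hence "(f' - f) * (f * g) = 0" by (intro mpol_eqI) simp
 hence "f' = f" using assms(2) by simp
 hence "ev f v = ev f (%i. v i + u i)" using f'[of v] by simp
 thus "ev f v = ev f w" by (simp add: u_def)
qed

lemma dep_dvd: "dep k f ==> f ~= 0 ==> g dvd f ==> dep k g"
 by (elim dvdE) (auto intro: dep_factor)

section \<open>Homogeneous polynomials and their factors\<close>

definition hmg :: "nat => mpol => bool" where
 "hmg d f \<longleftrightarrow> (ALL t v. ev f (vscale t v) = t ^ d * ev f v)"

lemma hmg_hp: "hmg d f \<longleftrightarrow> (ALL v. hp f v = monom (ev f v) d)"
proof
 assume "hmg d f"
 thus "ALL v. hp f v = monom (ev f v) d" by (intro allI hp_eqI) (simp add: hmg_def poly_monom)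
next
 assume h: "ALL v. hp f v = monom (ev f v) d"
 show "hmg d f" unfolding hmg_def by (metis h poly_hp poly_monom mult.commute)
qed

lemma hmg_simps [simp, intro]:
 "hmg d 0" "hmg 0 1" "hmg 0 (mC c)" "hmg 1 (mX i)"
 "hmg d f ==> hmg d g ==> hmg d (f + g)" "hmg d f ==> hmg d g ==> hmg d (f - g)" "hmg d f ==> hmg d (- f)"
 unfolding hmg_def by (auto simp: vscale_def algebra_simps)

lemma hmg_mult: "hmg d f ==> hmg e g ==> hmg (d + e) (f * g)"
 unfolding hmg_def by (auto simp: power_add)

lemma hmg_power: "hmg d f ==> hmg (d * m) (f ^ m)" unfolding hmg_def by (auto simp: power_mult power_mult_distrib)

lemma hmg_sum [intro]: "(!!x. x : A ==> hmg d (f x)) ==> hmg d (sum f A)"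
 by (induction A rule: infinite_finite_induct) auto

lemma hmg_hcomp: "hmg e (hcomp e f)" unfolding hmg_def
proof (intro allI)
 fix t v
 have "hp f (vscale t v) = pcompose (hp f v) [:0, t:]"
  by (rule hp_eqI) (simp add: poly_pcompose vscale_def mult.assoc mult.left_commute)
 thus "ev (hcomp e f) (vscale t v) = t ^ e * ev (hcomp e f) v" by (simp add: coeff_pcompose_linear)
qed

lemma hcomp_mult_hmg:
 assumes "hmg d f"
 shows "hcomp (d + e) (f * g) = f * hcomp e g" using assms unfolding hmg_hp by (intro mpol_eqI) (simp add: coeff_monom_mult)

lemma hcomp_mult_hmg_less:
 assumes "hmg d f" "e < d"
 shows "hcomp e (f * g) = 0" using assms unfolding hmg_hp by (intro mpol_eqI) (simp add: coeff_monom_mult)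

lemma hcomp_hmg: "hmg d f ==> hcomp e f = (if e = d then f else 0)" unfolding hmg_hp by (intro mpol_eqI) auto

lemma hcomp_add: "hcomp e (f + g) = hcomp e f + hcomp e g" by (intro mpol_eqI) simp

lemma hcomp_0 [simp]: "hcomp e 0 = 0" by (intro mpol_eqI) simp

lemma hcomp_sum: "hcomp e (sum f A) = (\<Sum>x\<in>A. hcomp e (f x))"
 by (induction A rule: infinite_finite_induct) (auto simp: hcomp_add)

lemma mpol_decomp: "f = (\<Sum>e\<le>tdeg f. hcomp e f)"
proof (rule mpol_eqI)
 fix v
 have "ev f v = poly (hp f v) 1" by (simp add: vscale_def)
 also have "\<dots> = (\<Sum>e\<le>tdeg f. coeff (hp f v) e)" unfolding poly_altdef power_one mult_1_right
  by (rule sum.mono_neutral_left) (use tdeg_ge[of f v] in \<open>auto intro: coeff_eq_0\<close>)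
 finally show "ev f v = ev (\<Sum>e\<le>tdeg f. hcomp e f) v" by simp
qed

lemma hmg_unique: "hmg d f ==> hmg e f ==> f ~= 0 ==> d = e" by (metis hcomp_hmg)

text \<open>Suppose two components of \<open>f\<close> are non-zero, and take a vector where both
  and the product do not vanish. On the line through it the product is a monomial, whose only root
  is zero; over the complex numbers each factor is then a monomial and cannot have two non-zero
  coefficients.\<close>

lemma hmg_factor:
 assumes "hmg d (f * g)" "f * g ~= 0"
 shows "EX e. hmg e f"
proof -
 have one: "hcomp e f = 0 | hcomp e' f = 0" if "e ~= e'" for e e'
 proof (rule ccontr)
  assume "~ ?thesis"
  hence "hcomp e f * hcomp e' f * (f * g) ~= 0" using assms(2) by simp
  then obtain v where v: "ev (hcomp e f * hcomp e' f * (f * g)) v ~= 0" using ev_neq_0 by blast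
  define p q c where "p = hp f v" and "q = hp g v" and "c = ev (f * g) v"
  have c: "c ~= 0" and pe: "coeff p e ~= 0" "coeff p e' ~= 0" using v by (auto simp: p_def c_def)
  have pq: "p * q = monom c d" using assms(1) unfolding hmg_hp p_def q_def c_def by (metis hp_simps(3))
  hence "p ~= 0" using c by (auto simp: monom_eq_0_iff)
  then obtain r where r: "p = [:- 0, 1:] ^ order 0 p * r" "~ [:- 0, 1:] dvd r" using order_decomp by blast
  \<comment> \<open>\<open>r\<close> is the part of \<open>p\<close> prime to the variable; a root
    of it would be a non-zero root of the monomial \<open>p * q\<close>.\<close>
  have "degree r = 0"
  proof (rule ccontr)
   assume "degree r ~= 0"
   then obtain z where z: "poly r z = 0" using fundamental_theorem_of_algebra[of r] by (auto simp: constant_degree)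
   moreover have "z ~= 0" using r(2) z by (metis poly_eq_0_iff_dvd)
   moreover have "poly (p * q) z = 0" using z by (subst r(1)) simp
   ultimately show False using c by (simp add: pq poly_monom)
  qed
  then obtain a where "r = [:a:]" by (auto elim: degree_eq_zeroE)
  hence "p = monom a (order 0 p)" by (subst r(1)) (simp add: monom_altdef mult.commute)
  hence "coeff p e = 0 | coeff p e' = 0" using that by (metis coeff_monom)
  with pe show False by simp
 qed
 have "f ~= 0" using assms(2) by auto
 hence "EX e. hcomp e f ~= 0" by (metis hcomp_tdeg)
 then obtain e where e: "hcomp e f ~= 0" by blast
 have "f = (\<Sum>e'\<le>tdeg f. hcomp e' f)" by (rule mpol_decomp)
 also have "\<dots> = (\<Sum>e'\<le>tdeg f. if e' = e then hcomp e f else 0)" by (rule sum.cong) (use one e in auto)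
 also have "hmg e \<dots>" by (intro hmg_sum) (auto simp: hmg_hcomp)
 finally show ?thesis by blast
qed

lemma hmg_dvd: "hmg d f ==> f ~= 0 ==> g dvd f ==> EX e. hmg e g"
 by (elim dvdE) (auto intro: hmg_factor)

section \<open>Comparison with explicit sums of monomials\<close>

definition hpol :: "nat => nat => mpol => bool" where
 "hpol n d f \<longleftrightarrow> dep (Suc n) f & hmg d f"

lemma hom_poly_add:
 assumes "hom_poly n d f" "hom_poly n d g"
 shows "hom_poly n d (%v. f v + g v)"
proof -
 obtain A c where A: "finite A" "ALL a:A. (\<Sum>i\<le>n. a i) = d"
  and f: "f = (%v. \<Sum>a\<in>A. c a * (\<Prod>i\<le>n. v i ^ a i))" using assms(1) unfolding hom_poly_def by blast
 obtain B b where B: "finite B" "ALL a:B. (\<Sum>i\<le>n. a i) = d"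
  and g: "g = (%v. \<Sum>a\<in>B. b a * (\<Prod>i\<le>n. v i ^ a i))" using assms(2) unfolding hom_poly_def by blast
 define e where "e a = (if a : A then c a else 0) + (if a : B then b a else 0)" for a
 have "f v = (\<Sum>a\<in>A \<union> B. (if a : A then c a else 0) * (\<Prod>i\<le>n. v i ^ a i))" for v
  unfolding f by (rule sum.mono_neutral_cong_left) (use A B in auto)
 moreover have "g v = (\<Sum>a\<in>A \<union> B. (if a : B then b a else 0) * (\<Prod>i\<le>n. v i ^ a i))" for v
  unfolding g by (rule sum.mono_neutral_cong_left) (use A B in auto)
 ultimately have "(%v. f v + g v) = (%v. \<Sum>a\<in>A \<union> B. e a * (\<Prod>i\<le>n. v i ^ a i))"
  by (simp add: e_def distrib_right sum.distrib)
 thus ?thesis unfolding hom_poly_def using A B by (intro exI[of _ "A \<union> B"] exI[of _ e]) auto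
qed

lemma hom_poly_0: "hom_poly n d (%v. 0)" unfolding hom_poly_def by (intro exI[of _ "{}"]) auto

lemma hom_poly_sum:
 "finite A ==> (!!x. x : A ==> hom_poly n d (f x)) ==> hom_poly n d (%v. \<Sum>x\<in>A. f x v)"
 by (induction A rule: finite_induct) (auto intro: hom_poly_0 hom_poly_add)

lemma hom_poly_const: "hom_poly n 0 (%v. c)" unfolding hom_poly_def
 by (rule exI[of _ "{%_. 0}"], rule exI[of _ "%_. c"]) auto

lemma hom_poly_coord:
 assumes "i <= n"
 shows "hom_poly n 1 (%v. v i)"
proof -
 have *: "(\<Prod>j\<le>n. (v :: nat => complex) j ^ (if j = i then 1 else 0)) = v i" for v
 proof -
  have "(\<Prod>j\<le>n. v j ^ (if j = i then 1 else 0)) = (\<Prod>j\<le>n. if j = i then v j else 1)" by (rule prod.cong) auto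
  thus ?thesis using assms by simp
 qed
 show ?thesis unfolding hom_poly_def by (rule exI[of _ "{%j. if j = i then 1 else 0}"], rule exI[of _ "%_. 1"])
   (use assms * in \<open>auto simp: fun_eq_iff\<close>)
qed

text \<open>Setting the variables beyond \<open>n\<close> to zero lets the induction over all
  polynomials run inside the explicit sums of \<open>hom_poly\<close>; a form in
  \<open>v 0, .., v n\<close> is not changed by the substitution.\<close>

lemma hom_poly_coeff_hp:
 "hom_poly n e (%v. coeff (hp f (%i. if i <= n then v i else 0)) e)"
proof (induction f arbitrary: e rule: mpol_induct)
 case (mC c)
 show ?case by (cases e) (auto intro: hom_poly_const hom_poly_0)
next
 case (mX i)
 show ?case using hom_poly_coord[of i n] by (cases "e = 1"; cases "i <= n") (auto intro: hom_poly_0)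
next
 case (add f g)
 thus ?case by (auto intro: hom_poly_add)
next
 case (mult f g)
 show ?case unfolding hp_simps coeff_mult
 proof (rule hom_poly_sum)
  fix i assume "i : {..e}"
  thus "hom_poly n e (%v. coeff (hp f (%i. if i <= n then v i else 0)) i *
    coeff (hp g (%i. if i <= n then v i else 0)) (e - i))" using hom_poly_mult[OF mult.IH, of i "e - i"] by simp
 qed simp
qed

lemma hom_poly_ev:
 assumes "hpol n d f"
 shows "hom_poly n d (ev f)"
proof -
 have "ev f v = coeff (hp f (%i. if i <= n then v i else 0)) d" for v
 proof -
  have "ev f v = ev f (%i. if i <= n then v i else 0)" using assms unfolding hpol_def by (auto intro: depD)
  also have "\<dots> = coeff (hp f (%i. if i <= n then v i else 0)) d" using assms unfolding hpol_def hmg_hp by simp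
  finally show ?thesis .
 qed
 hence "ev f = (%v. coeff (hp f (%i. if i <= n then v i else 0)) d)" by auto
 thus ?thesis using hom_poly_coeff_hp by simp
qed

lemma hom_poly_imp_hom:
 assumes "hom_poly n d F"
 shows "EX f. hpol n d f & F = ev f"
proof -
 obtain A c where A: "finite A" "ALL a:A. (\<Sum>i\<le>n. a i) = d"
  and F: "F = (%v. \<Sum>a\<in>A. c a * (\<Prod>i\<le>n. v i ^ a i))" using assms unfolding hom_poly_def by blast
 define f where "f = (\<Sum>a\<in>A. mC (c a) * (\<Prod>i\<le>n. mX i ^ a i))"
 have eq: "F = ev f" unfolding F f_def by auto
 moreover have "dep (Suc n) f" unfolding f_def by (intro dep_sum dep_ring(3) dep_prod dep_power) auto
 moreover have "hmg d f" unfolding hmg_def vscale_def using hom_poly_scale[OF assms] eq by simp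
 ultimately show ?thesis unfolding hpol_def by blast
qed

section \<open>Unique factorisation\<close>

definition indep :: "nat => mpol => bool" where
 "indep k f \<longleftrightarrow> (ALL v t. ev f (v(k := t)) = ev f v)"

lemma indep_simps [simp, intro]:
 "indep k 0" "indep k (mC c)" "i ~= k ==> indep k (mX i)"
 "indep k f ==> indep k g ==> indep k (f + g)" "indep k f ==> indep k g ==> indep k (f * g)"
 by (auto simp: indep_def)

lemma indep_sum: "(!!x. x : A ==> indep k (f x)) ==> indep k (sum f A)"
 by (induction A rule: infinite_finite_induct) auto

lemma dep_imp_indep: "dep k f ==> indep k f" unfolding indep_def by (auto intro: depD)

lemma univ_rep_ex: "EX P. poly P (mX k) = f & (ALL i. indep k (coeff P i))"
proof (induction f rule: mpol_induct)
 case (mC c)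
 show ?case by (rule exI[of _ "[:mC c:]"]) (auto simp: coeff_pCons split: nat.splits)
next
 case (mX i)
 show ?case
 proof (cases "i = k")
  case True
  thus ?thesis by (intro exI[of _ "[:mC 0, mC 1:]"]) (auto simp: coeff_pCons simp del: mC_simps split: nat.splits, simp)
 next
  case False
  thus ?thesis by (intro exI[of _ "[:mX i:]"]) (auto simp: coeff_pCons split: nat.splits)
 qed
next
 case (add f g)
 then obtain P Q where "poly P (mX k) = f" "ALL i. indep k (coeff P i)" "poly Q (mX k) = g" "ALL i. indep k (coeff Q i)"
  by blast
 thus ?case by (intro exI[of _ "P + Q"]) auto
next
 case (mult f g)
 then obtain P Q where "poly P (mX k) = f" "ALL i. indep k (coeff P i)" "poly Q (mX k) = g" "ALL i. indep k (coeff Q i)"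
  by blast
 thus ?case by (intro exI[of _ "P * Q"]) (auto simp: coeff_mult intro!: indep_sum)
qed

lemma ev_poly_mX: "ev (poly P (mX k)) w = poly (map_poly (%c. ev c w) P) (w k)"
 by (induction P) (auto simp: map_poly_pCons)

text \<open>Moving only coordinate \<open>k\<close> leaves the coefficients fixed, so the function
  of that coordinate determines them. This gives uniqueness of the representation.\<close>

lemma ev_univ_rep:
 assumes "ALL i. indep k (coeff P i)"
 shows "ev (poly P (mX k)) (v(k := t)) = poly (map_poly (%c. ev c v) P) t"
proof -
 have "map_poly (%c. ev c (v(k := t))) P = map_poly (%c. ev c v) P"
  using assms by (intro poly_eqI) (simp add: coeff_map_poly indep_def)
 thus ?thesis by (simp add: ev_poly_mX)
qed

lemma coeff_ev_map: "coeff (map_poly (%c. ev c v) P) i = ev (coeff P i) v" by (simp add: coeff_map_poly)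

definition dpoly :: "nat => mpol poly => bool" where
 "dpoly k P \<longleftrightarrow> (ALL i. dep k (coeff P i))"

lemma dpoly_indep: "dpoly k P ==> ALL i. indep k (coeff P i)"
 unfolding dpoly_def by (auto intro: dep_imp_indep)

lemma univ_rep_unique:
 assumes "dpoly k P" "dpoly k Q" "poly P (mX k) = poly Q (mX k)"
 shows "P = Q"
proof (rule poly_eqI, rule mpol_eqI)
 fix i v
 have "map_poly (%c. ev c v) P = map_poly (%c. ev c v) Q"
  using ev_univ_rep[OF dpoly_indep[OF assms(1)], of v] ev_univ_rep[OF dpoly_indep[OF assms(2)], of v] assms(3)
  by (simp add: poly_eq_poly_eq_iff[symmetric] fun_eq_iff)
 thus "ev (coeff P i) v = ev (coeff Q i) v" by (metis coeff_ev_map)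
qed

lemma univ_rep:
 assumes "dep (Suc k) f"
 obtains P where "poly P (mX k) = f" "dpoly k P"
proof -
 obtain P where P: "poly P (mX k) = f" "ALL i. indep k (coeff P i)" using univ_rep_ex by blast
 have "dep k (coeff P i)" for i
 proof (rule depI)
  fix v w :: "nat => complex"
  assume vw: "ALL i<k. v i = w i"
  have "poly (map_poly (%c. ev c v) P) t = poly (map_poly (%c. ev c w) P) t" for t
   unfolding ev_univ_rep[OF P(2), symmetric] P(1) by (rule depD[OF assms]) (use vw in \<open>auto simp: less_Suc_eq\<close>)
  hence "map_poly (%c. ev c v) P = map_poly (%c. ev c w) P"
   by (simp add: poly_eq_poly_eq_iff[symmetric] fun_eq_iff)
  thus "ev (coeff P i) v = ev (coeff P i) w" by (metis coeff_ev_map)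
 qed
 with P(1) show ?thesis using that unfolding dpoly_def by blast
qed

lemma dpoly_dep: "dpoly k P ==> dep (Suc k) (poly P (mX k))" unfolding poly_altdef dpoly_def
 by (intro dep_sum dep_ring(3) dep_power) (auto intro: dep_mono[of k])

lemma dpoly_simps [simp, intro]:
 "dpoly k 0" "dep k c ==> dpoly k [:c:]" "dpoly k P ==> dpoly k Q ==> dpoly k (P + Q)"
 "dpoly k P ==> dpoly k Q ==> dpoly k (P - Q)" "dpoly k P ==> dpoly k Q ==> dpoly k (P * Q)"
 "dep k c ==> dpoly k P ==> dpoly k (smult c P)" "dep k c ==> dpoly k (monom c j)"
 unfolding dpoly_def by (auto simp: coeff_pCons coeff_mult intro!: dep_sum split: nat.splits)

text \<open>The leading coefficient is in general not a unit; instead of passing to a fraction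
  field, \<open>G\<close> is multiplied by a power of it. Each step cancels the leading
  term.\<close>

lemma pseudo_division:
 assumes "dpoly k F" "F ~= 0" "dpoly k G"
 shows "EX m Q R. dpoly k Q & dpoly k R & smult (lead_coeff F ^ m) G = Q * F + R &
  (R = 0 | degree R < degree F)" using assms(3)
proof (induction "degree G" arbitrary: G rule: less_induct)
 case less
 show ?case
 proof (cases "G = 0 | degree G < degree F")
  case True
  thus ?thesis using less.prems by (intro exI[of _ 0] exI[of _ G]) auto
 next
  case False
  hence le: "degree F <= degree G" and G: "G ~= 0" by auto
  define M where "M = monom (lead_coeff G) (degree G - degree F)"
  define H where "H = smult (lead_coeff F) G - M * F"
  have lc: "dep k (lead_coeff F)" "dep k (lead_coeff G)" using assms less.prems by (auto simp: dpoly_def)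
  have M: "dpoly k M" using lc by (auto simp: M_def)
  have H: "dpoly k H" using M lc assms less.prems by (auto simp: H_def)
  have "coeff (M * F) (degree G) = lead_coeff G * lead_coeff F" unfolding M_def coeff_monom_mult using le by simp
  hence c0: "coeff H (degree G) = 0" by (simp add: H_def mult.commute)
  have "degree (M * F) <= degree G" using le degree_mult_le[of M F] degree_monom_le[of "lead_coeff G" "degree G - degree F"]
   by (auto simp: M_def)
  hence dH: "degree H <= degree G" unfolding H_def by (intro degree_diff_le) auto
  show ?thesis
  proof (cases "H = 0")
   case True
   hence "smult (lead_coeff F ^ 1) G = M * F + 0" by (simp add: H_def)
   thus ?thesis using M by blast
  next
   case False
   show ?thesis
   proof (cases "degree H < degree G")
    case True
    from less.hyps[OF True H] obtain m Q R where
     *: "dpoly k Q" "dpoly k R" "smult (lead_coeff F ^ m) H = Q * F + R" "R = 0 | degree R < degree F" by blast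
    have "smult (lead_coeff F ^ Suc m) G = smult (lead_coeff F ^ m) (H + M * F)" by (simp add: H_def mult.commute)
    also have "\<dots> = (Q + smult (lead_coeff F ^ m) M) * F + R" by (simp add: smult_add_right *(3) algebra_simps)
    finally have "smult (lead_coeff F ^ Suc m) G = (Q + smult (lead_coeff F ^ m) M) * F + R" .
    moreover have "dpoly k (Q + smult (lead_coeff F ^ m) M)" using * M lc by auto
    ultimately show ?thesis using * by blast
   next
    case False
    hence "degree H = degree G" using dH by simp
    hence "H = 0" using c0 by (metis leading_coeff_0_iff)
    with \<open>H ~= 0\<close> show ?thesis by simp
   qed
  qed
 qed
qed

text \<open>Primality tested only against polynomials in the first \<open>k\<close> variables, so
  that unique factorisation can be proved by induction on \<open>k\<close>.\<close>

definition sprime :: "nat => mpol => bool" where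
 "sprime k f \<longleftrightarrow> (ALL g h. dep k g --> dep k h --> f dvd g * h --> f dvd g | f dvd h)"

text \<open>The quotient involves no further variables and has a univariate representation itself;
  uniqueness then compares coefficients.\<close>

lemma const_dvd_iff:
 assumes "dep k c" "c ~= 0" "dpoly k G"
 shows "c dvd poly G (mX k) \<longleftrightarrow> (ALL i. c dvd coeff G i)"
proof
 assume "ALL i. c dvd coeff G i"
 thus "c dvd poly G (mX k)" unfolding poly_altdef by (auto intro!: dvd_sum)
next
 assume c: "c dvd poly G (mX k)"
 show "ALL i. c dvd coeff G i"
 proof (cases "G = 0")
  case False
  hence nz: "poly G (mX k) ~= 0" using univ_rep_unique[of k G 0] assms by auto
  obtain q where q: "poly G (mX k) = c * q" using c by (elim dvdE)
  hence "dep (Suc k) q" using dpoly_dep[OF assms(3)] nz dep_dvd by (metis dvd_triv_right)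
  then obtain Q where Q: "poly Q (mX k) = q" "dpoly k Q" by (rule univ_rep)
  have "G = smult c Q" by (rule univ_rep_unique[of k]) (use assms Q q in auto)
  thus ?thesis by auto
 qed simp
qed

text \<open>Gauss: compare the lowest coefficients that \<open>c\<close> does not divide.\<close>

lemma sprime_Suc:
 assumes c: "dep k c" "c ~= 0" "sprime k c"
 shows "sprime (Suc k) c" unfolding sprime_def
proof (intro allI impI)
 fix g h assume gh: "dep (Suc k) g" "dep (Suc k) h" "c dvd g * h"
 obtain G where G: "poly G (mX k) = g" "dpoly k G" using gh(1) by (rule univ_rep)
 obtain H where H: "poly H (mX k) = h" "dpoly k H" using gh(2) by (rule univ_rep)
 have GH: "c dvd coeff (G * H) i" for i using gh(3) const_dvd_iff[OF c(1,2), of "G * H"] G H by auto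
 show "c dvd g | c dvd h"
 proof (rule ccontr)
  assume "~ ?thesis"
  hence ex: "EX i. ~ c dvd coeff G i" "EX j. ~ c dvd coeff H j"
   using const_dvd_iff[OF c(1,2)] G H by blast+
  define i where "i = (LEAST i. ~ c dvd coeff G i)"
  define j where "j = (LEAST j. ~ c dvd coeff H j)"
  have i: "~ c dvd coeff G i" "!!i'. i' < i ==> c dvd coeff G i'"
   using LeastI_ex[OF ex(1)] not_less_Least unfolding i_def by blast+
  have j: "~ c dvd coeff H j" "!!j'. j' < j ==> c dvd coeff H j'"
   using LeastI_ex[OF ex(2)] not_less_Least unfolding j_def by blast+
  have "coeff (G * H) (i + j) = coeff G i * coeff H j + (\<Sum>l\<in>{..i + j} - {i}. coeff G l * coeff H (i + j - l))"
   unfolding coeff_mult by (subst sum.remove[of _ i]) auto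
  moreover have "c dvd (\<Sum>l\<in>{..i + j} - {i}. coeff G l * coeff H (i + j - l))"
  proof (rule dvd_sum)
   fix l assume "l : {..i + j} - {i}"
   hence "l < i | i + j - l < j" by auto
   thus "c dvd coeff G l * coeff H (i + j - l)" using i(2) j(2) by auto
  qed
  ultimately have "c dvd coeff G i * coeff H j"
   using GH[of "i + j"] dvd_add_left_iff[of c "\<Sum>l\<in>{..i + j} - {i}. coeff G l * coeff H (i + j - l)" "coeff G i * coeff H j"]
   by simp
  thus False using c(3) G(2) H(2) i(1) j(1) unfolding sprime_def dpoly_def by blast
 qed
qed

text \<open>If \<open>v k\<close> does not occur in \<open>f\<close>, Gauss's lemma
  \<open>sprime_Suc\<close> applies. Otherwise Euclid's argument in \<open>v k\<close> works up to
  denominators: among the \<open>R\<close> with \<open>f dvd R * h\<close> that \<open>f\<close>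
  does not divide, one of least degree is pseudo-divided into \<open>f\<close>, minimality kills the
  remainder, and irreducibility of \<open>f\<close> finishes.\<close>

lemma irreducible_sprime:
 "dep k f ==> irreducible f ==> sprime k f"
proof (induction k arbitrary: f)
 case 0
 hence "f = mC (ev f (%_. 0))" by (intro mpol_eqI) (auto intro: depD)
 moreover have "f ~= 0" "~ f dvd 1" using 0 by (auto simp: irreducible_def)
 ultimately show ?case using mC_unit mC_eq_0_iff by metis
next
 case (Suc k)
 have lift: "sprime (Suc k) c" if "dep k c" "irreducible c" for c using sprime_Suc Suc.IH that by (metis irreducible_def)
 show ?case
 proof (cases "dep k f")
  case True
  thus ?thesis using lift Suc.prems by blast
 next
  case False
  have f0: "f ~= 0" using Suc.prems by auto
  obtain F where F: "poly F (mX k) = f" "dpoly k F" using Suc.prems(1) by (rule univ_rep)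
  have F0: "F ~= 0" using F f0 by auto
  \<comment> \<open>\<open>f\<close> is irreducible and involves \<open>v k\<close>, so no
    irreducible factor of \<open>c\<close> divides it; these factors are removed from
    \<open>c * r\<close> one at a time.\<close>
  have cancel: "f dvd r" if "dep k c" "c ~= 0" "dep (Suc k) r" "f dvd c * r" for c r using that
  proof (induction "tdeg c" arbitrary: c rule: less_induct)
   case less
   show ?case
   proof (cases "c dvd 1")
    case True
    then obtain u where "1 = c * u" by (elim dvdE)
    hence "r = (c * r) * u" by (simp add: algebra_simps)
    thus ?thesis using less.prems(4) by (metis dvd_mult2)
   next
    case False
    then obtain p where p: "irreducible p" "p dvd c" using exists_irreducible_factor less.prems by blast
    then obtain c' where c': "c = p * c'" by (elim dvdE)
    have nz: "p ~= 0" "c' ~= 0" using c' less.prems by auto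
    have dp: "dep k p" "dep k c'" using dep_dvd[OF less.prems(1,2)] c' by auto
    obtain q where q: "c * r = f * q" using less.prems(4) by (elim dvdE)
    show ?thesis
    proof (cases "r = 0")
     case False
     hence "f * q ~= 0" "dep (Suc k) (f * q)"
      unfolding q[symmetric] using less.prems dep_mono[of k c "Suc k"] by auto
     hence "dep (Suc k) q" using dep_dvd[of "Suc k" "f * q" q] dvd_triv_right by blast
     moreover have "f * q = p * (c' * r)" using q c' by (simp add: mult.assoc)
     hence "p dvd f * q" by simp
     ultimately have "p dvd f | p dvd q" using lift[OF dp(1) p(1)] Suc.prems(1) unfolding sprime_def by blast
     moreover have "~ p dvd f"
     proof
      assume "p dvd f"
      then obtain u where u: "f = p * u" by (elim dvdE)
      hence "u dvd 1" using Suc.prems(2) p(1) by (meson irreducible_def irreducibleD)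
      then obtain b where "u = mC b" using mpol_unit_const by blast
      thus False using u dp False \<open>~ dep k f\<close> by auto
     qed
     ultimately obtain q' where "q = p * q'" by (auto elim: dvdE)
     hence "p * (c' * r) = p * (f * q')" using q c' by (simp add: algebra_simps)
     hence "c' * r = f * q'" using nz by simp
     hence "f dvd c' * r" by simp
     moreover have "tdeg c' < tdeg c" using tdeg_0_unit[OF nz(1)] p(1) nz c' by (auto simp: tdeg_mult irreducible_def)
     ultimately show ?thesis using less.hyps dp nz less.prems by blast
    qed auto
   qed
  qed
  \<comment> \<open>Every irreducible factor of \<open>c\<close> is absorbed by \<open>q\<close> or
    by \<open>r\<close>, as it is prime by \<open>lift\<close>.\<close>
  have split: "EX c1 c2 q' r'. dep k c1 & dep k c2 & q = c1 * q' & r = c2 * r' & f = q' * r'"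
   if "dep k c" "c ~= 0" "dep (Suc k) q" "dep (Suc k) r" "c * f = q * r" for c q r using that
  proof (induction "tdeg c" arbitrary: c q r rule: less_induct)
   case less
   show ?case
   proof (cases "c dvd 1")
    case True
    then obtain b where b: "b ~= 0" "c = mC b" using mpol_unit_const by blast
    have "mC (inverse b) * (c * f) = f" unfolding b(2) mult.assoc[symmetric] using b(1) by simp
    hence "f = (mC (inverse b) * q) * r" using less.prems by (simp add: mult.assoc)
    moreover have "q = mC b * (mC (inverse b) * q)" unfolding mult.assoc[symmetric] using b(1) by simp
    moreover have "dep k (mC b)" "dep k 1" "r = 1 * r" by auto
    ultimately show ?thesis by (intro exI[of _ "mC b"] exI[of _ 1] exI[of _ "mC (inverse b) * q"] exI[of _ r] conjI)
   next
    case False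
    then obtain p where p: "irreducible p" "p dvd c" using exists_irreducible_factor less.prems by blast
    then obtain c' where c': "c = p * c'" by (elim dvdE)
    have nz: "p ~= 0" "c' ~= 0" using c' less.prems by auto
    have dp: "dep k p" "dep k c'" using dep_dvd[OF less.prems(1,2)] c' by auto
    have lt: "tdeg c' < tdeg c" using tdeg_0_unit[OF nz(1)] p(1) nz c' by (auto simp: tdeg_mult irreducible_def)
    have qr0: "q ~= 0" "r ~= 0" using less.prems f0 by auto
    have "q * r = p * (c' * f)" using less.prems(5) c' by (simp add: mult.assoc)
    hence "p dvd q * r" by simp
    then consider "p dvd q" | "p dvd r" using lift[OF dp(1) p(1)] less.prems unfolding sprime_def by blast
    thus ?thesis
    proof cases
     case 1
     then obtain q1 where q1: "q = p * q1" by (elim dvdE)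
     have "p * (c' * f) = p * (q1 * r)" using less.prems(5) c' q1 by (simp add: algebra_simps)
     hence eq: "c' * f = q1 * r" using nz by simp
     have dq: "dep (Suc k) q1" using dep_dvd[OF less.prems(3) qr0(1)] q1 by auto
     obtain c1 c2 q' r' where
      s: "dep k c1" "dep k c2" "q1 = c1 * q'" "r = c2 * r'" "f = q' * r'"
      using less.hyps[OF lt dp(2) nz(2) dq less.prems(4) eq] by (elim exE conjE) (rule that)
     have "q = (p * c1) * q'" using q1 s(3) by (simp add: algebra_simps)
     moreover have "dep k (p * c1)" using dp(1) s(1) by simp
     ultimately show ?thesis using s by (intro exI[of _ "p * c1"] exI[of _ c2] exI[of _ q'] exI[of _ r'] conjI)
    next
     case 2
     then obtain r1 where r1: "r = p * r1" by (elim dvdE)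
     have "p * (c' * f) = p * (q * r1)" using less.prems(5) c' r1 by (simp add: algebra_simps)
     hence eq: "c' * f = q * r1" using nz by simp
     have dr: "dep (Suc k) r1" using dep_dvd[OF less.prems(4) qr0(2)] r1 by auto
     obtain c1 c2 q' r' where
      s: "dep k c1" "dep k c2" "q = c1 * q'" "r1 = c2 * r'" "f = q' * r'"
      using less.hyps[OF lt dp(2) nz(2) less.prems(3) dr eq] by (elim exE conjE) (rule that)
     have "r = (p * c2) * r'" using r1 s(4) by (simp add: algebra_simps)
     moreover have "dep k (p * c2)" using dp(1) s(2) by simp
     ultimately show ?thesis using s by (intro exI[of _ c1] exI[of _ "p * c2"] exI[of _ q'] exI[of _ r'] conjI)
    qed
   qed
  qed
  have lcF: "dep k (lead_coeff F ^ m)" "lead_coeff F ^ m ~= 0" for m using F F0 by (auto simp: dpoly_def)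
  show ?thesis unfolding sprime_def
  proof (intro allI impI, rule ccontr)
   fix g h assume gh: "dep (Suc k) g" "dep (Suc k) h" "f dvd g * h" and no: "~ (f dvd g | f dvd h)"
   obtain G where G: "poly G (mX k) = g" "dpoly k G" using gh(1) by (rule univ_rep)
   \<comment> \<open>The counterexample \<open>g\<close> is replaced by one of least degree in
     \<open>v k\<close>.\<close>
   define good where "good R \<longleftrightarrow> dpoly k R & f dvd poly R (mX k) * h & ~ f dvd poly R (mX k)" for R
   have "EX R. good R" using G gh no unfolding good_def by blast
   then obtain R where R: "good R" and min: "!!R'. good R' ==> degree R <= degree R'"
    using ex_has_least_nat[of good _ degree] by blast
   define r where "r = poly R (mX k)"
   have r: "dpoly k R" "f dvd r * h" "~ f dvd r" using R unfolding good_def r_def by auto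
   have dr: "dep (Suc k) r" using dpoly_dep[OF r(1)] by (simp add: r_def)
   have R0: "R ~= 0" using r by (auto simp: r_def)
   have lcR: "dep k (lead_coeff R ^ m)" "lead_coeff R ^ m ~= 0" for m using r R0 by (auto simp: dpoly_def)
   have degRF: "degree R < degree F"
   proof -
    obtain m Q R' where d: "dpoly k Q" "dpoly k R'" "smult (lead_coeff F ^ m) R = Q * F + R'"
     "R' = 0 | degree R' < degree F" using pseudo_division[OF F(2) F0 r(1)] by blast
    define r' where "r' = poly R' (mX k)"
    have eq: "lead_coeff F ^ m * r = poly Q (mX k) * f + r'"
     using arg_cong[OF d(3), of "%p. poly p (mX k)"] by (simp add: F r_def r'_def)
    have "~ f dvd r'"
    proof
     assume "f dvd r'"
     hence "f dvd lead_coeff F ^ m * r" unfolding eq by simp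
     thus False using cancel[OF lcF dr] r(3) by blast
    qed
    moreover have "f dvd r' * h"
    proof -
     have "r' * h = lead_coeff F ^ m * (r * h) - f * (poly Q (mX k) * h)" using eq by (simp add: algebra_simps)
     thus ?thesis using r(2) by simp
    qed
    ultimately have "good R'" using d unfolding good_def r'_def by simp
    moreover have "R' ~= 0" using \<open>~ f dvd r'\<close> by (auto simp: r'_def)
    ultimately show ?thesis using min[of R'] d(4) by simp
   qed
   obtain m Q R' where d: "dpoly k Q" "dpoly k R'" "smult (lead_coeff R ^ m) F = Q * R + R'"
    "R' = 0 | degree R' < degree R" using pseudo_division[OF r(1) R0 F(2)] by blast
   define r' where "r' = poly R' (mX k)"
   have eq: "lead_coeff R ^ m * f = poly Q (mX k) * r + r'"
    using arg_cong[OF d(3), of "%p. poly p (mX k)"] by (simp add: F r_def r'_def)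
   \<comment> \<open>A non-zero remainder would be a counterexample of smaller degree: its degree is
     below that of \<open>F\<close>, so \<open>f\<close> cannot divide it.\<close>
   have "R' = 0"
   proof (rule ccontr)
    assume R': "R' ~= 0"
    have "~ f dvd r'"
    proof
     assume "f dvd r'"
     then obtain q where q: "r' = f * q" by (elim dvdE)
     have r'0: "r' ~= 0" using univ_rep_unique[of k R' 0] d(2) R' by (auto simp: r'_def)
     have "dep (Suc k) r'" using dpoly_dep[OF d(2)] by (simp add: r'_def)
     hence "dep (Suc k) q" using q r'0 dep_dvd by (metis dvd_triv_right)
     then obtain Q' where Q': "poly Q' (mX k) = q" "dpoly k Q'" by (rule univ_rep)
     have "R' = F * Q'" by (rule univ_rep_unique[of k]) (use d F Q' q in \<open>auto simp: r'_def\<close>)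
     hence "degree F <= degree R'" using R' by (simp add: degree_mult_eq)
     with degRF d(4) R' show False by simp
    qed
    moreover have "f dvd r' * h"
    proof -
     have "r' = lead_coeff R ^ m * f - poly Q (mX k) * r" using eq by simp
     hence "r' * h = f * (lead_coeff R ^ m * h) - poly Q (mX k) * (r * h)" by (simp only: ring_distribs mult_ac)
     thus ?thesis using r(2) by simp
    qed
    ultimately have "good R'" using d unfolding good_def r'_def by simp
    thus False using min[of R'] d(4) R' by simp
   qed
   \<comment> \<open>Up to factors free of \<open>v k\<close>, \<open>f\<close> is now the product
     of the quotient and \<open>r\<close>. One of the two remaining factors is a unit: either
     \<open>f\<close> divides \<open>r\<close>, or \<open>r\<close> is free of \<open>v k\<close>
     and \<open>cancel\<close> yields \<open>f dvd h\<close>.\<close>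
   hence eq': "lead_coeff R ^ m * f = poly Q (mX k) * r" using eq by (simp add: r'_def)
   obtain c1 c2 q' r' where s: "dep k c1" "dep k c2" "poly Q (mX k) = c1 * q'" "r = c2 * r'" "f = q' * r'"
    using split[OF lcR dpoly_dep[OF d(1)] dr eq'] by (elim exE conjE) (rule that)
   hence "q' dvd 1 | r' dvd 1" using Suc.prems(2) by (auto dest: irreducibleD)
   thus False
   proof
    assume "q' dvd 1"
    hence "f dvd r'" using s(5) by (simp add: mult_unit_dvd_iff')
    thus False using s(4) r(3) by simp
   next
    assume "r' dvd 1"
    then obtain b where "r' = mC b" using mpol_unit_const by blast
    hence "dep k r" using s by auto
    thus False using cancel[of r h] gh(2) r no by (metis dvd_0_right)
   qed
  qed
 qed
qed

theorem irreducible_prime: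
 fixes f :: mpol
 assumes "irreducible f"
 shows "prime_elem f"
proof (rule prime_elemI)
 show "f ~= 0" "~ f dvd 1" using assms by (auto simp: irreducible_def)
 fix g h assume "f dvd g * h"
 obtain a b c where "dep a f" "dep b g" "dep c h" using ex_dep by metis
 hence "dep (a + b + c) f" "dep (a + b + c) g" "dep (a + b + c) h" by (auto intro: dep_mono)
 thus "f dvd g | f dvd h"
  using irreducible_sprime[of "a + b + c" f] assms \<open>f dvd g * h\<close> unfolding sprime_def by blast
qed

lemma exists_prime_factor:
 fixes f :: mpol
 assumes "f ~= 0" "~ f dvd 1"
 obtains p where "prime_elem p" "p dvd f" using exists_irreducible_factor[OF assms] irreducible_prime by blast

lemma coprime_representation:
 fixes a b :: mpol
 assumes "a ~= 0" "b ~= 0"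
 shows "EX g a' b'. a = g * a' & b = g * b' & (ALL p. prime_elem p --> ~ (p dvd a' & p dvd b'))"
 using assms
proof (induction "tdeg a" arbitrary: a b rule: less_induct)
 case less
 show ?case
 proof (cases "EX p. prime_elem p & p dvd a & p dvd b")
  case True
  then obtain p a1 b1 where p: "prime_elem p" "a = p * a1" "b = p * b1" by (auto elim!: dvdE)
  hence nz: "p ~= 0" "a1 ~= 0" "b1 ~= 0" using less.prems by auto
  have "tdeg p ~= 0" using tdeg_0_unit[OF nz(1)] p(1) by (auto simp: prime_elem_def)
  hence "tdeg a1 < tdeg a" using p nz by (simp add: tdeg_mult)
  from less.hyps[OF this nz(2,3)] obtain g a' b' where
   g: "a1 = g * a'" "b1 = g * b'" "ALL p. prime_elem p --> ~ (p dvd a' & p dvd b')" by blast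
  hence "a = (p * g) * a'" "b = (p * g) * b'" using p by (auto simp: mult.assoc)
  thus ?thesis using g(3) by blast
 next
  case False
  thus ?thesis by (intro exI[of _ 1] exI[of _ a] exI[of _ b]) auto
 qed
qed

section \<open>The homogeneous Nullstellensatz\<close>

text \<open>Two structures on the same ring: over the complex numbers, where dimension arguments
  take place, and over itself, where \<open>ideal.subspace\<close> means ideal and
  \<open>ideal.span\<close> the ideal generated.\<close>

interpretation cvs: vector_space "%c f. mC c * f" by standard (rule mpol_eqI; simp add: algebra_simps)+

interpretation ideal: Modules.module "(*) :: mpol => mpol => mpol" by standard (auto simp: algebra_simps)

declare ideal.scale_scale [simp del] cvs.scale_scale [simp del]
declare cvs.scale_left_distrib [algebra_simps del] cvs.scale_left_diff_distrib [algebra_simps del]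

lemma hp_one [simp]: "hp 1 v = 1" by (rule hp_eqI) simp

section \<open>Countable dimension of the polynomial ring\<close>

definition mon :: "nat list => mpol" where
 "mon l = prod_list (map mX l)"

lemma span_mon: "f : cvs.span (range mon)"
proof (induction f rule: mpol_induct)
 case (mC c)
 have "mC c * mon [] : cvs.span (range mon)" by (intro cvs.span_scale cvs.span_base) simp
 thus ?case by (simp add: mon_def)
next
 case (mX i)
 have "mon [i] : cvs.span (range mon)" by (intro cvs.span_base) simp
 thus ?case by (simp add: mon_def)
next
 case (add f g)
 thus ?case by (rule cvs.span_add)
next
 case (mult f g)
 have one: "mon l * h : cvs.span (range mon)" if "h : cvs.span (range mon)" for l h using that
 proof (induction rule: cvs.span_induct_alt)
  case base
  thus ?case by (simp add: cvs.span_zero)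
 next
  case (step c x y)
  then obtain l' where "x = mon l'" by blast
  hence "mon l * x = mon (l @ l')" by (simp add: mon_def)
  hence "mC c * (mon l * x) + mon l * y : cvs.span (range mon)"
   using step by (intro cvs.span_add cvs.span_scale) (auto intro: cvs.span_base)
  moreover have "mon l * (mC c * x + y) = mC c * (mon l * x) + mon l * y"
   by (simp only: distrib_left mult.left_commute[of "mon l" "mC c"])
  ultimately show ?case by (simp only:)
 qed
 from mult(1) show ?case
 proof (induction rule: cvs.span_induct_alt)
  case base
  thus ?case by (simp add: cvs.span_zero)
 next
  case (step c x y)
  then obtain l' where "x = mon l'" by blast
  hence "mC c * (x * g) + y * g : cvs.span (range mon)"
   using step one[OF mult(2)] by (intro cvs.span_add cvs.span_scale) auto
  thus ?case by (simp only: distrib_right mult.assoc)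
 qed
qed

text \<open>Monomials are lists of indices, hence countable. The resulting exhaustion by
  finite-dimensional spaces is what an uncountable family is played against.\<close>

lemma span_mon_finite: "EX d. f : cvs.span ((%k. mon (from_nat k)) ` {..<d})"
proof -
 obtain t r where t: "finite t" "t <= range mon" "f = (\<Sum>a\<in>t. mC (r a) * a)"
  using span_mon[of f] unfolding cvs.span_explicit by blast
 have "ALL a:t. EX k. a = mon (from_nat k)" using t(2) by (metis from_nat_to_nat rangeE subsetD)
 then obtain k where k: "ALL a:t. a = mon (from_nat (k a))" by metis
 define d where "d = Suc (Max (insert 0 (k ` t)))"
 have "k a < d" if "a : t" for a using t(1) that by (auto simp: d_def less_Suc_eq_le intro!: Max_ge)
 hence "a : (%k. mon (from_nat k)) ` {..<d}" if "a : t" for a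
  using that k by (intro image_eqI[of _ _ "k a"]) auto
 hence "f : cvs.span ((%k. mon (from_nat k)) ` {..<d})"
  unfolding t(3) by (intro cvs.span_sum cvs.span_scale cvs.span_base)
 thus ?thesis by blast
qed

definition uniX :: "nat => complex poly => mpol" where
 "uniX i P = poly (map_poly mC P) (mX i)"

lemma ev_uniX [simp]: "ev (uniX i P) v = poly P (v i)" unfolding uniX_def by (induction P) (auto simp: map_poly_pCons)

lemma uniX_mult: "uniX i (P * Q) = uniX i P * uniX i Q" by (rule mpol_eqI) simp

lemma uniX_linear: "uniX i [:- z, 1:] = mX i - mC z" by (rule mpol_eqI) simp

section \<open>Zeros of maximal ideals\<close>

locale max_ideal =
 fixes M :: "mpol set"
 assumes M: "ideal.subspace M" and M1: "1 \<notin> M"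
  and Mmax: "!!J. ideal.subspace J ==> 1 \<notin> J ==> M <= J ==> J = M"
begin

lemma M_add: "a : M ==> b : M ==> a + b : M" using M by (rule ideal.subspace_add)

lemma M_diff: "a : M ==> b : M ==> a - b : M" using M by (rule ideal.subspace_diff)

lemma M_mult: "a : M ==> c * a : M" using M by (rule ideal.subspace_scale)

lemma M_0: "0 : M" using M by (rule ideal.subspace_0)

lemma M_sum: "(!!x. x : A ==> f x : M) ==> sum f A : M"
 using M by (rule ideal.subspace_sum)

text \<open>The ideal generated by \<open>M\<close> and \<open>f\<close> is larger than
  \<open>M\<close> and so contains 1.\<close>

lemma M_inverse:
 assumes "f \<notin> M"
 shows "EX u. u * f - 1 : M"
proof -
 define J where "J = {u * f + m | u m. m : M}"
 have "ideal.subspace J"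
 proof (rule ideal.subspaceI)
  have "0 = 0 * f + 0" by simp
  thus "0 : J" unfolding J_def using M_0 by blast
 next
  fix x y assume "x : J" "y : J"
  then obtain u m u' m' where "x = u * f + m" "y = u' * f + m'" "m : M" "m' : M" unfolding J_def by blast
  hence "x + y = (u + u') * f + (m + m')" "m + m' : M" by (simp_all only: distrib_right add_ac M_add)
  thus "x + y : J" unfolding J_def by blast
 next
  fix c x assume "x : J"
  then obtain u m where "x = u * f + m" "m : M" unfolding J_def by blast
  hence "c * x = (c * u) * f + c * m" "c * m : M" by (simp_all only: distrib_left mult.assoc M_mult)
  thus "c * x : J" unfolding J_def by blast
 qed
 moreover have "M <= J"
 proof
  fix m assume "m : M"
  moreover have "m = 0 * f + m" by simp
  ultimately show "m : J" unfolding J_def by blast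
 qed
 moreover have "f = 1 * f + 0" by simp
 hence "f : J" unfolding J_def using M_0 by blast
 ultimately have "1 : J" using Mmax assms by blast
 then obtain u m where "1 = u * f + m" "m : M" unfolding J_def by blast
 hence "u * f - 1 = - 1 * m" by (simp add: algebra_simps)
 thus ?thesis using M_mult \<open>m : M\<close> by metis
qed

lemma M_prime:
 assumes "a * b : M" "a \<notin> M"
 shows "b : M"
proof -
 obtain u where u: "u * a - 1 : M" using M_inverse assms(2) by blast
 have "b = u * (a * b) - b * (u * a - 1)" by (simp add: algebra_simps)
 thus ?thesis using M_diff M_mult assms(1) u by metis
qed

lemma M_const: "mC c : M ==> c = 0" using M_mult[of "mC c" "mC (inverse c)"] M1 by (cases "c = 0") auto

text \<open>Over the complex numbers the polynomial splits into linear factors, and \<open>M\<close>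
  is prime, so one of the factors lies in \<open>M\<close>.\<close>

lemma uniX_root: "P ~= 0 ==> uniX i P : M ==> EX z. mX i - mC z : M"
proof (induction "degree P" arbitrary: P rule: less_induct)
 case less
 show ?case
 proof (cases "degree P = 0")
  case True
  then obtain a where a: "P = [:a:]" by (auto elim: degree_eq_zeroE)
  have "uniX i P = mC a" by (rule mpol_eqI) (simp add: a)
  hence "a = 0" using less.prems M_const by simp
  thus ?thesis using less.prems a by simp
 next
  case False
  then obtain z where "poly P z = 0" using fundamental_theorem_of_algebra[of P] by (auto simp: constant_degree)
  then obtain Q where Q: "P = [:- z, 1:] * Q" by (metis poly_eq_0_iff_dvd dvdE)
  have Q0: "Q ~= 0" using Q less.prems by auto
  hence dQ: "degree Q < degree P" unfolding Q by (subst degree_mult_eq) auto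
  have "(mX i - mC z) * uniX i Q : M" using less.prems(2) unfolding Q uniX_mult uniX_linear .
  then consider "mX i - mC z : M" | "uniX i Q : M" using M_prime by blast
  thus ?thesis using less.hyps[OF dQ Q0] by cases auto
 qed
qed

text \<open>If no \<open>x\<^sub>i - c\<close> were in \<open>M\<close>, their uncountably many inverses modulo \<open>M\<close> would be linearly
 dependent over \<open>\<complex>\<close>; clearing denominators makes \<open>x\<^sub>i\<close> algebraic modulo \<open>M\<close>.\<close>

lemma coordinate_value: "EX z. mX i - mC z : M"
proof (rule ccontr)
 assume no: "~ ?thesis"
 have "ALL r::real. EX u. u * (mX i - mC (of_real r)) - 1 : M" using M_inverse no by blast
 then obtain u where u: "!!r::real. u r * (mX i - mC (of_real r)) - 1 : M" by metis
 have inj: "inj u"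
 proof (rule injI, rule ccontr)
  fix r s assume rs: "u r = u s" "r ~= s"
  have "(u s * (mX i - mC (of_real s)) - 1) - (u r * (mX i - mC (of_real r)) - 1) =
    (mC (of_real r) - mC (of_real s)) * u r" using rs by (simp add: algebra_simps)
  also have "mC (of_real r) - mC (of_real s) = mC (of_real (r - s))" by (rule mpol_eqI) simp
  finally have "mC (of_real (r - s)) * u r : M" using M_diff[OF u[of s] u[of r]] by metis
  hence "u r : M" using M_prime M_const rs(2) by (metis eq_iff_diff_eq_0 of_real_eq_0_iff)
  hence "u r * (mX i - mC (of_real r)) : M" using M_mult by (metis mult.commute)
  from M_diff[OF this u[of r]] show False using M1 by simp
 qed
 \<comment> \<open>The real numbers are not a countable union of finite sets.\<close>
 have "EX d. infinite {r. u r : cvs.span ((%k. mon (from_nat k)) ` {..<d})}"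
 proof (rule ccontr)
  assume "~ ?thesis"
  hence "countable (\<Union>d. {r. u r : cvs.span ((%k. mon (from_nat k)) ` {..<d})})"
   by (intro countable_UN) (auto intro: countable_finite)
  moreover have "(\<Union>d. {r. u r : cvs.span ((%k. mon (from_nat k)) ` {..<d})}) = UNIV"
   using span_mon_finite by blast
  ultimately show False using uncountable_UNIV_real by simp
 qed
 then obtain d where "infinite {r. u r : cvs.span ((%k. mon (from_nat k)) ` {..<d})}" by blast
 hence inf: "infinite (u ` {r. u r : cvs.span ((%k. mon (from_nat k)) ` {..<d})})"
  using inj by (simp add: finite_image_iff inj_on_subset)
 have "cvs.dependent (u ` {r. u r : cvs.span ((%k. mon (from_nat k)) ` {..<d})})"
  using cvs.independent_span_bound[of "(%k. mon (from_nat k)) ` {..<d}"] inf by blast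
 then obtain t l where t: "finite t" "t <= range u" "(\<Sum>v\<in>t. mC (l v) * v) = 0" "EX v:t. l v ~= 0"
  unfolding cvs.dependent_explicit by blast
 define A where "A = {r. u r : t}"
 have tA: "t = u ` A" using t(2) by (auto simp: A_def)
 have finA: "finite A" using t(1) inj unfolding tA by (simp add: finite_image_iff inj_on_subset)
 define q where "q r = (\<Prod>s\<in>A - {r}. [:- complex_of_real s, 1:])" for r
 define P where "P = (\<Sum>r\<in>A. smult (l (u r)) (q r))"
 define all where "all = (\<Prod>s\<in>A. (mX i - mC (of_real s)))"
 have rel: "(\<Sum>r\<in>A. mC (l (u r)) * u r) = 0"
  using t(3) unfolding tA using inj by (subst (asm) sum.reindex) (auto intro: inj_on_subset)
 have allq: "all = (mX i - mC (of_real r)) * uniX i (q r)" if "r : A" for r unfolding all_def using finA that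
  by (subst prod.remove[of _ r]) (auto intro!: mpol_eqI simp: q_def poly_prod)
 have "uniX i P = (\<Sum>r\<in>A. mC (l (u r)) * uniX i (q r))" by (rule mpol_eqI) (simp add: P_def poly_sum)
 also have "\<dots> = (\<Sum>r\<in>A. mC (l (u r)) * (u r * all)) - (\<Sum>r\<in>A. mC (l (u r)) * uniX i (q r) * (u r * (mX i - mC (of_real r)) - 1))"
  unfolding sum_subtractf[symmetric] by (rule sum.cong) (auto simp: allq algebra_simps)
 also have "(\<Sum>r\<in>A. mC (l (u r)) * (u r * all)) = 0"
  using rel by (simp add: sum_distrib_right[symmetric] mult.assoc[symmetric])
 finally have "uniX i P : M" using M_diff[OF M_0 M_sum[of A]] M_mult[OF u] by simp
 moreover have "P ~= 0"
 proof -
  \<comment> \<open>At \<open>c\<close> every \<open>q r\<close> with \<open>r ~= c\<close> contains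
    a factor that vanishes, so only one summand of \<open>P\<close> survives.\<close>
  obtain c where c: "c : A" "l (u c) ~= 0" using t(4) unfolding tA by blast
  have z: "poly (q r) (of_real c) = 0" if "r : A" "r ~= c" for r
   unfolding q_def poly_prod using that c finA by (intro prod_zero) (auto intro!: bexI[of _ c])
  have "poly P (of_real c) = (\<Sum>r\<in>A. l (u r) * poly (q r) (of_real c))" by (simp add: P_def poly_sum)
  also have "\<dots> = l (u c) * poly (q c) (of_real c)" using finA c z by (subst sum.remove[of _ c]) (auto intro!: sum.neutral)
  finally have "poly P (of_real c) = l (u c) * poly (q c) (of_real c)" .
  moreover have "poly (q c) (of_real c) ~= 0" unfolding q_def poly_prod using finA by auto
  ultimately show ?thesis using c by auto
 qed
 ultimately show False using uniX_root no by blast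
qed

text \<open>Modulo \<open>M\<close> every coordinate, hence every polynomial, is congruent to its
  value at \<open>v\<close>. For a member of \<open>M\<close> this value is a constant in
  \<open>M\<close>, thus zero.\<close>

lemma common_zero: "EX v. ALL f:M. ev f v = 0"
proof -
 obtain v where v: "!!i. mX i - mC (v i) : M" using coordinate_value by metis
 have "f - mC (ev f v) : M" for f
 proof (induction f rule: mpol_induct)
  case (mC c)
  thus ?case using M_0 by simp
 next
  case (mX i)
  thus ?case using v by simp
 next
  case (add f g)
  have "f + g - mC (ev (f + g) v) = (f - mC (ev f v)) + (g - mC (ev g v))" by (rule mpol_eqI) simp
  thus ?case using M_add[OF add] by (simp only:)
 next
  case (mult f g)
  have "f * g - mC (ev (f * g) v) = g * (f - mC (ev f v)) + mC (ev f v) * (g - mC (ev g v))"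
   by (rule mpol_eqI) (simp add: algebra_simps)
  thus ?case using M_add M_mult mult by metis
 qed
 hence "mC (ev f v) : M" if "f : M" for f using M_diff[OF that, of "f - mC (ev f v)"] by simp
 thus ?thesis using M_const by blast
qed

end

section \<open>Weak and homogeneous Nullstellensatz\<close>

theorem weak_nullstellensatz:
 assumes "!!v. EX f:S. ev f v ~= 0"
 shows "1 : ideal.span S"
proof (rule ccontr)
 assume 1: "1 \<notin> ideal.span S"
 define A where "A = {J. ideal.subspace J & ideal.span S <= J & 1 \<notin> J}"
 have "A ~= {}" using 1 by (auto simp: A_def)
 moreover have "\<Union>C : A" if C: "C ~= {}" "subset.chain A C" for C
 proof -
  have CA: "C <= A" and lin: "!!X Y. X : C ==> Y : C ==> X <= Y | Y <= X"
   using C(2) unfolding subset.chain_def by auto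
  have "ideal.subspace (\<Union>C)"
  proof (rule ideal.subspaceI)
   show "0 : \<Union>C" using C(1) CA unfolding A_def by (auto intro: ideal.subspace_0)
  next
   fix x y assume "x : \<Union>C" "y : \<Union>C"
   then obtain X Y where XY: "x : X" "y : Y" "X : C" "Y : C" by blast
   then obtain Z where "x : Z" "y : Z" "Z : C" using lin by blast
   thus "x + y : \<Union>C" using CA unfolding A_def by (auto intro: ideal.subspace_add)
  next
   fix c x assume "x : \<Union>C"
   thus "c * x : \<Union>C" using CA unfolding A_def by (auto intro: ideal.subspace_scale)
  qed
  thus ?thesis using C(1) CA unfolding A_def by auto
 qed
 ultimately obtain M where Mx: "M : A" "!!X. X : A ==> M <= X ==> X = M"
  using subset_Zorn_nonempty[of A] by blast
 interpret max_ideal M by standard (use Mx in \<open>auto simp: A_def\<close>)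
 obtain v where "ALL f:M. ev f v = 0" using common_zero by blast
 moreover have "ideal.span S <= M" using Mx(1) by (simp add: A_def)
 hence "S <= M" using ideal.span_superset[of S] by (rule subset_trans[rotated])
 ultimately show False using assms[of v] by blast
qed

text \<open>The components of a multiple of a homogeneous generator are multiples of that
  generator.\<close>

lemma span_hcomp:
 assumes "!!g. g : S ==> EX d. hmg d g" "f : ideal.span S"
 shows "hcomp e f : ideal.span S" using assms(2)
proof (induction rule: ideal.span_induct_alt)
 case base
 thus ?case by (simp add: ideal.span_zero)
next
 case (step c x y)
 obtain d where d: "hmg d x" using assms(1) step by blast
 have "hcomp e (c * x) : ideal.span S"
 proof (cases "d <= e")
  case True
  hence "hcomp e (c * x) = hcomp (e - d) c * x" using hcomp_mult_hmg[OF d, of "e - d" c] by (simp add: mult.commute)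
  thus ?thesis using step(1) by (simp add: ideal.span_scale ideal.span_base)
 next
  case False
  thus ?thesis using hcomp_mult_hmg_less[OF d, of e c] by (simp add: mult.commute ideal.span_zero)
 qed
 thus ?case using step by (simp add: hcomp_add ideal.span_add)
qed

text \<open>Apply the weak form to \<open>S \<union> {1 - f}\<close> and compare homogeneous components.\<close>

theorem hom_nullstellensatz:
 assumes S: "!!g. g : S ==> EX d. hmg d g" and f: "hmg D f" "D > 0"
  and van: "!!v. ALL g:S. ev g v = 0 ==> ev f v = 0"
 shows "EX N. f ^ N : ideal.span S"
proof -
 have "EX g:insert (1 - f) S. ev g v ~= 0" for v using van[of v] by (cases "ALL g:S. ev g v = 0") auto
 hence "1 : ideal.span (insert (1 - f) S)" by (rule weak_nullstellensatz)
 then obtain c where c: "1 - c * (1 - f) : ideal.span S" using ideal.span_breakdown_eq by blast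
 have deg: "hcomp e (1 :: mpol) = (if e = 0 then 1 else 0)" for e using hcomp_hmg[of 0 1 e] by simp
 \<comment> \<open>Read \<open>c * (1 - f) = 1\<close> modulo the ideal in degrees
   \<open>D * m\<close>: the component of \<open>c\<close> in degree zero is 1, and each following
   one is \<open>f\<close> times its predecessor. Beyond the degree of \<open>c\<close> the
   components are zero.\<close>
 have "f ^ m - hcomp (D * m) c : ideal.span S" for m
 proof (induction m)
  case 0
  have "hcomp 0 (1 - c * (1 - f)) = hcomp 0 (1 + (- c) + f * c)" by (simp add: algebra_simps)
  also have "\<dots> = 1 - hcomp 0 c"
   using f by (intro mpol_eqI) (simp add: hcomp_mult_hmg_less[OF f] hmg_hp coeff_monom_mult deg)
  finally show ?case using span_hcomp[OF S c, of 0] by simp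
 next
  case (Suc m)
  have "hcomp (D * Suc m) (1 - c * (1 - f)) = hcomp (D * Suc m) (1 + (- c) + f * c)" by (simp add: algebra_simps)
  also have "\<dots> = - hcomp (D * Suc m) c + f * hcomp (D * m) c" using hcomp_mult_hmg[OF f(1), of "D * m" c] f(2)
   by (intro mpol_eqI) (simp add: hcomp_add deg)
  finally have "- hcomp (D * Suc m) c + f * hcomp (D * m) c : ideal.span S" using span_hcomp[OF S c, of "D * Suc m"] by simp
  from ideal.span_add[OF this ideal.span_scale[OF Suc, of f]] show ?case by (simp add: algebra_simps)
 qed
 from this[of "Suc (tdeg c)"] have "f ^ Suc (tdeg c) - hcomp (D * Suc (tdeg c)) c : ideal.span S" .
 moreover have "hcomp (D * Suc (tdeg c)) c = 0"
 proof (rule mpol_eqI)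
  fix v
  have "tdeg c < D * Suc (tdeg c)" using f(2) by (metis lessI mult_le_mono1 nat_mult_1 order_less_le_trans Suc_leI One_nat_def)
  thus "ev (hcomp (D * Suc (tdeg c)) c) v = ev 0 v" using tdeg_ge[of c v] by (auto intro: coeff_eq_0)
 qed
 ultimately show ?thesis by (metis diff_zero)
qed

text \<open>Otherwise a power of \<open>f\<close> lies in the ideal of \<open>p\<close>, and the
  prime \<open>p\<close> divides \<open>f\<close>.\<close>

lemma prime_hypersurface_point:
 assumes p: "prime_elem p" "hmg d p" and f: "hmg e f" "e > 0" "~ p dvd f"
 shows "EX v. ev p v = 0 & ev f v ~= 0"
proof (rule ccontr)
 assume "~ ?thesis"
 then obtain N where "f ^ N : ideal.span {p}" using hom_nullstellensatz[of "{p}" e f] p f by auto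
 hence "p dvd f ^ N" unfolding ideal.span_singleton by auto
 thus False using p(1) f(3) prime_elem_dvd_power by blast
qed

lemma truncate_ex: "EX g. ALL v. ev g v = ev f (%i. if i < k then v i else 0)"
proof (induction f rule: mpol_induct)
 case (mC c)
 show ?case by (rule exI[of _ "mC c"]) simp
next
 case (mX i)
 show ?case by (rule exI[of _ "if i < k then mX i else 0"]) simp
next
 case (add f g)
 then obtain a b where "ALL v. ev a v = ev f (%i. if i < k then v i else 0)"
  "ALL v. ev b v = ev g (%i. if i < k then v i else 0)" by blast
 thus ?case by (intro exI[of _ "a + b"]) simp
next
 case (mult f g)
 then obtain a b where "ALL v. ev a v = ev f (%i. if i < k then v i else 0)"
  "ALL v. ev b v = ev g (%i. if i < k then v i else 0)" by blast
 thus ?case by (intro exI[of _ "a * b"]) simp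
qed

text \<open>Take the component of degree \<open>e\<close> of an arbitrary representation and set the
  variables beyond \<open>n\<close> to zero. This fixes \<open>f\<close> and commutes with
  multiplication by the generators, so the coefficients become forms of the complementary
  degrees.\<close>

lemma hom_span_representation:
 assumes S: "!!g. g : S ==> hpol n (dg g) g" and f: "hpol n e f" "f : ideal.span S"
 shows "EX T c. finite T & T <= S & f = (\<Sum>g\<in>T. c g * g) &
  (ALL g:T. if dg g <= e then hpol n (e - dg g) (c g) else c g = 0)"
proof -
 obtain T a where T: "finite T" "T <= S" "f = (\<Sum>g\<in>T. a g * g)"
  using f(2) unfolding ideal.span_explicit by blast
 define k where "k = Suc n"
 have "ALL h. EX g. ALL v. ev g v = ev h (%i. if i < k then v i else 0)" by (intro allI truncate_ex)
 from choice[OF this] obtain tr where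
  tr: "ALL h v. ev (tr h) v = ev h (%i. if i < k then v i else 0)" ..
 define c where "c g = (if dg g <= e then tr (hcomp (e - dg g) (a g)) else 0)" for g
 have trdep: "dep k g ==> tr g = g" for g by (rule mpol_eqI) (auto simp: tr intro: depD)
 have "hcomp e (a g * g) = (if dg g <= e then hcomp (e - dg g) (a g) * g else 0)" if "g : T" for g
 proof -
  have "hmg (dg g) g" using S T(2) that unfolding hpol_def by blast
  thus ?thesis using hcomp_mult_hmg[of "dg g" g "e - dg g" "a g"] hcomp_mult_hmg_less[of "dg g" g e "a g"]
   by (auto simp: mult.commute)
 qed
 hence "f = (\<Sum>g\<in>T. (if dg g <= e then hcomp (e - dg g) (a g) * g else 0))"
  using hcomp_hmg[of e f e] f(1) T(3) unfolding hpol_def by (simp add: hcomp_sum)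
 hence "tr f = (\<Sum>g\<in>T. c g * tr g)" by (intro mpol_eqI) (auto simp: tr c_def intro!: sum.cong)
 moreover have "tr f = f" using f(1) trdep unfolding hpol_def k_def by blast
 moreover have "(\<Sum>g\<in>T. c g * tr g) = (\<Sum>g\<in>T. c g * g)"
  using S T(2) trdep unfolding hpol_def k_def by (intro sum.cong) auto
 moreover have "hpol n (e - dg g) (c g)" if "dg g <= e" for g
 proof -
  have "dep k (c g)" unfolding c_def by (rule depI) (use that in \<open>auto simp: tr intro!: arg_cong[of _ _ "%v. coeff (hp _ v) _"]\<close>)
  moreover have "hmg (e - dg g) (c g)" unfolding hmg_def
  proof (intro allI)
   fix t v
   have "(%i. if i < k then vscale t v i else 0) = vscale t (%i. if i < k then v i else 0)"
    by (auto simp: vscale_def)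
   thus "ev (c g) (vscale t v) = t ^ (e - dg g) * ev (c g) v"
    using that hmg_hcomp[of "e - dg g" "a g"] unfolding c_def hmg_def by (simp only: if_True tr)
  qed
  ultimately show ?thesis unfolding hpol_def k_def by simp
 qed
 ultimately show ?thesis using T(1,2) by (intro exI[of _ T] exI[of _ c]) (auto simp: c_def)
qed

section \<open>Rational functions on projective space\<close>

definition rp :: "point => nat => complex" where
 "rp q = (SOME v. v : q)"

lemma line_through_memD: "w : line_through v ==> EX c. c ~= 0 & w = vscale c v"
 unfolding line_through_def vscale_def by auto

lemma line_through_self: "v : line_through v" unfolding line_through_def by (auto intro!: exI[of _ 1])

lemma line_through_eq:
 assumes "w : line_through v"
 shows "line_through w = line_through v"
proof -
 obtain c where c: "c ~= 0" "w = vscale c v" using line_through_memD[OF assms] by blast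
 show ?thesis
 proof (intro subset_antisym subsetI)
  fix u assume "u : line_through w"
  then obtain d where "d ~= 0" "u = vscale d w" using line_through_memD by blast
  hence "u = (%i. (d * c) * v i)" "d * c ~= 0" using c by (auto simp: vscale_def)
  thus "u : line_through v" unfolding line_through_def by blast
 next
  fix u assume "u : line_through v"
  then obtain d where "d ~= 0" "u = vscale d v" using line_through_memD by blast
  hence "u = (%i. (d / c) * w i)" "d / c ~= 0" using c by (auto simp: vscale_def)
  thus "u : line_through w" unfolding line_through_def by blast
 qed
qed

context
 fixes n :: nat and q :: point
 assumes q: "q : proj_space n"
begin

lemma rp_mem: "rp q : q"
proof -
 obtain v where "v : q" using q line_through_self unfolding proj_space_def by blast
 thus ?thesis unfolding rp_def by (rule someI[of "%v. v : q" v])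
qed

lemma line_through_mem: "v : q ==> line_through v = q" using q line_through_eq unfolding proj_space_def by auto

lemma mem_scale_rp: "v : q ==> EX c. c ~= 0 & v = vscale c (rp q)"
 using line_through_mem[OF rp_mem] line_through_memD by metis

lemma rp_nonzero: "EX i<=n. rp q i ~= 0"
proof -
 obtain v where v: "q = line_through v" "EX i. v i ~= 0" "ALL i>n. v i = 0"
  using q unfolding proj_space_def by blast
 then obtain c where "c ~= 0" "rp q = vscale c v" using rp_mem line_through_memD by blast
 thus ?thesis using v by (metis mult_eq_0_iff not_less vscale_def)
qed

lemma rp_zero: "i > n ==> rp q i = 0"
proof -
 assume "i > n"
 obtain v where v: "q = line_through v" "EX i. v i ~= 0" "ALL i>n. v i = 0"
  using q unfolding proj_space_def by blast
 then obtain c where "c ~= 0" "rp q = vscale c v" using rp_mem line_through_memD by blast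
 thus ?thesis using v \<open>i > n\<close> by (simp add: vscale_def)
qed

end

lemma proj_spaceI: "EX i. w i ~= 0 ==> ALL i>n. w i = 0 ==> line_through w : proj_space n"
 unfolding proj_space_def by blast

definition nz :: "mpol => point => bool" where
 "nz f q \<longleftrightarrow> ev f (rp q) ~= 0"

lemma nz_mult [simp]: "nz (f * g) q \<longleftrightarrow> nz f q & nz g q" by (simp add: nz_def)

lemma nz_power: "nz f q ==> nz (f ^ k) q" by (simp add: nz_def)

lemma nz_1 [simp]: "nz 1 q" by (simp add: nz_def)

lemma nz_0 [simp]: "~ nz 0 q" by (simp add: nz_def)

lemma nz_nonzero: "nz f q ==> f ~= 0" by auto

lemma nz_iff:
 assumes "q : proj_space n" "hmg d f" "v : q"
 shows "nz f q \<longleftrightarrow> ev f v ~= 0" using mem_scale_rp[OF assms(1,3)] assms(2) by (auto simp: nz_def hmg_def)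

lemma homD: "hpol n d f ==> dep (Suc n) f" "hpol n d f ==> hmg d f" by (auto simp: hpol_def)

lemma hom_simps [simp, intro]:
 "hpol n d 0" "hpol n 0 1" "hpol n 0 (mC c)" "i <= n ==> hpol n 1 (mX i)" "i <= n ==> hpol n (Suc 0) (mX i)"
 "hpol n d f ==> hpol n d g ==> hpol n d (f + g)" "hpol n d f ==> hpol n d g ==> hpol n d (f - g)"
 "hpol n d f ==> hpol n d (- f)" using hmg_simps(4) by (auto simp: hpol_def)

lemma hom_mult: "hpol n d f ==> hpol n e g ==> hpol n (d + e) (f * g)"
 by (auto simp: hpol_def hmg_mult)

lemma hom_power: "hpol n d f ==> hpol n (d * m) (f ^ m)" by (auto simp: hpol_def hmg_power)

lemma hom_sum: "(!!x. x : A ==> hpol n d (f x)) ==> hpol n d (sum f A)"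
 by (auto simp: hpol_def)

lemma hom_dvd: "hpol n d f ==> f ~= 0 ==> g dvd f ==> EX e. hpol n e g"
 unfolding hpol_def using hmg_dvd dep_dvd by metis

lemma hom_unique: "hpol n d f ==> hpol n e f ==> f ~= 0 ==> d = e"
 unfolding hpol_def using hmg_unique by blast

text \<open>The Nullstellensatz speaks of arbitrary sequences \<open>v\<close>. Cutting off the
  coordinates beyond \<open>n\<close> preserves the values of forms, and the positive degree of
  \<open>f\<close> guarantees that the rest is not the zero vector.\<close>

lemma point_of_vector:
 assumes "ev f v ~= 0" "hpol n d f" "d > 0"
 shows "EX z:proj_space n. ALL e g. hpol n e g --> (nz g z \<longleftrightarrow> ev g v ~= 0)"
proof -
 define w where "w i = (if i <= n then v i else 0)" for i
 have eq: "ev g w = ev g v" if "hpol n e g" for e g by (rule depD[OF homD(1)[OF that]]) (auto simp: w_def)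
 have "EX i. w i ~= 0"
 proof (rule ccontr)
  assume "~ ?thesis"
  hence "w = vscale 0 w" by (auto simp: vscale_def)
  hence "ev f w = 0 ^ d * ev f w" using homD(2)[OF assms(2)] unfolding hmg_def by metis
  thus False using assms eq[OF assms(2)] zero_power[OF assms(3), where 'a = complex] by simp
 qed
 hence z: "line_through w : proj_space n" by (rule proj_spaceI) (simp add: w_def)
 show ?thesis
 proof (rule bexI[OF _ z], intro allI impI)
  fix e g assume g: "hpol n e g"
  show "nz g (line_through w) \<longleftrightarrow> ev g v ~= 0"
   by (simp add: nz_iff[OF z homD(2)[OF g] line_through_self] eq[OF g])
 qed
qed

lemma hom_nonzero_point:
 assumes "hpol n d f" "f ~= 0"
 shows "EX z:proj_space n. nz f z"
proof -
 have f: "hpol n (d + 1) (f * mX 0)" using assms by (intro hom_mult) auto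
 obtain v where v: "ev (f * mX 0) v ~= 0" using ev_neq_0 assms by (metis mX_neq_0 mult_eq_0_iff)
 thus ?thesis using point_of_vector[OF v f] assms(1) by auto
qed

lemma exists_coordinate:
 assumes "q : proj_space n"
 obtains j where "j <= n" "nz (mX j) q" using rp_nonzero[OF assms] by (auto simp: nz_def)

section \<open>The Zariski topology\<close>

definition ptD :: "nat => mpol => point set" where
 "ptD n f = {q : proj_space n. nz f q}"

lemma zariski_open_subset: "zariski_open n U ==> U <= proj_space n" unfolding zariski_open_def by auto

lemma open_ptD: "hpol n d f ==> zariski_open n (ptD n f)" unfolding zariski_open_def
proof (intro exI[of _ "{ev f}"] conjI)
 assume f: "hpol n d f"
 show "ALL f:{ev f}. EX d. hom_poly n d f" using hom_poly_ev[OF f] by auto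
 show "ptD n f = proj_space n - {p : proj_space n. ALL f:{ev f}. ALL v:p. f v = 0}"
  using nz_iff[OF _ homD(2)[OF f]] rp_mem unfolding ptD_def by (auto; blast)
qed

text \<open>Multiplication by a coordinate that does not vanish at \<open>q\<close> makes the degree
  positive, as \<open>point_of_vector\<close> requires.\<close>

lemma zariski_basis:
 assumes "zariski_open n U" "q : U"
 shows "EX d f. hpol n d f & nz f q & ptD n f <= U & d > 0"
proof -
 obtain S where S: "ALL f:S. EX d. hom_poly n d f" "U = proj_space n - {p : proj_space n. ALL f:S. ALL v:p. f v = 0}"
  using assms(1) unfolding zariski_open_def by blast
 have q: "q : proj_space n" using assms S by auto
 obtain F v where F: "F : S" "v : q" "F v ~= 0" using assms S by blast
 obtain d f where f: "hpol n d f" "F = ev f" using S(1) F(1) hom_poly_imp_hom by blast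
 obtain j where j: "j <= n" "nz (mX j) q" using exists_coordinate[OF q] .
 have "nz f q" using F f nz_iff[OF q homD(2)[OF f(1)]] by auto
 hence "nz (f * mX j) q" using j by simp
 moreover have "hpol n (d + 1) (f * mX j)" using f j by (intro hom_mult) auto
 moreover have "ptD n (f * mX j) <= U"
 proof
  fix p assume "p : ptD n (f * mX j)"
  hence p: "p : proj_space n" "nz f p" by (auto simp: ptD_def)
  hence "F (rp p) ~= 0" "rp p : p" using f rp_mem by (auto simp: nz_def)
  thus "p : U" unfolding S(2) using F(1) p(1) by blast
 qed
 ultimately show ?thesis by (intro exI[of _ "d + 1"] exI[of _ "f * mX j"]) simp
qed

lemma zariski_open_Int: "zariski_open n U ==> zariski_open n V ==> zariski_open n (U \<inter> V)"
 using openin_Int[of "zariski n" U V] by simp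

lemma zariski_open_proj: "zariski_open n (proj_space n)"
proof -
 have "ptD n 1 = proj_space n" by (auto simp: ptD_def)
 thus ?thesis using open_ptD[of n 0 1] by auto
qed

text \<open>The product of two non-zero forms is non-zero at some point. This is what allows all
  stalks to live in one field and makes values of sections survive restriction.\<close>

lemma zariski_irreducible:
 assumes "zariski_open n U" "zariski_open n V" "U ~= {}" "V ~= {}"
 shows "U \<inter> V ~= {}"
proof -
 obtain p q where pq: "p : U" "q : V" using assms(3,4) by blast
 obtain d f where f: "hpol n d f" "nz f p" "ptD n f <= U" using zariski_basis[OF assms(1) pq(1)] by blast
 obtain e g where g: "hpol n e g" "nz g q" "ptD n g <= V" using zariski_basis[OF assms(2) pq(2)] by blast
 have "f * g ~= 0" using f g nz_nonzero by auto
 then obtain z where "z : proj_space n" "nz (f * g) z" using hom_nonzero_point[OF hom_mult[OF f(1) g(1)]] by blast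
 thus ?thesis using f g by (auto simp: ptD_def)
qed

section \<open>Stalks of twists inside the function field of the cone\<close>

type_synonym rat = "mpol fract"

text \<open>The stalk of \<open>O(k)\<close> at \<open>q\<close>. In the same way \<open>ulc\<close>
  consists of the generators of this stalk, and \<open>krat\<close> of the rational sections of
  \<open>O(k)\<close>.\<close>

definition loc :: "nat => int => point => rat set" where
 "loc n k q = {Fract g h | g h d e. hpol n d g & hpol n e h & int d - int e = k & nz h q}"

definition ulc :: "nat => int => point => rat set" where
 "ulc n k q = {Fract g h | g h d e. hpol n d g & hpol n e h & int d - int e = k & nz g q & nz h q}"

definition krat :: "nat => int => rat set" where
 "krat n k = {Fract g h | g h d e. hpol n d g & hpol n e h & int d - int e = k & h ~= 0}"

lemma locI: "hpol n d g ==> hpol n e h ==> nz h q ==> int d - int e = k ==> Fract g h : loc n k q"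
 unfolding loc_def by blast

lemma locE:
 assumes "x : loc n k q"
 obtains g h d e where "x = Fract g h" "hpol n d g" "hpol n e h" "int d - int e = k" "nz h q"
 using assms unfolding loc_def by blast

lemma ulcI: "hpol n d g ==> hpol n e h ==> nz g q ==> nz h q ==> int d - int e = k ==> Fract g h : ulc n k q"
 unfolding ulc_def by blast

lemma ulcE:
 assumes "x : ulc n k q"
 obtains g h d e where "x = Fract g h" "hpol n d g" "hpol n e h" "int d - int e = k" "nz g q" "nz h q"
 using assms unfolding ulc_def by blast

lemma kratI: "hpol n d g ==> hpol n e h ==> h ~= 0 ==> int d - int e = k ==> Fract g h : krat n k"
 unfolding krat_def by blast

lemma kratE:
 assumes "x : krat n k"
 obtains g h d e where "x = Fract g h" "hpol n d g" "hpol n e h" "int d - int e = k" "h ~= 0"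
 using assms unfolding krat_def by blast

lemma loc_krat: "x : loc n k q ==> x : krat n k" by (elim locE) (auto intro!: kratI dest: nz_nonzero)

lemma ulc_loc: "x : ulc n k q ==> x : loc n k q" by (elim ulcE) (auto intro!: locI)

lemma hom_nonvanishing:
 assumes "q : proj_space n"
 obtains h where "hpol n e h" "nz h q"
proof -
 obtain j where "j <= n" "nz (mX j) q" using exists_coordinate[OF assms] .
 hence "hpol n (1 * e) (mX j ^ e)" "nz (mX j ^ e) q" using hom_power[of n 1 "mX j" e] nz_power by auto
 thus ?thesis using that by simp
qed

lemma loc_0 [simp]:
 assumes "q : proj_space n"
 shows "0 : loc n k q"
proof -
 obtain h where h: "hpol n (nat (- k)) h" "nz h q" using hom_nonvanishing[OF assms] .
 have "Fract 0 h : loc n k q" by (rule locI[of n "nat k" _ "nat (- k)"]) (use h in auto)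
 thus ?thesis using nz_nonzero[OF h(2)] by (simp add: fract_collapse)
qed

lemma loc_add:
 assumes "x : loc n k q" "y : loc n k q"
 shows "x + y : loc n k q"
proof -
 obtain g h d e where x: "x = Fract g h" "hpol n d g" "hpol n e h" "int d - int e = k" "nz h q" using assms(1) by (rule locE)
 obtain g' h' d' e' where y: "y = Fract g' h'" "hpol n d' g'" "hpol n e' h'" "int d' - int e' = k" "nz h' q"
  using assms(2) by (rule locE)
 have deg: "d' + e = d + e'" using x(4) y(4) by linarith
 have xy: "x + y = Fract (g * h' + g' * h) (h * h')" using x y by (simp add: add_fract nz_nonzero)
 have "hpol n (d + e') (g * h' + g' * h)" using hom_mult[OF x(2) y(3)] hom_mult[OF y(2) x(3)] by (simp add: deg)
 thus ?thesis unfolding xy by (rule locI[OF _ hom_mult[OF x(3) y(3)]]) (use x y in auto)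
qed

lemma loc_mult:
 assumes "x : loc n k q" "y : loc n l q"
 shows "x * y : loc n (k + l) q"
proof -
 obtain g h d e where x: "x = Fract g h" "hpol n d g" "hpol n e h" "int d - int e = k" "nz h q" using assms(1) by (rule locE)
 obtain g' h' d' e' where y: "y = Fract g' h'" "hpol n d' g'" "hpol n e' h'" "int d' - int e' = l" "nz h' q"
  using assms(2) by (rule locE)
 show ?thesis unfolding x(1) y(1) mult_fract by (rule locI[OF hom_mult[OF x(2) y(2)] hom_mult[OF x(3) y(3)]]) (use x y in auto)
qed

lemma krat_mult:
 assumes "x : krat n k" "y : krat n l"
 shows "x * y : krat n (k + l)"
proof -
 obtain g h d e where x: "x = Fract g h" "hpol n d g" "hpol n e h" "int d - int e = k" "h ~= 0"
  using assms(1) by (rule kratE)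
 obtain g' h' d' e' where y: "y = Fract g' h'" "hpol n d' g'" "hpol n e' h'" "int d' - int e' = l" "h' ~= 0"
  using assms(2) by (rule kratE)
 show ?thesis unfolding x(1) y(1) mult_fract by (rule kratI[OF hom_mult[OF x(2) y(2)] hom_mult[OF x(3) y(3)]]) (use x y in auto)
qed

lemma krat_add:
 assumes "x : krat n k" "y : krat n k"
 shows "x + y : krat n k"
proof -
 obtain g h d e where x: "x = Fract g h" "hpol n d g" "hpol n e h" "int d - int e = k" "h ~= 0"
  using assms(1) by (rule kratE)
 obtain g' h' d' e' where y: "y = Fract g' h'" "hpol n d' g'" "hpol n e' h'" "int d' - int e' = k" "h' ~= 0"
  using assms(2) by (rule kratE)
 have deg: "d' + e = d + e'" using x(4) y(4) by linarith
 have xy: "x + y = Fract (g * h' + g' * h) (h * h')" using x y by (simp add: add_fract)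
 have "hpol n (d + e') (g * h' + g' * h)" using hom_mult[OF x(2) y(3)] hom_mult[OF y(2) x(3)] by (simp add: deg)
 thus ?thesis unfolding xy by (rule kratI[OF _ hom_mult[OF x(3) y(3)]]) (use x y in auto)
qed

lemma krat_inverse:
 assumes "x : krat n k" "x ~= 0"
 shows "inverse x : krat n (- k)"
proof -
 obtain g h d e where x: "x = Fract g h" "hpol n d g" "hpol n e h" "int d - int e = k" "h ~= 0"
  using assms(1) by (rule kratE)
 have "g ~= 0" using assms(2) x by (auto simp: fract_collapse)
 thus ?thesis unfolding x(1) inverse_fract by (rule kratI[OF x(3,2)]) (use x in auto)
qed

lemma ulc_mult:
 assumes "x : ulc n k q" "y : ulc n l q"
 shows "x * y : ulc n (k + l) q"
proof -
 obtain g h d e where x: "x = Fract g h" "hpol n d g" "hpol n e h" "int d - int e = k" "nz g q" "nz h q"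
  using assms(1) by (rule ulcE)
 obtain g' h' d' e' where y: "y = Fract g' h'" "hpol n d' g'" "hpol n e' h'" "int d' - int e' = l" "nz g' q" "nz h' q"
  using assms(2) by (rule ulcE)
 show ?thesis unfolding x(1) y(1) mult_fract by (rule ulcI[OF hom_mult[OF x(2) y(2)] hom_mult[OF x(3) y(3)]]) (use x y in auto)
qed

lemma ulc_inverse:
 assumes "x : ulc n k q"
 shows "inverse x : ulc n (- k) q"
proof -
 obtain g h d e where x: "x = Fract g h" "hpol n d g" "hpol n e h" "int d - int e = k" "nz g q" "nz h q"
  using assms by (rule ulcE)
 show ?thesis unfolding x(1) inverse_fract by (rule ulcI[OF x(3,2)]) (use x in auto)
qed

lemma ulc_divide: "x : ulc n k q ==> y : ulc n l q ==> x / y : ulc n (k - l) q"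
 using ulc_mult[OF _ ulc_inverse, of x n k q y l] by (simp add: divide_inverse)

lemma ulc_nonzero: "x : ulc n k q ==> x ~= 0"
 by (elim ulcE) (auto dest!: nz_nonzero simp: Zero_fract_def eq_fract)

lemma loc_1: "1 : loc n 0 q" unfolding One_fract_def by (rule locI[of n 0 _ 0]) auto

lemma loc_uminus: "x : loc n k q ==> - x : loc n k q" by (elim locE) (auto intro!: locI)

lemma loc_diff: "x : loc n k q ==> y : loc n k q ==> x - y : loc n k q"
 using loc_add[OF _ loc_uminus, of x n k q y] by simp

lemma loc_open:
 assumes "x : loc n k q" "q : proj_space n"
 obtains V where "zariski_open n V" "q : V" "!!z. z : V ==> x : loc n k z"
proof -
 obtain g h d e where x: "x = Fract g h" "hpol n d g" "hpol n e h" "int d - int e = k" "nz h q" using assms(1) by (rule locE)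
 show ?thesis
 proof (rule that)
  show "zariski_open n (ptD n h)" using open_ptD x by blast
  show "q : ptD n h" using x assms by (auto simp: ptD_def)
  show "x : loc n k z" if "z : ptD n h" for z
   unfolding x(1) by (rule locI) (use x that in \<open>auto simp: ptD_def\<close>)
 qed
qed

lemma ulc_open:
 assumes "x : ulc n k q" "q : proj_space n"
 obtains V where "zariski_open n V" "q : V" "!!z. z : V ==> x : ulc n k z"
proof -
 obtain g h d e where x: "x = Fract g h" "hpol n d g" "hpol n e h" "int d - int e = k" "nz g q" "nz h q"
  using assms(1) by (rule ulcE)
 show ?thesis
 proof (rule that)
  show "zariski_open n (ptD n (g * h))" using open_ptD[OF hom_mult[OF x(2,3)]] .
  show "q : ptD n (g * h)" using x assms by (auto simp: ptD_def)
  show "x : ulc n k z" if "z : ptD n (g * h)" for z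
   unfolding x(1) by (rule ulcI) (use x that in \<open>auto simp: ptD_def\<close>)
 qed
qed

text \<open>The value of a fraction at \<open>v\<close>; it is junk where no representation is defined.\<close>

definition evk :: "rat => (nat => complex) => complex" where
 "evk x v = (THE c. EX g h. x = Fract g h & ev h v ~= 0 & c = ev g v / ev h v)"

lemma evk_Fract:
 assumes "ev h v ~= 0"
 shows "evk (Fract g h) v = ev g v / ev h v" unfolding evk_def
proof (rule the_equality)
 show "EX g' h'. Fract g h = Fract g' h' & ev h' v ~= 0 & ev g v / ev h v = ev g' v / ev h' v"
  using assms by blast
 fix c assume "EX g' h'. Fract g h = Fract g' h' & ev h' v ~= 0 & c = ev g' v / ev h' v"
 then obtain g' h' where *: "Fract g h = Fract g' h'" "ev h' v ~= 0" "c = ev g' v / ev h' v" by blast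
 have "h ~= 0" "h' ~= 0" using assms * by auto
 hence "g * h' = g' * h" using *(1) by (simp add: eq_fract)
 hence "ev (g * h') v = ev (g' * h) v" by (rule arg_cong)
 thus "c = ev g v / ev h v" using *(2,3) assms by (simp add: frac_eq_eq)
qed

lemma locE_ev:
 assumes "x : loc n k q" "q : proj_space n" "v : q"
 obtains g h d e where "x = Fract g h" "hpol n d g" "hpol n e h" "int d - int e = k" "nz h q"
  "ev h v ~= 0" "evk x v = ev g v / ev h v"
proof -
 obtain g h d e where x: "x = Fract g h" "hpol n d g" "hpol n e h" "int d - int e = k" "nz h q" using assms(1) by (rule locE)
 moreover have "ev h v ~= 0" using nz_iff[OF assms(2) homD(2)[OF x(3)] assms(3)] x(5) by simp
 ultimately show ?thesis using that evk_Fract by metis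
qed

lemma evk_add:
 assumes "x : loc n k q" "y : loc n k q" "q : proj_space n" "v : q"
 shows "evk (x + y) v = evk x v + evk y v"
proof -
 obtain g h where x: "x = Fract g h" "ev h v ~= 0" "evk x v = ev g v / ev h v" using locE_ev[OF assms(1,3,4)] by metis
 obtain g' h' where y: "y = Fract g' h'" "ev h' v ~= 0" "evk y v = ev g' v / ev h' v"
  using locE_ev[OF assms(2,3,4)] by metis
 have "h ~= 0" "h' ~= 0" using x y by auto
 hence "x + y = Fract (g * h' + g' * h) (h * h')" using x y by (simp add: add_fract)
 moreover have "ev (h * h') v ~= 0" using x y by simp
 ultimately show ?thesis using x y by (simp add: evk_Fract field_simps)
qed

lemma evk_mult:
 assumes "x : loc n k q" "y : loc n l q" "q : proj_space n" "v : q"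
 shows "evk (x * y) v = evk x v * evk y v"
proof -
 obtain g h where x: "x = Fract g h" "ev h v ~= 0" "evk x v = ev g v / ev h v" using locE_ev[OF assms(1,3,4)] by metis
 obtain g' h' where y: "y = Fract g' h'" "ev h' v ~= 0" "evk y v = ev g' v / ev h' v"
  using locE_ev[OF assms(2,3,4)] by metis
 have "ev (h * h') v ~= 0" using x y by simp
 thus ?thesis using x y by (simp add: evk_Fract)
qed

lemma evk_0 [simp]: "evk 0 v = 0" using evk_Fract[of 1 v 0] by (simp add: Zero_fract_def)

lemma evk_1 [simp]: "evk 1 v = 1" using evk_Fract[of 1 v 1] by (simp add: One_fract_def)

text \<open>The cross-multiplied numerators agree on the cone over \<open>U\<close>. Multiplied by
  \<open>f\<close>, \<open>h\<close> and \<open>h'\<close>, their difference vanishes at all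
  vectors, so the identity holds between polynomials.\<close>

lemma evk_unique:
 assumes U: "zariski_open n U" "U ~= {}"
  and x: "!!q. q : U ==> x : loc n k q" and y: "!!q. q : U ==> y : loc n l q"
  and eq: "!!q v. q : U ==> v : q ==> evk x v = evk y v"
 shows "x = y"
proof -
 obtain q where q: "q : U" using U by blast
 obtain g h d e where x': "x = Fract g h" "hpol n d g" "hpol n e h" "int d - int e = k" "nz h q" using x[OF q] by (rule locE)
 obtain g' h' d' e' where y': "y = Fract g' h'" "hpol n d' g'" "hpol n e' h'" "int d' - int e' = l" "nz h' q"
  using y[OF q] by (rule locE)
 obtain c f where f: "hpol n c f" "nz f q" "ptD n f <= U" "c > 0" using zariski_basis[OF U(1) q] by blast
 have hom: "hpol n (c + e + e') (f * h * h')" using hom_mult[OF hom_mult[OF f(1) x'(3)] y'(3)] .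
 have "ev ((g * h' - g' * h) * (f * h * h')) v = 0" for v
 proof (cases "ev (f * h * h') v = 0")
  case False
  define w where "w i = (if i <= n then v i else 0)" for i
  have w: "ev p w = ev p v" if "hpol n e p" for e p by (rule depD[OF homD(1)[OF that]]) (auto simp: w_def)
  have "ev f v ~= 0" using False by simp
  hence fw: "ev f w ~= 0" using w f by simp
  have "EX i. w i ~= 0"
  proof (rule ccontr)
   assume "~ ?thesis"
   hence "w = vscale 0 w" by (auto simp: vscale_def)
   hence "ev f w = 0 ^ c * ev f w" using homD(2)[OF f(1)] unfolding hmg_def by metis
   thus False using fw zero_power[OF f(4), where 'a = complex] by simp
  qed
  hence z: "line_through w : proj_space n" by (rule proj_spaceI) (simp add: w_def)
  have "nz f (line_through w)" using nz_iff[OF z homD(2)[OF f(1)] line_through_self] fw by simp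
  hence "line_through w : U" using f(3) z by (auto simp: ptD_def)
  from eq[OF this line_through_self] have "ev g w / ev h w = ev g' w / ev h' w" using False w x' y' by (simp add: evk_Fract)
  moreover have "ev g w = ev g v" "ev h w = ev h v" "ev g' w = ev g' v" "ev h' w = ev h' v" using w x'(2,3) y'(2,3) by blast+
  ultimately have "ev g v * ev h' v = ev g' v * ev h v" using False by (simp add: frac_eq_eq)
  thus ?thesis by simp
 qed simp
 hence "(g * h' - g' * h) * (f * h * h') = 0" by (intro mpol_eqI) simp
 hence "g * h' = g' * h" using f x' y' nz_nonzero by auto
 thus ?thesis unfolding x'(1) y'(1) using x' y' nz_nonzero by (auto simp: eq_fract)
qed

text \<open>Two local quotients agree on the intersection of their domains, which is not empty, so
  they are one element of the field.\<close>

lemma rational_function_exists: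
 assumes U: "zariski_open n U" "U ~= {}"
  and F: "!!p. p : U ==> EX V d e g h. zariski_open n V & p : V & V <= U & hpol n d g & hpol n e h &
   int d - int e = k & (ALL q:V. ALL v:q. ev h v ~= 0 & F v = ev g v / ev h v)"
 shows "EX x. ALL q:U. x : loc n k q & (ALL v:q. F v = evk x v)"
proof -
 have Uq: "q : proj_space n" if "q : U" for q using zariski_open_subset[OF U(1)] that by blast
 have loc1: "EX V x. zariski_open n V & p : V & V <= U & (ALL q:V. x : loc n k q & (ALL v:q. F v = evk x v))"
  if p: "p : U" for p
 proof -
  obtain V d e g h where V: "zariski_open n V" "p : V" "V <= U" "hpol n d g" "hpol n e h"
   "int d - int e = k" "ALL q:V. ALL v:q. ev h v ~= 0 & F v = ev g v / ev h v"
   using F[OF p] by blast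
  have "Fract g h : loc n k q & (ALL v:q. F v = evk (Fract g h) v)" if q: "q : V" for q
  proof
   have qp: "q : proj_space n" using q V(3) Uq by blast
   have "nz h q" using V(7) q rp_mem[OF qp] unfolding nz_def by blast
   thus "Fract g h : loc n k q" using V by (auto intro: locI)
   show "ALL v:q. F v = evk (Fract g h) v" using V(7) q by (auto simp: evk_Fract)
  qed
  thus ?thesis using V by blast
 qed
 obtain p where p: "p : U" using U by blast
 obtain V x where V: "zariski_open n V" "p : V" "V <= U" and x: "ALL q:V. x : loc n k q & (ALL v:q. F v = evk x v)"
  using loc1[OF p] by blast
 have "x : loc n k q & (ALL v:q. F v = evk x v)" if q: "q : U" for q
 proof -
  obtain W y where W: "zariski_open n W" "q : W" "W <= U" and y: "ALL q:W. y : loc n k q & (ALL v:q. F v = evk y v)"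
   using loc1[OF q] by blast
  have "x = y"
  proof (rule evk_unique[of n "V \<inter> W" x k y k])
   show "zariski_open n (V \<inter> W)" using V W zariski_open_Int by blast
   show "V \<inter> W ~= {}" using zariski_irreducible[OF V(1) W(1)] V(2) W(2) by blast
  qed (use x y in auto)
  thus ?thesis using y W(2) by blast
 qed
 thus ?thesis by blast
qed

text \<open>The section of \<open>\<O>(t)\<close> over a nonempty open set \<open>U\<close>, as an element of the function field of the cone.\<close>

definition iO :: "nat => int => point set => ((nat => complex) => complex) => rat" where
 "iO n t U f = (THE x. ALL q:U. x : loc n t q & (ALL v:q. f v = evk x v))"

text \<open>A regular function, pulled back to the cone, is a section of degree zero.\<close>

definition iR :: "nat => point set => (point => complex) => rat" where
 "iR n U a = iO n 0 U (%v. a (line_through v))"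

definition isO :: "nat => int => point set => ((nat => complex) => complex) => rat => bool" where
 "isO n t U f x \<longleftrightarrow> (ALL q:U. x : loc n t q & (ALL v:q. f v = evk x v))"

lemma iO_eqI:
 assumes "zariski_open n U" "U ~= {}" "isO n t U f x"
 shows "iO n t U f = x" unfolding iO_def
proof (rule the_equality)
 show "ALL q:U. x : loc n t q & (ALL v:q. f v = evk x v)" using assms(3) unfolding isO_def .
 fix y assume y: "ALL q:U. y : loc n t q & (ALL v:q. f v = evk y v)"
 show "y = x" by (rule evk_unique[OF assms(1,2), of y t x t]) (use y assms(3) in \<open>auto simp: isO_def\<close>)
qed

lemma O_twist_carrier_isO:
 assumes "zariski_open n U" "U ~= {}" "f : Sec (O_twist n t) U"
 shows "isO n t U f (iO n t U f)"
proof -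
 have "EX x. ALL q:U. x : loc n t q & (ALL v:q. f v = evk x v)"
 proof (rule rational_function_exists[OF assms(1,2)])
  fix p assume "p : U"
  then obtain V d e g h where V: "zariski_open n V" "p : V" "V <= U" "hom_poly n d g" "hom_poly n e h"
   "int d - int e = t" "ALL v:\<Union>V. h v ~= 0 & f v = g v / h v"
   using assms(3) unfolding O_twist_def by auto
  obtain g' h' where gh: "hpol n d g'" "g = ev g'" "hpol n e h'" "h = ev h'" using hom_poly_imp_hom V(4,5) by metis
  have "ALL q:V. ALL v:q. ev h' v ~= 0 & f v = ev g' v / ev h' v" using V(7) gh by blast
  thus "EX V d e g h. zariski_open n V & p : V & V <= U & hpol n d g & hpol n e h &
   int d - int e = t & (ALL q:V. ALL v:q. ev h v ~= 0 & f v = ev g v / ev h v)"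
   using V(1,2,3,6) gh by blast
 qed
 then obtain x where "isO n t U f x" unfolding isO_def by blast
 thus ?thesis using iO_eqI assms by metis
qed

lemma isO_O_twist_carrier:
 assumes "zariski_open n U" "ALL q:U. x : loc n t q"
 shows "(\<lambda>v\<in>\<Union>U. evk x v) : Sec (O_twist n t) U"
  and "isO n t U (\<lambda>v\<in>\<Union>U. evk x v) x"
proof -
 have Uq: "q : proj_space n" if "q : U" for q using zariski_open_subset[OF assms(1)] that by blast
 have "EX V d e g h. openin (zariski n) V & p : V & V <= U &
     hom_poly n d g & hom_poly n e h & int d - int e = t &
     (ALL v:\<Union>V. h v ~= 0 & (\<lambda>v\<in>\<Union>U. evk x v) v = g v / h v)" if p: "p : U" for p
 proof -
  obtain g h d e where x: "x = Fract g h" "hpol n d g" "hpol n e h" "int d - int e = t" "nz h p"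
   using bspec[OF assms(2) p] by (rule locE)
  define V where "V = ptD n h \<inter> U"
  have V: "zariski_open n V" "p : V" "V <= U"
   unfolding V_def using open_ptD[OF x(3)] assms(1) zariski_open_Int p Uq x(5) by (auto simp: ptD_def)
  have "ev h v ~= 0 & (\<lambda>v\<in>\<Union>U. evk x v) v = ev g v / ev h v" if "v : \<Union>V" for v
  proof -
   obtain q where q: "q : U" "nz h q" "q : proj_space n" "v : q" using \<open>v : \<Union>V\<close> by (auto simp: V_def ptD_def)
   hence "ev h v ~= 0" using nz_iff[OF q(3) homD(2)[OF x(3)] q(4)] by simp
   thus ?thesis using q x by (auto simp: evk_Fract)
  qed
  thus ?thesis using V x hom_poly_ev[OF x(2)] hom_poly_ev[OF x(3)] by (metis openin_zariski)
 qed
 thus "(\<lambda>v\<in>\<Union>U. evk x v) : Sec (O_twist n t) U" unfolding O_twist_def by simp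
 show "isO n t U (\<lambda>v\<in>\<Union>U. evk x v) x" using assms(2) unfolding isO_def by auto
qed

lemma reg_ring_isO:
 assumes "zariski_open n U" "U ~= {}" "a : Reg n U"
 shows "isO n 0 U (%v. a (line_through v)) (iR n U a)"
proof -
 have Uq: "q : proj_space n" if "q : U" for q using zariski_open_subset[OF assms(1)] that by blast
 have "EX x. ALL q:U. x : loc n 0 q & (ALL v:q. a (line_through v) = evk x v)"
 proof (rule rational_function_exists[OF assms(1,2)])
  fix p assume p: "p : U"
  have "regular_fun n U a" using assms(3) by (simp add: reg_ring_def)
  from bspec[OF this[unfolded regular_fun_def openin_zariski] p]
  obtain V d g h where V: "zariski_open n V" "p : V" "V <= U" "hom_poly n d g" "hom_poly n d h"
   "ALL q:V. ALL v:q. h v ~= 0 & a q = g v / h v" by (elim exE conjE) (rule that)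
  obtain g' h' where gh: "hpol n d g'" "g = ev g'" "hpol n d h'" "h = ev h'" using hom_poly_imp_hom V(4,5) by metis
  have "ALL q:V. ALL v:q. ev h' v ~= 0 & a (line_through v) = ev g' v / ev h' v"
   using V(3,6) gh line_through_mem Uq by (metis subsetD)
  thus "EX V d e g h. zariski_open n V & p : V & V <= U & hpol n d g & hpol n e h &
   int d - int e = 0 & (ALL q:V. ALL v:q. ev h v ~= 0 & a (line_through v) = ev g v / ev h v)"
   using V(1,2,3) gh by (metis diff_self)
 qed
 then obtain x where "isO n 0 U (%v. a (line_through v)) x" unfolding isO_def by blast
 thus ?thesis using iO_eqI assms unfolding iR_def by metis
qed

lemma isO_reg_ring_carrier:
 assumes "zariski_open n U" "ALL q:U. x : loc n 0 q"
 shows "(\<lambda>q\<in>U. evk x (rp q)) : Reg n U"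
  and "isO n 0 U (%v. (\<lambda>q\<in>U. evk x (rp q)) (line_through v)) x"
proof -
 have Uq: "q : proj_space n" if "q : U" for q using zariski_open_subset[OF assms(1)] that by blast
 have scale: "evk x v = evk x (rp q)" if q: "q : U" "v : q" for q v
 proof -
  obtain g h d e where x: "x = Fract g h" "hpol n d g" "hpol n e h" "int d - int e = 0" "nz h q"
   using bspec[OF assms(2) q(1)] by (rule locE)
  obtain c where c: "c ~= 0" "v = vscale c (rp q)" using mem_scale_rp[OF Uq] q by blast
  have "ev g v = c ^ d * ev g (rp q)" "ev h v = c ^ e * ev h (rp q)"
   using homD(2)[OF x(2)] homD(2)[OF x(3)] c unfolding hmg_def by auto
  thus ?thesis using x c by (simp add: evk_Fract nz_def)
 qed
 have "regular_fun n U (\<lambda>q\<in>U. evk x (rp q))" unfolding regular_fun_def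
 proof
  fix p assume p: "p : U"
  obtain g h d e where x: "x = Fract g h" "hpol n d g" "hpol n e h" "int d - int e = 0" "nz h p"
   using bspec[OF assms(2) p] by (rule locE)
  define V where "V = ptD n h \<inter> U"
  have V: "zariski_open n V" "p : V" "V <= U"
   unfolding V_def using open_ptD[OF x(3)] assms(1) zariski_open_Int p Uq x(5) by (auto simp: ptD_def)
  have "ev h v ~= 0 & (\<lambda>q\<in>U. evk x (rp q)) q = ev g v / ev h v" if "q : V" "v : q" for q v
  proof -
   have q: "q : U" "nz h q" "q : proj_space n" using that by (auto simp: V_def ptD_def)
   hence "ev h v ~= 0" using nz_iff[OF q(3) homD(2)[OF x(3)] that(2)] by simp
   thus ?thesis using q x scale[OF q(1) that(2)] by (auto simp: evk_Fract)
  qed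
  moreover have "hom_poly n d (ev g)" "hom_poly n d (ev h)" using hom_poly_ev x by auto
  ultimately show "EX V d g h. openin (zariski n) V & p : V & V <= U & hom_poly n d g & hom_poly n d h &
    (ALL q:V. ALL v:q. h v ~= 0 & (\<lambda>q\<in>U. evk x (rp q)) q = g v / h v)"
   unfolding openin_zariski using V by blast
 qed
 thus "(\<lambda>q\<in>U. evk x (rp q)) : Reg n U" unfolding reg_ring_def by simp
 show "isO n 0 U (%v. (\<lambda>q\<in>U. evk x (rp q)) (line_through v)) x"
  unfolding isO_def using assms(2) scale line_through_mem[OF Uq] by auto
qed

section \<open>Global equations of divisors\<close>

lemma vanishing_prime_factor:
 assumes "f ~= 0" "ev f v = 0"
 shows "EX p. prime_elem p & p dvd f & ev p v = 0" using assms
proof (induction "tdeg f" arbitrary: f rule: less_induct)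
 case less
 have "~ f dvd 1" using mpol_unit_const less.prems by force
 then obtain p where p: "prime_elem p" "p dvd f" using exists_prime_factor less.prems by blast
 then obtain g where g: "f = p * g" by (elim dvdE)
 hence nz: "p ~= 0" "g ~= 0" using less.prems by auto
 show ?case
 proof (cases "ev p v = 0")
  case False
  have "tdeg p ~= 0" using tdeg_0_unit[OF nz(1)] p(1) by (auto simp: prime_elem_def)
  hence "tdeg g < tdeg f" using g nz by (simp add: tdeg_mult)
  moreover have "ev g v = 0" using less.prems(2) g False by simp
  ultimately obtain q where "prime_elem q" "q dvd g" "ev q v = 0" using less.hyps nz by blast
  thus ?thesis using g by auto
 qed (use p in blast)
qed

lemma prime_imp_irreducible:
 fixes p :: mpol
 assumes "prime_elem p"
 shows "irreducible p"
proof (rule irreducibleI)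
 show "p ~= 0" "~ p dvd 1" using assms by (auto simp: prime_elem_def)
 have aux: "v dvd 1" if uv: "p = u * v" "p dvd u" for u v
 proof -
  obtain w where w: "u = p * w" using uv(2) by (elim dvdE)
  have "p * (v * w) = p * 1" using uv(1) w by (simp add: mult_ac)
  hence "1 = v * w" using \<open>p ~= 0\<close> by simp
  thus ?thesis by (rule dvdI)
 qed
 fix a b assume ab: "p = a * b"
 hence "p dvd a | p dvd b" using assms prime_elem_dvd_mult_iff by (metis dvd_refl)
 thus "a dvd 1 | b dvd 1" using aux[of a b] aux[of b a] ab by (auto simp: mult.commute)
qed

text \<open>The test for divisibility used below, applied to products: a prime that divides none of
  several forms has a zero at which none of them vanishes.\<close>

lemma prime_point:
 assumes p: "prime_elem p" "hpol n d p" and f: "hpol n e f" "e > 0" "~ p dvd f"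
 shows "EX z:proj_space n. ~ nz p z & nz f z"
proof -
 obtain v where v: "ev p v = 0" "ev f v ~= 0"
  using prime_hypersurface_point[OF p(1) homD(2)[OF p(2)] homD(2)[OF f(1)] f(2,3)] by blast
 thus ?thesis using point_of_vector[OF v(2) f(1,2)] p(2) f(1) by blast
qed

lemma dvd_nz: "p dvd f ==> nz f z ==> nz p z" by (auto elim!: dvdE)

text \<open>A common divisor of \<open>v 0\<close> and \<open>v 1\<close> depends on
  \<open>v 0\<close> alone, but does not vanish where \<open>v 1\<close> is the only non-zero
  coordinate; being homogeneous, it is constant. Together with \<open>prime_point\<close> this
  provides points on the hypersurface of \<open>p\<close>.\<close>

lemma prime_not_dvd_coordinate:
 assumes "prime_elem p" "n >= 1"
 shows "EX j<=n. ~ p dvd mX j"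
proof -
 have "~ (p dvd mX 0 & p dvd mX 1)"
 proof
  assume "p dvd mX 0 & p dvd mX 1"
  hence p: "p dvd mX 0" "p dvd mX 1" by auto
  have d: "dep (Suc 0) p" using dep_dvd[of "Suc 0" "mX 0" p] p(1) by auto
  obtain e where e: "hmg e p" using hmg_dvd[OF hmg_simps(4) mX_neq_0 p(1)] by blast
  obtain b where b: "mX 1 = p * b" using p(2) by (elim dvdE)
  define u :: "nat => complex" where "u = (%i. if i = 1 then 1 else 0)"
  have pu: "ev p u ~= 0" using arg_cong[OF b, of "%f. ev f u"] by (auto simp: u_def)
  have "ev p u = ev p (vscale 0 u)" by (rule depD[OF d]) (simp add: u_def vscale_def)
  also have "\<dots> = 0 ^ e * ev p u" using e unfolding hmg_def by blast
  finally have "e = 0" using pu by (cases "e = 0") (simp_all add: power_0_left)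
  have "ev p v = ev p (%_. 0)" for v
  proof -
   have "ev p (vscale 0 v) = ev p v" using e \<open>e = 0\<close> unfolding hmg_def by simp
   thus ?thesis by (simp add: vscale_def)
  qed
  hence "p = mC (ev p (%_. 0))" by (intro mpol_eqI) simp
  then obtain c where c: "p = mC c" by blast
  hence "c ~= 0" using assms(1) by (auto simp: prime_elem_def)
  hence "p dvd 1" using mC_unit c by simp
  thus False using assms(1) by (simp add: prime_elem_def)
 qed
 thus ?thesis using assms(2) by (metis le0)
qed

lemma mult_cancel_fract: "c ~= 0 ==> Fract (c * a) (c * b) = Fract a (b :: mpol)"
 using mult_fract_cancel by blast

text \<open>Factors of forms are forms and their degrees add up, so reduction to lowest terms keeps
  the degree \<open>k\<close>.\<close>

lemma krat_coprime:
 assumes "x : krat n k" "x ~= 0"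
 shows "EX a b d e. x = Fract a b & hpol n d a & hpol n e b & int d - int e = k & a ~= 0 & b ~= 0 &
  (ALL p. prime_elem p --> ~ (p dvd a & p dvd b))"
proof -
 obtain g h d e where x: "x = Fract g h" "hpol n d g" "hpol n e h" "int d - int e = k" "h ~= 0"
  using assms(1) by (rule kratE)
 have g: "g ~= 0" using assms(2) x by (auto simp: fract_collapse)
 obtain c a b where c: "g = c * a" "h = c * b" "ALL p. prime_elem p --> ~ (p dvd a & p dvd b)"
  using coprime_representation[OF g x(5)] by blast
 have nz: "a ~= 0" "b ~= 0" "c ~= 0" using c g x by auto
 obtain i where i: "hpol n i a" using hom_dvd[OF x(2) g, of a] c(1) by auto
 obtain j where j: "hpol n j b" using hom_dvd[OF x(3,5), of b] c(2) by auto
 obtain l where l: "hpol n l c" using hom_dvd[OF x(2) g, of c] c(1) by auto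
 have "l + i = d" by (rule hom_unique[OF _ x(2) g]) (use hom_mult[OF l i] c(1) in simp)
 moreover have "l + j = e" by (rule hom_unique[OF _ x(3,5)]) (use hom_mult[OF l j] c(2) in simp)
 ultimately have "int i - int j = k" using x(4) by linarith
 moreover have "x = Fract a b" using x c nz by (simp add: mult_cancel_fract)
 ultimately show ?thesis using c(3) nz i j by blast
qed

text \<open>Induction over the prime factors of a
 form \<open>f\<close> outside of whose zero set the local equations are units: dividing by the power of the
 prime \<open>p\<close> that occurs near a point of \<open>V(p)\<close> removes the factor \<open>p\<close>.\<close>

lemma global_equation_aux:
 assumes n: "n >= 1" and U: "!!q. q : proj_space n ==> zariski_open n (U q) & q : U q"
  and f: "hpol n e f" "f ~= 0"
  and G: "!!q. q : proj_space n ==> G q : krat n k & G q ~= 0"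
  and coc: "!!q r z. q : proj_space n ==> r : proj_space n ==> z : U q ==> z : U r ==> G q / G r : ulc n 0 z"
  and triv: "!!q z. q : proj_space n ==> z : U q ==> nz f z ==> G q : ulc n k z"
 shows "EX l G0. G0 : krat n l & G0 ~= 0 & (ALL q:proj_space n. G q / G0 : ulc n (k - l) q)"
 using f G coc triv
proof (induction "tdeg f" arbitrary: f e G k rule: less_induct)
 case less
 note G = less.prems(3) and coc = less.prems(4) and triv = less.prems(5)
 show ?case
 proof (cases "f dvd 1")
  case True
  then obtain c where "c ~= 0" "f = mC c" using mpol_unit_const by blast
  hence "nz f q" for q by (simp add: nz_def)
  hence "G q / 1 : ulc n (k - 0) q" if "q : proj_space n" for q using triv U that by simp
  moreover have "(1 :: rat) : krat n 0" unfolding One_fract_def by (rule kratI[of n 0 _ 0]) auto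
  ultimately show ?thesis by (intro exI[of _ 0] exI[of _ 1]) auto
 next
  case False
  then obtain p where p: "prime_elem p" "p dvd f" using exists_prime_factor less.prems by blast
  then obtain f' where f': "f = p * f'" by (elim dvdE)
  have f0: "p ~= 0" "f' ~= 0" using f' less.prems by auto
  obtain d where d: "hpol n d p" using hom_dvd[OF less.prems(1,2) p(2)] by blast
  obtain e' where e': "hpol n e' f'" using hom_dvd[OF less.prems(1,2), of f'] f' by auto
  have tp: "tdeg f' < tdeg f" using f' f0 p(1) tdeg_0_unit[OF f0(1)] by (auto simp: tdeg_mult prime_elem_def)
  obtain j where j: "j <= n" "~ p dvd mX j" using prime_not_dvd_coordinate[OF p(1) n] by blast
  have hj: "hpol n 1 (mX j)" using j(1) by auto
  \<comment> \<open>\<open>r0\<close> lies on the hypersurface of \<open>p\<close>. The exponent of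
    \<open>p\<close> in \<open>G r0\<close> is the multiplicity of that hypersurface in the divisor,
    and \<open>P\<close> is the power of \<open>p\<close> that removes it.\<close>
  obtain r0 where r0: "r0 : proj_space n" "~ nz p r0" using prime_point[OF p(1) d hj _ j(2)] by auto
  obtain A B dA dB where AB: "G r0 = Fract A B" "hpol n dA A" "hpol n dB B" "int dA - int dB = k" "B ~= 0"
   using G[OF r0(1)] by (auto elim: kratE)
  have A0: "A ~= 0" using G[OF r0(1)] AB by (auto simp: fract_collapse)
  have np: "~ p dvd 1" using p(1) by (simp add: prime_elem_def)
  have fin: "EX a A'. A = p ^ a * A' & ~ p dvd A'" if "A ~= 0" for A using that
  proof (induction "tdeg A" arbitrary: A rule: less_induct)
   case less
   show ?case
   proof (cases "p dvd A")
    case True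
    then obtain A1 where A1: "A = p * A1" by (elim dvdE)
    hence "A1 ~= 0" using less.prems by auto
    hence "tdeg A1 < tdeg A" using A1 f0 p(1) tdeg_0_unit[OF f0(1)] by (auto simp: tdeg_mult prime_elem_def)
    then obtain a A' where "A1 = p ^ a * A'" "~ p dvd A'" using less.hyps \<open>A1 ~= 0\<close> by blast
    hence "A = p ^ Suc a * A'" "~ p dvd A'" using A1 by auto
    thus ?thesis by blast
   next
    case False
    moreover have "A = p ^ 0 * A" by simp
    ultimately show ?thesis by blast
   qed
  qed
  obtain a A' where A': "A = p ^ a * A'" "~ p dvd A'" using fin[OF A0] by blast
  obtain b B' where B': "B = p ^ b * B'" "~ p dvd B'" using fin[OF AB(5)] by blast
  have AB0: "A' ~= 0" "B' ~= 0" using A' B' by auto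
  define P where "P = Fract (p ^ a) (p ^ b)"
  define k' where "k' = int (d * a) - int (d * b)"
  have P: "P : krat n k'" "P ~= 0" unfolding P_def k'_def using f0
   by (auto intro!: kratI[OF hom_power[OF d] hom_power[OF d]] simp: Zero_fract_def eq_fract)
  have Pu: "P : ulc n k' z" if "nz p z" for z
   unfolding P_def k'_def by (rule ulcI[OF hom_power[OF d] hom_power[OF d]]) (use that in \<open>auto intro: nz_power\<close>)
  define G' where "G' q = G q / P" for q
  have GP: "G r0 / P = Fract A' B'" using f0 AB0 unfolding AB(1) A' B' P_def by (simp add: eq_fract mult_ac)
  have G'k: "G' q : krat n (k - k') & G' q ~= 0" if "q : proj_space n" for q
   using krat_mult[OF _ krat_inverse[OF P], of "G q" k] G[OF that] P(2) by (auto simp: G'_def divide_inverse)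
  have coc': "G' q / G' r : ulc n 0 z"
   if "q : proj_space n" "r : proj_space n" "z : U q" "z : U r" for q r z
   using coc[OF that] P(2) by (simp add: G'_def)
  have triv': "G' q : ulc n (k - k') z" if q: "q : proj_space n" and z: "z : U q" "nz f' z" for q z
  proof (cases "nz p z")
   case True
   thus ?thesis unfolding G'_def using ulc_divide[OF triv[OF q z(1)] Pu] z f' by simp
  next
   case False
   have zP: "z : proj_space n" using U[OF q] z(1) zariski_open_subset by blast
   obtain C D dC dD where CD: "G' q = Fract C D" "hpol n dC C" "hpol n dD D" "int dC - int dD = k - k'"
    "C ~= 0" "D ~= 0" and CDp: "ALL s. prime_elem s --> ~ (s dvd C & s dvd D)"
    using krat_coprime[OF conjunct1[OF G'k[OF q]] conjunct2[OF G'k[OF q]]] by (elim exE conjE) (rule that)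
   obtain dh h where h: "hpol n dh h" "nz h z" "ptD n h <= U q" "dh > 0"
    using zariski_basis[OF conjunct1[OF U[OF q]] z(1)] by blast
   obtain dh0 h0 where h0: "hpol n dh0 h0" "nz h0 r0" "ptD n h0 <= U r0" "dh0 > 0"
    using zariski_basis[OF conjunct1[OF U[OF r0(1)]] conjunct2[OF U[OF r0(1)]]] by blast
   \<comment> \<open>Both \<open>z\<close> and \<open>r0\<close> are zeros of \<open>p\<close>, so
     \<open>p\<close> divides neither \<open>h\<close> nor \<open>h0\<close>, and it has a zero in
     both charts at once. There \<open>G q / G r0\<close> is a unit, which compares the exponents of
     \<open>p\<close>.\<close>
   have "~ p dvd h" "~ p dvd h0" using dvd_nz h(2) False h0(2) r0(2) by blast+
   hence "~ p dvd h * h0" using p(1) prime_elem_dvd_mult_iff by blast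
   then obtain w where w: "w : proj_space n" "~ nz p w" "nz h w" "nz h0 w"
    using prime_point[OF p(1) d hom_mult[OF h(1) h0(1)]] h(4) by auto
   have "w : U q" "w : U r0" using w h(3) h0(3) by (auto simp: ptD_def)
   hence "G q / G r0 : ulc n 0 w" using coc q r0 by blast
   then obtain c' d' where cd: "G q / G r0 = Fract c' d'" "nz c' w" "nz d' w" by (auto elim: ulcE)
   have cd0: "c' ~= 0" "d' ~= 0" using cd nz_nonzero by auto
   have "G' q = (G q / G r0) * (G r0 / P)" using G[OF r0(1)] P(2) by (simp add: G'_def)
   hence "Fract C D = Fract (c' * A') (d' * B')" using CD(1) cd GP by simp
   hence eq: "C * (d' * B') = c' * A' * D" using CD(6) cd0 AB0 by (simp add: eq_fract)
   have ncd: "~ p dvd c'" "~ p dvd d'" using cd w(2) dvd_nz by blast+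
   have pC: "~ p dvd C"
   proof
    assume pC: "p dvd C"
    hence "p dvd c' * A' * D" using eq by (metis dvd_mult2)
    hence "p dvd D" using p(1) ncd A'(2) by (simp add: prime_elem_dvd_mult_iff)
    thus False using CDp p(1) pC by blast
   qed
   have pD: "~ p dvd D"
   proof
    assume pD: "p dvd D"
    hence "p dvd C * (d' * B')" using eq by (metis dvd_mult)
    hence "p dvd C" using p(1) ncd B'(2) by (simp add: prime_elem_dvd_mult_iff)
    thus False using pC by blast
   qed
   \<comment> \<open>A prime \<open>s\<close> that divides numerator or denominator and vanishes at
     \<open>z\<close> divides none of \<open>p\<close>, \<open>f'\<close>, \<open>h\<close>. At a
     zero of \<open>s\<close> off these three the fraction is a unit, so \<open>s\<close> would
     divide both numerator and denominator.\<close>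
   have key: "ev S (rp z) ~= 0" if S: "S = C & T = D | S = D & T = C" for S T
   proof
    assume S0: "ev S (rp z) = 0"
    have "S ~= 0" using S CD by auto
    then obtain s where s: "prime_elem s" "s dvd S" "ev s (rp z) = 0" using vanishing_prime_factor S0 by blast
    obtain ds where ds: "hpol n ds s" using S s(2) CD hom_dvd by metis
    have sz: "~ nz s z" using s(3) by (simp add: nz_def)
    have "~ s dvd p"
    proof
     assume "s dvd p"
     then obtain u where u: "p = s * u" by (elim dvdE)
     have "~ s dvd 1" using s(1) by (simp add: prime_elem_def)
     hence "u dvd 1" using prime_imp_irreducible[OF p(1)] u by (meson irreducibleD)
     then obtain v where "1 = u * v" by (elim dvdE)
     hence "s = p * v" using u by (simp add: mult.assoc)
     hence "p dvd s" by (rule dvdI)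
     hence "p dvd S" using s(2) dvd_trans by blast
     thus False using S pC pD by blast
    qed
    moreover have "~ s dvd f'" "~ s dvd h" using dvd_nz z(2) h(2) sz by blast+
    ultimately have "~ s dvd p * f' * h" using s(1) by (simp add: prime_elem_dvd_mult_iff)
    then obtain w where w: "w : proj_space n" "~ nz s w" "nz p w" "nz f' w" "nz h w"
     using prime_point[OF s(1) ds hom_mult[OF hom_mult[OF d e'] h(1)]] h(4) by auto
    hence "w : U q" "nz f w" using h(3) f' by (auto simp: ptD_def)
    hence "G' q : ulc n (k - k') w" unfolding G'_def using ulc_divide[OF triv[OF q] Pu] w by simp
    then obtain c' d' where cd: "G' q = Fract c' d'" "nz c' w" "nz d' w" by (auto elim: ulcE)
    have "Fract C D = Fract c' d'" using CD(1) cd(1) by simp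
    hence eq: "C * d' = c' * D" using CD(6) nz_nonzero[OF cd(3)] by (simp add: eq_fract)
    have "~ s dvd c'" "~ s dvd d'" using cd w(2) dvd_nz by blast+
    moreover have "s dvd C * d'" "s dvd c' * D" using S s(2) eq by (metis dvd_mult dvd_mult2)+
    ultimately have "s dvd C" "s dvd D" using s(1) prime_elem_dvd_mult_iff by blast+
    thus False using CDp s(1) by blast
   qed
   show ?thesis unfolding CD(1)
    by (rule ulcI[OF CD(2,3)]) (use key[of C D] key[of D C] CD(4) in \<open>auto simp: nz_def\<close>)
  qed
  obtain l G0 where G0: "G0 : krat n l" "G0 ~= 0" "ALL q:proj_space n. G' q / G0 : ulc n (k - k' - l) q"
   using less.hyps[OF tp e' f0(2), of G' "k - k'"] G'k coc' triv' by blast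
  show ?thesis
  proof (intro exI conjI ballI)
   show "P * G0 : krat n (k' + l)" using krat_mult P G0 by blast
   show "P * G0 ~= 0" using P G0 by simp
   fix q assume "q : proj_space n"
   thus "G q / (P * G0) : ulc n (k - (k' + l)) q" using G0(3) by (simp add: G'_def algebra_simps)
  qed
 qed
qed

text \<open>Every divisor on projective space has an equation. Division by \<open>G q0\<close> turns
  the data into units on \<open>U q0\<close>, and a form \<open>f\<close> with
  \<open>ptD n f \<subseteq> U q0\<close> starts the induction. Two charts are compared at
  \<open>z\<close> through the data \<open>G z\<close> of the point itself.\<close>

theorem global_equation:
 assumes n: "n >= 1" and U: "!!q. q : proj_space n ==> zariski_open n (U q) & q : U q"
  and G: "!!q. q : proj_space n ==> G q : krat n k & G q ~= 0"
  and coc: "!!q z. q : proj_space n ==> z : U q ==> G z / G q : ulc n 0 z"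
 shows "EX l G0. G0 : krat n l & G0 ~= 0 & (ALL q:proj_space n. G q / G0 : ulc n (k - l) q)"
proof -
 obtain q0 where q0: "q0 : proj_space n" using hom_nonzero_point[of n 0 1] by auto
 obtain e f where f: "hpol n e f" "nz f q0" "ptD n f <= U q0" using zariski_basis[OF conjunct1[OF U[OF q0]] conjunct2[OF U[OF q0]]] by blast
 define H where "H q = G q / G q0" for q
 have coc': "G q / G r : ulc n 0 z" if "q : proj_space n" "r : proj_space n" "z : U q" "z : U r" for q r z
 proof -
  have "z : proj_space n" using that U zariski_open_subset by blast
  hence "G q / G r = (G z / G r) / (G z / G q)" using G that by simp
  thus ?thesis using ulc_divide[OF coc[OF that(2,4)] coc[OF that(1,3)]] by simp
 qed
 have "EX l G0. G0 : krat n l & G0 ~= 0 & (ALL q:proj_space n. H q / G0 : ulc n (0 - l) q)"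
 proof (rule global_equation_aux[OF n U f(1)])
  show "f ~= 0" using nz_nonzero f by blast
  show "H q : krat n 0 & H q ~= 0" if "q : proj_space n" for q
   using krat_mult[OF _ krat_inverse, of "G q" n k "G q0" k] G[OF that] G[OF q0] by (simp add: H_def divide_inverse)
  show "H q / H r : ulc n 0 z" if "q : proj_space n" "r : proj_space n" "z : U q" "z : U r" for q r z
   using coc'[OF that] G[OF q0] by (simp add: H_def)
  show "H q : ulc n 0 z" if "q : proj_space n" "z : U q" "nz f z" for q z
  proof -
   have "z : proj_space n" using that U zariski_open_subset by blast
   hence "z : U q0" using f(3) that by (auto simp: ptD_def)
   thus ?thesis using coc' that q0 unfolding H_def by blast
  qed
 qed blast+
 then obtain l G0 where G0: "G0 : krat n l" "G0 ~= 0" "ALL q:proj_space n. H q / G0 : ulc n (0 - l) q" by blast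
 show ?thesis
 proof (intro exI conjI ballI)
  show "G q0 * G0 : krat n (k + l)" using krat_mult G[OF q0] G0 by blast
  show "G q0 * G0 ~= 0" using G[OF q0] G0 by simp
  fix q assume "q : proj_space n"
  thus "G q / (G q0 * G0) : ulc n (k - (k + l)) q" using G0(3) by (simp add: H_def)
 qed
qed

section \<open>Alternating sums and Koszul complexes\<close>

text \<open>The Cech coboundary on functions of lists: the alternating sum over the deletions of one
 entry.  On the empty list it is the augmentation.\<close>

fun dl :: "('p list => 'b::ab_group_add) => 'p list => 'b" where
 "dl c [] = 0"
| "dl c (x # xs) = c xs - dl (%l. c (x # l)) xs"

lemma dl_zero [simp]: "dl (%l. 0) l = 0" by (induction l) auto

lemma dl_diff: "dl (%l. a l - b l) l = dl a l - dl b l" by (induction l arbitrary: a b) auto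

lemma dl_add: "dl (%l. a l + b l) l = dl a l + dl b l" by (induction l arbitrary: a b) auto

lemma dl_additive:
 assumes "!!x y. \<phi> (x - y) = \<phi> x - \<phi> y"
 shows "\<phi> (dl c l) = dl (%l. \<phi> (c l)) l"
proof -
 have "\<phi> 0 = 0" using assms[of 0 0] by simp
 thus ?thesis by (induction l arbitrary: c) (auto simp: assms)
qed

lemma dl_sum: "dl (%l. \<Sum>t\<in>T. c t l) l = (\<Sum>t\<in>T. dl (c t) l)"
 by (induction T rule: infinite_finite_induct) (auto simp: dl_add)

lemma dl_dl: "dl (dl c) l = 0"
proof (induction l arbitrary: c)
 case (Cons x xs)
 have "dl (dl c) (x # xs) = dl c xs - dl (%l. c l - dl (%m. c (x # m)) l) xs" by simp
 thus ?case by (simp add: dl_diff Cons.IH)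
qed simp

lemma dl_map: "dl c (map \<rho> l) = dl (%l. c (map \<rho> l)) l" by (induction l arbitrary: c) auto

lemma dl_cong:
 assumes "!!l'. Suc (length l') = length l ==> set l' <= set l ==> c l' = c' l'"
 shows "dl c l = dl c' l" using assms
proof (induction l arbitrary: c c')
 case (Cons x xs)
 have "c xs = c' xs" by (rule Cons.prems) auto
 moreover have "dl (%l. c (x # l)) xs = dl (%l. c' (x # l)) xs" by (rule Cons.IH) (auto intro!: Cons.prems)
 ultimately show ?case by simp
qed simp

lemma dl_mem:
 assumes "!!l'. Suc (length l') = length l ==> set l' <= set l ==> c l' : A"
  and A: "0 : A" "!!x y. x : A ==> y : A ==> x - y : A"
 shows "dl c l : A" using assms(1)
proof (induction l arbitrary: c)
 case (Cons x xs)
 have "c xs : A" by (rule Cons.prems) auto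
 moreover have "dl (%l. c (x # l)) xs : A" by (rule Cons.IH) (auto intro!: Cons.prems)
 ultimately show ?case using A(2) by simp
qed (use A in simp)

text \<open>The prism operator: a homotopy between a cochain and its pullback under a map of indices.\<close>

fun prism :: "('p => 'p) => ('p list => 'b::ab_group_add) => 'p list => 'b" where
 "prism \<rho> a [] = 0"
| "prism \<rho> a (x # xs) = a (x # map \<rho> (x # xs)) - prism \<rho> (%l. a (x # l)) xs"

lemma prism_diff: "prism \<rho> (%l. a l - b l) l = prism \<rho> a l - prism \<rho> b l"
 by (induction l arbitrary: a b) auto

lemma prism_homotopy: "dl (prism \<rho> a) l + prism \<rho> (dl a) l = a (map \<rho> l) - a l"
proof (induction l arbitrary: a)
 case (Cons x xs)
 have arith: "(P - (Q - R)) + ((M - (N - Q)) - (P - S)) = M - Z" if "R + S = N - Z" for P Q R M N S Z :: "'c::ab_group_add"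
 proof -
  have "N = R + S + Z" using that by simp
  thus ?thesis by simp
 qed
 have 1: "prism \<rho> (%l. dl a (x # l)) xs = prism \<rho> a xs - prism \<rho> (dl (%l. a (x # l))) xs"
  by (simp add: prism_diff)
 have 2: "dl (%l. prism \<rho> a (x # l)) xs
   = dl (%l. a (x # map \<rho> (x # l))) xs - dl (prism \<rho> (%l. a (x # l))) xs" by (simp add: dl_diff)
 have 3: "dl a (x # map \<rho> (x # xs)) = a (map \<rho> (x # xs)) - (a (x # map \<rho> xs) - dl (%l. a (x # map \<rho> (x # l))) xs)"
  by (simp add: dl_map)
 show ?case unfolding dl.simps(2)[of "prism \<rho> a"] prism.simps(2)[of \<rho> "dl a"] 1 2 3 by (rule arith) (rule Cons.IH)
qed simp

lemma prism_mem:
 assumes "!!l'. length l' = Suc (length l) ==> set l' <= set l \<union> \<rho> ` set l ==> a l' : A"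
  and A: "0 : A" "!!x y. x : A ==> y : A ==> x - y : A"
 shows "prism \<rho> a l : A" using assms(1)
proof (induction l arbitrary: a)
 case (Cons x xs)
 have "a (x # map \<rho> (x # xs)) : A" by (rule Cons.prems) auto
 moreover have "prism \<rho> (%l. a (x # l)) xs : A" by (rule Cons.IH) (rule Cons.prems; auto)
 ultimately show ?case using A(2) by simp
qed (use A in simp)

abbreviation tc :: "bool list => nat" where
 "tc J == count_list J True"

text \<open>Koszul complexes; \<open>J\<close> is the characteristic list of a subset of the generators.\<close>

locale koszul = Modules.module scale
 for scale :: "'a::comm_ring_1 => 'b::ab_group_add => 'b"
begin

text \<open>\<open>kd\<close> is the exterior product with \<open>\<Sum> y\<^sub>i e\<^sub>i\<close>
  and \<open>ki\<close> the contraction by the list \<open>zs\<close>: the value at \<open>J\<close>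
  is a signed sum over the removal, respectively the insertion, of one element.\<close>

fun kd :: "'a list => (bool list => 'b) => bool list => 'b" where
 "kd (y # ys) c (True # J) = scale y (c (False # J)) - kd ys (%J. c (True # J)) J"
| "kd (y # ys) c (False # J) = kd ys (%J. c (False # J)) J"
| "kd [] c J = 0"
| "kd (y # ys) c [] = 0"

fun ki :: "'a list => (bool list => 'b) => bool list => 'b" where
 "ki (z # zs) c (False # J) = scale z (c (True # J)) + ki zs (%J. c (False # J)) J"
| "ki (z # zs) c (True # J) = - ki zs (%J. c (True # J)) J"
| "ki [] c J = 0"
| "ki (z # zs) c [] = 0"

lemma kd_diff: "kd ys (%J. c J - c' J) J = kd ys c J - kd ys c' J"
 by (induction ys c J arbitrary: c' rule: kd.induct) (auto simp: scale_right_diff_distrib)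

lemma ki_diff: "ki ys (%J. c J - c' J) J = ki ys c J - ki ys c' J"
 by (induction ys c J arbitrary: c' rule: ki.induct) (auto simp: scale_right_diff_distrib)

lemma kd_zero [simp]: "kd ys (%J. 0) J = 0" using kd_diff[of ys "%J. 0" "%J. 0" J] by simp

lemma ki_zero [simp]: "ki ys (%J. 0) J = 0" using ki_diff[of ys "%J. 0" "%J. 0" J] by simp

lemma kd_add: "kd ys (%J. c J + c' J) J = kd ys c J + kd ys c' J"
 using kd_diff[of ys "%J. c J + c' J" c' J] by (simp add: algebra_simps)

lemma ki_add: "ki ys (%J. c J + c' J) J = ki ys c J + ki ys c' J"
 using ki_diff[of ys "%J. c J + c' J" c' J] by (simp add: algebra_simps)

lemma kd_scale: "kd ys (%J. scale u (c J)) J = scale u (kd ys c J)"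
 by (induction ys c J rule: kd.induct) (auto simp: scale_right_diff_distrib mult.commute)

lemma ki_scale: "ki ys (%J. scale u (c J)) J = scale u (ki ys c J)"
 by (induction ys c J rule: ki.induct) (auto simp: scale_right_distrib mult.commute)

lemma kd_sum: "kd ys (%J. \<Sum>t\<in>T. c t J) J = (\<Sum>t\<in>T. kd ys (c t) J)"
 by (induction T rule: infinite_finite_induct) (auto simp: kd_add)

lemma ki_ki: "ki zs (ki zs c) J = 0"
proof (induction zs c J rule: ki.induct)
 case (1 z zs c J)
 have "ki zs (%J. ki (z # zs) c (False # J)) J = scale z (ki zs (%J. c (True # J)) J)"
  using 1 by (simp add: ki_add ki_scale)
 thus ?case by simp
next
 case (2 z zs c J)
 have "ki zs (%J. - ki zs (%J. c (True # J)) J) J = - ki zs (ki zs (%J. c (True # J))) J"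
  using ki_diff[of zs "%J. 0" "ki zs (%J. c (True # J))" J] by simp
 thus ?case using 2 by simp
qed auto

text \<open>Exterior product with one vector and contraction by another anticommute up to their
  scalar product. Where that product is 1, each is a contracting homotopy for the other.\<close>

lemma kd_ki_homotopy:
 assumes "length zs = length ys" "length J = length ys"
 shows "kd ys (ki zs c) J + ki zs (kd ys c) J = scale (\<Sum>i<length ys. zs ! i * ys ! i) (c J)" using assms
proof (induction ys arbitrary: zs c J)
 case (Cons y ys)
 obtain z zs' where zs: "zs = z # zs'" "length zs' = length ys" using Cons.prems by (cases zs) auto
 obtain b J' where J: "J = b # J'" "length J' = length ys" using Cons.prems by (cases J) auto
 have dot: "(\<Sum>i<length (y # ys). zs ! i * (y # ys) ! i) = z * y + (\<Sum>i<length ys. zs' ! i * ys ! i)"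
  unfolding zs(1) by (simp add: sum.lessThan_Suc_shift del: sum.lessThan_Suc)
 show ?case
 proof (cases b)
  case True
  let ?A = "kd ys (ki zs' (%J. c (True # J))) J'" and ?B = "ki zs' (kd ys (%J. c (True # J))) J'"
  let ?K = "ki zs' (%J. c (False # J)) J'" and ?S = "\<Sum>i<length ys. zs' ! i * ys ! i"
  have 1: "kd ys (%J. - ki zs' (%J. c (True # J)) J) J' = - ?A"
   using kd_diff[of ys "%J. 0" "ki zs' (%J. c (True # J))" J'] by simp
  have 2: "ki zs' (%J. scale y (c (False # J)) - kd ys (%J. c (True # J)) J) J' = scale y ?K - ?B"
   by (simp only: ki_diff ki_scale)
  have "kd (y # ys) (ki zs c) J + ki zs (kd (y # ys) c) J =
    scale y (scale z (c (True # J')) + ?K) - - ?A + - (scale y ?K - ?B)"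
   using True by (simp only: J(1) zs(1) kd.simps ki.simps 1 2)
  also have "\<dots> = scale (z * y) (c (True # J')) + (?A + ?B)" by (simp add: scale_right_distrib mult.commute)
  also have "?A + ?B = scale ?S (c (True # J'))" using Cons.IH[OF zs(2) J(2), of "%J. c (True # J)"] .
  finally show ?thesis unfolding dot using True by (simp only: J(1) scale_left_distrib)
 next
  case False
  let ?A = "kd ys (ki zs' (%J. c (False # J))) J'" and ?B = "ki zs' (kd ys (%J. c (False # J))) J'"
  let ?K = "kd ys (%J. c (True # J)) J'" and ?S = "\<Sum>i<length ys. zs' ! i * ys ! i"
  have 1: "kd ys (%J. scale z (c (True # J)) + ki zs' (%J. c (False # J)) J) J' = scale z ?K + ?A"
   by (simp only: kd_add kd_scale)
  have b: "b = False" using False by simp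
  have "kd (y # ys) (ki zs c) J + ki zs (kd (y # ys) c) J =
    scale z ?K + ?A + (scale z (scale y (c (False # J')) - ?K) + ?B)" by (simp only: b J(1) zs(1) kd.simps ki.simps 1)
  also have "\<dots> = scale (z * y) (c (False # J')) + (?A + ?B)" by (simp add: scale_right_diff_distrib)
  also have "?A + ?B = scale ?S (c (False # J'))" using Cons.IH[OF zs(2) J(2), of "%J. c (False # J)"] .
  finally show ?thesis unfolding dot by (simp only: b J(1) scale_left_distrib)
 qed
qed simp

lemma kd_dl: "kd ys (%J. dl (c J) l) J = dl (%l. kd ys (%J. c J l) J) l"
proof (induction l arbitrary: c)
 case (Cons x xs)
 thus ?case by (simp add: kd_diff)
qed simp

lemma ki_dl: "ki ys (%J. dl (c J) l) J = dl (%l. ki ys (%J. c J l) J) l"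
proof (induction l arbitrary: c)
 case (Cons x xs)
 thus ?case by (simp add: ki_diff)
qed simp

lemma kd_cong:
 assumes "!!J'. length J' = length J ==> Suc (tc J') = tc J ==> c J' = c' J'"
 shows "kd ys c J = kd ys c' J" using assms
proof (induction ys c J arbitrary: c' rule: kd.induct)
 case (1 y ys c J)
 have "c (False # J) = c' (False # J)" by (rule "1.prems") auto
 moreover have "kd ys (%J. c (True # J)) J = kd ys (%J. c' (True # J)) J" by (rule 1) (auto intro!: "1.prems")
 ultimately show ?case by simp
next
 case (2 y ys c J)
 have "kd ys (%J. c (False # J)) J = kd ys (%J. c' (False # J)) J" by (rule 2) (auto intro!: "2.prems")
 thus ?case by simp
qed auto

lemma kd_mem:
 assumes "!!J'. length J' = length J ==> Suc (tc J') = tc J ==> c J' : A"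
  and "!!y a. y : set ys ==> a : A ==> scale y a : B"
  and B: "0 : B" "!!x y. x : B ==> y : B ==> x - y : B"
 shows "kd ys c J : B" using assms(1,2)
proof (induction ys c J rule: kd.induct)
 case (1 y ys c J)
 have "scale y (c (False # J)) : B" using "1.prems" by auto
 moreover have "kd ys (%J. c (True # J)) J : B" by (rule 1) (use "1.prems" in auto)
 ultimately show ?case using B by simp
next
 case (2 y ys c J)
 have "kd ys (%J. c (False # J)) J : B" by (rule 2) (use "2.prems" in auto)
 thus ?case by simp
qed (use B in auto)

lemma ki_mem:
 assumes "!!J'. length J' = length J ==> tc J' = Suc (tc J) ==> c J' : A"
  and "!!y a. y : set ys ==> a : A ==> scale y a : B"
  and B: "0 : B" "!!x y. x : B ==> y : B ==> x - y : B"
 shows "ki ys c J : B" using assms(1,2)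
proof (induction ys c J rule: ki.induct)
 case (1 y ys c J)
 have "scale y (c (True # J)) : B" using "1.prems" by auto
 moreover have "ki ys (%J. c (False # J)) J : B" by (rule 1) (use "1.prems" in auto)
 ultimately show ?case using B(2)[OF _ B(2)[OF B(1)], of "scale y (c (True # J))"] by simp
next
 case (2 y ys c J)
 have "ki ys (%J. c (True # J)) J : B" by (rule 2) (use "2.prems" in auto)
 thus ?case using B(2)[OF B(1)] by simp
qed (use B in auto)

lemma kd_additive:
 assumes "!!x y. \<phi> (x - y) = \<phi> x - \<phi> y" "!!y x. y : set ys ==> \<phi> (scale y x) = scale y (\<psi> x)"
 shows "\<phi> (kd ys c J) = kd ys (%J. \<psi> (c J)) J"
proof -
 have "\<phi> 0 = 0" using assms(1)[of 0 0] by simp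
 thus ?thesis using assms(2) by (induction ys c J rule: kd.induct) (auto simp: assms(1))
qed

text \<open>In top degree the image of \<open>kd\<close> consists of the combinations of
  \<open>ys\<close>. Thus \<open>regular_seq\<close> says that each entry is a non-zero-divisor
  modulo the later ones.\<close>

definition top_multiple :: "'a list => 'b => bool" where
 "top_multiple ys f \<longleftrightarrow> (EX e. f = kd ys e (replicate (length ys) True))"

fun regular_seq :: "'a list => bool" where
 "regular_seq [] \<longleftrightarrow> True"
| "regular_seq (y # ys) \<longleftrightarrow> regular_seq ys & (ALL f. top_multiple ys (scale y f) --> top_multiple ys f)"

lemma tc_full: "tc J = length J ==> J = replicate (length J) True"
proof (induction J)
 case (Cons b J)
 have "tc J <= length J" by (rule count_le_length)
 with Cons show ?case by (cases b) auto
qed simp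

text \<open>Split by membership of the first generator \<open>y\<close>. The part without
  \<open>y\<close> is closed for the shorter sequence and exact by induction, except in its top
  degree, where regularity of \<open>y\<close> takes over. The part with \<open>y\<close> becomes
  closed after subtraction from \<open>y * eF\<close>, and is exact by induction too.\<close>

lemma koszul_exact:
 assumes "regular_seq ys" "p < length ys"
  and "!!J. length J = length ys ==> tc J = Suc p ==> kd ys c J = 0"
 shows "EX e. ALL J. length J = length ys --> tc J = p --> c J = kd ys e J" using assms
proof (induction ys arbitrary: c p)
 case (Cons y ys)
 have reg: "regular_seq ys" "!!f. top_multiple ys (scale y f) ==> top_multiple ys f"
  using Cons.prems(1) by auto
 have cF: "kd ys (%J. c (False # J)) J = 0" if "length J = length ys" "tc J = Suc p" for J
  using Cons.prems(3)[of "False # J"] that by simp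
 have cT: "scale y (c (False # J)) = kd ys (%J. c (True # J)) J" if "length J = length ys" "tc J = p" for J
  using Cons.prems(3)[of "True # J"] that by simp
 have "EX eF. ALL J. length J = length ys --> tc J = p --> c (False # J) = kd ys eF J"
 proof (cases "p < length ys")
  case True
  thus ?thesis using Cons.IH[OF reg(1) True cF] by blast
 next
  case False
  hence p: "p = length ys" using Cons.prems(2) by simp
  define top where "top = replicate (length ys) True"
  have "count_list (replicate m True) True = m" for m by (induction m) auto
  hence "tc top = p" "length top = length ys" by (auto simp: top_def p)
  hence "top_multiple ys (scale y (c (False # top)))" using cT unfolding top_multiple_def top_def by blast
  then obtain eF where "c (False # top) = kd ys eF top" using reg(2) unfolding top_multiple_def top_def by blast
  moreover have "J = top" if "length J = length ys" "tc J = p" for J using tc_full[of J] that p unfolding top_def by simp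
  ultimately show ?thesis by blast
 qed
 then obtain eF where eF: "!!J. length J = length ys ==> tc J = p ==> c (False # J) = kd ys eF J" by blast
 have "EX eT. ALL J. length J = length ys --> Suc (tc J) = p --> c (True # J) = scale y (eF J) - kd ys eT J"
 proof (cases p)
  case (Suc p')
  have "kd ys (%J. scale y (eF J) - c (True # J)) J = 0" if "length J = length ys" "tc J = Suc p'" for J
   using cT[of J] eF[of J] that Suc by (simp add: kd_diff kd_scale)
  moreover have "p' < length ys" using Cons.prems(2) Suc by simp
  ultimately obtain eT where "!!J. length J = length ys ==> tc J = p' ==> scale y (eF J) - c (True # J) = kd ys eT J"
   using Cons.IH[OF reg(1)] by blast
  hence "ALL J. length J = length ys --> Suc (tc J) = p --> c (True # J) = scale y (eF J) - kd ys eT J"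
   using Suc by (metis diff_diff_eq2 add_diff_cancel_left' old.nat.inject)
  thus ?thesis by blast
 qed simp
 then obtain eT where eT: "!!J. length J = length ys ==> Suc (tc J) = p ==> c (True # J) = scale y (eF J) - kd ys eT J"
  by blast
 define e where "e J = (if hd J then eT (tl J) else eF (tl J))" for J
 have "c J = kd (y # ys) e J" if len: "length J = length (y # ys)" "tc J = p" for J
 proof -
  obtain b J' where J: "J = b # J'" "length J' = length ys" using len by (cases J) auto
  show ?thesis using eF[of J'] eT[of J'] len J by (cases b) (auto simp: e_def)
 qed
 thus ?case by blast
qed simp

end

interpretation KR: koszul "(*) :: mpol => mpol => mpol" by standard
interpretation KK: koszul "(*) :: rat => rat => rat" by standard (auto simp: algebra_simps)

declare KK.scale_scale [simp del]

section \<open>Powers of the variables form a regular sequence\<close>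

lemma indep_rep_unique:
 assumes "ALL i. indep k (coeff P i)" "ALL i. indep k (coeff Q i)" "poly P (mX k) = poly Q (mX k)"
 shows "P = Q"
proof (rule poly_eqI, rule mpol_eqI)
 fix i v
 have "map_poly (%c. ev c v) P = map_poly (%c. ev c v) Q"
  using ev_univ_rep[OF assms(1), of v] ev_univ_rep[OF assms(2), of v] assms(3)
  by (simp add: poly_eq_poly_eq_iff[symmetric] fun_eq_iff)
 thus "ev (coeff P i) v = ev (coeff Q i) v" by (metis coeff_ev_map)
qed

text \<open>The normal forms modulo \<open>v k ^ N\<close>.\<close>

definition lowdeg :: "nat => nat => mpol => bool" where
 "lowdeg k N r \<longleftrightarrow> (EX R. poly R (mX k) = r & (ALL i. indep k (coeff R i)) & (ALL i>=N. coeff R i = 0))"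

lemma indep_minus: "indep k f ==> indep k g ==> indep k (f - g)" unfolding indep_def by simp

lemma lowdeg_0: "lowdeg k N 0" unfolding lowdeg_def by (intro exI[of _ 0]) auto

lemma lowdeg_diff: "lowdeg k N r ==> lowdeg k N s ==> lowdeg k N (r - s)" unfolding lowdeg_def
proof (elim exE conjE)
 fix R S assume "poly R (mX k) = r" "ALL i. indep k (coeff R i)" "ALL i>=N. coeff R i = 0"
  "poly S (mX k) = s" "ALL i. indep k (coeff S i)" "ALL i>=N. coeff S i = 0"
 thus "EX R. poly R (mX k) = r - s & (ALL i. indep k (coeff R i)) & (ALL i>=N. coeff R i = 0)"
  by (intro exI[of _ "R - S"]) (auto intro: indep_minus)
qed

lemma lowdeg_mult: "indep k c ==> lowdeg k N r ==> lowdeg k N (c * r)" unfolding lowdeg_def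
proof (elim exE conjE)
 fix R assume "indep k c" "poly R (mX k) = r" "ALL i. indep k (coeff R i)" "ALL i>=N. coeff R i = 0"
 thus "EX R. poly R (mX k) = c * r & (ALL i. indep k (coeff R i)) & (ALL i>=N. coeff R i = 0)"
  by (intro exI[of _ "smult c R"]) auto
qed

lemma mX_power_division: "EX q r. f = mX k ^ N * q + r & lowdeg k N r"
proof -
 obtain P where P: "poly P (mX k) = f" "ALL i. indep k (coeff P i)" using univ_rep_ex by blast
 define Q where "Q = poly_shift N P"
 define R where "R = P - monom 1 N * Q"
 have "coeff (monom 1 N * Q) i = (if i < N then 0 else coeff P i)" for i by (simp add: Q_def coeff_monom_mult coeff_poly_shift)
 hence R: "coeff R i = (if i < N then coeff P i else 0)" for i by (simp add: R_def)
 have "P = monom 1 N * Q + R" by (simp add: R_def)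
 hence "f = mX k ^ N * poly Q (mX k) + poly R (mX k)" using P(1) by (metis poly_add poly_monom poly_mult mult_1)
 moreover have "lowdeg k N (poly R (mX k))" unfolding lowdeg_def using R P(2) by (intro exI[of _ R]) auto
 ultimately show ?thesis by blast
qed

lemma lowdeg_multiple: "lowdeg k N (mX k ^ N * f) ==> f = 0"
proof -
 assume "lowdeg k N (mX k ^ N * f)"
 then obtain R where R: "poly R (mX k) = mX k ^ N * f" "ALL i. indep k (coeff R i)" "ALL i>=N. coeff R i = 0"
  unfolding lowdeg_def by blast
 obtain P where P: "poly P (mX k) = f" "ALL i. indep k (coeff P i)" using univ_rep_ex by blast
 have "R = monom 1 N * P" by (rule indep_rep_unique[of k]) (use R P in \<open>auto simp: coeff_monom_mult poly_monom\<close>)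
 hence "coeff P i = coeff R (i + N)" for i by (simp add: coeff_monom_mult)
 hence "P = 0" using R(3) by (intro poly_eqI) simp
 thus "f = 0" using P by simp
qed

text \<open>The remaining powers do not involve \<open>v j\<close>, so coefficients can be reduced
  modulo \<open>v j ^ N\<close>. What is left has degree below \<open>N\<close> in
  \<open>v j\<close> and is a multiple of \<open>v j ^ N\<close>, hence zero.\<close>

lemma regular_powers: "distinct js ==> KR.regular_seq (map (%j. mX j ^ N) js)"
proof (induction js)
 case (Cons j js)
 let ?ys = "map (%j. mX j ^ N) js"
 have "KR.top_multiple ?ys f" if tm: "KR.top_multiple ?ys (mX j ^ N * f)" for f
 proof -
  define T where "T = replicate (length js) True"
  obtain e where e: "mX j ^ N * f = KR.kd ?ys e T" using tm unfolding KR.top_multiple_def T_def by auto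
  have "ALL J. EX q. lowdeg j N (e J - mX j ^ N * q)"
  proof
   fix J obtain q r where "e J = mX j ^ N * q + r" "lowdeg j N r" using mX_power_division by blast
   thus "EX q. lowdeg j N (e J - mX j ^ N * q)" by (intro exI[of _ q]) simp
  qed
  then obtain q where q: "!!J. lowdeg j N (e J - mX j ^ N * q J)" by metis
  have "mX j ^ N * (f - KR.kd ?ys q T) = KR.kd ?ys (%J. e J - mX j ^ N * q J) T"
   by (simp add: KR.kd_diff KR.kd_scale e right_diff_distrib)
  moreover have "KR.kd ?ys (%J. e J - mX j ^ N * q J) T : {r. lowdeg j N r}"
  proof (rule KR.kd_mem[where A = "{r. lowdeg j N r}"])
   fix y a assume "y : set ?ys" "a : {r. lowdeg j N r}"
   then obtain i where i: "i : set js" "y = mX i ^ N" by auto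
   hence "indep j (mX i ^ N)" using Cons.prems by (auto simp: indep_def)
   thus "y * a : {r. lowdeg j N r}" using i \<open>a : _\<close> lowdeg_mult by simp
  qed (use q lowdeg_0 lowdeg_diff in auto)
  ultimately have "f - KR.kd ?ys q T = 0" using lowdeg_multiple[of j N "f - KR.kd ?ys q T"] by (simp only: mem_Collect_eq)
  thus ?thesis unfolding KR.top_multiple_def T_def by auto
 qed
 thus ?case using Cons by simp
qed simp

text \<open>In two variables every monomial of degree at least \<open>2 N - 1\<close> is divisible by one of the powers.\<close>

lemma two_variable_powers:
 assumes f: "hpol 1 d f" and d: "2 * N <= d + 1"
 shows "EX a b. f = mX 0 ^ N * a + mX 1 ^ N * b"
proof -
 have I: "{..1::nat} = {0, 1}" by auto
 obtain A c where A: "finite A" "ALL a:A. (\<Sum>i\<le>1. a i) = d"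
  and F: "ev f = (%v. \<Sum>a\<in>A. c a * (\<Prod>i\<le>1. v i ^ a i))"
  using hom_poly_ev[OF f] unfolding hom_poly_def by blast
 have "f = (\<Sum>a\<in>A. mC (c a) * (mX 0 ^ a 0 * mX 1 ^ a 1))" by (rule mpol_eqI) (simp add: F I)
 moreover have "EX p q. (\<Sum>a\<in>A'. mC (c a) * (mX 0 ^ a 0 * mX 1 ^ a 1)) = mX 0 ^ N * p + mX 1 ^ N * q"
  if "finite A'" "A' <= A" for A' using that
 proof (induction A' rule: finite_induct)
  case empty
  show ?case by (intro exI[of _ 0]) simp
 next
  case (insert a A')
  then obtain p q where pq: "(\<Sum>a\<in>A'. mC (c a) * (mX 0 ^ a 0 * mX 1 ^ a 1)) = mX 0 ^ N * p + mX 1 ^ N * q" by auto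
  have "a 0 + a 1 = d" using A(2) insert.prems by (auto simp: I)
  then consider "N <= a 0" | "N <= a 1" using d by linarith
  thus ?case
  proof cases
   case 1
   hence "mX 0 ^ a 0 = mX 0 ^ N * mX 0 ^ (a 0 - N)" by (simp flip: power_add)
   hence "(\<Sum>a\<in>insert a A'. mC (c a) * (mX 0 ^ a 0 * mX 1 ^ a 1)) =
     mX 0 ^ N * (mC (c a) * (mX 0 ^ (a 0 - N) * mX 1 ^ a 1) + p) + mX 1 ^ N * q"
    using insert.hyps pq by (simp add: algebra_simps)
   thus ?thesis by blast
  next
   case 2
   hence "mX 1 ^ a 1 = mX 1 ^ N * mX 1 ^ (a 1 - N)" by (simp flip: power_add)
   hence "(\<Sum>a\<in>insert a A'. mC (c a) * (mX 0 ^ a 0 * mX 1 ^ a 1)) =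
     mX 0 ^ N * p + mX 1 ^ N * (mC (c a) * (mX 0 ^ a 0 * mX 1 ^ (a 1 - N)) + q)"
    using insert.hyps pq by (simp add: algebra_simps)
   thus ?thesis by blast
  qed
 qed
 ultimately show ?thesis using A(1) by auto
qed

section \<open>Koszul exactness with prescribed degrees and poles\<close>

abbreviation pows :: "nat => nat => mpol list" where
 "pows n N == map (%j. mX j ^ N) [0..<Suc n]"

text \<open>Exactness becomes homogeneous by taking components and dropping the variables beyond
  \<open>n\<close>. The alternative \<open>p = 2\<close> for \<open>n = 1\<close> is the top degree,
  where \<open>d\<close> must be so large that every form lies in the ideal of the two
  powers.\<close>

lemma koszul_exact_hom:
 assumes c: "!!J. length J = Suc n ==> tc J = p ==> hpol n d (c J)"
  and closed: "!!J. length J = Suc n ==> tc J = Suc p ==> KR.kd (pows n N) c J = 0"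
  and p: "p <= n | n = 1 & p = 2 & 2 * N <= d + 1"
 shows "EX e. (ALL J. length J = Suc n --> tc J = p --> c J = KR.kd (pows n N) e J) &
  (ALL J. if N <= d then hpol n (d - N) (e J) else e J = 0)"
proof -
 have "EX e. ALL J. length J = Suc n --> tc J = p --> c J = KR.kd (pows n N) e J"
 proof (cases "p <= n")
  case True
  thus ?thesis using KR.koszul_exact[of "pows n N" p c] regular_powers[of "[0..<Suc n]" N] closed by auto
 next
  case False
  hence p2: "n = 1" "p = 2" "2 * N <= d + 1" using p by auto
  have "hpol 1 d (c [True, True])" using c[of "[True, True]"] p2 by simp
  then obtain a b where ab: "c [True, True] = mX 0 ^ N * a + mX 1 ^ N * b" using two_variable_powers p2(3) by blast
  define e where "e J = (if J = [False, True] then a else - b)" for J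
  have "J = [True, True]" if "length J = Suc n" "tc J = p" for J using KR.tc_full[of J] that p2 by (simp add: numeral_2_eq_2)
  moreover have "c [True, True] = KR.kd (pows n N) e [True, True]" by (simp add: ab e_def p2(1) upt_rec)
  ultimately show ?thesis by blast
 qed
 then obtain e where e: "!!J. length J = Suc n ==> tc J = p ==> c J = KR.kd (pows n N) e J" by blast
 define k where "k = Suc n"
 have "ALL h. EX g. ALL v. ev g v = ev h (%i. if i < k then v i else 0)" by (intro allI truncate_ex)
 from choice[OF this] obtain tr where
  tr: "ALL h v. ev (tr h) v = ev h (%i. if i < k then v i else 0)" ..
 define e' where "e' J = (if N <= d then tr (hcomp (d - N) (e J)) else 0)" for J
 have hmg: "hmg N (mX j ^ N)" for j using hmg_power[OF hmg_simps(4), of N j] by simp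
 have hc: "hcomp d (mX j ^ N * x) = mX j ^ N * (if N <= d then hcomp (d - N) x else 0)" for j x
  using hcomp_mult_hmg[OF hmg, of "d - N" j x] hcomp_mult_hmg_less[OF hmg, of d j x] by auto
 have trhc: "tr (hcomp d (y * x)) = y * (if N <= d then tr (hcomp (d - N) x) else 0)" if y: "y : set (pows n N)" for x y
 proof (rule mpol_eqI)
  fix v
  obtain j where j: "j < k" "y = mX j ^ N" using y unfolding k_def set_map set_upt by auto
  show "ev (tr (hcomp d (y * x))) v = ev (y * (if N <= d then tr (hcomp (d - N) x) else 0)) v"
   using j tr hc by (auto simp del: ev_hcomp)
 qed
 have lin: "tr (hcomp d (x - y)) = tr (hcomp d x) - tr (hcomp d y)" for x y by (rule mpol_eqI) (simp add: tr)
 have "c J = KR.kd (pows n N) e' J" if J: "length J = Suc n" "tc J = p" for J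
 proof -
  have "hpol n d (c J)" using c J by blast
  hence "hcomp d (c J) = c J" "tr (c J) = c J" by (auto simp: hpol_def hcomp_hmg tr k_def intro!: mpol_eqI depD)
  hence "c J = tr (hcomp d (KR.kd (pows n N) e J))" using e[OF J] by simp
  also have "\<dots> = KR.kd (pows n N) e' J" unfolding e'_def using KR.kd_additive[of "%x. tr (hcomp d x)" "pows n N"
     "%x. if N <= d then tr (hcomp (d - N) x) else 0" e J] lin trhc by blast
  finally show ?thesis .
 qed
 moreover have "hpol n (d - N) (e' J)" if "N <= d" for J
 proof -
  have "dep k (e' J)"
   by (rule depI) (use that in \<open>auto simp: e'_def tr intro!: arg_cong[of _ _ "%v. coeff (hp _ v) _"]\<close>)
  moreover have "hmg (d - N) (e' J)" unfolding hmg_def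
  proof (intro allI)
   fix t v
   have "(%i. if i < k then vscale t v i else 0) = vscale t (%i. if i < k then v i else 0)"
    by (auto simp: vscale_def)
   thus "ev (e' J) (vscale t v) = t ^ (d - N) * ev (e' J) v"
    using that hmg_hcomp[of "d - N" "e J"] unfolding e'_def hmg_def by (simp only: if_True tr)
  qed
  ultimately show ?thesis by (simp add: hpol_def k_def)
 qed
 moreover have "e' J = 0" if "~ N <= d" for J using that by (simp add: e'_def)
 ultimately show ?thesis by (intro exI[of _ e']) auto
qed

text \<open>Sections of \<open>\<O>(k)\<close> over the intersection of the sets \<open>F t \<noteq> 0\<close> for \<open>t\<close> in \<open>l\<close>, with poles of order one.\<close>

definition adm :: "nat => ('p => mpol) => ('p => nat) => int => 'p list => rat set" where
 "adm n F D k l = {Fract g (prod_list (map F l)) | g d. hpol n d g & (g = 0 | int d = k + int (sum_list (map D l)))}"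

text \<open>All values share one denominator, the product of the \<open>F t\<close>, so the claim is
  about numerators. If their degree \<open>m + s\<close> is negative, they are all zero.\<close>

lemma koszul_exact_adm:
 assumes F: "!!t. t : set l ==> F t ~= 0"
  and x: "!!J. length J = Suc n ==> tc J = p ==> x J : adm n F D m l"
  and closed: "!!J. length J = Suc n ==> tc J = Suc p ==> KK.kd (map to_fract (pows n N)) x J = 0"
  and p: "p <= n | n = 1 & p = 2 & l = [] & 2 * int N <= m + 1"
 shows "EX e. (ALL J. length J = Suc n --> tc J = p --> x J = KK.kd (map to_fract (pows n N)) e J) &
  (ALL J. e J : adm n F D (m - int N) l)"
proof -
 define P where "P = prod_list (map F l)"
 have P0: "P ~= 0" using F unfolding P_def by (induction l) auto
 define s where "s = sum_list (map D l)"
 define d where "d = nat (m + int s)"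
 have "EX g. hpol n d g & x J = Fract g P & (g = 0 | m + int s >= 0)"
  if J: "length J = Suc n" "tc J = p" for J
 proof -
  obtain g d' where g: "x J = Fract g P" "hpol n d' g" "g = 0 | int d' = m + int s"
   using x[OF J] unfolding adm_def P_def s_def by blast
  hence "g ~= 0 ==> d' = d" by (simp add: d_def)
  thus ?thesis using g by (cases "g = 0") (auto intro!: exI[of _ g])
 qed
 hence "ALL J. EX g. length J = Suc n --> tc J = p --> hpol n d g & x J = Fract g P & (g = 0 | m + int s >= 0)" by blast
 from choice[OF this] obtain c where
  c: "!!J. length J = Suc n ==> tc J = p ==> hpol n d (c J) & x J = Fract (c J) P & (c J = 0 | m + int s >= 0)" by blast
 have frP: "Fract g P = to_fract g * Fract 1 P" for g by (simp add: to_fract_def)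
 have kdfr: "KK.kd (map to_fract (pows n N)) (%J. Fract (g J) P) J = Fract (KR.kd (pows n N) g J) P" for g J
 proof -
  have "KK.kd (map to_fract ys) (%J. Fract (g J) P) J = Fract (KR.kd ys g J) P" for ys
   by (induction ys g J rule: KR.kd.induct)
    (auto simp: to_fract_def P0 fract_collapse diff_fract eq_fract algebra_simps)
  thus ?thesis .
 qed
 show ?thesis
 proof (cases "m + int s >= 0")
  case False
  hence "x J = KK.kd (map to_fract (pows n N)) (%J. 0) J" if "length J = Suc n" "tc J = p" for J
   using c[OF that] P0 by (simp add: fract_collapse)
  moreover have "0 : adm n F D (m - int N) l"
   using P0 unfolding adm_def P_def by (auto intro!: exI[of _ 0] simp: fract_collapse)
  ultimately show ?thesis by (intro exI[of _ "%J. 0"]) auto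
 next
  case True
  have "KR.kd (pows n N) c J = 0" if J: "length J = Suc n" "tc J = Suc p" for J
  proof -
   have "KK.kd (map to_fract (pows n N)) x J = KK.kd (map to_fract (pows n N)) (%J. Fract (c J) P) J"
    by (rule KK.kd_cong) (use c J in auto)
   hence "Fract (KR.kd (pows n N) c J) P = 0" using closed[OF J] kdfr by simp
   thus ?thesis using P0 by (simp add: Zero_fract_def eq_fract)
  qed
  moreover have "p <= n | n = 1 & p = 2 & 2 * N <= d + 1" using p True unfolding d_def s_def by auto
  ultimately obtain e where e: "ALL J. length J = Suc n --> tc J = p --> c J = KR.kd (pows n N) e J"
   "ALL J. if N <= d then hpol n (d - N) (e J) else e J = 0" using koszul_exact_hom[of n p d c N] c by blast
  have "x J = KK.kd (map to_fract (pows n N)) (%J. Fract (e J) P) J" if J: "length J = Suc n" "tc J = p" for J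
   unfolding kdfr using c[OF J] e(1) J by simp
  moreover have "Fract (e J) P : adm n F D (m - int N) l" for J unfolding adm_def P_def[symmetric] s_def[symmetric]
   using e(2)[rule_format, of J] True by (intro CollectI exI[of _ "e J"] exI[of _ "d - N"]) (auto simp: d_def split: if_splits)
  ultimately show ?thesis by (intro exI[of _ "%J. Fract (e J) P"]) auto
 qed
qed

lemma adm_0:
 assumes "!!t. t : set l ==> F t ~= 0"
 shows "0 : adm n F D k l"
proof -
 have "prod_list (map F l) ~= 0" using assms by (induction l) auto
 thus ?thesis unfolding adm_def by (auto intro!: exI[of _ 0] simp: fract_collapse)
qed

lemma adm_add:
 assumes F: "!!t. t : set l ==> F t ~= 0" and xy: "x : adm n F D k l" "y : adm n F D k l"
 shows "x + y : adm n F D k l"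
proof -
 have P0: "prod_list (map F l) ~= 0" using F by (induction l) auto
 obtain g d where g: "x = Fract g (prod_list (map F l))" "hpol n d g" "g = 0 | int d = k + int (sum_list (map D l))"
  using xy(1) unfolding adm_def by blast
 obtain h e where h: "y = Fract h (prod_list (map F l))" "hpol n e h" "h = 0 | int e = k + int (sum_list (map D l))"
  using xy(2) unfolding adm_def by blast
 show ?thesis
 proof (cases "g = 0 | h = 0")
  case True
  hence "x = 0 | y = 0" using g(1) h(1) P0 fract_collapse(1) by metis
  thus ?thesis using xy by auto
 next
  case False
  hence "d = e" using g h by auto
  moreover have "x + y = Fract (g + h) (prod_list (map F l))" unfolding g(1) h(1) using P0 by (simp add: eq_fract algebra_simps)
  ultimately show ?thesis unfolding adm_def using g h False by blast
 qed
qed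

lemma adm_loc:
 assumes F: "!!t. t : set l ==> hpol n (D t) (F t) & nz (F t) z" and x: "x : adm n F D k l"
  and z: "z : proj_space n"
 shows "x : loc n k z"
proof -
 obtain g d where g: "x = Fract g (prod_list (map F l))" "hpol n d g" "g = 0 | int d = k + int (sum_list (map D l))"
  using x unfolding adm_def by blast
 have P: "hpol n (sum_list (map D l)) (prod_list (map F l))" "nz (prod_list (map F l)) z"
  using F by (induction l) (auto intro: hom_mult)
 show ?thesis
 proof (cases "g = 0")
  case True
  hence "x = 0" using g P nz_nonzero by (auto simp: fract_collapse)
  thus ?thesis using z by simp
 next
  case False
  thus ?thesis unfolding g(1) by (intro locI[OF g(2) P]) (use g in auto)
 qed
qed

text \<open>Iterated contracting homotopies, one for each element of the subset \<open>J\<close>.\<close>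

fun hk :: "(('p list => rat) => 'p list => rat) list => bool list => ('p list => rat) => 'p list => rat" where
 "hk (h # hs) (True # J) c = h (hk hs J c)"
| "hk (h # hs) (False # J) c = hk hs J c"
| "hk hs J c = c"

text \<open>The contraction of the Cech complex with weights \<open>u t\<close>. With weights of sum
  1 it would be the usual contracting homotopy; here the sum will be \<open>v j ^ N\<close>.\<close>

definition hop :: "'p set => ('p => mpol) => ('p list => rat) => 'p list => rat" where
 "hop T u c l = (\<Sum>t\<in>T. to_fract (u t) * c (t # l))"

lemma to_fract_sum: "to_fract (sum f A) = (\<Sum>x\<in>A. to_fract (f x :: mpol))"
 by (induction A rule: infinite_finite_induct) auto

lemma hop_homotopy: "dl (hop T u c) l + hop T u (dl c) l = to_fract (\<Sum>t\<in>T. u t) * c l"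
proof -
 have "dl (hop T u c) l = (\<Sum>t\<in>T. to_fract (u t) * dl (%l. c (t # l)) l)" unfolding hop_def dl_sum
  by (intro sum.cong refl dl_additive[symmetric]) (simp add: right_diff_distrib)
 moreover have "hop T u (dl c) l = (\<Sum>t\<in>T. to_fract (u t) * c l) - (\<Sum>t\<in>T. to_fract (u t) * dl (%l. c (t # l)) l)"
  unfolding hop_def sum_subtractf[symmetric] by (simp add: right_diff_distrib)
 ultimately show ?thesis by (simp add: to_fract_sum sum_distrib_right)
qed

lemma hop_linear: "hop T u (%l. a l + s * b l) l = hop T u a l + s * hop T u b l"
 unfolding hop_def by (simp add: distrib_left sum.distrib sum_distrib_left mult.left_commute)

lemma hop_kd: "hop T u (%l. KK.kd ys (%J. c J l) J) l = KK.kd ys (%J. hop T u (c J) l) J"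
 unfolding hop_def by (simp add: KK.kd_sum KK.kd_scale)

text \<open>Moving \<open>dl\<close> past one homotopy costs a multiplication by its weight sum.
  These terms assemble into the Koszul differential of the weight sums, so for a cocycle the Cech
  coboundary of the family over all \<open>J\<close> is its Koszul coboundary.\<close>

lemma hk_dl:
 assumes "length J = length js"
 shows "dl (hk (map (%j. hop T (u j)) js) J c) l =
  KK.kd (map (%j. to_fract (\<Sum>t\<in>T. u j t)) js) (%J. hk (map (%j. hop T (u j)) js) J c l) J
   + (- 1) ^ tc J * hk (map (%j. hop T (u j)) js) J (dl c) l" using assms
proof (induction js arbitrary: J l)
 case (Cons j js)
 obtain b J' where J: "J = b # J'" "length J' = length js" using Cons.prems by (cases J) auto
 let ?hs = "map (%j. hop T (u j)) js" and ?ys = "map (%j. to_fract (\<Sum>t\<in>T. u j t)) js"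
 have IH: "dl (hk ?hs J' c) = (%l. KK.kd ?ys (%J. hk ?hs J c l) J' + (- 1) ^ tc J' * hk ?hs J' (dl c) l)"
  using Cons.IH[OF J(2)] by auto
 show ?case
 proof (cases b)
  case True
  have "dl (hop T (u j) (hk ?hs J' c)) l =
    to_fract (\<Sum>t\<in>T. u j t) * hk ?hs J' c l - hop T (u j) (dl (hk ?hs J' c)) l"
   using hop_homotopy[of T "u j" "hk ?hs J' c" l] by (simp add: algebra_simps)
  also have "hop T (u j) (dl (hk ?hs J' c)) l =
    KK.kd ?ys (%J. hop T (u j) (hk ?hs J c) l) J' + (- 1) ^ tc J' * hop T (u j) (hk ?hs J' (dl c)) l"
   unfolding IH hop_linear hop_kd ..
  finally show ?thesis using True J(1) by (simp add: KK.kd.simps)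
 next
  case False
  thus ?thesis using J(1) IH by (simp add: KK.kd.simps)
 qed
qed simp

lemma hk_none: "tc J = 0 ==> hk hs J c = c" by (induction hs J c rule: hk.induct) auto

lemma hk_zero:
 assumes "!!l. set l <= T ==> length l = L ==> c l = 0"
  and "set l <= T" "length l + tc J = L" "length J = length js"
 shows "hk (map (%j. hop T (u j)) js) J c l = 0" using assms(2-4)
proof (induction js arbitrary: J l)
 case Nil
 thus ?case using assms(1) by simp
next
 case (Cons j js)
 obtain b J' where J: "J = b # J'" "length J' = length js" using Cons.prems by (cases J) auto
 show ?case using Cons.IH[of _ J'] Cons.prems J by (cases b) (auto simp: hop_def intro!: sum.neutral)
qed

text \<open>In contrast to \<open>dl_mem\<close> the hypothesis knows where an entry was removed;
  \<open>adm\<close> depends on the list, and \<open>adm_insert\<close> has to put the entry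
  back.\<close>

lemma dl_mem_split:
 assumes "!!l1 x l2. l = l1 @ x # l2 ==> c (l1 @ l2) : A"
  and A: "0 : A" "!!x y. x : A ==> y : A ==> x - y : A"
 shows "dl c l : A" using assms(1)
proof (induction l arbitrary: c)
 case (Cons x xs)
 have "c xs : A" using Cons.prems[of "[]" x xs] by simp
 moreover have "dl (%l. c (x # l)) xs : A" by (rule Cons.IH) (metis Cons.prems append_Cons)
 ultimately show ?case using A(2) by simp
qed (use A in simp)

lemma adm_uminus: "x : adm n F D k l ==> - x : adm n F D k l" unfolding adm_def
proof (elim CollectE exE conjE)
 fix g d assume "x = Fract g (prod_list (map F l))" "hpol n d g" "g = 0 | int d = k + int (sum_list (map D l))"
 thus "- x : {Fract g (prod_list (map F l)) |g d. hpol n d g & (g = 0 | int d = k + int (sum_list (map D l)))}"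
  by (intro CollectI exI[of _ "- g"] exI[of _ d]) auto
qed

lemma adm_diff:
 assumes "!!t. t : set l ==> F t ~= 0" "x : adm n F D k l" "y : adm n F D k l"
 shows "x - y : adm n F D k l" using adm_add[OF assms(1,2) adm_uminus[OF assms(3)]] by simp

lemma adm_insert:
 assumes "x : adm n F D k (l1 @ l2)" "hpol n (D t) (F t)" "F t ~= 0"
 shows "x : adm n F D k (l1 @ t # l2)"
proof -
 obtain g d where g: "x = Fract g (prod_list (map F (l1 @ l2)))" "hpol n d g"
  "g = 0 | int d = k + int (sum_list (map D (l1 @ l2)))" using assms(1) unfolding adm_def by blast
 have "x = Fract (F t * g) (F t * prod_list (map F (l1 @ l2)))" using g assms by (simp add: mult_cancel_fract)
 hence "x = Fract (F t * g) (prod_list (map F (l1 @ t # l2)))" by (simp add: mult_ac)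
 moreover have "hpol n (D t + d) (F t * g)" using hom_mult assms g by blast
 moreover have "F t * g = 0 | int (D t + d) = k + int (sum_list (map D (l1 @ t # l2)))" using g(3) by auto
 ultimately show ?thesis unfolding adm_def by blast
qed

text \<open>The sets \<open>F t ~= 0\<close> with a witness that they cover: a power of each
  coordinate is a combination of the \<open>F t\<close>. The alternative \<open>g = 0\<close> covers
  those \<open>F t\<close> whose degree exceeds \<open>N\<close>.\<close>

locale finite_cover =
 fixes n N :: nat and T :: "'p set" and F :: "'p => mpol" and D :: "'p => nat" and u :: "nat => 'p => mpol"
 assumes T: "finite T" and F: "!!t. t : T ==> hpol n (D t) (F t) & F t ~= 0"
  and u: "!!j t. j <= n ==> t : T ==> EX g. u j t = g * F t & (g = 0 | D t <= N & hpol n (N - D t) g)"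
  and sum_u: "!!j. j <= n ==> (\<Sum>t\<in>T. u j t) = mX j ^ N"
begin

text \<open>The factor \<open>F t\<close> of \<open>u j t\<close> cancels the pole that
  \<open>c (t # l)\<close> has along \<open>F t = 0\<close>; the degree goes up by
  \<open>N\<close>.\<close>

lemma hop_adm:
 assumes "j <= n" "set l <= T" "!!t. t : T ==> c (t # l) : adm n F D k (t # l)"
 shows "hop T (u j) c l : adm n F D (k + int N) l"
proof -
 have Fl: "F t ~= 0" if "t : set l" for t using F assms(2) that by blast
 have trm: "to_fract (u j t) * c (t # l) : adm n F D (k + int N) l" if t: "t : T" for t
 proof -
  obtain g where g: "u j t = g * F t" "g = 0 | D t <= N & hpol n (N - D t) g" using u[OF assms(1) t] by blast
  obtain h d where h: "c (t # l) = Fract h (prod_list (map F (t # l)))" "hpol n d h"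
   "h = 0 | int d = k + int (sum_list (map D (t # l)))" using assms(3)[OF t] unfolding adm_def by blast
  show ?thesis
  proof (cases "g = 0 | h = 0")
   case True
   have "prod_list (map F (t # l)) ~= 0" using F t assms(2) by (induction l) auto
   hence "to_fract (u j t) * c (t # l) = 0" using True g(1) h(1) by (auto simp: fract_collapse)
   thus ?thesis using adm_0 Fl by metis
  next
   case False
   have "to_fract (u j t) * c (t # l) = Fract (F t * (g * h)) (F t * prod_list (map F l))"
    by (simp add: g(1) h(1) to_fract_def mult_ac)
   also have "\<dots> = Fract (g * h) (prod_list (map F l))" using F[OF t] by (simp add: mult_cancel_fract)
   finally have eq: "to_fract (u j t) * c (t # l) = Fract (g * h) (prod_list (map F l))" .
   have "hpol n (N - D t + d) (g * h)" using hom_mult g(2) h(2) False by blast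
   moreover have "int (N - D t + d) = k + int N + int (sum_list (map D l))" using g(2) h(3) False by auto
   ultimately show ?thesis unfolding eq adm_def by blast
  qed
 qed
 have "(\<Sum>t\<in>T'. to_fract (u j t) * c (t # l)) : adm n F D (k + int N) l" if "T' <= T" for T'
  using finite_subset[OF that T] that
 proof (induction T' rule: finite_induct)
  case empty
  show ?case using adm_0 Fl by (metis sum.empty)
 next
  case (insert t T')
  thus ?case using adm_add[OF Fl trm[of t]] by auto
 qed
 thus ?thesis unfolding hop_def by blast
qed

lemma hk_adm:
 assumes "!!l. set l <= T ==> length l = L ==> c l : adm n F D k l" "set js <= {..n}"
  and "set l <= T" "length l + tc J = L" "length J = length js"
 shows "hk (map (%j. hop T (u j)) js) J c l : adm n F D (k + int N * int (tc J)) l" using assms(2-5)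
proof (induction js arbitrary: J l)
 case Nil
 thus ?case using assms(1) by simp
next
 case (Cons j js)
 obtain b J' where J: "J = b # J'" "length J' = length js" using Cons.prems by (cases J) auto
 show ?case
 proof (cases b)
  case True
  have "hk (map (%j. hop T (u j)) js) J' c (t # l) : adm n F D (k + int N * int (tc J')) (t # l)" if "t : T" for t
   by (rule Cons.IH) (use Cons.prems J True that in auto)
  hence "hop T (u j) (hk (map (%j. hop T (u j)) js) J' c) l : adm n F D (k + int N * int (tc J') + int N) l"
   using Cons.prems by (intro hop_adm) auto
  thus ?thesis using J(1) True by (simp add: algebra_simps)
 next
  case False
  thus ?thesis using Cons.IH[of l J'] Cons.prems J by auto
 qed
qed

text \<open>A chase in the double complex of Cech cochains and the Koszul complex of the
  \<open>v j ^ N\<close>. The family \<open>C\<close> continues \<open>a\<close> into the Koszul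
  degrees up to \<open>Suc i\<close>. From there corrections are pulled down one Koszul degree at a
  time, until in degree zero \<open>a\<close> itself is a coboundary. Exactness is used in the
  degrees from 1 to \<open>Suc i\<close>, whence \<open>i < n\<close>.\<close>

lemma vanishing:
 assumes i: "0 < i" "i < n | n = 1 & i = 1 & k >= - 1"
  and a: "!!l. set l <= T ==> length l = Suc i ==> a l : adm n F D k l"
  and cocycle: "!!l. set l <= T ==> length l = Suc (Suc i) ==> dl a l = 0"
 shows "EX b. (ALL l. set l <= T --> length l = i --> b l : adm n F D k l) &
  (ALL l. set l <= T --> length l = Suc i --> a l = dl b l)"
proof -
 define C where "C J = hk (map (%j. hop T (u j)) [0..<Suc n]) J a" for J
 define ys where "ys = map to_fract (pows n N)"
 have ys: "ys = map (%j. to_fract (\<Sum>t\<in>T. u j t)) [0..<Suc n]"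
  unfolding ys_def map_map comp_def by (rule map_cong[OF refl]) (subst sum_u; auto)
 have Fl: "F t ~= 0" if "set l <= T" "t : set l" for l t using F that by blast
 have star: "KK.kd ys (%J. C J l) J = dl (C J) l"
  if l: "length J = Suc n" "set l <= T" "length l + tc J = Suc (Suc i)" for J l
 proof -
  have "hk (map (%j. hop T (u j)) [0..<Suc n]) J (dl a) l = 0"
   by (rule hk_zero[of T "Suc (Suc i)"]) (use cocycle l in auto)
  thus ?thesis unfolding C_def ys using hk_dl[of J "[0..<Suc n]" T u a l] l by simp
 qed
 have Cadm: "C J l : adm n F D (k + int N * int (tc J)) l"
  if l: "length J = Suc n" "set l <= T" "length l + tc J = Suc i" for J l
  unfolding C_def by (rule hk_adm[of "Suc i"]) (use a l in auto)
 \<comment> \<open>\<open>S p\<close>: there is a correction \<open>e\<close> in Koszul degree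
   \<open>p\<close>, on lists of length \<open>i - p\<close>, such that the part of
   \<open>C - dl e\<close> in that degree is Koszul closed.\<close>
 define S where "S p \<longleftrightarrow> (EX e. (ALL J l. length J = Suc n --> tc J = p --> set l <= T --> length l + p = i -->
    e J l : adm n F D (k + int N * int p) l) &
   (ALL J l. length J = Suc n --> tc J = Suc p --> set l <= T --> length l + p = Suc i -->
    KK.kd ys (%J. C J l - dl (e J) l) J = 0))" for p
 have "S (Suc i)" unfolding S_def
 proof (intro exI[of _ "%_ _. 0"] conjI allI impI)
  fix J l assume *: "length J = Suc n" "tc J = Suc (Suc i)" "set l <= T" "length l + Suc i = Suc i"
  hence "l = []" by simp
  thus "KK.kd ys (%J. C J l - dl (%_. 0) l) J = 0" using star[of J l] * by simp
 qed simp
 moreover have "S p" if S: "S (Suc p)" and p: "p <= i" for p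
 proof -
  obtain e where e: "!!J l. length J = Suc n ==> tc J = Suc p ==> set l <= T ==> length l + Suc p = i ==>
    e J l : adm n F D (k + int N * int (Suc p)) l"
   and closed: "!!J l. length J = Suc n ==> tc J = Suc (Suc p) ==> set l <= T ==> length l + Suc p = Suc i ==>
    KK.kd ys (%J. C J l - dl (e J) l) J = 0" using S unfolding S_def by blast
  have "EX f. (ALL J. length J = Suc n --> tc J = Suc p --> C J l - dl (e J) l = KK.kd ys f J) &
    (ALL J. f J : adm n F D (k + int N * int (Suc p) - int N) l)"
   if l: "set l <= T" "length l + p = i" for l unfolding ys_def
  proof (rule koszul_exact_adm[OF Fl[OF l(1)]])
   fix J assume J: "length J = Suc n" "tc J = Suc p"
   have "dl (e J) l : adm n F D (k + int N * int (Suc p)) l"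
   proof (rule dl_mem_split)
    fix l1 x l2 assume lx: "l = l1 @ x # l2"
    have "e J (l1 @ l2) : adm n F D (k + int N * int (Suc p)) (l1 @ l2)" using J lx l by (intro e) auto
    thus "e J (l1 @ l2) : adm n F D (k + int N * int (Suc p)) l" unfolding lx using F l lx by (intro adm_insert) auto
   qed (use adm_0 adm_diff Fl[OF l(1)] in blast)+
   moreover have "C J l : adm n F D (k + int N * int (Suc p)) l" using Cadm[of J l] J l by simp
   ultimately show "C J l - dl (e J) l : adm n F D (k + int N * int (Suc p)) l"
    by (intro adm_diff) (use Fl[OF l(1)] in auto)
  next
   fix J assume "length J = Suc n" "tc J = Suc (Suc p)"
   thus "KK.kd (map to_fract (pows n N)) (%J. C J l - dl (e J) l) J = 0" using closed l unfolding ys_def by simp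
  next
   \<comment> \<open>Only on the projective line is Koszul degree 2 reached. There the list is
     empty, and \<open>k >= - 1\<close> provides the degree that \<open>two_variable_powers\<close>
     asks for.\<close>
   show "Suc p <= n | n = 1 & Suc p = 2 & l = [] & 2 * int N <= k + int N * int (Suc p) + 1"
   proof (cases "Suc p <= n")
    case False
    hence *: "n = 1" "i = 1" "k >= - 1" using i(2) p by auto
    have "p = 1" using False * p by linarith
    moreover from this have "l = []" using l(2) * by simp
    ultimately show ?thesis using * by simp
   qed simp
  qed
  hence "ALL l. EX f. set l <= T --> length l + p = i -->
    (ALL J. length J = Suc n --> tc J = Suc p --> C J l - dl (e J) l = KK.kd ys f J) &
    (ALL J. f J : adm n F D (k + int N * int (Suc p) - int N) l)" by blast
  from choice[OF this] obtain f where
   f: "!!l J. set l <= T ==> length l + p = i ==> length J = Suc n ==> tc J = Suc p ==>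
     C J l - dl (e J) l = KK.kd ys (f l) J"
    "!!l J. set l <= T ==> length l + p = i ==> f l J : adm n F D (k + int N * int (Suc p) - int N) l" by blast
  define e' where "e' J l = f l J" for J l
  have "KK.kd ys (%J. C J l - dl (e' J) l) J = 0"
   if J: "length J = Suc n" "tc J = Suc p" and l: "set l <= T" "length l + p = Suc i" for J l
  proof -
   have "KK.kd ys (%J. dl (e' J) l) J = dl (%l. KK.kd ys (%J. e' J l) J) l" by (rule KK.kd_dl)
   also have "\<dots> = dl (%l. C J l - dl (e J) l) l"
    by (rule dl_cong) (use f(1)[OF _ _ J] l in \<open>auto simp: e'_def\<close>)
   also have "\<dots> = dl (C J) l" by (simp add: dl_diff dl_dl)
   finally show ?thesis using star[of J l] J l by (simp add: KK.kd_diff)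
  qed
  moreover have deg: "k + int N * int (Suc p) - int N = k + int N * int p" by (simp add: algebra_simps)
  moreover have "e' J l : adm n F D (k + int N * int p) l" if "set l <= T" "length l + p = i" for J l
   using f(2)[OF that] unfolding e'_def deg .
  ultimately show ?thesis unfolding S_def by (intro exI[of _ e'] conjI allI impI) simp_all
 qed
 ultimately have "S (Suc i - m)" for m
 proof (induction m)
  case (Suc m)
  show ?case
  proof (cases "m <= i")
   case True
   hence "Suc i - m = Suc (i - m)" by simp
   thus ?thesis using Suc by simp
  next
   case False
   hence "Suc i - Suc m = Suc i - m" by simp
   thus ?thesis using Suc by (simp only:)
  qed
 qed simp
 from this[of "Suc i"] have "S 0" by simp
 then obtain e where e0: "ALL J l. length J = Suc n --> tc J = 0 --> set l <= T --> length l + 0 = i -->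
    e J l : adm n F D (k + int N * int 0) l"
  and closed0: "ALL J l. length J = Suc n --> tc J = Suc 0 --> set l <= T --> length l + 0 = Suc i -->
    KK.kd ys (%J. C J l - dl (e J) l) J = 0" unfolding S_def by (elim exE conjE) (rule that)
 have e: "e J l : adm n F D k l" if "length J = Suc n" "tc J = 0" "set l <= T" "length l = i" for J l
  using e0 that by simp
 have closed: "KK.kd ys (%J. C J l - dl (e J) l) J = 0"
  if "length J = Suc n" "tc J = Suc 0" "set l <= T" "length l = Suc i" for J l using closed0 that by simp
 define J0 where "J0 = replicate (Suc n) False"
 have tc0: "tc (replicate m False) = 0" for m by (induction m) auto
 have "a l = dl (e J0) l" if l: "set l <= T" "length l = Suc i" for l
 proof -
  \<comment> \<open>At the subset consisting of the first variable, closedness says that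
    \<open>v 0 ^ N\<close> times the difference is zero.\<close>
  have ys0: "ys = to_fract (mX 0 ^ N) # map to_fract (map (%j. mX j ^ N) [1..<Suc n])"
   unfolding ys_def by (simp add: upt_rec del: upt_Suc)
  have "KK.kd zs c (replicate n False) = KK.kd zs (%J. 0) (replicate n False)" for zs and c :: "bool list => rat"
   by (rule KK.kd_cong) (simp add: tc0)
  moreover have "KK.kd ys (%J. C J l - dl (e J) l) (True # replicate n False) = 0" by (rule closed) (use l tc0 in auto)
  ultimately have "to_fract (mX 0 ^ N) * (C J0 l - dl (e J0) l) = 0" unfolding ys0 J0_def by (simp add: KK.kd.simps)
  hence "C J0 l = dl (e J0) l" by simp
  moreover have "C J0 l = a l" unfolding C_def by (subst hk_none) (simp_all only: J0_def tc0)
  ultimately show ?thesis by simp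
 qed
 moreover have "e J0 l : adm n F D k l" if "set l <= T" "length l = i" for l
  by (rule e) (use that tc0 in \<open>auto simp: J0_def\<close>)
 ultimately show ?thesis by blast
qed

end

section \<open>Cohomology of line bundles\<close>

text \<open>Vanishing of the \<open>i\<close>-th cohomology of the sheaf whose sections over \<open>U\<close> are the elements that
 lie in \<open>M z\<close> for all \<open>z \<in> U\<close>.\<close>

definition stalk_vanishing :: "nat => (point => 'b::ab_group_add set) => nat => bool" where
 "stalk_vanishing n M i \<longleftrightarrow> (ALL W a. point_cover n W -->
   (ALL l:simplices n i. ALL z:inters W l. a l : M z) -->
   (ALL l:simplices n (Suc i). dl a l = 0) -->
   (EX W'. point_cover n W' & (ALL q:proj_space n. W' q <= W q) &
    (case i of 0 => ALL l:simplices n 0. a l = 0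
    | Suc j => EX b. (ALL l:simplices n j. ALL z:inters W' l. b l : M z) &
      (ALL l:simplices n i. a l = dl b l))))"

text \<open>The forms that clear the denominator of \<open>x\<close> have no common zero where
  \<open>f\<close> is non-zero. So a power of \<open>f\<close> is a combination of them and clears
  the denominator too.\<close>

lemma section_principal:
 assumes f: "hpol n D f" "D > 0" and x: "!!z. z : ptD n f ==> x : loc n k z"
 shows "EX M d g. hpol n d g & (g = 0 | int d = k + int (M * D)) & to_fract (f ^ M) * x = to_fract g"
proof -
 define S where "S = {h. EX e d g. hpol n e h & hpol n d g & int d - int e = k & to_fract h * x = to_fract g}"
 have S: "EX e. hpol n e h" if "h : S" for h using that unfolding S_def by blast
 have van: "ev f v = 0" if v: "ALL h:S. ev h v = 0" for v
 proof (rule ccontr)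
  assume fv: "ev f v ~= 0"
  obtain z where z: "z : proj_space n" "ALL e g. hpol n e g --> (nz g z \<longleftrightarrow> ev g v ~= 0)"
   using point_of_vector[OF fv f] by blast
  hence "z : ptD n f" using f(1) fv by (auto simp: ptD_def)
  then obtain g h d e where gh: "x = Fract g h" "hpol n d g" "hpol n e h" "int d - int e = k" "nz h z"
   using x[of z] by (meson locE)
  have "to_fract h * x = to_fract g" using gh nz_nonzero[OF gh(5)] by (simp add: to_fract_def eq_fract)
  hence "h : S" unfolding S_def using gh by blast
  thus False using v z(2) gh by blast
 qed
 have "EX M. f ^ M : ideal.span S"
  by (rule hom_nullstellensatz[OF _ homD(2)[OF f(1)] f(2)]) (use S homD(2) van in blast)+
 then obtain M where M: "f ^ M : ideal.span S" by blast
 define dg where "dg h = (if h = 0 then 0 else (THE e. hpol n e h))" for h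
 have dg: "dg h = e" if "hpol n e h" "h ~= 0" for h e unfolding dg_def using that hom_unique by auto
 have dgS: "hpol n (dg h) h" if "h : S" for h using S[OF that] dg by (cases "h = 0") (auto simp: dg_def)
 obtain T c where T: "finite T" "T <= S" "f ^ M = (\<Sum>g\<in>T. c g * g)"
  "ALL g:T. if dg g <= D * M then hpol n (D * M - dg g) (c g) else c g = 0"
  using hom_span_representation[OF dgS hom_power[OF f(1)] M] by blast
 have "ALL h:S. EX g d. hpol n d g & (h = 0 | int d - int (dg h) = k) & to_fract h * x = to_fract g"
 proof
  fix h assume "h : S"
  then obtain e d g where g: "hpol n e h" "hpol n d g" "int d - int e = k" "to_fract h * x = to_fract g"
   unfolding S_def by blast
  thus "EX g d. hpol n d g & (h = 0 | int d - int (dg h) = k) & to_fract h * x = to_fract g"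
   using dg[OF g(1)] by (intro exI[of _ g] exI[of _ d]) auto
 qed
 then obtain G d where G: "ALL h:S. hpol n (d h) (G h) & (h = 0 | int (d h) - int (dg h) = k) & to_fract h * x = to_fract (G h)"
  by metis
 define g where "g = (\<Sum>h\<in>T. c h * G h)"
 define m where "m = nat (k + int (D * M))"
 have trm: "hpol n m (c h * G h) & (c h * G h = 0 | int m = k + int (D * M))" if h: "h : T" for h
 proof (cases "c h * G h = 0")
  case False
  hence "h ~= 0" using G T(2) h by (metis mult_eq_0_iff subsetD to_fract_eq_0_iff)
  hence dh: "hpol n (d h) (G h)" "int (d h) - int (dg h) = k" using G T(2) h by blast+
  have le: "dg h <= D * M" "hpol n (D * M - dg h) (c h)" using T(4) h False by (auto split: if_splits)
  hence "int (D * M - dg h + d h) = k + int (D * M)" using dh by simp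
  hence "D * M - dg h + d h = m" "int m = k + int (D * M)" unfolding m_def by auto
  thus ?thesis using hom_mult[OF le(2) dh(1)] by simp
 next
  case True
  thus ?thesis by (simp only: True) simp
 qed
 have "hpol n m g" unfolding g_def by (rule hom_sum) (use trm in blast)
 moreover have "g = 0 | int m = k + int (M * D)"
 proof (cases "g = 0")
  case False
  then obtain h where "h : T" "c h * G h ~= 0" unfolding g_def by (meson sum.neutral)
  hence "int m = k + int (D * M)" using trm by blast
  thus ?thesis by (simp add: mult.commute)
 qed simp
 moreover have "to_fract (f ^ M) * x = to_fract g"
 proof -
  have "to_fract (f ^ M) * x = (\<Sum>h\<in>T. to_fract (c h) * (to_fract h * x))"
   unfolding T(3) to_fract_sum by (simp add: sum_distrib_right mult.assoc)
  also have "\<dots> = (\<Sum>h\<in>T. to_fract (c h * G h))" using G T(2) by (intro sum.cong) auto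
  finally show ?thesis unfolding g_def to_fract_sum .
 qed
 ultimately show ?thesis by blast
qed

text \<open>The coefficients are indexed by \<open>T\<close>, on which \<open>F\<close> may fail to
  be injective: each generator gets its coefficient at one chosen preimage and zero at the
  others.\<close>

lemma span_image_representation:
 assumes T: "finite T" and F: "!!t. t : T ==> hpol n (D t) (F t) & F t ~= 0"
  and f: "hpol n e f" "f : ideal.span (F ` T)"
 shows "EX u. (\<Sum>t\<in>T. u t) = f & (ALL t:T. EX g. u t = g * F t & (g = 0 | D t <= e & hpol n (e - D t) g))"
proof -
 define dg where "dg h = (THE d. hpol n d h)" for h
 have dg: "dg (F t) = D t" if "t : T" for t unfolding dg_def using F[OF that] hom_unique by blast
 have h: "hpol n (dg h) h" if "h : F ` T" for h using that dg F by auto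
 obtain S c where S: "finite S" "S <= F ` T" "f = (\<Sum>g\<in>S. c g * g)"
  "ALL g:S. if dg g <= e then hpol n (e - dg g) (c g) else c g = 0" using hom_span_representation[OF h f] by blast
 define R where "R = inv_into T F ` S"
 have RT: "R <= T" unfolding R_def using S(2) by (auto intro: inv_into_into)
 define u where "u t = (if t : R then c (F t) * F t else 0)" for t
 have "(\<Sum>t\<in>T. u t) = (\<Sum>t\<in>R. c (F t) * F t)" unfolding u_def using RT T by (simp add: sum.If_cases Int_absorb1)
 also have "\<dots> = (\<Sum>g\<in>S. c g * g)" unfolding R_def
 proof (subst sum.reindex)
  show "inj_on (inv_into T F) S" using S(2) by (rule inj_on_inv_into)
  show "sum ((%t. c (F t) * F t) \<circ> inv_into T F) S = (\<Sum>g\<in>S. c g * g)"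
  proof (rule sum.cong[OF refl])
   fix g assume "g : S"
   hence "F (inv_into T F g) = g" using f_inv_into_f[of g F T] S(2) by blast
   thus "((%t. c (F t) * F t) \<circ> inv_into T F) g = c g * g" by simp
  qed
 qed
 finally have "(\<Sum>t\<in>T. u t) = f" using S(3) by simp
 moreover have "EX g. u t = g * F t & (g = 0 | D t <= e & hpol n (e - D t) g)" if t: "t : T" for t
 proof (cases "t : R")
  case True
  then obtain g where g: "g : S" "t = inv_into T F g" unfolding R_def by blast
  hence "F t = g" using f_inv_into_f[of g F T] S(2) by blast
  hence "if D t <= e then hpol n (e - D t) (c (F t)) else c (F t) = 0"
   using bspec[OF S(4) g(1)] unfolding \<open>F t = g\<close>[symmetric] dg[OF t] by simp
  moreover have "u t = c (F t) * F t" using True by (simp add: u_def)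
  ultimately show ?thesis by (intro exI[of _ "c (F t)"]) presburger
 next
  case False
  thus ?thesis by (intro exI[of _ 0]) (simp add: u_def)
 qed
 ultimately show ?thesis by blast
qed

lemma inters_nonempty_subset:
 assumes "point_cover n W" "l : simplices n i" "z : inters W l"
 shows "z : proj_space n"
proof -
 have "l ~= []" using assms(2) by (auto simp: simplices_def)
 hence "hd l : set l" by simp
 hence "z : W (hd l)" "hd l : proj_space n" using assms by (auto simp: inters_def simplices_def)
 thus ?thesis using assms(1) zariski_open_subset unfolding point_cover_def by auto
qed

text \<open>Quasi-compactness in algebraic form: without a common zero in projective space, the
  forms generate an ideal to which the Nullstellensatz applies for every coordinate. The sum of the
  exponents serves all coordinates.\<close>

lemma coordinate_powers_in_span:
 assumes S: "!!h. h : S ==> EX e. hpol n e h" and nv: "!!z. z : proj_space n ==> EX h:S. nz h z"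
 shows "EX N. ALL j<=n. mX j ^ N : ideal.span S"
proof -
 have "EX N. mX j ^ N : ideal.span S" if j: "j <= n" for j
 proof (rule hom_nullstellensatz[of S 1])
  show "EX d. hmg d g" if "g : S" for g using S[OF that] homD(2) by blast
  fix v assume v: "ALL g:S. ev g v = 0"
  show "ev (mX j) v = 0"
  proof (rule ccontr)
   assume nzv: "ev (mX j) v ~= 0"
   have "hpol n 1 (mX j)" using j by auto
   from point_of_vector[OF nzv this] obtain z where
    z: "z : proj_space n" "ALL e g. hpol n e g --> (nz g z \<longleftrightarrow> ev g v ~= 0)" by auto
   thus False using nv S v by metis
  qed
 qed (auto intro: hmg_simps(4)[unfolded One_nat_def])
 then obtain N where N: "!!j. j <= n ==> mX j ^ N j : ideal.span S" by metis
 have "mX j ^ (\<Sum>i\<le>n. N i) : ideal.span S" if j: "j <= n" for j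
 proof -
  have "N j <= (\<Sum>i\<le>n. N i)" using j by (intro member_le_sum) auto
  hence "mX j ^ (\<Sum>i\<le>n. N i) = mX j ^ ((\<Sum>i\<le>n. N i) - N j) * mX j ^ N j" by (simp flip: power_add)
  thus ?thesis using ideal.span_scale[OF N[OF j]] by metis
 qed
 thus ?thesis by blast
qed

text \<open>The cover is refined by basic open sets, finitely many of which suffice. On these the
  sections have poles of bounded order; passing to powers \<open>f t ^ M\<close> makes the order
  one, which is the situation of \<open>finite_cover\<close>. The prism carries the result back to
  covers indexed by all points.\<close>

theorem line_bundle_vanishing:
 assumes i: "0 < i" "i < n | n = 1 & i = 1 & k >= - 1"
 shows "stalk_vanishing n (loc n k) i" unfolding stalk_vanishing_def
proof (intro allI impI)
 fix W a
 assume W: "point_cover n W" and a: "ALL l:simplices n i. ALL z:inters W l. a l : loc n k z"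
  and coc: "ALL l:simplices n (Suc i). dl a l = 0"
 have Wq: "zariski_open n (W q)" "q : W q" if "q : proj_space n" for q using W that by (auto simp: point_cover_def)
 have "ALL q. EX f d. q : proj_space n --> hpol n d f & nz f q & ptD n f <= W q & d > 0"
  using zariski_basis[OF Wq] by blast
 then obtain f Df where f: "!!q. q : proj_space n ==> hpol n (Df q) (f q) & nz (f q) q & ptD n (f q) <= W q & Df q > 0"
  by metis
 have "EX N. ALL j<=n. mX j ^ N : ideal.span (f ` proj_space n)"
  by (rule coordinate_powers_in_span) (use f in blast)+
 then obtain N0 where N0: "!!j. j <= n ==> mX j ^ N0 : ideal.span (f ` proj_space n)" by blast
 have "EX Tj. finite Tj & Tj <= proj_space n & mX j ^ N0 : ideal.span (f ` Tj)" if j: "j <= n" for j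
 proof -
  obtain t r where t: "finite t" "t <= f ` proj_space n" "mX j ^ N0 = (\<Sum>a\<in>t. r a * a)"
   using N0[OF j] unfolding ideal.span_explicit by blast
  obtain Tj where Tj: "finite Tj" "Tj <= proj_space n" "t = f ` Tj" using t(1,2) by (meson finite_subset_image)
  have "mX j ^ N0 : ideal.span (f ` Tj)"
   unfolding t(3) Tj(3)[symmetric] by (intro ideal.span_sum ideal.span_scale ideal.span_base)
  thus ?thesis using Tj by blast
 qed
 then obtain Tj where Tj: "!!j. j <= n ==> finite (Tj j) & Tj j <= proj_space n & mX j ^ N0 : ideal.span (f ` Tj j)"
  by metis
 define T where "T = (\<Union>j\<le>n. Tj j)"
 have T: "finite T" "T <= proj_space n" unfolding T_def using Tj by auto
 have spanT: "mX j ^ N0 : ideal.span (f ` T)" if "j <= n" for j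
  using Tj[OF that] ideal.span_mono[of "f ` Tj j" "f ` T"] that unfolding T_def by auto
 have fT: "EX t:T. nz (f t) z" if z: "z : proj_space n" for z
 proof (rule ccontr)
  assume no: "~ ?thesis"
  obtain j where j: "j <= n" "nz (mX j) z" using exists_coordinate[OF z] .
  have "ev h (rp z) = 0" if "h : ideal.span (f ` T)" for h
   using that by (induction rule: ideal.span_induct_alt) (use no in \<open>auto simp: nz_def\<close>)
  from this[OF spanT[OF j(1)]] have "rp z j = 0" by simp
  thus False using j(2) by (simp add: nz_def)
 qed
 \<comment> \<open>The refinement map: \<open>\<rho> z\<close> is a member of the finite cover that
   contains \<open>z\<close>.\<close>
 then obtain \<rho> where \<rho>: "!!z. z : proj_space n ==> \<rho> z : T & nz (f (\<rho> z)) z" by metis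
 have fT0: "hpol n (Df t) (f t)" "f t ~= 0" "Df t > 0" "ptD n (f t) <= W t" "t : proj_space n" if "t : T" for t
  using f[of t] T that nz_nonzero by auto
 define PL where "PL l = prod_list (map f l)" for l
 define DL where "DL l = sum_list (map Df l)" for l
 have PL: "hpol n (DL l) (PL l)" if "set l <= T" for l
  using that by (induction l) (auto simp: PL_def DL_def intro!: hom_mult fT0)
 define LL where "LL = {l. set l <= T & length l = Suc i}"
 have LL: "finite LL" unfolding LL_def using finite_lists_length_eq[OF T(1)] by simp
 have secs: "EX M d g. hpol n d g & (g = 0 | int d = k + int (M * DL l)) & to_fract (PL l ^ M) * a l = to_fract g"
  if l: "l : LL" for l
 proof (rule section_principal[OF PL])
  show "set l <= T" using l by (simp add: LL_def)
  obtain t l' where tl: "l = t # l'" "t : T" using l by (cases l) (auto simp: LL_def)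
  thus "0 < DL l" using fT0(3) by (simp add: DL_def)
  fix z assume z: "z : ptD n (PL l)"
  have nzl: "nz (prod_list (map f l)) z ==> t : set l ==> nz (f t) z" for t l
   by (induction l) auto
  have "nz (f t) z" if "t : set l" for t using nzl[of l t] z that by (simp add: ptD_def PL_def)
  hence "z : inters W l" using z l fT0(4) by (auto simp: inters_def ptD_def LL_def)
  moreover have "l : simplices n i" using l T by (auto simp: LL_def simplices_def)
  ultimately show "a l : loc n k z" using a by blast
 qed
 then obtain Ml where Ml: "!!l. l : LL ==> EX d g. hpol n d g & (g = 0 | int d = k + int (Ml l * DL l)) &
   to_fract (PL l ^ Ml l) * a l = to_fract g" by metis
 define M where "M = Suc (\<Sum>l\<in>LL. Ml l)"
 have MM: "Ml l <= M" if "l : LL" for l unfolding M_def using member_le_sum[OF that, of Ml] LL by simp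
 define F where "F t = f t ^ M" for t
 define D where "D t = Df t * M" for t
 have F: "hpol n (D t) (F t) & F t ~= 0" if "t : T" for t using fT0[OF that] hom_power by (auto simp: F_def D_def)
 have FL: "prod_list (map F l) = PL l ^ M" "sum_list (map D l) = DL l * M" for l
  by (induction l) (auto simp: F_def D_def PL_def DL_def power_mult_distrib add_mult_distrib)
 have aadm: "a l : adm n F D k l" if l: "set l <= T" "length l = Suc i" for l
 proof -
  have lL: "l : LL" using l by (simp add: LL_def)
  obtain d g where g: "hpol n d g" "g = 0 | int d = k + int (Ml l * DL l)" "to_fract (PL l ^ Ml l) * a l = to_fract g"
   using Ml[OF lL] by blast
  have P0: "PL l ~= 0" unfolding PL_def using fT0(2) l(1) by (induction l) auto
  define h where "h = PL l ^ (M - Ml l) * g"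
  have pw: "PL l ^ M = PL l ^ (M - Ml l) * PL l ^ Ml l" using MM[OF lL] by (simp flip: power_add)
  have "to_fract (PL l ^ M) * a l = to_fract h" unfolding pw h_def using g(3) by (simp add: mult.assoc)
  moreover have "to_fract (PL l ^ M) ~= 0" using P0 by simp
  ultimately have "a l = to_fract h / to_fract (PL l ^ M)" by (simp add: field_simps)
  hence "a l = Fract h (prod_list (map F l))" unfolding FL by (simp add: to_fract_def)
  moreover have "hpol n (DL l * (M - Ml l) + d) h" unfolding h_def by (intro hom_mult hom_power PL l g)
  moreover have "h = 0 | int (DL l * (M - Ml l) + d) = k + int (sum_list (map D l))"
  proof (cases "g = 0")
   case False
   have "DL l * M = DL l * (M - Ml l) + DL l * Ml l" using MM[OF lL] by (metis add_mult_distrib2 le_add_diff_inverse2)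
   thus ?thesis using g(2) False unfolding FL by (simp add: mult.commute)
  qed (simp add: h_def)
  ultimately show ?thesis unfolding adm_def by blast
 qed
 have "EX N. ALL j<=n. mX j ^ N : ideal.span (F ` T)"
 proof (rule coordinate_powers_in_span)
  show "EX e. hpol n e h" if "h : F ` T" for h using that F by blast
  show "EX h:F ` T. nz h z" if "z : proj_space n" for z using \<rho>[OF that] nz_power unfolding F_def by blast
 qed
 then obtain N where N: "!!j. j <= n ==> mX j ^ N : ideal.span (F ` T)" by blast
 have "EX u. (\<Sum>t\<in>T. u t) = mX j ^ N & (ALL t:T. EX g. u t = g * F t & (g = 0 | D t <= N & hpol n (N - D t) g))"
  if j: "j <= n" for j
 proof (rule span_image_representation[OF T(1) F _ N[OF j]])
  show "hpol n N (mX j ^ N)" using hom_power[of n 1 "mX j" N] j by auto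
 qed
 hence "ALL j. EX u. j <= n --> (\<Sum>t\<in>T. u t) = mX j ^ N & (ALL t:T. EX g. u t = g * F t & (g = 0 | D t <= N & hpol n (N - D t) g))"
  by blast
 from choice[OF this] obtain u where
  u: "!!j. j <= n ==> (\<Sum>t\<in>T. u j t) = mX j ^ N"
   "!!j t. j <= n ==> t : T ==> EX g. u j t = g * F t & (g = 0 | D t <= N & hpol n (N - D t) g)" by blast
 note TP = T(2)
 interpret finite_cover n N T F D u by standard (use T F u in auto)
 have "EX b. (ALL l. set l <= T --> length l = i --> b l : adm n F D k l) &
  (ALL l. set l <= T --> length l = Suc i --> a l = dl b l)"
 proof (rule vanishing[OF i aadm])
  show "dl a l = 0" if "set l <= T" "length l = Suc (Suc i)" for l
   using coc that subset_trans[OF that(1) TP] by (simp add: simplices_def)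
 qed
 then obtain b where b: "!!l. set l <= T ==> length l = i ==> b l : adm n F D k l"
  "!!l. set l <= T ==> length l = Suc i ==> a l = dl b l" by blast
 \<comment> \<open>The second factor puts \<open>W' q\<close> inside \<open>W (\<rho> q)\<close> as
   well, as needed for the prism, which mixes \<open>q\<close> with \<open>\<rho> q\<close>.\<close>
 define W' where "W' q = W q \<inter> ptD n (f (\<rho> q))" for q
 have W': "point_cover n W'" unfolding point_cover_def W'_def openin_zariski
  using Wq \<rho> open_ptD fT0(1) zariski_open_Int by (auto simp: ptD_def; blast)
 obtain j where j: "i = Suc j" using i(1) by (cases i) auto
 \<comment> \<open>The pullback of \<open>b\<close> bounds the pullback of \<open>a\<close>, and the
   prism bounds the difference between that and \<open>a\<close>.\<close>
 define b' where "b' l = b (map \<rho> l) - prism \<rho> a l" for l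
 have \<rho>l: "set (map \<rho> l) <= T" if "l : simplices n m" for l m
  using that \<rho> by (auto simp: simplices_def)
 have "b' l : loc n k z" if l: "l : simplices n j" and z: "z : inters W' l" for l z
 proof -
  have zP: "z : proj_space n" using inters_nonempty_subset[OF W' l z] .
  have zl: "z : W q" "nz (f (\<rho> q)) z" "q : proj_space n" if "q : set l" for q
   using z l that by (auto simp: inters_def W'_def ptD_def simplices_def)
  have "b (map \<rho> l) : loc n k z"
  proof (rule adm_loc[OF _ b(1) zP])
   show "set (map \<rho> l) <= T" using \<rho>l[OF l] .
   show "length (map \<rho> l) = i" using l j by (simp add: simplices_def)
   show "hpol n (D t) (F t) & nz (F t) z" if t: "t : set (map \<rho> l)" for t
    using F \<rho>l[OF l] t zl(2) nz_power unfolding F_def by auto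
  qed
  moreover have "prism \<rho> a l : loc n k z"
  proof (rule prism_mem)
   fix l' assume l': "length l' = Suc (length l)" "set l' <= set l \<union> \<rho> ` set l"
   have "set l' <= proj_space n" using l' zl(3) \<rho> TP by blast
   hence "l' : simplices n i" using l l'(1) j by (auto simp: simplices_def)
   moreover have "z : W q" if q: "q : set l'" for q
   proof -
    consider "q : set l" | q' where "q' : set l" "q = \<rho> q'" using l'(2) q by blast
    thus ?thesis
    proof cases
     case 2
     hence "z : ptD n (f q)" using zl zP by (auto simp: ptD_def)
     thus ?thesis using fT0(4) \<rho> zl(3) 2 by blast
    qed (use zl in blast)
   qed
   hence "z : inters W l'" by (auto simp: inters_def)
   ultimately show "a l' : loc n k z" using a by blast
  qed (use zP loc_diff in auto)
  ultimately show ?thesis unfolding b'_def by (rule loc_diff)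
 qed
 moreover have "a l = dl b' l" if l: "l : simplices n i" for l
 proof -
  have "prism \<rho> (dl a) l : {0}"
  proof (rule prism_mem)
   fix l' assume l': "length l' = Suc (length l)" "set l' <= set l \<union> \<rho> ` set l"
   have "\<rho> ` set l <= proj_space n" using l \<rho> TP by (auto simp: simplices_def)
   moreover have "set l <= proj_space n" using l by (simp add: simplices_def)
   ultimately have "set l' <= proj_space n" using l'(2) by blast
   hence "l' : simplices n (Suc i)" using l l'(1) by (simp add: simplices_def)
   thus "dl a l' : {0}" using coc by simp
  qed auto
  hence "dl (prism \<rho> a) l = a (map \<rho> l) - a l" using prism_homotopy[of \<rho> a l] by simp
  moreover have "a (map \<rho> l) = dl (%l. b (map \<rho> l)) l"
   using b(2)[OF \<rho>l[OF l]] l by (simp add: simplices_def dl_map)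
  ultimately show ?thesis unfolding b'_def by (simp add: dl_diff)
 qed
 ultimately show "EX W'. point_cover n W' & (ALL q:proj_space n. W' q <= W q) &
    (case i of 0 => ALL l:simplices n 0. a l = 0
    | Suc j => EX b. (ALL l:simplices n j. ALL z:inters W' l. b l : loc n k z) &
      (ALL l:simplices n i. a l = dl b l))" using W' by (intro exI[of _ W']) (auto simp: W'_def j)
qed

section \<open>Lattices of rank two\<close>

text \<open>A cocycle in degree zero has one value for all points, and this value lies in every
  stalk.\<close>

lemma stalk_vanishing_0:
 assumes M: "!!z. z : proj_space n ==> 0 : M z"
 shows "stalk_vanishing n M 0 \<longleftrightarrow> (ALL x. (ALL z:proj_space n. x : M z) --> x = 0)"
proof
 assume v: "stalk_vanishing n M 0"
 show "ALL x. (ALL z:proj_space n. x : M z) --> x = 0"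
 proof (intro allI impI)
  fix x assume x: "ALL z:proj_space n. x : M z"
  have W: "point_cover n (%_. proj_space n)" using zariski_open_proj by (simp add: point_cover_def)
  have "ALL l:simplices n 0. ALL z:inters (%_. proj_space n) l. x : M z"
   using x inters_nonempty_subset[OF W] by blast
  moreover have "ALL l:simplices n (Suc 0). dl (%_. x) l = 0" by (auto simp: simplices_def length_Suc_conv)
  ultimately have "ALL l:simplices n 0. x = 0" using v W unfolding stalk_vanishing_def by fastforce
  moreover obtain q where "q : proj_space n" using hom_nonzero_point[of n 0 1] by auto
  hence "[q] : simplices n 0" by (simp add: simplices_def)
  ultimately show "x = 0" by blast
 qed
next
 assume z: "ALL x. (ALL z:proj_space n. x : M z) --> x = 0"
 show "stalk_vanishing n M 0" unfolding stalk_vanishing_def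
 proof (intro allI impI)
  fix W a assume W: "point_cover n W" and a: "ALL l:simplices n 0. ALL z:inters W l. a l : M z"
   and coc: "ALL l:simplices n (Suc 0). dl a l = 0"
  have eq: "a [q] = a [r]" if "q : proj_space n" "r : proj_space n" for q r
  proof -
   have "[r, q] : simplices n (Suc 0)" using that by (simp add: simplices_def)
   hence "dl a [r, q] = 0" using coc by blast
   thus ?thesis by simp
  qed
  have mem: "a [q] : M q" if "q : proj_space n" for q
  proof -
   have "[q] : simplices n 0" "q : inters W [q]" using that W by (auto simp: simplices_def inters_def point_cover_def)
   thus ?thesis using a by blast
  qed
  have "a [q] = 0" if q: "q : proj_space n" for q using z mem eq[OF q] by (metis (mono_tags))
  hence "ALL l:simplices n 0. a l = 0" by (auto simp: simplices_def length_Suc_conv)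
  thus "EX W'. point_cover n W' & (ALL q:proj_space n. W' q <= W q) &
    (case 0 of 0 => ALL l:simplices n 0. a l = 0
    | Suc j => EX b. (ALL l:simplices n j. ALL z:inters W' l. b l : M z) &
      (ALL l:simplices n 0. a l = dl b l))" using W by auto
 qed
qed

section \<open>Vectors and lattices over the function field\<close>

type_synonym rat2 = "rat \<times> rat"

definition sm :: "rat => rat2 => rat2" where
 "sm a x = (a * fst x, a * snd x)"

interpretation K2: koszul sm by standard (auto simp: sm_def algebra_simps)

definition det2 :: "rat2 => rat2 => rat" where
 "det2 x y = fst x * snd y - snd x * fst y"

lemma det2_simps:
 "det2 (x + x') y = det2 x y + det2 x' y" "det2 x (y + y') = det2 x y + det2 x y'"
 "det2 (x - x') y = det2 x y - det2 x' y" "det2 x (y - y') = det2 x y - det2 x y'"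
 "det2 (sm a x) y = a * det2 x y" "det2 x (sm a y) = a * det2 x y" "det2 x x = 0" "det2 y x = - det2 x y"
 by (simp_all add: det2_def sm_def algebra_simps)

lemma sm_eq_0: "sm a x = 0 \<longleftrightarrow> a = 0 | x = 0" by (cases x) (auto simp: sm_def zero_prod_def)

lemma det2_zero_multiple:
 assumes "det2 s y = 0" "s ~= 0"
 shows "EX a. y = sm a s"
proof (cases "fst s = 0")
 case True
 hence "snd s ~= 0" using assms(2) by (simp add: prod_eq_iff)
 hence "fst y = 0" using assms(1) True by (simp add: det2_def)
 hence "y = sm (snd y / snd s) s" using True \<open>snd s ~= 0\<close> by (simp add: sm_def prod_eq_iff)
 thus ?thesis by blast
next
 case False
 hence "snd y = fst y / fst s * snd s" using assms(1) by (simp add: det2_def field_simps)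
 hence "y = sm (fst y / fst s) s" using False by (simp add: sm_def prod_eq_iff)
 thus ?thesis by blast
qed

lemma basis_unique:
 assumes "det2 x y ~= 0" "sm a x + sm b y = sm c x + sm d y"
 shows "a = c" "b = d"
proof -
 have "det2 (sm a x + sm b y) y = det2 (sm c x + sm d y) y" "det2 x (sm a x + sm b y) = det2 x (sm c x + sm d y)"
  using assms(2) by auto
 hence "a * det2 x y = c * det2 x y" "b * det2 x y = d * det2 x y"
  by (simp_all only: det2_simps(1,2,5,6) det2_simps(7) mult_zero_right add_0_left add_0_right)
 thus "a = c" "b = d" using assms(1) by auto
qed

lemma loc_inverse_pair:
 assumes "x : loc n 0 z" "y : loc n 0 z" "x * y = 1"
 shows "x : ulc n 0 z"
proof -
 obtain g h d e where x: "x = Fract g h" "hpol n d g" "hpol n e h" "int d - int e = 0" "nz h z" using assms(1) by (rule locE)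
 obtain g' h' where y: "y = Fract g' h'" "nz h' z" using assms(2) by (rule locE)
 have "g * g' = h * h'" using assms(3) x y nz_nonzero[OF x(5)] nz_nonzero[OF y(2)] by (simp add: One_fract_def eq_fract)
 hence "nz (g * g') z" using x y by simp
 thus ?thesis unfolding x(1) using x by (auto intro: ulcI)
qed

text \<open>The stalk at \<open>z\<close> of \<open>O(s) x + O(t) y\<close>. The two degrees differ
  because adapted frames combine rational sections of different twists.\<close>

definition span2 :: "nat => rat2 => int => rat2 => int => point => rat2 set" where
 "span2 n x s y t z = {sm a x + sm b y | a b. a : loc n s z & b : loc n t z}"

lemma span2I: "a : loc n s z ==> b : loc n t z ==> sm a x + sm b y : span2 n x s y t z"
 unfolding span2_def by blast

lemma span2_diff: "v : span2 n x s y t z ==> w : span2 n x s y t z ==> v - w : span2 n x s y t z"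
proof -
 assume "v : span2 n x s y t z" "w : span2 n x s y t z"
 then obtain a b c d where *: "v = sm a x + sm b y" "w = sm c x + sm d y"
  "a : loc n s z" "b : loc n t z" "c : loc n s z" "d : loc n t z" unfolding span2_def by blast
 have "v - w = sm (a - c) x + sm (b - d) y" using * by (simp add: K2.scale_left_diff_distrib)
 thus ?thesis using * by (auto intro: span2I loc_diff)
qed

lemma span2_0: "z : proj_space n ==> 0 : span2 n x s y t z" using span2I[of 0 n s z 0 t x y] by simp

lemma span2_add:
 assumes "z : proj_space n" "v : span2 n x s y t z" "w : span2 n x s y t z"
 shows "v + w : span2 n x s y t z" using span2_diff[OF assms(2) span2_diff[OF span2_0[OF assms(1)] assms(3)]] by simp

lemma span2_scale:
 assumes "c : loc n u z" "v : span2 n x s y t z"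
 shows "sm c v : span2 n x (u + s) y (u + t) z"
proof -
 obtain a b where *: "v = sm a x + sm b y" "a : loc n s z" "b : loc n t z" using assms(2) unfolding span2_def by blast
 have "sm c v = sm (c * a) x + sm (c * b) y" using * by (simp add: K2.scale_right_distrib)
 thus ?thesis using * assms(1) by (auto intro: span2I loc_mult)
qed

lemma span2_subset:
 assumes z: "z : proj_space n" and x: "x : span2 n x' s' y' t' z" and y: "y : span2 n x' s'' y' t'' z"
  and deg: "s + s' = S" "s + t' = T" "t + s'' = S" "t + t'' = T"
 shows "span2 n x s y t z <= span2 n x' S y' T z"
proof
 fix v assume "v : span2 n x s y t z"
 then obtain a b where v: "v = sm a x + sm b y" "a : loc n s z" "b : loc n t z" unfolding span2_def by blast
 show "v : span2 n x' S y' T z"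
  unfolding v(1) using span2_scale[OF v(2) x] span2_scale[OF v(3) y] span2_add[OF z] deg by metis
qed

text \<open>A rank two bundle inside the constant sheaf \<open>K\<^sup>2\<close>, given by frames
  over a cover indexed by points. The frame of \<open>q\<close> is compared with that of
  \<open>z \<in> U q\<close> in the stalk at \<open>z\<close> only; this determines all stalks, and
  \<open>lat t z\<close> is the one of the twist by \<open>t\<close>.\<close>

locale lattice =
 fixes n :: nat and U :: "point => point set" and e1 e2 :: "point => rat2"
 assumes U: "!!q. q : proj_space n ==> zariski_open n (U q) & q : U q"
  and krat: "!!q. q : proj_space n ==> fst (e1 q) : krat n 0 & snd (e1 q) : krat n 0 &
   fst (e2 q) : krat n 0 & snd (e2 q) : krat n 0"
  and det: "!!q. q : proj_space n ==> det2 (e1 q) (e2 q) ~= 0"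
  and change: "!!q z. q : proj_space n ==> z : U q ==>
   e1 z : span2 n (e1 q) 0 (e2 q) 0 z & e2 z : span2 n (e1 q) 0 (e2 q) 0 z &
   e1 q : span2 n (e1 z) 0 (e2 z) 0 z & e2 q : span2 n (e1 z) 0 (e2 z) 0 z"
begin

definition lat :: "int => point => rat2 set" where
 "lat t z = span2 n (e1 z) t (e2 z) t z"

lemma U_proj: "q : proj_space n ==> z : U q ==> z : proj_space n"
 using U zariski_open_subset by blast

lemma lat_eq:
 assumes "q : proj_space n" "z : U q"
 shows "lat t z = span2 n (e1 q) t (e2 q) t z"
proof -
 note c = change[OF assms]
 show ?thesis unfolding lat_def
 proof
  show "span2 n (e1 z) t (e2 z) t z <= span2 n (e1 q) t (e2 q) t z"
   by (rule span2_subset[OF U_proj[OF assms], where s' = 0 and s'' = 0 and t' = 0 and t'' = 0]) (use c in auto)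
  show "span2 n (e1 q) t (e2 q) t z <= span2 n (e1 z) t (e2 z) t z"
   by (rule span2_subset[OF U_proj[OF assms], where s' = 0 and s'' = 0 and t' = 0 and t'' = 0]) (use c in auto)
 qed
qed

lemma lat_0: "z : proj_space n ==> 0 : lat t z" unfolding lat_def by (rule span2_0)

lemma lat_diff: "x : lat t z ==> y : lat t z ==> x - y : lat t z"
 unfolding lat_def by (rule span2_diff)

lemma lat_add: "z : proj_space n ==> x : lat t z ==> y : lat t z ==> x + y : lat t z"
 unfolding lat_def by (rule span2_add)

lemma lat_scale: "c : loc n u z ==> x : lat t z ==> u + t = v ==> sm c x : lat v z"
 unfolding lat_def using span2_scale by blast

lemma lat_open:
 assumes "x : lat t q" "q : proj_space n"
 shows "EX V. zariski_open n V & q : V & V <= U q & (ALL z:V. x : lat t z)"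
proof -
 obtain a b where x: "x = sm a (e1 q) + sm b (e2 q)" "a : loc n t q" "b : loc n t q"
  using assms(1) unfolding lat_def span2_def by blast
 obtain A where A: "zariski_open n A" "q : A" "!!z. z : A ==> a : loc n t z" by (rule loc_open[OF x(2) assms(2)]) (rule that, auto)
 obtain B where B: "zariski_open n B" "q : B" "!!z. z : B ==> b : loc n t z" by (rule loc_open[OF x(3) assms(2)]) (rule that, auto)
 have "x : lat t z" if "z : A \<inter> B \<inter> U q" for z
  unfolding x(1) using lat_eq[OF assms(2), of z t] that A B by (auto intro: span2I)
 thus ?thesis using U[OF assms(2)] A B by (intro exI[of _ "A \<inter> B \<inter> U q"]) (auto intro: zariski_open_Int)
qed

text \<open>The Koszul complex on linear forms \<open>ls\<close> that cut out the point \<open>p\<close>, against the Cech complex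
 of a cover whose members other than the one at \<open>p\<close> lie in the complements of the zero sets of the
 forms; there the Koszul complex is contracted by \<open>Z\<close>.\<close>

context
 fixes p :: point and ls :: "mpol list"
 assumes p: "p : proj_space n" and ls: "length ls = n"
  and lin: "!!i. i < n ==> hpol n 1 (ls ! i)"
  and cut: "!!q. q : proj_space n ==> q ~= p ==> EX i<n. nz (ls ! i) q"
begin

definition LS :: "rat list" where "LS = map to_fract ls"

definition jx :: "point => nat" where
 "jx q = (SOME i. i < n & nz (ls ! i) q)"

lemma jx: "q : proj_space n ==> q ~= p ==> jx q < n & nz (ls ! jx q) q"
 unfolding jx_def using someI_ex[OF cut] by blast

text \<open>The first vertex other than \<open>p\<close> has a linear form without zeros on its
  member of the cover. The inverse of this form is the only non-zero entry, so the scalar product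
  with the forms is 1 and contraction is possible.\<close>

definition Z :: "point list => rat list" where
 "Z l = map (%i. if i = jx (hd (filter (%q. q ~= p) l)) then inverse (LS ! i) else 0) [0..<n]"

text \<open>Successive lifts of \<open>s\<close> through the Koszul complex: the coboundary of one
  lift is lifted again by the contraction. On simplices with \<open>p\<close> as their only vertex
  there is no contraction; there the given preimage \<open>x0\<close> starts and zero
  continues.\<close>

fun ee :: "rat2 => (bool list => rat2) => nat => bool list => point list => rat2" where
 "ee s x0 0 J l = s"
| "ee s x0 (Suc k) J l = (if EX q:set l. q ~= p then K2.kd (Z l) (%J. dl (ee s x0 k J) l) J
   else if k = 0 then x0 J else 0)"

lemma ki_cong:
 assumes "!!J'. length J' = length J ==> tc J' = Suc (tc J) ==> c J' = c' J'"
 shows "K2.ki zs c J = K2.ki zs c' J"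
proof -
 have "K2.ki zs (%J. c J - c' J) J : {0}" by (rule K2.ki_mem[where A = "{0}"]) (use assms in auto)
 thus ?thesis by (simp add: K2.ki_diff)
qed

lemma first_other:
 assumes "EX q:set l. q ~= p" "set l <= proj_space n"
 shows "EX q. q = hd (filter (%q. q ~= p) l) & q : set l & q ~= p & q : proj_space n"
proof -
 have "filter (%q. q ~= p) l ~= []" using assms(1) by (auto simp: filter_empty_conv)
 hence "hd (filter (%q. q ~= p) l) : set (filter (%q. q ~= p) l)" by (rule hd_in_set)
 thus ?thesis using assms(2) by auto
qed

lemma Z_sum:
 assumes "EX q:set l. q ~= p" "set l <= proj_space n"
 shows "(\<Sum>i<length (Z l). LS ! i * Z l ! i) = 1"
proof -
 obtain q where q: "q = hd (filter (%q. q ~= p) l)" "q : set l" "q ~= p" "q : proj_space n"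
  using first_other[OF assms] by blast
 have j: "jx q < n" "nz (ls ! jx q) q" using jx q by auto
 hence nzL: "LS ! jx q ~= 0" using nz_nonzero[OF j(2)] ls by (simp add: LS_def)
 have "(\<Sum>i<length (Z l). LS ! i * Z l ! i) = (\<Sum>i<n. if i = jx q then LS ! i * inverse (LS ! i) else 0)"
  unfolding Z_def q(1)[symmetric] by (intro sum.cong) auto
 thus ?thesis using j(1) nzL by simp
qed

text \<open>By the homotopy formula the contraction lifts whatever \<open>ki\<close> annihilates,
  and \<open>ki\<close> annihilates \<open>dl (ee s x0 k)\<close> by the previous lift and
  \<open>dl_dl\<close>.\<close>

lemma ee_koszul:
 assumes x0: "s = K2.ki LS x0 (replicate n False)"
  and "length J = n" "tc J = k" "length l = Suc k" "set l <= proj_space n"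
 shows "K2.ki LS (%J. ee s x0 (Suc k) J l) J = dl (ee s x0 k J) l" using assms(2-5)
proof (induction k arbitrary: J l rule: less_induct)
 case (less k)
 note J = less.prems(1,2) and l = less.prems(3,4)
 have IH: "K2.ki LS (%J. ee s x0 (Suc k') J l) J = dl (ee s x0 k' J) l"
  if "k = Suc k'" "length J = n" "tc J = k'" "length l = Suc k'" "set l <= proj_space n" for k' J l
  by (rule less.IH) (use that in auto)
 show ?case
 proof (cases "EX q:set l. q ~= p")
  case True
  define X where "X = (%J. dl (ee s x0 k J) l)"
  have "K2.kd (Z l) (K2.ki LS X) J = K2.kd (Z l) (%_. 0) J"
  proof (rule K2.kd_cong)
   fix J' assume J': "length J' = length J" "Suc (tc J') = tc J"
   then obtain k' where k': "k = Suc k'" "tc J' = k'" using J by (cases k) auto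
   have "K2.ki LS X J' = dl (%l. K2.ki LS (%J. ee s x0 k J l) J') l" unfolding X_def by (rule K2.ki_dl)
   also have "\<dots> = dl (dl (ee s x0 k' J')) l"
   proof (rule dl_cong)
    fix l' assume l': "Suc (length l') = length l" "set l' <= set l"
    have "K2.ki LS (%J. ee s x0 (Suc k') J l') J' = dl (ee s x0 k' J') l'"
     by (rule IH[OF k'(1)]) (use k' J J' l l' in auto)
    thus "K2.ki LS (%J. ee s x0 k J l') J' = dl (ee s x0 k' J') l'" by (simp only: k'(1))
   qed
   finally show "K2.ki LS X J' = 0" by (simp add: dl_dl)
  qed
  moreover have "K2.kd (Z l) (K2.ki LS X) J + K2.ki LS (K2.kd (Z l) X) J = sm 1 (X J)"
   using K2.kd_ki_homotopy[of LS "Z l" J X] Z_sum[OF True l(2)] J ls by (simp add: LS_def Z_def)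
  ultimately show ?thesis using True by (simp add: X_def)
 next
  case False
  hence lp: "l = replicate (Suc k) p" using l(1) by (metis replicate_length_same)
  have J0: "J = replicate n False" if "k = 0" using J that by (induction J arbitrary: n) (auto split: if_splits)
  show ?thesis
  proof (cases k)
   case 0
   thus ?thesis using False lp x0 J0 by simp
  next
   case (Suc k')
   \<comment> \<open>On a constant simplex the alternating sum vanishes: for \<open>k = 1\<close>
     two equal values \<open>x0 J\<close> cancel, later all values are zero.\<close>
   have "dl (ee s x0 k J) (replicate (Suc k) p) = 0"
   proof (cases k')
    case 0
    thus ?thesis using Suc by simp
   next
    case (Suc k'')
    have "dl (ee s x0 k J) (replicate (Suc k) p) = dl (%_. 0) (replicate (Suc k) p)"
     by (rule dl_cong) (use \<open>k = Suc k'\<close> Suc in auto)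
    thus ?thesis by simp
   qed
   thus ?thesis using False lp Suc by simp
  qed
 qed
qed

text \<open>Each contraction divides by a linear form that has no zeros on the open set, which
  lowers the twist by one.\<close>

lemma ee_lat:
 assumes W: "point_cover n W" "!!q. q : proj_space n ==> q ~= p ==> W q <= ptD n (ls ! jx q)"
  and s: "!!z. z : proj_space n ==> s : lat m z"
  and x0: "!!z J. z : W p ==> x0 J : lat (m - 1) z"
  and "length J = n" "tc J = Suc k" "l : simplices n k" "z : inters W l"
 shows "ee s x0 (Suc k) J l : lat (m - 1 - int k) z" using assms(5-8)
proof (induction k arbitrary: J l rule: less_induct)
 case (less k)
 note J = less.prems(1,2) and l = less.prems(3,4)
 have IH: "ee s x0 (Suc k') J l : lat (m - 1 - int k') z"
  if "k = Suc k'" "length J = n" "tc J = Suc k'" "l : simplices n k'" "z : inters W l" for k' J l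
  by (rule less.IH) (use that in auto)
 have zP: "z : proj_space n" by (rule inters_nonempty_subset[OF W(1) l])
 have lP: "length l = Suc k" "set l <= proj_space n" using l(1) by (auto simp: simplices_def)
 show ?case
 proof (cases "EX q:set l. q ~= p")
  case True
  obtain q where q: "q = hd (filter (%q. q ~= p) l)" "q : set l" "q ~= p" "q : proj_space n"
   using first_other[OF True lP(2)] by blast
  have j: "jx q < n" using jx q by auto
  have "z : W q" using l(2) q(2) by (simp add: inters_def)
  hence nzz: "nz (ls ! jx q) z" using W(2)[OF q(4,3)] by (auto simp: ptD_def)
  have "to_fract (ls ! jx q) : ulc n 1 z" unfolding to_fract_def by (rule ulcI[OF lin[OF j], of 0]) (use nzz in auto)
  hence inv: "inverse (LS ! jx q) : loc n (- 1) z" using ulc_loc[OF ulc_inverse] j ls by (simp add: LS_def)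
  have "K2.kd (Z l) (%J. dl (ee s x0 k J) l) J : lat (m - 1 - int k) z"
  proof (rule K2.kd_mem[where A = "lat (m - int k) z"])
   fix J' assume J': "length J' = length J" "Suc (tc J') = tc J"
   show "dl (ee s x0 k J') l : lat (m - int k) z"
   proof (cases k)
    case 0
    then obtain x where "l = [x]" using lP(1) by (auto simp: length_Suc_conv)
    thus ?thesis using 0 s[OF zP] by simp
   next
    case (Suc k')
    show ?thesis
    proof (rule dl_mem)
     fix l' assume l': "Suc (length l') = length l" "set l' <= set l"
     have "ee s x0 (Suc k') J' l' : lat (m - 1 - int k') z"
     proof (rule IH[OF Suc])
      show "l' : simplices n k'" using l' lP Suc by (auto simp: simplices_def)
      show "z : inters W l'" using l(2) l'(2) by (auto simp: inters_def)
     qed (use J J' Suc in auto)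
     thus "ee s x0 k J' l' : lat (m - int k) z" using Suc by (simp add: algebra_simps)
    qed (use lat_0[OF zP] lat_diff in auto)
   qed
  next
   fix y a assume y: "y : set (Z l)" and a: "a : lat (m - int k) z"
   have "y = 0 | y = inverse (LS ! jx q)" using y unfolding Z_def q(1)[symmetric] by auto
   hence "y : loc n (- 1) z" using inv loc_0[OF zP] by auto
   thus "sm y a : lat (m - 1 - int k) z" using a by (rule lat_scale) simp
  qed (use lat_0[OF zP] lat_diff in auto)
  thus ?thesis using True by simp
 next
  case False
  hence "hd l = p" "hd l : set l" using lP(1) by (cases l; simp)+
  hence "z : W p" using l(2) by (auto simp: inters_def)
  thus ?thesis using False x0 lat_0[OF zP] by (cases k) auto
 qed
qed

text \<open>The lifts lead up to Koszul degree \<open>n\<close>, above which there is nothing. On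
  the way back, the corrected lift in Cech degree \<open>k + 1\<close> is a cocycle of twist
  \<open>m - 1 - (k + 1)\<close>, hence a coboundary, and this corrects the lift in degree
  \<open>k\<close>. At the end the first lift is itself a contraction, so \<open>s\<close> is a
  contraction of a contraction.\<close>

lemma vanishing_at_point_imp_zero:
 assumes n: "n >= 1"
  and van: "!!i. i < n ==> stalk_vanishing n (lat (m - 1 - int i)) i"
  and s: "!!z. z : proj_space n ==> s : lat m z"
  and x0: "s = K2.ki LS x0 (replicate n False)" "!!J. x0 J : lat (m - 1) p"
  and fin: "finite (range x0)"
 shows "s = 0"
proof -
 \<comment> \<open>\<open>x0\<close> has finitely many values, so one neighbourhood of
   \<open>p\<close> serves them all; it becomes the member of the cover at \<open>p\<close>.\<close>
 have "EX V. zariski_open n V & p : V & (ALL x:X. ALL z:V. x : lat (m - 1) z)" if "finite X" "X <= range x0" for X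
  using that
 proof (induction X rule: finite_induct)
  case empty
  show ?case using zariski_open_proj p by auto
 next
  case (insert x X)
  then obtain V where V: "zariski_open n V" "p : V" "ALL x:X. ALL z:V. x : lat (m - 1) z" by auto
  have "x : lat (m - 1) p" using insert.prems x0(2) by auto
  then obtain V' where "zariski_open n V'" "p : V'" "ALL z:V'. x : lat (m - 1) z"
   using lat_open[OF _ p] by blast
  thus ?case using V by (intro exI[of _ "V \<inter> V'"]) (auto intro: zariski_open_Int)
 qed
 from this[OF fin subset_refl] obtain V where
  V': "zariski_open n V" "p : V" "ALL x:range x0. ALL z:V. x : lat (m - 1) z" by blast
 hence V: "zariski_open n V" "p : V" "!!J z. z : V ==> x0 J : lat (m - 1) z" by auto
 define W where "W q = (if q = p then V else ptD n (ls ! jx q))" for q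
 have W: "point_cover n W" unfolding point_cover_def openin_zariski
 proof
  fix q assume q: "q : proj_space n"
  show "zariski_open n (W q) & q : W q"
   using V(1,2) jx[OF q] open_ptD[OF lin[of "jx q"]] q by (auto simp: W_def ptD_def)
 qed
 have Wq: "W q <= ptD n (ls ! jx q)" if "q ~= p" for q using that by (simp add: W_def)
 have eelat: "ee s x0 (Suc k) J l : lat (m - 1 - int k) z"
  if "length J = n" "tc J = Suc k" "l : simplices n k" "z : inters W l" for k J l z
  by (rule ee_lat[OF W Wq s _ that]) (use V(3) in \<open>auto simp: W_def\<close>)
 have eek: "K2.ki LS (%J. ee s x0 (Suc k) J l) J = dl (ee s x0 k J) l"
  if "length J = n" "tc J = k" "l : simplices n k" for k J l
  by (rule ee_koszul[OF x0(1)]) (use that in \<open>auto simp: simplices_def\<close>)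
 \<comment> \<open>\<open>Q k\<close>: on some refinement, subtracting the contraction of
   \<open>f\<close> turns the lift in Cech degree \<open>k\<close> into a cocycle.\<close>
 define Q where "Q k \<longleftrightarrow> (EX W' f. point_cover n W' & (ALL q:proj_space n. W' q <= W q) &
   (ALL J l z. length J = n --> tc J = Suc (Suc k) --> l : simplices n k --> z : inters W' l -->
     f J l : lat (m - 2 - int k) z) &
   (ALL J l. length J = n --> tc J = Suc k --> l : simplices n (Suc k) -->
     dl (%l. ee s x0 (Suc k) J l - K2.ki LS (%J. f J l) J) l = 0))" for k
 have tc_le: "tc J <= n" if "length J = n" for J using that count_le_length[of J True] by simp
 have "Q (n - 1)" unfolding Q_def
 proof (intro exI[of _ W] exI[of _ "%_ _. 0"] conjI allI impI)
  fix J l assume J: "length J = n" "tc J = Suc (n - 1)" and l: "l : simplices n (Suc (n - 1))"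
  have "K2.ki LS (%J. ee s x0 (Suc (Suc (n - 1))) J l) J = K2.ki LS (%_. 0) J"
  proof (rule ki_cong)
   fix J' assume "length J' = length J" "tc J' = Suc (tc J)"
   hence False using tc_le[of J'] J n by simp
   thus "ee s x0 (Suc (Suc (n - 1))) J' l = 0" ..
  qed
  thus "dl (%l. ee s x0 (Suc (n - 1)) J l - K2.ki LS (%J. 0) J) l = 0"
   using eek[OF J l] by (simp del: ee.simps)
 qed (use W tc_le in force)+
 moreover have "Q k" if Q: "Q (Suc k)" and k: "Suc k < n" for k
 proof -
  obtain W' f where W'0: "point_cover n W'" "ALL q:proj_space n. W' q <= W q"
  and f0: "ALL J l z. length J = n --> tc J = Suc (Suc (Suc k)) --> l : simplices n (Suc k) --> z : inters W' l -->
     f J l : lat (m - 2 - int (Suc k)) z"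
  and cl0: "ALL J l. length J = n --> tc J = Suc (Suc k) --> l : simplices n (Suc (Suc k)) -->
     dl (%l. ee s x0 (Suc (Suc k)) J l - K2.ki LS (%J. f J l) J) l = 0"
  using Q unfolding Q_def by (elim exE conjE) (rule that)
 note W' = W'0[rule_format] and f = f0[rule_format] and cl = cl0[rule_format]
  define g where "g J l = ee s x0 (Suc (Suc k)) J l - K2.ki LS (%J. f J l) J" for J l
  have gl: "g J l : lat (m - 1 - int (Suc k)) z"
   if J: "length J = n" "tc J = Suc (Suc k)" and l: "l : simplices n (Suc k)" "z : inters W' l" for J l z
  proof -
   have zP: "z : proj_space n" by (rule inters_nonempty_subset[OF W'(1) l])
   have "set l <= proj_space n" using l(1) by (simp add: simplices_def)
   hence zW: "z : inters W l" using l(2) W'(2) by (auto simp: inters_def)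
   have "K2.ki LS (%J. f J l) J : lat (m - 1 - int (Suc k)) z"
   proof (rule K2.ki_mem[where A = "lat (m - 2 - int (Suc k)) z"])
    fix J' assume "length J' = length J" "tc J' = Suc (tc J)"
    thus "f J' l : lat (m - 2 - int (Suc k)) z" using f[of J' l z] J l by simp
   next
    fix y a assume "y : set LS" and a: "a : lat (m - 2 - int (Suc k)) z"
    then obtain i where i: "i < n" "y = to_fract (ls ! i)" unfolding LS_def using ls by (auto simp: in_set_conv_nth)
    have "y : loc n 1 z" unfolding i(2) to_fract_def by (rule locI[OF lin[OF i(1)], of 0]) auto
    thus "sm y a : lat (m - 1 - int (Suc k)) z" using a by (rule lat_scale) simp
   qed (use lat_0[OF zP] lat_diff in auto)
   thus ?thesis unfolding g_def by (rule lat_diff[OF eelat[OF J l(1) zW]])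
  qed
  have "EX V b. point_cover n V & (ALL q:proj_space n. V q <= W' q) &
    (ALL l:simplices n k. ALL z:inters V l. b l : lat (m - 1 - int (Suc k)) z) &
    (ALL l:simplices n (Suc k). g J l = dl b l)" if J: "length J = n" "tc J = Suc (Suc k)" for J
  proof -
   have "ALL l:simplices n (Suc k). ALL z:inters W' l. g J l : lat (m - 1 - int (Suc k)) z"
    using gl[OF J] by blast
   moreover have "ALL l:simplices n (Suc (Suc k)). dl (g J) l = 0" using cl[OF J] unfolding g_def by blast
   ultimately show ?thesis using van[OF k, unfolded stalk_vanishing_def, rule_format, of W' "g J"] W'(1) by auto
  qed
  hence "ALL J. EX V b. length J = n --> tc J = Suc (Suc k) --> point_cover n V & (ALL q:proj_space n. V q <= W' q) &
    (ALL l:simplices n k. ALL z:inters V l. b l : lat (m - 1 - int (Suc k)) z) &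
    (ALL l:simplices n (Suc k). g J l = dl b l)" by blast
  then obtain V b where Vb: "!!J. length J = n ==> tc J = Suc (Suc k) ==> point_cover n (V J) &
    (ALL q:proj_space n. V J q <= W' q) &
    (ALL l:simplices n k. ALL z:inters (V J) l. b J l : lat (m - 1 - int (Suc k)) z) &
    (ALL l:simplices n (Suc k). g J l = dl (b J) l)" by metis
  define JJ where "JJ = {J :: bool list. length J = n & tc J = Suc (Suc k)}"
  have JJ: "finite JJ"
  proof -
   have "JJ <= {J. set J <= UNIV & length J = n}" by (auto simp: JJ_def)
   thus ?thesis using finite_lists_length_eq[of "UNIV :: bool set" n] finite_subset by auto
  qed
  \<comment> \<open>A common refinement for the finitely many subsets \<open>J\<close>.\<close>
  define W'' where "W'' q = W' q \<inter> (\<Inter>J\<in>JJ. V J q)" for q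
  have W'': "point_cover n W''" unfolding point_cover_def
  proof
   fix q assume q: "q : proj_space n"
   have "openin (zariski n) (W' q \<inter> (\<Inter>J\<in>K. V J q))" if "finite K" "K <= JJ" for K using that
   proof (induction K rule: finite_induct)
    case empty
    show ?case using W'(1) q by (simp add: point_cover_def)
   next
    case (insert J K)
    have "openin (zariski n) (V J q)" using Vb[of J] insert.prems q by (auto simp: JJ_def point_cover_def)
    moreover have "openin (zariski n) (W' q \<inter> (\<Inter>J\<in>K. V J q))" using insert.IH insert.prems by blast
    ultimately have "openin (zariski n) (V J q \<inter> (W' q \<inter> (\<Inter>J\<in>K. V J q)))" by (rule openin_Int)
    thus ?case by (simp add: Int_ac)
   qed
   moreover have "q : V J q" if "J : JJ" for J using Vb[of J] that q by (auto simp: JJ_def point_cover_def)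
   moreover have "q : W' q" using W'(1) q by (auto simp: point_cover_def)
   ultimately show "openin (zariski n) (W'' q) & q : W'' q" unfolding W''_def using JJ by auto
  qed
  show "Q k" unfolding Q_def
  proof (intro exI[of _ W''] exI[of _ b] conjI allI impI ballI)
   show "point_cover n W''" by (rule W'')
   show "W'' q <= W q" if "q : proj_space n" for q using W'(2)[OF that] by (auto simp: W''_def)
   fix J l
   { fix z assume J: "length J = n" "tc J = Suc (Suc k)" and l: "l : simplices n k" "z : inters W'' l"
    have "z : inters (V J) l" using l(2) J by (auto simp: inters_def W''_def JJ_def)
    hence "b J l : lat (m - 1 - int (Suc k)) z" using Vb[OF J] l(1) by blast
    thus "b J l : lat (m - 2 - int k) z" by (simp add: algebra_simps) }
   assume J: "length J = n" "tc J = Suc k" and l: "l : simplices n (Suc k)"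
   have "K2.ki LS (%J. dl (b J) l) J = K2.ki LS (%J. g J l) J" by (rule ki_cong) (use Vb J l in auto)
   also have "\<dots> = K2.ki LS (%J. ee s x0 (Suc (Suc k)) J l) J - K2.ki LS (K2.ki LS (%J. f J l)) J"
    unfolding g_def by (rule K2.ki_diff)
   also have "\<dots> = dl (ee s x0 (Suc k) J) l" using eek[OF J l] by (simp add: K2.ki_ki)
   finally show "dl (%l. ee s x0 (Suc k) J l - K2.ki LS (%J. b J l) J) l = 0"
    unfolding dl_diff K2.ki_dl by (simp del: ee.simps)
  qed
 qed
 ultimately have "Q (n - 1 - j)" for j
 proof (induction j)
  case (Suc j)
  show ?case
  proof (cases "Suc j <= n - 1")
   case True
   hence "n - 1 - j = Suc (n - 1 - Suc j)" by simp
   thus ?thesis using Suc.IH[OF Suc.prems(1,2)] Suc.prems(2)[of "n - 1 - Suc j"] True by simp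
  next
   case False
   hence "n - 1 - Suc j = n - 1 - j" by simp
   thus ?thesis using Suc.IH[OF Suc.prems(1,2)] by (simp only:)
  qed
 qed simp
 from this[of "n - 1"] have "Q 0" by simp
 then obtain W' f where W'0: "point_cover n W'" "ALL q:proj_space n. W' q <= W q"
  and f0: "ALL J l z. length J = n --> tc J = Suc (Suc 0) --> l : simplices n 0 --> z : inters W' l -->
     f J l : lat (m - 2 - int 0) z"
  and cl0: "ALL J l. length J = n --> tc J = Suc 0 --> l : simplices n (Suc 0) -->
     dl (%l. ee s x0 (Suc 0) J l - K2.ki LS (%J. f J l) J) l = 0"
  unfolding Q_def by (elim exE conjE) (rule that)
 note W' = W'0[rule_format] and f = f0[rule_format] and cl = cl0[rule_format]
 \<comment> \<open>The difference is a cocycle in Cech degree zero, thus a global section of twist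
   \<open>m - 1\<close>, and vanishes by the hypothesis for \<open>i = 0\<close>.\<close>
 have g0: "ee s x0 (Suc 0) J l = K2.ki LS (%J. f J l) J"
  if J: "length J = n" "tc J = Suc 0" and l: "l : simplices n 0" for J l
 proof -
  have mem: "ee s x0 (Suc 0) J l - K2.ki LS (%J. f J l) J : lat (m - 1 - int 0) z"
   if l: "l : simplices n 0" "z : inters W' l" for l z
  proof -
   have zP: "z : proj_space n" by (rule inters_nonempty_subset[OF W'(1) l])
   have "set l <= proj_space n" using l(1) by (simp add: simplices_def)
   hence zW: "z : inters W l" using l(2) W'(2) by (auto simp: inters_def)
   have "K2.ki LS (%J. f J l) J : lat (m - 1 - int 0) z"
   proof (rule K2.ki_mem[where A = "lat (m - 2 - int 0) z"])
    fix J' assume "length J' = length J" "tc J' = Suc (tc J)"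
    thus "f J' l : lat (m - 2 - int 0) z" using f[of J' l z] J l by simp
   next
    fix y a assume "y : set LS" and a: "a : lat (m - 2 - int 0) z"
    then obtain i where i: "i < n" "y = to_fract (ls ! i)" unfolding LS_def using ls by (auto simp: in_set_conv_nth)
    have "y : loc n 1 z" unfolding i(2) to_fract_def by (rule locI[OF lin[OF i(1)], of 0]) auto
    thus "sm y a : lat (m - 1 - int 0) z" using a by (rule lat_scale) simp
   qed (use lat_0[OF zP] lat_diff in auto)
   thus ?thesis by (rule lat_diff[OF eelat[OF J l(1) zW]])
  qed
  define h where "h = (%l. ee s x0 (Suc 0) J l - K2.ki LS (%J. f J l) J)"
  have "stalk_vanishing n (lat (m - 1 - int 0)) 0" using van[of 0] n by simp
  moreover have "ALL l:simplices n 0. ALL z:inters W' l. h l : lat (m - 1 - int 0) z"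
   unfolding h_def using mem by blast
  moreover have "ALL l:simplices n (Suc 0). dl h l = 0" unfolding h_def using cl[OF J] by blast
  ultimately have "ALL l:simplices n 0. h l = 0" using W'(1) unfolding stalk_vanishing_def by fastforce
  hence "h l = 0" using l by blast
  thus ?thesis unfolding h_def by (simp del: ee.simps)
 qed
 have l: "[p] : simplices n 0" using p by (simp add: simplices_def)
 have tc0: "tc (replicate k False) = 0" for k by (induction k) auto
 have "s = dl (ee s x0 0 (replicate n False)) [p]" by simp
 also have "\<dots> = K2.ki LS (%J. ee s x0 (Suc 0) J [p]) (replicate n False)"
  using eek[of "replicate n False" 0 "[p]"] l tc0 by simp
 also have "\<dots> = K2.ki LS (K2.ki LS (%J. f J [p])) (replicate n False)"
  by (rule ki_cong) (use g0 l tc0 in \<open>auto simp del: ee.simps\<close>)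
 finally show ?thesis by (simp add: K2.ki_ki)
qed

end

end

section \<open>The splitting criterion for lattices\<close>

text \<open>With \<open>rp p a ~= 0\<close> and \<open>c j\<close> the affine coordinates of
  \<open>p\<close>, the forms \<open>v j - c j * v a\<close> for \<open>j ~= a\<close> cut out
  \<open>p\<close>. Modulo them a form of degree \<open>d\<close> is its value at the vector
  \<open>c\<close> times \<open>v a ^ d\<close>, so one that vanishes at \<open>p\<close> is a
  combination of them.\<close>

lemma linear_forms_at_point:
 assumes p: "p : proj_space n"
 shows "EX ls. length ls = n & (ALL i<n. hpol n 1 (ls ! i)) &
  (ALL q:proj_space n. q ~= p --> (EX i<n. nz (ls ! i) q)) &
  (ALL d g. hpol n d g --> ~ nz g p -->
   (EX G. g = (\<Sum>i<n. G i * ls ! i) & (ALL i<n. G i = 0 | 1 <= d & hpol n (d - 1) (G i))))"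
proof -
 obtain a where a: "a <= n" "rp p a ~= 0" using rp_nonzero[OF p] by blast
 define c where "c j = rp p j / rp p a" for j
 define js where "js = filter (%j. j ~= a) [0..<Suc n]"
 define L where "L j = mX j - mC (c j) * mX a" for j
 define ls where "ls = map L js"
 have js: "set js = {..n} - {a}" unfolding js_def by auto
 have "length js = card ({..n} - {a})" using distinct_card[of js] js by (simp add: js_def)
 hence len: "length ls = n" using a by (simp add: ls_def)
 have jsi: "js ! i <= n & js ! i ~= a" if "i < n" for i using nth_mem[of i js] js that len by (auto simp: ls_def)
 have lsi: "ls ! i = L (js ! i)" if "i < n" for i using that len by (simp add: ls_def)
 have homL: "hpol n 1 (L j)" if "j <= n" for j unfolding L_def using hom_mult[of n 0 "mC (c j)" 1 "mX a"] that a by auto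
 have L0: "L j ~= 0" if "j ~= a" for j
 proof
  assume "L j = 0"
  hence "ev (L j) (%i. if i = j then 1 else 0) = ev 0 (%i. if i = j then 1 else 0)" by (rule arg_cong)
  thus False using that by (simp add: L_def)
 qed
 have cut: "EX i<n. nz (ls ! i) q" if q: "q : proj_space n" "q ~= p" for q
 proof (rule ccontr)
  assume no: "~ ?thesis"
  have eq: "rp q j = c j * rp q a" for j
  proof (cases "j <= n & j ~= a")
   case True
   hence "j : set js" using js by auto
   then obtain i where i: "i < length js" "js ! i = j" by (auto simp: in_set_conv_nth)
   hence "i < n" using len by (simp add: ls_def)
   hence "~ nz (L j) q" using no lsi i by auto
   thus ?thesis by (simp add: nz_def L_def)
  next
   case False
   thus ?thesis using rp_zero[OF q(1), of j] rp_zero[OF p, of j] a by (cases "j = a") (auto simp: c_def)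
  qed
  have "rp q a ~= 0" using rp_nonzero[OF q(1)] eq by (metis mult_zero_right)
  moreover define t where "t = rp q a / rp p a"
  have "rp q j = t * rp p j" for j using eq[of j] a(2) by (simp add: c_def t_def)
  hence "rp q = (%j. t * rp p j)" by (rule ext)
  moreover have "t ~= 0" using calculation(1) a(2) by (simp add: t_def)
  ultimately have "rp q : line_through (rp p)" unfolding line_through_def by (intro CollectI exI[of _ t] conjI)
  hence "line_through (rp q) = line_through (rp p)" by (rule line_through_eq)
  thus False using line_through_mem[OF q(1) rp_mem[OF q(1)]] line_through_mem[OF p rp_mem[OF p]] q(2) by simp
 qed
 \<comment> \<open>Substituting \<open>c i * v a\<close> for \<open>v i\<close> does not change a
   polynomial modulo the forms; for a form vanishing at \<open>p\<close> the result is zero.\<close>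
 have subst: "EX g. (ALL v. ev g v = ev f (%i. if i <= n then c i * v a else v i)) & f - g : ideal.span (L ` {..n})" for f
 proof (induction f rule: mpol_induct)
  case (mC x)
  show ?case by (rule exI[of _ "mC x"]) (simp add: ideal.span_zero)
 next
  case (mX i)
  show ?case
  proof (cases "i <= n")
   case True
   have "mX i - mC (c i) * mX a : ideal.span (L ` {..n})" using True by (intro ideal.span_base) (auto simp: L_def)
   thus ?thesis using True by (intro exI[of _ "mC (c i) * mX a"]) simp
  next
   case False
   thus ?thesis by (intro exI[of _ "mX i"]) (simp add: ideal.span_zero)
  qed
 next
  case (add f g)
  then obtain f' g' where *: "ALL v. ev f' v = ev f (%i. if i <= n then c i * v a else v i)" "f - f' : ideal.span (L ` {..n})"
   "ALL v. ev g' v = ev g (%i. if i <= n then c i * v a else v i)" "g - g' : ideal.span (L ` {..n})" by blast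
  have "f + g - (f' + g') = (f - f') + (g - g')" by simp
  hence "f + g - (f' + g') : ideal.span (L ` {..n})" using ideal.span_add[OF *(2,4)] by (simp only:)
  thus ?case using * by (intro exI[of _ "f' + g'"]) simp
 next
  case (mult f g)
  then obtain f' g' where *: "ALL v. ev f' v = ev f (%i. if i <= n then c i * v a else v i)" "f - f' : ideal.span (L ` {..n})"
   "ALL v. ev g' v = ev g (%i. if i <= n then c i * v a else v i)" "g - g' : ideal.span (L ` {..n})" by blast
  have "f * g - f' * g' = g * (f - f') + f' * (g - g')" by (simp add: algebra_simps)
  hence "f * g - f' * g' : ideal.span (L ` {..n})"
   using ideal.span_add[OF ideal.span_scale[OF *(2)] ideal.span_scale[OF *(4)]] by (simp only:)
  thus ?case using * by (intro exI[of _ "f' * g'"]) simp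
 qed
 have rep: "EX G. g = (\<Sum>i<n. G i * ls ! i) & (ALL i<n. G i = 0 | 1 <= d & hpol n (d - 1) (G i))"
  if g: "hpol n d g" "~ nz g p" for d g
 proof -
  obtain g' where g': "ALL v. ev g' v = ev g (%i. if i <= n then c i * v a else v i)" "g - g' : ideal.span (L ` {..n})"
   using subst by blast
  have "ev g' v = 0" for v
  proof -
   have "ev g' v = ev g (vscale (v a / rp p a) (rp p))"
    unfolding g'(1)[rule_format] by (rule depD[OF homD(1)[OF g(1)]]) (auto simp: c_def vscale_def)
   also have "\<dots> = (v a / rp p a) ^ d * ev g (rp p)" using homD(2)[OF g(1)] unfolding hmg_def by blast
   also have "\<dots> = 0" using g(2) by (simp add: nz_def)
   finally show ?thesis .
  qed
  hence "g' = 0" by (intro mpol_eqI) simp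
  hence "g : ideal.span (L ` {..n})" using g'(2) by simp
  moreover have "L ` {..n} <= ideal.span ((!) ls ` {..<n})"
  proof
   fix x assume "x : L ` {..n}"
   then obtain j where j: "j <= n" "x = L j" by blast
   show "x : ideal.span ((!) ls ` {..<n})"
   proof (cases "j = a")
    case True
    hence "x = 0" unfolding j(2) L_def using a(2) by (intro mpol_eqI) (simp add: c_def)
    thus ?thesis by (simp add: ideal.span_zero)
   next
    case False
    hence "j : set js" using js j(1) by auto
    then obtain i where i: "i < length js" "js ! i = j" by (auto simp: in_set_conv_nth)
    hence "i < n" using len by (simp add: ls_def)
    hence "x : (!) ls ` {..<n}" using lsi i j(2) by auto
    thus ?thesis by (rule ideal.span_base)
   qed
  qed
  hence "ideal.span (L ` {..n}) <= ideal.span ((!) ls ` {..<n})"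
   by (rule ideal.span_minimal) (rule ideal.subspace_span)
  ultimately have "g : ideal.span ((!) ls ` {..<n})" by blast
  moreover have "hpol n 1 (ls ! t) & ls ! t ~= 0" if "t < n" for t using jsi[OF that] lsi[OF that] homL L0 by simp
  ultimately obtain u where u: "(\<Sum>t<n. u t) = g" "ALL t:{..<n}. EX G. u t = G * ls ! t & (G = 0 | 1 <= d & hpol n (d - 1) G)"
   using span_image_representation[of "{..<n}" n "%_. 1" "(!) ls" d g] g(1) by auto
  from bchoice[OF u(2)] obtain G where G: "ALL t:{..<n}. u t = G t * ls ! t & (G t = 0 | 1 <= d & hpol n (d - 1) (G t))" ..
  hence "g = (\<Sum>i<n. G i * ls ! i)" using u(1) by auto
  thus ?thesis using G by blast
 qed
 show ?thesis by (intro exI[of _ ls]) (use len cut rep lsi homL jsi in auto)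
qed

section \<open>Change of generators\<close>

lemma span2_commute: "span2 n x s y t z = span2 n y t x s z" unfolding span2_def by (auto simp: add.commute) (metis add.commute)+

lemma krat_uminus: "x : krat n k ==> - x : krat n k" by (elim kratE) (auto intro!: kratI)

lemma span2_left: "z : proj_space n ==> a : loc n s z ==> sm a x : span2 n x s y t z"
 using span2I[of a n s z 0 t x y] by simp

lemma span2_right: "z : proj_space n ==> b : loc n t z ==> sm b y : span2 n x s y t z"
 using span2I[of 0 n s z b t x y] by simp

text \<open>A unit coefficient can be solved for, so \<open>s\<close> replaces \<open>x\<close>. The
  vector \<open>s\<close> has degree \<open>m\<close>, so its coefficients have degree
  \<open>t - m\<close>.\<close>

lemma span2_exchange:
 assumes z: "z : proj_space n" and s: "s = sm a x + sm b y" and a: "a : ulc n m z" and b: "b : loc n m z"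
 shows "span2 n x t y t z = span2 n s (t - m) y t z"
proof
 have a0: "a ~= 0" using ulc_nonzero[OF a] .
 have ia: "inverse a : loc n (- m) z" using ulc_loc[OF ulc_inverse[OF a]] .
 have y: "y : span2 n v k y 0 z" for v k using span2_right[OF z loc_1, of y v k] by simp
 have "x = sm (inverse a) s + sm (- (inverse a * b)) y" using a0 unfolding s by (simp add: K2.scale_right_distrib)
 hence "x : span2 n s (- m) y 0 z" using span2I[OF ia loc_uminus[OF loc_mult[OF ia b]], of s y] by simp
 thus "span2 n x t y t z <= span2 n s (t - m) y t z"
  by (intro span2_subset[OF z, where s' = "- m" and t' = 0 and s'' = "- m" and t'' = 0] y) auto
 have "s : span2 n x m y m z" unfolding s using ulc_loc[OF a] b by (rule span2I)
 thus "span2 n s (t - m) y t z <= span2 n x t y t z"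
  by (intro span2_subset[OF z, where s' = m and t' = m and s'' = 0 and t'' = 0] y) auto
qed

lemma span2_rescale:
 assumes z: "z : proj_space n" and k: "k : ulc n c z"
 shows "span2 n s (t - m) w t z = span2 n s (t - m) (sm k w) (t - c) z"
proof
 have s: "s : span2 n s 0 v i z" for v i using span2_left[OF z loc_1, of s v i] by simp
 have k0: "k ~= 0" using ulc_nonzero[OF k] .
 have "sm (inverse k) (sm k w) : span2 n s (- m) (sm k w) (- c) z" by (rule span2_right[OF z ulc_loc[OF ulc_inverse[OF k]]])
 hence "w : span2 n s (- m) (sm k w) (- c) z" using k0 by simp
 thus "span2 n s (t - m) w t z <= span2 n s (t - m) (sm k w) (t - c) z"
  by (intro span2_subset[OF z, where s' = 0 and t' = "m - c" and s'' = "- m" and t'' = "- c"] s) auto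
 have "sm k w : span2 n s (c - m) w c z" by (rule span2_right[OF z ulc_loc[OF k]])
 thus "span2 n s (t - m) (sm k w) (t - c) z <= span2 n s (t - m) w t z"
  by (intro span2_subset[OF z, where s' = 0 and t' = m and s'' = "c - m" and t'' = c] s) auto
qed

lemma span2_shear:
 assumes z: "z : proj_space n" and b: "b : loc n (c - m) z"
 shows "span2 n s (t - m) w (t - c) z = span2 n s (t - m) (w - sm b s) (t - c) z"
proof
 let ?y = "w - sm b s"
 have s: "s : span2 n s 0 v i z" for v i using span2_left[OF z loc_1, of s v i] by simp
 have "w : span2 n s (c - m) ?y 0 z" using span2I[OF b loc_1, of s ?y] by simp
 thus "span2 n s (t - m) w (t - c) z <= span2 n s (t - m) ?y (t - c) z"
  by (intro span2_subset[OF z, where s' = 0 and t' = "m - c" and s'' = "c - m" and t'' = 0] s) auto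
 have "?y : span2 n s (c - m) w 0 z" using span2I[OF loc_uminus[OF b] loc_1, of s w] by (simp add: algebra_simps)
 thus "span2 n s (t - m) ?y (t - c) z <= span2 n s (t - m) w (t - c) z"
  by (intro span2_subset[OF z, where s' = 0 and t' = "m - c" and s'' = "c - m" and t'' = 0] s) auto
qed

lemma proj_space_0_unique:
 assumes "q : proj_space 0" "r : proj_space 0"
 shows "q = r"
proof -
 have q: "rp q 0 ~= 0" "rp r 0 ~= 0" using rp_nonzero[OF assms(1)] rp_nonzero[OF assms(2)] by auto
 define t where "t = rp q 0 / rp r 0"
 have "rp q i = t * rp r i" for i
  using q rp_zero[OF assms(1), of i] rp_zero[OF assms(2), of i] by (cases "i = 0") (auto simp: t_def)
 hence "rp q = (%i. t * rp r i)" by (rule ext)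
 moreover have "t ~= 0" using q by (simp add: t_def)
 ultimately have "rp q : line_through (rp r)" unfolding line_through_def by (intro CollectI exI[of _ t] conjI)
 hence "line_through (rp q) = line_through (rp r)" by (rule line_through_eq)
 thus ?thesis
  using line_through_mem[OF assms(1) rp_mem[OF assms(1)]] line_through_mem[OF assms(2) rp_mem[OF assms(2)]] by simp
qed

text \<open>The coefficient of a multiple of \<open>s\<close>, extended linearly.\<close>

definition cf :: "rat2 => rat2 => rat" where
 "cf s x = (if fst s ~= 0 then fst x / fst s else snd x / snd s)"

lemma cf_diff: "cf s (x - y) = cf s x - cf s y" by (simp add: cf_def diff_divide_distrib)

lemma cf_sm: "s ~= 0 ==> cf s (sm a s) = a" by (auto simp: cf_def sm_def prod_eq_iff)

lemma cf_scale: "cf s (sm a x) = a * cf s x" by (simp add: cf_def sm_def)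

lemma cf_multiple: "det2 s x = 0 ==> s ~= 0 ==> sm (cf s x) s = x"
 using det2_zero_multiple[of s x] cf_sm[of s] by metis

section \<open>Nowhere vanishing sections and splitting\<close>

context lattice
begin

text \<open>If neither coefficient is a unit, both numerators vanish at \<open>p\<close> and are
  combinations of the linear forms there. So \<open>s\<close> has a Koszul preimage in the stalk at
  \<open>p\<close> and must be zero.\<close>

lemma nowhere_vanishing:
 assumes n: "n >= 1"
  and van: "!!i. i < n ==> stalk_vanishing n (lat (m - 1 - int i)) i"
  and s: "!!z. z : proj_space n ==> s : lat m z" "s ~= 0"
  and p: "p : proj_space n" and ab: "s = sm a (e1 p) + sm b (e2 p)" "a : loc n m p" "b : loc n m p"
 shows "a : ulc n m p | b : ulc n m p"
proof (rule ccontr)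
 assume no: "~ ?thesis"
 obtain ls where ls0: "length ls = n" "ALL i<n. hpol n 1 (ls ! i)"
  "ALL q:proj_space n. q ~= p --> (EX i<n. nz (ls ! i) q)"
  "ALL d g. hpol n d g --> ~ nz g p -->
   (EX G. g = (\<Sum>i<n. G i * ls ! i) & (ALL i<n. G i = 0 | 1 <= d & hpol n (d - 1) (G i)))"
  using linear_forms_at_point[OF p] by (elim exE conjE) (rule that)
 note ls = ls0[rule_format]
 have dec: "EX f. (ALL i<n. f i : loc n (m - 1) p) & x = (\<Sum>i<n. to_fract (ls ! i) * f i)"
  if x: "x : loc n m p" "x \<notin> ulc n m p" for x
 proof -
  obtain g h d e where g: "x = Fract g h" "hpol n d g" "hpol n e h" "int d - int e = m" "nz h p" using x(1) by (rule locE)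
  have "~ nz g p" using x(2) g by (auto intro: ulcI)
  then obtain G where G: "g = (\<Sum>i<n. G i * ls ! i)" "ALL i<n. G i = 0 | 1 <= d & hpol n (d - 1) (G i)"
   using ls0(4) g(2) by blast
  have "Fract (G i) h : loc n (m - 1) p" if "i < n" for i
  proof (cases "G i = 0")
   case True
   thus ?thesis using loc_0[OF p] nz_nonzero[OF g(5)] by (simp add: fract_collapse)
  next
   case False
   thus ?thesis using G(2) that g by (intro locI[of n "d - 1" _ e]) auto
  qed
  moreover have "x = (\<Sum>i<n. to_fract (ls ! i) * Fract (G i) h)"
  proof -
   have fr: "Fract k h = to_fract k * Fract 1 h" for k by (simp add: to_fract_def)
   have "x = to_fract (\<Sum>i<n. G i * ls ! i) * Fract 1 h" unfolding g(1) G(1) by (rule fr)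
   also have "\<dots> = (\<Sum>i<n. to_fract (ls ! i) * (to_fract (G i) * Fract 1 h))"
    unfolding to_fract_sum sum_distrib_right by (intro sum.cong refl) (simp only: to_fract_mult mult_ac)
   finally show ?thesis unfolding fr[symmetric] .
  qed
  ultimately show ?thesis by (intro exI[of _ "%i. Fract (G i) h"] conjI allI impI) simp_all
 qed
 have au: "a \<notin> ulc n m p" and bu: "b \<notin> ulc n m p" using no by simp_all
 obtain f where f0: "(ALL i<n. f i : loc n (m - 1) p) & a = (\<Sum>i<n. to_fract (ls ! i) * f i)"
  by (rule exE[OF dec[OF ab(2) au]])
 obtain g where g0: "(ALL i<n. g i : loc n (m - 1) p) & b = (\<Sum>i<n. to_fract (ls ! i) * g i)"
  by (rule exE[OF dec[OF ab(3) bu]])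
 note f = conjunct1[OF f0, rule_format] conjunct2[OF f0]
 note g = conjunct1[OF g0, rule_format] conjunct2[OF g0]
 define y where "y i = (if i < n then sm (f i) (e1 p) + sm (g i) (e2 p) else 0)" for i
 \<comment> \<open>Only singletons enter the formula for \<open>s\<close>; the position of the first
   \<open>True\<close> selects \<open>y i\<close>. The other subsets also take values among the
   \<open>y i\<close> and zero, so the range stays finite.\<close>
 define x0 where "x0 J = y (length (takeWhile Not J))" for J
 have kiz: "K2.ki zs x (replicate (length zs) False) = (\<Sum>i<length zs. sm (zs ! i) (x ((replicate (length zs) False)[i := True])))"
  for zs x
 proof (induction zs arbitrary: x)
  case (Cons w zs)
  thus ?case by (simp add: sum.lessThan_Suc_shift del: sum.lessThan_Suc)
 qed simp
 have tw: "length (takeWhile Not ((replicate k False)[i := True])) = i" if "i < k" for i k using that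
 proof (induction k arbitrary: i)
  case (Suc k)
  thus ?case by (cases i) auto
 qed simp
 have sm_sum: "sm (sum h A) v = (\<Sum>i\<in>A. sm (h i) v)" for h v and A :: "nat set" by (rule K2.scale_sum_left)
 have s_eq: "s = K2.ki (map to_fract ls) x0 (replicate n False)"
 proof -
  have "K2.ki (map to_fract ls) x0 (replicate n False) = (\<Sum>i<n. sm (to_fract (ls ! i)) (y i))"
   using kiz[of "map to_fract ls" x0] ls(1) tw by (simp add: x0_def)
  also have "\<dots> = (\<Sum>i<n. sm (to_fract (ls ! i) * f i) (e1 p) + sm (to_fract (ls ! i) * g i) (e2 p))"
   by (intro sum.cong) (auto simp: y_def K2.scale_right_distrib)
  also have "\<dots> = s" unfolding ab(1) f(2) g(2) sm_sum sum.distrib ..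
  finally show ?thesis by simp
 qed
 have x0: "x0 J : lat (m - 1) p" for J unfolding x0_def y_def lat_def using f(1) g(1) span2_0[OF p] by (auto intro: span2I)
 have "range x0 <= insert 0 (y ` {..<n})" unfolding x0_def y_def by auto
 hence fin: "finite (range x0)" by (rule finite_subset) simp
 have "s = 0"
 proof (rule vanishing_at_point_imp_zero[OF p ls(1,2,3) n van s(1) _ x0 fin])
  show "s = K2.ki (LS ls) x0 (replicate n False)" using s_eq by (simp add: LS_def[OF p ls(1,2,3)])
 qed
 thus False using s(2) by simp
qed

text \<open>Near a point where one coefficient of \<open>s\<close> is a unit, \<open>s\<close> can
  take the place of the corresponding frame vector.\<close>

lemma adapted_frame:
 assumes n: "n >= 1"
  and van: "!!i. i < n ==> stalk_vanishing n (lat (m - 1 - int i)) i"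
  and s: "!!z. z : proj_space n ==> s : lat m z" "s ~= 0" and q: "q : proj_space n"
 shows "EX w V. zariski_open n V & q : V & det2 s w ~= 0 & det2 s w : krat n m &
  (ALL z:V. ALL t. lat t z = span2 n s (t - m) w t z)"
proof -
 obtain a b where ab: "s = sm a (e1 q) + sm b (e2 q)" "a : loc n m q" "b : loc n m q"
  using s(1)[OF q] unfolding lat_def span2_def by blast
 have kd: "det2 (e1 q) (e2 q) : krat n 0"
 proof -
  note k = krat[OF q]
  have "fst (e1 q) * snd (e2 q) : krat n (0 + 0)" "- (snd (e1 q) * fst (e2 q)) : krat n (0 + 0)"
   by (intro krat_uminus krat_mult; simp add: k)+
  from krat_add[OF this] show ?thesis by (simp add: det2_def)
 qed
 obtain A where A: "zariski_open n A" "q : A" "ALL z:A. a : loc n m z" by (rule loc_open[OF ab(2) q]) (rule that, auto)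
 obtain B where B: "zariski_open n B" "q : B" "ALL z:B. b : loc n m z" by (rule loc_open[OF ab(3) q]) (rule that, auto)
 from nowhere_vanishing[OF n van s q ab] show ?thesis
 proof
  assume au: "a : ulc n m q"
  obtain A' where A': "zariski_open n A'" "q : A'" "ALL z:A'. a : ulc n m z" by (rule ulc_open[OF au q]) (rule that, auto)
  have d: "det2 s (e2 q) = a * det2 (e1 q) (e2 q)" unfolding ab(1) det2_simps(1,5) det2_simps(7) by simp
  have "lat t z = span2 n s (t - m) (e2 q) t z" if z: "z : A' \<inter> B \<inter> U q" for z t
  proof -
   have zP: "z : proj_space n" using U_proj[OF q] z by blast
   show ?thesis using lat_eq[OF q, of z t] span2_exchange[OF zP ab(1), of m t] z A' B by simp
  qed
  moreover have "zariski_open n (A' \<inter> B \<inter> U q)" using A' B U[OF q] by (auto intro: zariski_open_Int)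
  moreover have "det2 s (e2 q) ~= 0" using d det[OF q] ulc_nonzero[OF au] by simp
  moreover have "det2 s (e2 q) : krat n m" using d krat_mult[OF loc_krat[OF ab(2)] kd] by simp
  ultimately show ?thesis using A' B U[OF q] by (intro exI[of _ "e2 q"] exI[of _ "A' \<inter> B \<inter> U q"]) auto
 next
  assume bu: "b : ulc n m q"
  obtain B' where B': "zariski_open n B'" "q : B'" "ALL z:B'. b : ulc n m z" by (rule ulc_open[OF bu q]) (rule that, auto)
  have ab': "s = sm b (e2 q) + sm a (e1 q)" using ab(1) by (simp add: add.commute)
  have d: "det2 s (e1 q) = - (b * det2 (e1 q) (e2 q))" by (simp add: ab(1) det2_def sm_def algebra_simps)
  have "lat t z = span2 n s (t - m) (e1 q) t z" if z: "z : B' \<inter> A \<inter> U q" for z t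
  proof -
   have zP: "z : proj_space n" using U_proj[OF q] z by blast
   show ?thesis using lat_eq[OF q, of z t] span2_exchange[OF zP ab', of m t] z A B'
     span2_commute[of n "e1 q" t "e2 q" t z] by simp
  qed
  moreover have "zariski_open n (B' \<inter> A \<inter> U q)" using A B' U[OF q] by (auto intro: zariski_open_Int)
  moreover have "det2 s (e1 q) ~= 0" using d det[OF q] ulc_nonzero[OF bu] by simp
  moreover have "det2 s (e1 q) : krat n m" using d krat_uminus[OF krat_mult[OF loc_krat[OF ab(3)] kd]] by simp
  ultimately show ?thesis using A B' U[OF q] by (intro exI[of _ "e1 q"] exI[of _ "B' \<inter> A \<inter> U q"]) auto
 qed
qed

text \<open>The section \<open>s\<close> is the first vector of the global frame. The second is
  glued from local complements: their determinants with \<open>s\<close> are local equations of a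
  divisor, whose global equation \<open>G0\<close> normalises them, and what remains is a cocycle of
  multiples of \<open>s\<close>.\<close>

theorem splitting:
 assumes v0: "stalk_vanishing n (lat (m - 1)) 0" and nv: "~ stalk_vanishing n (lat m) 0"
  and v: "!!i. 0 < i ==> i < n ==> stalk_vanishing n (lat (m - 1 - int i)) i"
 shows "EX x y a c. det2 x y ~= 0 & (ALL z:proj_space n. ALL t. lat t z = span2 n x (t - a) y (t - c) z)"
proof -
 have H0: "x = 0" if "!!z. z : proj_space n ==> x : lat (m - 1) z" for x
  using iffD1[OF stalk_vanishing_0[of n "lat (m - 1)", OF lat_0] v0] that by blast
 \<comment> \<open>Projective space of dimension zero is a point, where every twist has non-zero
   sections, contrary to \<open>H0\<close>.\<close>
 have n: "n >= 1"
 proof (rule ccontr)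
  assume "~ n >= 1"
  hence n0: "n = 0" by simp
  obtain q where q: "q : proj_space n" using hom_nonzero_point[of n 0 1] by auto
  obtain h where h: "hpol n (nat (m - 1)) h" "nz h q" using hom_nonvanishing[OF q] .
  obtain h' where h': "hpol n (nat (1 - m)) h'" "nz h' q" using hom_nonvanishing[OF q] .
  have u: "Fract h h' : ulc n (m - 1) q" by (rule ulcI[OF h(1) h'(1) h(2) h'(2)]) auto
  define x where "x = sm (Fract h h') (e1 q)"
  have "x = sm (Fract h h') (e1 q) + sm 0 (e2 q)" by (simp add: x_def)
  hence "x : lat (m - 1) q" unfolding lat_def using span2I[OF ulc_loc[OF u] loc_0[OF q]] by simp
  moreover have "z = q" if "z : proj_space n" for z using proj_space_0_unique q that n0 by simp
  ultimately have "x = 0" by (intro H0) metis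
  hence "e1 q = 0" using ulc_nonzero[OF u] by (simp add: x_def sm_eq_0)
  thus False using det[OF q] by (simp add: det2_def)
 qed
 have van: "stalk_vanishing n (lat (m - 1 - int i)) i" if "i < n" for i using v0 v that by (cases "i = 0") auto
 obtain s where s: "!!z. z : proj_space n ==> s : lat m z" "s ~= 0"
  using nv stalk_vanishing_0[of n "lat m", OF lat_0] by blast
 have "ALL q. EX w V. q : proj_space n --> zariski_open n V & q : V & det2 s w ~= 0 & det2 s w : krat n m &
  (ALL z:V. ALL t. lat t z = span2 n s (t - m) w t z)" using adapted_frame[OF n van s] by blast
 then obtain w V where wV: "!!q. q : proj_space n ==> zariski_open n (V q) & q : V q & det2 s (w q) ~= 0 &
   det2 s (w q) : krat n m & (ALL z:V q. ALL t. lat t z = span2 n s (t - m) (w q) t z)" by metis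
 have VP: "z : proj_space n" if "q : proj_space n" "z : V q" for q z
  using wV[OF that(1)] zariski_open_subset that(2) by blast
 have expr: "EX \<alpha> \<beta>. w r = sm \<alpha> s + sm \<beta> (w q) & \<beta> : loc n 0 z"
  if q: "q : proj_space n" "z : V q" and r: "r : proj_space n" "z : V r" for q r z
 proof -
  have zP: "z : proj_space n" using VP q by blast
  have "w r = sm 0 s + sm 1 (w r)" by simp
  hence "w r : span2 n s (0 - m) (w r) 0 z" using span2I[OF loc_0[OF zP] loc_1] by metis
  also have "\<dots> = span2 n s (0 - m) (w q) 0 z" using wV[OF q(1)] wV[OF r(1)] q r by metis
  finally show ?thesis unfolding span2_def by blast
 qed
 \<comment> \<open>Between two complements the change is multiplication by \<open>\<beta>\<close> up
   to a multiple of \<open>s\<close>, and the determinant with \<open>s\<close> sees only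
   \<open>\<beta>\<close>. The reverse change shows that \<open>\<beta>\<close> is a unit.\<close>
 have coc: "det2 s (w z) / det2 s (w q) : ulc n 0 z" if q: "q : proj_space n" "z : V q" for q z
 proof -
  have zP: "z : proj_space n" "z : V z" using VP q wV by blast+
  obtain \<alpha> \<beta> where 1: "w z = sm \<alpha> s + sm \<beta> (w q)" "\<beta> : loc n 0 z" using expr[OF q zP] by blast
  obtain \<alpha>' \<beta>' where 2: "w q = sm \<alpha>' s + sm \<beta>' (w z)" "\<beta>' : loc n 0 z" using expr[OF zP q] by blast
  have D1: "det2 s (w z) = \<beta> * det2 s (w q)" by (subst 1(1)) (simp add: det2_simps(2,6,7))
  have D2: "det2 s (w q) = \<beta>' * det2 s (w z)" by (subst 2(1)) (simp add: det2_simps(2,6,7))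
  have nz: "det2 s (w z) ~= 0" "det2 s (w q) ~= 0" using wV zP q by blast+
  have "\<beta> * \<beta>' * det2 s (w z) = 1 * det2 s (w z)" using D1 D2 by (metis mult.assoc mult_1)
  hence "\<beta> * \<beta>' = 1" using nz(1) by simp
  hence "\<beta> : ulc n 0 z" using loc_inverse_pair 1 2 by blast
  thus ?thesis using D1 nz by simp
 qed
 have "EX l G0. G0 : krat n l & G0 ~= 0 & (ALL q:proj_space n. det2 s (w q) / G0 : ulc n (m - l) q)"
  by (rule global_equation[OF n, of V]) (simp_all add: wV coc)
 then obtain l G0 where G0: "G0 : krat n l" "G0 ~= 0" "!!q. q : proj_space n ==> det2 s (w q) / G0 : ulc n (m - l) q"
  by blast
 define c where "c = l - m"
 define k where "k q = G0 / det2 s (w q)" for q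
 have ku: "k q : ulc n c q" if "q : proj_space n" for q using ulc_inverse[OF G0(3)[OF that]] by (simp add: k_def c_def)
 \<comment> \<open>After rescaling all determinants with \<open>s\<close> equal \<open>G0\<close>,
   so differences of the \<open>w'\<close> are multiples of \<open>s\<close>.\<close>
 define w' where "w' q = sm (k q) (w q)" for q
 have dw': "det2 s (w' q) = G0" if "q : proj_space n" for q using wV[OF that] by (simp add: w'_def k_def det2_simps(6))
 have "EX V'. zariski_open n V' & q : V' & (ALL z:V'. z : V q & k q : ulc n c z)" if q: "q : proj_space n" for q
 proof -
  obtain A where "zariski_open n A" "q : A" "ALL z:A. k q : ulc n c z" by (rule ulc_open[OF ku[OF q] q]) (rule that, auto)
  thus ?thesis using wV[OF q] by (intro exI[of _ "A \<inter> V q"]) (auto intro: zariski_open_Int)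
 qed
 then obtain V' where V': "!!q. q : proj_space n ==> zariski_open n (V' q) & q : V' q & (ALL z:V' q. z : V q & k q : ulc n c z)"
  by metis
 have lat': "lat t z = span2 n s (t - m) (w' q) (t - c) z" if q: "q : proj_space n" "z : V' q" for q z t
 proof -
  have "z : V q" "k q : ulc n c z" using V' q by blast+
  moreover have "z : proj_space n" using VP q calculation by blast
  ultimately show ?thesis using wV[OF q(1)] span2_rescale[of z n "k q" c s t m "w q"] by (simp add: w'_def)
 qed
 define a where "a L = (case L of [q, r] => cf s (w' r - w' q) | _ => 0)" for L :: "point list"
 have V'cov: "point_cover n V'" using V' by (simp add: point_cover_def)
 have same: "sm (cf s (w' r - w' q)) s = w' r - w' q" if "q : proj_space n" "r : proj_space n" for q r
  by (rule cf_multiple) (use dw' that s(2) in \<open>simp_all add: det2_simps(4)\<close>)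
 have aloc: "a L : loc n (c - m) z" if L: "L : simplices n (Suc 0)" "z : inters V' L" for L z
 proof -
  obtain q r where qr: "L = [q, r]" "q : proj_space n" "r : proj_space n"
   using L(1) by (auto simp: simplices_def length_Suc_conv)
  have z: "z : V' q" "z : V' r" using L(2) qr by (auto simp: inters_def)
  have zP: "z : proj_space n" using inters_nonempty_subset[OF V'cov L] .
  have "w' r = sm 0 s + sm 1 (w' r)" by simp
  hence "w' r : span2 n s (c - m) (w' r) (c - c) z" using span2I[OF loc_0[OF zP] loc_1] by (metis diff_self)
  also have "\<dots> = span2 n s (c - m) (w' q) (c - c) z" using lat'[OF qr(2) z(1)] lat'[OF qr(3) z(2)] by metis
  finally obtain \<alpha> \<beta> where \<alpha>\<beta>: "w' r = sm \<alpha> s + sm \<beta> (w' q)" "\<alpha> : loc n (c - m) z" unfolding span2_def by blast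
  have "det2 s (w' r) = \<beta> * det2 s (w' q)" by (subst \<alpha>\<beta>(1)) (simp add: det2_simps(2,6,7))
  hence "\<beta> = 1" using dw' qr G0(2) by simp
  hence "w' r - w' q = sm \<alpha> s" using \<alpha>\<beta>(1) by simp
  thus ?thesis using \<alpha>\<beta>(2) s(2) by (simp add: a_def qr(1) cf_sm)
 qed
 have acoc: "dl a L = 0" if "L : simplices n (Suc (Suc 0))" for L
 proof -
  have "EX q r t. L = [q, r, t]" using that by (cases L; cases "tl L"; cases "tl (tl L)") (auto simp: simplices_def)
  then obtain q r t where "L = [q, r, t]" by (elim exE) (rule that)
  thus ?thesis by (simp add: a_def cf_diff)
 qed
 \<comment> \<open>The factor \<open>\<phi>\<close> is 1 in the final use. On the projective line a
   form is needed to move the cocycle to a twist whose cohomology is known to vanish.\<close>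
 have glue: "EX b. (ALL q:proj_space n. b q : loc n (i + c - m) q) &
   (ALL q:proj_space n. ALL r:proj_space n. \<phi> * a [q, r] = b r - b q)"
  if van1: "stalk_vanishing n (loc n (i + c - m)) (Suc 0)" and \<phi>: "!!z. z : proj_space n ==> \<phi> : loc n i z" for i \<phi>
 proof -
  have "ALL L:simplices n (Suc 0). ALL z:inters V' L. \<phi> * a L : loc n (i + c - m) z"
   using loc_mult[OF \<phi> aloc] inters_nonempty_subset[OF V'cov] by (metis (no_types, lifting) add_diff_eq)
  moreover have "ALL L:simplices n (Suc (Suc 0)). dl (%L. \<phi> * a L) L = 0"
  proof
   fix L assume "L : simplices n (Suc (Suc 0))"
   hence "dl a L = 0" by (rule acoc)
   moreover have "\<phi> * dl a L = dl (%L. \<phi> * a L) L" by (rule dl_additive) (simp add: right_diff_distrib)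
   ultimately show "dl (%L. \<phi> * a L) L = 0" by simp
  qed
  ultimately obtain W' b where b: "point_cover n W'" "ALL l:simplices n 0. ALL z:inters W' l. b l : loc n (i + c - m) z"
   "ALL l:simplices n (Suc 0). \<phi> * a l = dl b l"
   using van1[unfolded stalk_vanishing_def, rule_format, of V' "%L. \<phi> * a L"] V'cov by auto
  have "b [q] : loc n (i + c - m) q" if "q : proj_space n" for q
  proof -
   have "[q] : simplices n 0" "q : inters W' [q]"
    using that b(1) by (auto simp: simplices_def inters_def point_cover_def)
   thus ?thesis using b(2) by blast
  qed
  moreover have "\<phi> * a [q, r] = b [r] - b [q]" if "q : proj_space n" "r : proj_space n" for q r
  proof -
   have "[q, r] : simplices n (Suc 0)" using that by (simp add: simplices_def)
   hence "\<phi> * a [q, r] = dl b [q, r]" using b(3) by blast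
   thus ?thesis by simp
  qed
  ultimately show ?thesis by (intro exI[of _ "%q. b [q]"]) blast
 qed
 obtain q0 where q0: "q0 : proj_space n" using hom_nonzero_point[of n 0 1] by auto
 \<comment> \<open>If the degree were smaller for \<open>n = 1\<close>, the factor
   \<open>v 0 ^ (m - 1 - c)\<close> would move the cocycle to degree \<open>- 1\<close>, where it
   splits. This yields a section of twist \<open>m - 1\<close>, non-zero because its determinant
   with \<open>s\<close> is \<open>\<phi> * G0\<close>, against \<open>H0\<close>.\<close>
 have "n > 1 | c - m >= - 1"
 proof (rule ccontr)
  assume "~ ?thesis"
  hence n1: "n = 1" and cm: "c - m < - 1" using n by auto
  define j where "j = m - 1 - c"
  define \<phi> where "\<phi> = to_fract (mX 0 ^ nat j)"
  have \<phi>: "\<phi> : loc n j z" for z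
   unfolding \<phi>_def to_fract_def using hom_power[of n 1 "mX 0" "nat j"] cm by (intro locI[of n "nat j" _ 0]) (auto simp: j_def)
  have jc: "j + c - m = - 1" by (simp add: j_def)
  have "stalk_vanishing n (loc n (j + c - m)) (Suc 0)" unfolding jc by (rule line_bundle_vanishing) (use n1 in auto)
  from glue[OF this \<phi>] obtain b where b: "ALL q:proj_space n. b q : loc n (j + c - m) q"
   "ALL q:proj_space n. ALL r:proj_space n. \<phi> * a [q, r] = b r - b q" by blast
  define y where "y = sm \<phi> (w' q0) - sm (b q0) s"
  have yq: "y = sm \<phi> (w' q) - sm (b q) s" if q: "q : proj_space n" for q
  proof -
   have "sm (\<phi> * a [q0, q]) s = sm \<phi> (w' q - w' q0)"
    using same[OF q0 q] by (simp add: a_def K2.scale_scale[symmetric])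
   hence "sm (b q - b q0) s = sm \<phi> (w' q - w' q0)" using b(2) q0 q by simp
   thus ?thesis by (simp add: y_def K2.scale_left_diff_distrib K2.scale_right_diff_distrib algebra_simps)
  qed
  have "y : lat (m - 1) q" if q: "q : proj_space n" for q
  proof -
   have "w' q = sm 0 s + sm 1 (w' q)" by simp
   hence "w' q : span2 n s (c - m) (w' q) (c - c) q" using span2I[OF loc_0[OF q] loc_1] by (metis diff_self)
   hence "w' q : lat c q" using lat'[OF q, of q c] V' q by simp
   hence "sm \<phi> (w' q) : lat (m - 1) q" by (rule lat_scale[OF \<phi>]) (simp add: j_def)
   moreover have "sm (b q) s : lat (m - 1) q" by (rule lat_scale[OF bspec[OF b(1) q] s(1)[OF q]]) (simp add: j_def)
   ultimately show ?thesis unfolding yq[OF q] by (rule lat_diff)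
  qed
  hence "y = 0" by (rule H0)
  moreover have "det2 s y = \<phi> * G0" using dw'[OF q0] by (simp add: y_def det2_simps(4,6,7))
  ultimately show False using G0(2) by (simp add: \<phi>_def det2_def)
 qed
 hence "stalk_vanishing n (loc n (0 + c - m)) (Suc 0)" using n by (intro line_bundle_vanishing) auto
 from glue[OF this loc_1] obtain b where b: "ALL q:proj_space n. b q : loc n (0 + c - m) q"
  "ALL q:proj_space n. ALL r:proj_space n. 1 * a [q, r] = b r - b q" by blast
 \<comment> \<open>The cochain \<open>b\<close> turns the local complements into one global
   vector.\<close>
 define y where "y = w' q0 - sm (b q0) s"
 have yq: "y = w' q - sm (b q) s" if q: "q : proj_space n" for q
 proof -
  have "sm (b q - b q0) s = w' q - w' q0" using same[OF q0 q] b(2) q0 q by (simp add: a_def)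
  thus ?thesis by (simp add: y_def K2.scale_left_diff_distrib algebra_simps)
 qed
 have "lat t z = span2 n s (t - m) y (t - c) z" if z: "z : proj_space n" for z t
  using lat'[OF z, of z t] V'[OF z] span2_shear[OF z, of "b z" c m s t "w' z"] b(1) z yq[OF z] by simp
 moreover have "det2 s y ~= 0" using dw'[OF q0] G0(2) by (simp add: y_def det2_simps(4,6,7))
 ultimately show ?thesis by blast
qed

text \<open>Diagonal frames split the lattice into two line bundles, one in each coordinate. Their
  global equations \<open>A\<close> and \<open>B\<close> identify these with \<open>O(t - k)\<close>
  and \<open>O(t - l)\<close>, for which the vanishing is known.\<close>

theorem diagonal_vanishing:
 assumes diag: "!!q. q : proj_space n ==> snd (e1 q) = 0 & fst (e2 q) = 0" and i: "0 < i" "i < n"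
 shows "stalk_vanishing n (lat t) i"
proof -
 have n: "n >= 1" using i by simp
 have nz: "fst (e1 q) ~= 0" "snd (e2 q) ~= 0" if "q : proj_space n" for q
  using det[OF that] diag[OF that] by (auto simp: det2_def)
 have ch: "fst (e1 z) / fst (e1 q) : ulc n 0 z & snd (e2 z) / snd (e2 q) : ulc n 0 z"
  if q: "q : proj_space n" "z : U q" for q z
 proof -
  have z: "z : proj_space n" using U_proj q by blast
  note c = change[OF q] and d = diag[OF q(1)] diag[OF z] and z0 = nz[OF q(1)] nz[OF z]
  obtain a b where 1: "e1 z = sm a (e1 q) + sm b (e2 q)" "a : loc n 0 z" using c unfolding span2_def by blast
  obtain a' b' where 2: "e1 q = sm a' (e1 z) + sm b' (e2 z)" "a' : loc n 0 z" using c unfolding span2_def by blast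
  have A: "fst (e1 z) = a * fst (e1 q)" "fst (e1 q) = a' * fst (e1 z)"
   using arg_cong[OF 1(1), of fst] arg_cong[OF 2(1), of fst] d by (simp_all add: sm_def)
  have "a * a' * fst (e1 z) = 1 * fst (e1 z)" using A by (metis mult.assoc mult_1)
  hence "a * a' = 1" using z0(3) by simp
  hence "a : ulc n 0 z" using loc_inverse_pair 1(2) 2(2) by blast
  hence "fst (e1 z) / fst (e1 q) : ulc n 0 z" using A(1) z0(1) by simp
  moreover
  obtain x y where 3: "e2 z = sm x (e1 q) + sm y (e2 q)" "y : loc n 0 z" using c unfolding span2_def by blast
  obtain x' y' where 4: "e2 q = sm x' (e1 z) + sm y' (e2 z)" "y' : loc n 0 z" using c unfolding span2_def by blast
  have B: "snd (e2 z) = y * snd (e2 q)" "snd (e2 q) = y' * snd (e2 z)"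
   using arg_cong[OF 3(1), of snd] arg_cong[OF 4(1), of snd] d by (simp_all add: sm_def)
  have "y * y' * snd (e2 z) = 1 * snd (e2 z)" using B by (metis mult.assoc mult_1)
  hence "y * y' = 1" using z0(4) by simp
  hence "y : ulc n 0 z" using loc_inverse_pair 3(2) 4(2) by blast
  hence "snd (e2 z) / snd (e2 q) : ulc n 0 z" using B(1) z0(2) by simp
  ultimately show ?thesis by blast
 qed
 have "EX k A. A : krat n k & A ~= 0 & (ALL q:proj_space n. fst (e1 q) / A : ulc n (0 - k) q)"
  by (rule global_equation[OF n U]) (simp_all add: krat nz ch)
 then obtain k A where A: "A ~= 0" "!!q. q : proj_space n ==> fst (e1 q) / A : ulc n (0 - k) q" by blast
 have "EX l B. B : krat n l & B ~= 0 & (ALL q:proj_space n. snd (e2 q) / B : ulc n (0 - l) q)"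
  by (rule global_equation[OF n U]) (simp_all add: krat nz ch)
 then obtain l B where B: "B ~= 0" "!!q. q : proj_space n ==> snd (e2 q) / B : ulc n (0 - l) q" by blast
 have lat: "x : lat t z \<longleftrightarrow> fst x / A : loc n (t - k) z & snd x / B : loc n (t - l) z" if z: "z : proj_space n" for x z
 proof
  assume "x : lat t z"
  then obtain a b where ab: "x = sm a (e1 z) + sm b (e2 z)" "a : loc n t z" "b : loc n t z"
   unfolding lat_def span2_def by blast
  have f: "fst x / A = a * (fst (e1 z) / A)" "snd x / B = b * (snd (e2 z) / B)" using diag[OF z] by (simp_all add: ab(1) sm_def)
  show "fst x / A : loc n (t - k) z & snd x / B : loc n (t - l) z"
   unfolding f using loc_mult[OF ab(2) ulc_loc[OF A(2)[OF z]]] loc_mult[OF ab(3) ulc_loc[OF B(2)[OF z]]] by simp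
 next
  assume x: "fst x / A : loc n (t - k) z & snd x / B : loc n (t - l) z"
  have "fst x / fst (e1 z) = (fst x / A) * inverse (fst (e1 z) / A)"
   "snd x / snd (e2 z) = (snd x / B) * inverse (snd (e2 z) / B)" using A(1) B(1) nz[OF z] by (simp_all add: field_simps)
  hence "fst x / fst (e1 z) : loc n t z" "snd x / snd (e2 z) : loc n t z"
   using loc_mult[OF conjunct1[OF x] ulc_loc[OF ulc_inverse[OF A(2)[OF z]]]]
    loc_mult[OF conjunct2[OF x] ulc_loc[OF ulc_inverse[OF B(2)[OF z]]]] A(1) B(1) by simp_all
  moreover have "x = sm (fst x / fst (e1 z)) (e1 z) + sm (snd x / snd (e2 z)) (e2 z)"
   using nz[OF z] diag[OF z] by (simp add: sm_def prod_eq_iff)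
  ultimately show "x : lat t z" unfolding lat_def by (metis span2I)
 qed
 obtain j where j: "i = Suc j" using i(1) by (cases i) auto
 show ?thesis unfolding stalk_vanishing_def
 proof (intro allI impI)
  fix W a assume W: "point_cover n W" and a: "ALL L:simplices n i. ALL z:inters W L. a L : lat t z"
   and coc: "ALL L:simplices n (Suc i). dl a L = 0"
  have coc1: "dl (%L. fst (a L) / A) L = 0" "dl (%L. snd (a L) / B) L = 0" if "L : simplices n (Suc i)" for L
  proof -
   have "fst (dl a L) / A = dl (%L. fst (a L) / A) L"
    by (rule dl_additive[of "%x. fst x / A"]) (simp add: diff_divide_distrib)
   thus "dl (%L. fst (a L) / A) L = 0" using coc that by simp
   have "snd (dl a L) / B = dl (%L. snd (a L) / B) L"
    by (rule dl_additive[of "%x. snd x / B"]) (simp add: diff_divide_distrib)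
   thus "dl (%L. snd (a L) / B) L = 0" using coc that by simp
  qed
  have mem: "fst (a L) / A : loc n (t - k) z & snd (a L) / B : loc n (t - l) z"
   if "L : simplices n i" "z : inters W L" for L z using lat[OF inters_nonempty_subset[OF W that]] a that by blast
  have lb: "stalk_vanishing n (loc n k) i" for k by (rule line_bundle_vanishing) (use i in auto)
  obtain W1 b1 where 1: "point_cover n W1" "ALL q:proj_space n. W1 q <= W q"
   "ALL L:simplices n j. ALL z:inters W1 L. b1 L : loc n (t - k) z" "ALL L:simplices n i. fst (a L) / A = dl b1 L"
   using lb[of "t - k", unfolded stalk_vanishing_def, THEN spec[of _ W], THEN spec[of _ "%L. fst (a L) / A"]]
    W coc1(1) mem j by auto
  obtain W2 b2 where 2: "point_cover n W2" "ALL q:proj_space n. W2 q <= W q"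
   "ALL L:simplices n j. ALL z:inters W2 L. b2 L : loc n (t - l) z" "ALL L:simplices n i. snd (a L) / B = dl b2 L"
   using lb[of "t - l", unfolded stalk_vanishing_def, THEN spec[of _ W], THEN spec[of _ "%L. snd (a L) / B"]]
    W coc1(2) mem j by auto
  define W' where "W' q = W1 q \<inter> W2 q" for q
  define b where "b L = (A * b1 L, B * b2 L)" for L
  have W': "point_cover n W'" using 1(1) 2(1) unfolding point_cover_def W'_def by (auto intro: zariski_open_Int)
  have "b L : lat t z" if L: "L : simplices n j" "z : inters W' L" for L z
  proof -
   have "z : inters W1 L" "z : inters W2 L" using L(2) by (auto simp: inters_def W'_def)
   thus ?thesis using lat[OF inters_nonempty_subset[OF W' L]] 1(3) 2(3) L(1) A(1) B(1) by (simp add: b_def)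
  qed
  moreover have "a L = dl b L" if L: "L : simplices n i" for L
  proof -
   have "fst (dl b L) = dl (%L. A * b1 L) L" "snd (dl b L) = dl (%L. B * b2 L) L"
    using dl_additive[of fst b L] dl_additive[of snd b L] by (simp_all add: b_def)
   moreover have "A * dl b1 L = dl (%L. A * b1 L) L" "B * dl b2 L = dl (%L. B * b2 L) L"
    by (rule dl_additive; simp add: right_diff_distrib)+
   ultimately have "fst (dl b L) = fst (a L)" "snd (dl b L) = snd (a L)"
    using 1(4) 2(4) L A(1) B(1) by (metis nonzero_eq_divide_eq mult.commute)+
   thus ?thesis by (simp add: prod_eq_iff)
  qed
  ultimately show "EX W'. point_cover n W' & (ALL q:proj_space n. W' q <= W q) &
    (case i of 0 => ALL l:simplices n 0. a l = 0
    | Suc j => EX b. (ALL l:simplices n j. ALL z:inters W' l. b l : lat t z) &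
      (ALL l:simplices n i. a l = dl b l))" using W' 1(2) by (intro exI[of _ W']) (auto simp: W'_def j)
 qed
qed

end

section \<open>Cech cohomology of sheaves of stalks\<close>

text \<open>Irreducibility of the space keeps finite intersections non-empty, so that the value of a
  cochain on any simplex can be read in the fixed group.\<close>

lemma inters_open:
 assumes "point_cover n U" "l : simplices n i"
 shows "zariski_open n (inters U l)" "inters U l ~= {}"
proof -
 have "l ~= []" "set l <= proj_space n" using assms(2) by (auto simp: simplices_def)
 hence "zariski_open n (inters U l) & inters U l ~= {}"
 proof (induction l rule: list_nonempty_induct)
  case (single x)
  thus ?case using assms(1) by (auto simp: inters_def point_cover_def)
 next
  case (cons x xs)
  have x: "zariski_open n (U x)" "U x ~= {}" using assms(1) cons by (auto simp: point_cover_def)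
  have "inters U (x # xs) = U x \<inter> inters U xs" by (auto simp: inters_def)
  thus ?case using cons zariski_open_Int[OF x(1)] zariski_irreducible[OF x(1) _ x(2)] by simp
 qed
 thus "zariski_open n (inters U l)" "inters U l ~= {}" by auto
qed

lemma inters_mono:
 assumes "!!p. p : proj_space n ==> W p <= U p" "l : simplices n i"
 shows "inters W l <= inters U l" using assms unfolding inters_def simplices_def by fastforce

text \<open>The bridge from the recursion \<open>dl\<close> to the sum over deletions in the
  definition of the coboundary.\<close>

lemma dl_alternating_sum:
 "dl c l = (\<Sum>j<length l. if even j then c (take j l @ drop (Suc j) l) else - c (take j l @ drop (Suc j) l))"
proof (induction l arbitrary: c)
 case (Cons x xs)
 have "(\<Sum>j<length xs. if even (Suc j) then c (take (Suc j) (x # xs) @ drop (Suc (Suc j)) (x # xs))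
   else - c (take (Suc j) (x # xs) @ drop (Suc (Suc j)) (x # xs))) = - dl (%l. c (x # l)) xs"
  unfolding Cons.IH sum_negf[symmetric] by (intro sum.cong) auto
 thus ?case by (simp add: sum.lessThan_Suc_shift del: sum.lessThan_Suc)
qed simp

text \<open>The condition of \<open>stalk_vanishing\<close> on a fixed cover, isolated because it is
  stable under differences and refinement.\<close>

definition stalk_coboundary ::
 "nat => (point => 'b::ab_group_add set) => nat => (point => point set) => (point list => 'b) => bool" where
 "stalk_coboundary n M i W f \<longleftrightarrow> (case i of 0 => ALL l:simplices n 0. f l = 0
   | Suc j => EX e. (ALL l:simplices n j. ALL z:inters W l. e l : M z) & (ALL l:simplices n i. f l = dl e l))"

lemma stalk_vanishing_alt:
 "stalk_vanishing n M i \<longleftrightarrow> (ALL W a. point_cover n W -->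
   (ALL l:simplices n i. ALL z:inters W l. a l : M z) --> (ALL l:simplices n (Suc i). dl a l = 0) -->
   (EX W'. point_cover n W' & (ALL q:proj_space n. W' q <= W q) & stalk_coboundary n M i W' a))"
 unfolding stalk_vanishing_def stalk_coboundary_def ..

text \<open>The coboundary is a sum in the module of sections over one open set;
  \<open>\<phi>\<close> carries it to an ordinary sum of values.\<close>

lemma (in abelian_monoid) finsum_transport:
 fixes \<phi> :: "'a => 'c::ab_group_add"
 assumes add: "!!s t. s : carrier G ==> t : carrier G ==> \<phi> (s \<oplus> t) = \<phi> s + \<phi> t" and zero: "\<phi> \<zero> = 0"
  and A: "finite A" "f : A \<rightarrow> carrier G"
 shows "\<phi> (finsum G f A) = (\<Sum>x\<in>A. \<phi> (f x))" using A
proof (induction A rule: finite_induct)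
 case (insert x A)
 hence "finsum G f A : carrier G" by (intro finsum_closed) auto
 thus ?case using insert by (simp add: finsum_insert add Pi_iff)
qed (simp add: zero)

text \<open>A presheaf \<open>F\<close> whose sections over every non-empty open set \<open>U\<close> are identified, by \<open>\<Phi> U\<close>, with
 the elements of a fixed group that lie in the stalk \<open>M z\<close> for every \<open>z \<in> U\<close>.\<close>

locale stalk_model =
 fixes n :: nat and F :: "'a presheaf" and M :: "point => 'b::ab_group_add set" and \<Phi> :: "point set => 'a => 'b"
 assumes M0: "z : proj_space n ==> 0 : M z"
  and Mdiff: "z : proj_space n ==> x : M z ==> y : M z ==> x - y : M z"
  and bij: "zariski_open n U ==> U ~= {} ==> bij_betw (\<Phi> U) (Sec F U) {x. ALL z:U. x : M z}"
  and zero: "zariski_open n U ==> U ~= {} ==> \<zero>\<^bsub>sec F U\<^esub> : Sec F U & \<Phi> U \<zero>\<^bsub>sec F U\<^esub> = 0"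
  and add: "zariski_open n U ==> U ~= {} ==> s : Sec F U ==> t : Sec F U ==>
   s \<oplus>\<^bsub>sec F U\<^esub> t : Sec F U & \<Phi> U (s \<oplus>\<^bsub>sec F U\<^esub> t) = \<Phi> U s + \<Phi> U t"
  and res: "zariski_open n U ==> zariski_open n V ==> V ~= {} ==> V <= U ==> s : Sec F U ==>
   res F U V s : Sec F V & \<Phi> V (res F U V s) = \<Phi> U s"
begin

lemma inj:
 assumes "zariski_open n U" "U ~= {}" "s : Sec F U" "t : Sec F U" "\<Phi> U s = \<Phi> U t"
 shows "s = t" using bij_betw_imp_inj_on[OF bij[OF assms(1,2)]] assms by (auto dest: inj_onD)

lemma M_values: "zariski_open n U ==> z : U ==> s : Sec F U ==> \<Phi> U s : M z"
 using bij_betwE[OF bij[of U]] by auto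

lemma surj:
 assumes "zariski_open n U" "U ~= {}" "!!z. z : U ==> x : M z"
 shows "EX s:Sec F U. \<Phi> U s = x"
proof -
 have "x : \<Phi> U ` Sec F U" unfolding bij_betw_imp_surj_on[OF bij[OF assms(1,2)]] using assms(3) by simp
 thus ?thesis by (elim imageE) (intro bexI, auto)
qed

lemma abelian:
 assumes U: "zariski_open n U" "U ~= {}"
 shows "abelian_group (sec F U)"
proof -
 note cl = conjunct1[OF add[OF U]] conjunct1[OF zero[OF U]] and ad = conjunct2[OF add[OF U]] conjunct2[OF zero[OF U]]
 show ?thesis
proof (rule abelian_groupI)
 fix x assume x: "x : Sec F U"
 have "- \<Phi> U x : M z" if "z : U" for z
 proof -
  have z: "z : proj_space n" using zariski_open_subset[OF U(1)] that by blast
  show ?thesis using Mdiff[OF z M0[OF z] M_values[OF U(1) that x]] by simp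
 qed
 then obtain y where y: "y : Sec F U" "\<Phi> U y = - \<Phi> U x" using surj[OF U] by blast
 have "y \<oplus>\<^bsub>sec F U\<^esub> x = \<zero>\<^bsub>sec F U\<^esub>"
  by (rule inj[OF U]) (use add[OF U y(1) x] zero[OF U] y(2) in simp_all)
 thus "EX y:Sec F U. y \<oplus>\<^bsub>sec F U\<^esub> x = \<zero>\<^bsub>sec F U\<^esub>" using y(1) by blast
qed (auto intro!: inj[OF U] simp: cl ad algebra_simps)
qed

lemma uminus:
 assumes U: "zariski_open n U" "U ~= {}" and s: "s : Sec F U"
 shows "\<ominus>\<^bsub>sec F U\<^esub> s : Sec F U" "\<Phi> U (\<ominus>\<^bsub>sec F U\<^esub> s) = - \<Phi> U s"
proof -
 interpret abelian_group "sec F U" by (rule abelian[OF U])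
 show 1: "\<ominus>\<^bsub>sec F U\<^esub> s : Sec F U" using s by simp
 have "\<Phi> U s + \<Phi> U (\<ominus>\<^bsub>sec F U\<^esub> s) = 0" using add[OF U s 1] zero[OF U] r_neg[OF s] by simp
 thus "\<Phi> U (\<ominus>\<^bsub>sec F U\<^esub> s) = - \<Phi> U s" by (simp add: add_eq_0_iff)
qed

text \<open>The cochain as a function into the fixed group. Restriction does not change values, so
  the coboundary becomes \<open>dl\<close>.\<close>

definition val :: "(point => point set) => (point list => 'a) => point list => 'b" where
 "val U c l = \<Phi> (inters U l) (c l)"

lemma val_coboundary:
 assumes U: "point_cover n U" and c: "c : cochains n F U i" and l: "l : simplices n (Suc i)"
 shows "coboundary n F U i c l : carrier (sec F (inters U l))" "val U (coboundary n F U i c) l = dl (val U c) l"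
proof -
 let ?U = "inters U l"
 note O = inters_open[OF U l]
 interpret G: abelian_group "sec F ?U" by (rule abelian[OF O])
 define t where "t j = take j l @ drop (Suc j) l" for j
 define r where "r j = res F (inters U (t j)) ?U (c (t j))" for j
 define u where "u j = (if even j then r j else \<ominus>\<^bsub>sec F ?U\<^esub> r j)" for j
 have ll: "length l = Suc (Suc i)" "set l <= proj_space n" using l by (auto simp: simplices_def)
 have r: "r j : carrier (sec F ?U) & \<Phi> ?U (r j) = val U c (t j)" if "j <= Suc i" for j
 proof -
  have s: "set (t j) <= set l" unfolding t_def using set_take_subset set_drop_subset by fastforce
  have t: "t j : simplices n i" using ll that s by (auto simp: simplices_def t_def)
  have "c (t j) : carrier (sec F (inters U (t j)))" using c t by (auto simp: cochains_def)
  moreover have "?U <= inters U (t j)" using s by (auto simp: inters_def)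
  ultimately show ?thesis unfolding r_def val_def using res[OF inters_open(1)[OF U t] O] by blast
 qed
 have u: "u j : carrier (sec F ?U)" "\<Phi> ?U (u j) = (if even j then val U c (t j) else - val U c (t j))" if "j <= Suc i" for j
  using r[OF that] uminus[OF O] by (auto simp: u_def)
 have eq: "coboundary n F U i c l = finsum (sec F ?U) u {..Suc i}"
  using l unfolding coboundary_def Let_def u_def[abs_def] r_def t_def by simp
 show "coboundary n F U i c l : carrier (sec F (inters U l))" unfolding eq using u(1) by (intro G.finsum_closed) auto
 have "\<Phi> ?U (finsum (sec F ?U) u {..Suc i}) = (\<Sum>j\<in>{..Suc i}. \<Phi> ?U (u j))"
  by (rule G.finsum_transport) (use add[OF O] zero[OF O] u(1) in auto)
 also have "\<dots> = (\<Sum>j<length l. if even j then val U c (t j) else - val U c (t j))"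
  by (rule sum.cong) (use ll u(2) in auto)
 also have "\<dots> = dl (val U c) l" unfolding dl_alternating_sum t_def ..
 finally show "val U (coboundary n F U i c) l = dl (val U c) l" unfolding val_def eq by simp
qed

lemma cocycles_iff:
 assumes U: "point_cover n U"
 shows "c : cocycles n F U i \<longleftrightarrow> c : cochains n F U i & (ALL l:simplices n (Suc i). dl (val U c) l = 0)"
proof -
 have "coboundary n F U i c = (\<lambda>l\<in>simplices n (Suc i). \<zero>\<^bsub>sec F (inters U l)\<^esub>) \<longleftrightarrow>
  (ALL l:simplices n (Suc i). dl (val U c) l = 0)" (is "?A = ?B \<longleftrightarrow> ?C") if c: "c : cochains n F U i"
 proof
  assume eq: "?A = ?B"
  show ?C
  proof
   fix l assume l: "l : simplices n (Suc i)"
   thus "dl (val U c) l = 0"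
    using val_coboundary(2)[OF U c l] zero[OF inters_open[OF U l]] unfolding eq by (simp add: val_def)
  qed
 next
  assume C: ?C
  show "?A = ?B"
  proof
   fix l show "?A l = ?B l"
   proof (cases "l : simplices n (Suc i)")
    case True
    have "?A l = \<zero>\<^bsub>sec F (inters U l)\<^esub>" by (rule inj[OF inters_open[OF U True]])
      (use val_coboundary[OF U c True] zero[OF inters_open[OF U True]] C True in \<open>auto simp: val_def\<close>)
    thus ?thesis using True by simp
   qed (simp add: coboundary_def)
  qed
 qed
 thus ?thesis unfolding cocycles_def by blast
qed

lemma val_mem: "point_cover n U ==> c : cochains n F U i ==> l : simplices n i ==> z : inters U l ==> val U c l : M z"
 unfolding val_def by (rule M_values[OF inters_open(1)]) (auto simp: cochains_def)

lemma cochain_exists: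
 assumes U: "point_cover n U" and a: "!!l z. l : simplices n i ==> z : inters U l ==> a l : M z"
 shows "EX c:cochains n F U i. ALL l:simplices n i. val U c l = a l"
proof -
 have "ALL l:simplices n i. EX s. s : carrier (sec F (inters U l)) & \<Phi> (inters U l) s = a l"
  using surj[OF inters_open[OF U]] a by blast
 then obtain s where "ALL l:simplices n i. s l : carrier (sec F (inters U l)) & \<Phi> (inters U l) (s l) = a l"
  by (rule bchoice[THEN exE])
 thus ?thesis by (intro bexI[of _ "\<lambda>l\<in>simplices n i. s l"]) (auto simp: cochains_def val_def)
qed

lemma val_cong: "(!!l. l : simplices n i ==> a l = b l) ==> l : simplices n (Suc i) ==> dl a l = dl b l"
 by (rule dl_cong) (auto simp: simplices_def)

text \<open>Refinement is invisible to values, so cocycles on different covers can be subtracted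
  directly.\<close>

lemma cohomologous_iff:
 assumes U: "point_cover n U" "a : cocycles n F U i" and V: "point_cover n V" "b : cocycles n F V i"
  and W: "point_cover n W" "!!p. p : proj_space n ==> W p <= U p \<inter> V p"
 shows "(EX z:coboundaries n F W i. refine n F U W i a = cochain_add n F W i (refine n F V W i b) z) \<longleftrightarrow>
  stalk_coboundary n M i W (%l. val U a l - val V b l)"
proof -
 have ac: "a : cochains n F U i" and bc: "b : cochains n F V i" using U V by (auto simp: cocycles_def)
 have ra: "res F (inters U l) (inters W l) (a l) : carrier (sec F (inters W l)) &
   \<Phi> (inters W l) (res F (inters U l) (inters W l) (a l)) = val U a l" if l: "l : simplices n i" for l
  unfolding val_def using ac l W(2)
  by (intro res inters_open[OF U(1) l] inters_open[OF W(1) l] inters_mono[OF _ l]) (auto simp: cochains_def)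
 have rb: "res F (inters V l) (inters W l) (b l) : carrier (sec F (inters W l)) &
   \<Phi> (inters W l) (res F (inters V l) (inters W l) (b l)) = val V b l" if l: "l : simplices n i" for l
  unfolding val_def using bc l W(2)
  by (intro res inters_open[OF V(1) l] inters_open[OF W(1) l] inters_mono[OF _ l]) (auto simp: cochains_def)
 have eq: "refine n F U W i a = cochain_add n F W i (refine n F V W i b) z \<longleftrightarrow>
  (ALL l:simplices n i. val U a l - val V b l = val W z l)"
  if z: "!!l. l : simplices n i ==> z l : carrier (sec F (inters W l))" for z
 proof -
  have "res F (inters U l) (inters W l) (a l) = res F (inters V l) (inters W l) (b l) \<oplus>\<^bsub>sec F (inters W l)\<^esub> z l \<longleftrightarrow>
   val U a l - val V b l = val W z l" if l: "l : simplices n i" for l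
  proof -
   note A = add[OF inters_open[OF W(1) l] conjunct1[OF rb[OF l]] z[OF l]]
   have "res F (inters U l) (inters W l) (a l) = res F (inters V l) (inters W l) (b l) \<oplus>\<^bsub>sec F (inters W l)\<^esub> z l \<longleftrightarrow>
    val U a l = val V b l + val W z l"
    using inj[OF inters_open[OF W(1) l] conjunct1[OF ra[OF l]] conjunct1[OF A]] ra[OF l] rb[OF l] A by (auto simp: val_def)
   thus ?thesis by (simp add: diff_eq_eq add.commute)
  qed
  thus ?thesis unfolding refine_def cochain_add_def restrict_def fun_eq_iff by (auto; metis)
 qed
 show ?thesis
 proof (cases i)
  case 0
  have "val W (\<lambda>l\<in>simplices n 0. \<zero>\<^bsub>sec F (inters W l)\<^esub>) l = 0" if "l : simplices n 0" for l
   using zero[OF inters_open[OF W(1) that]] that by (simp add: val_def)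
  thus ?thesis using eq[of "\<lambda>l\<in>simplices n 0. \<zero>\<^bsub>sec F (inters W l)\<^esub>"] 0 zero[OF inters_open[OF W(1)]]
   by (simp add: coboundaries_def stalk_coboundary_def)
 next
  case (Suc j)
  have cb: "refine n F U W i a = cochain_add n F W i (refine n F V W i b) (coboundary n F W j c) \<longleftrightarrow>
   (ALL l:simplices n i. val U a l - val V b l = dl (val W c) l)" if c: "c : cochains n F W j" for c
   using eq[of "coboundary n F W j c"] val_coboundary[OF W(1) c] Suc by simp
  show ?thesis
  proof
   assume "EX z:coboundaries n F W i. refine n F U W i a = cochain_add n F W i (refine n F V W i b) z"
   then obtain c where c: "c : cochains n F W j" "ALL l:simplices n i. val U a l - val V b l = dl (val W c) l"
    using cb Suc by (auto simp: coboundaries_def)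
   thus "stalk_coboundary n M i W (%l. val U a l - val V b l)"
    unfolding stalk_coboundary_def Suc using val_mem[OF W(1) c(1)] by auto
  next
   assume "stalk_coboundary n M i W (%l. val U a l - val V b l)"
   then obtain e where e: "ALL l:simplices n j. ALL z:inters W l. e l : M z"
    "ALL l:simplices n (Suc j). val U a l - val V b l = dl e l" unfolding stalk_coboundary_def Suc by auto
   obtain c where c: "c : cochains n F W j" "ALL l:simplices n j. val W c l = e l"
    using cochain_exists[OF W(1), of j e] e(1) by blast
   have "dl (val W c) l = dl e l" if "l : simplices n (Suc j)" for l by (rule val_cong[OF _ that]) (use c in auto)
   thus "EX z:coboundaries n F W i. refine n F U W i a = cochain_add n F W i (refine n F V W i b) z"
    using cb[OF c(1)] e(2) c(1) Suc by (auto simp: coboundaries_def)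
  qed
 qed
qed

lemma stalk_coboundary_diff:
 assumes W: "point_cover n W" and f: "stalk_coboundary n M i W f" and g: "stalk_coboundary n M i W g"
 shows "stalk_coboundary n M i W (%l. f l - g l)"
proof (cases i)
 case 0
 thus ?thesis using f g by (simp add: stalk_coboundary_def)
next
 case (Suc j)
 obtain e where e: "ALL l:simplices n j. ALL z:inters W l. e l : M z" "ALL l:simplices n (Suc j). f l = dl e l"
  using f unfolding stalk_coboundary_def Suc by auto
 obtain e' where e': "ALL l:simplices n j. ALL z:inters W l. e' l : M z" "ALL l:simplices n (Suc j). g l = dl e' l"
  using g unfolding stalk_coboundary_def Suc by auto
 have "e l - e' l : M z" if "l : simplices n j" "z : inters W l" for l z
  using that e(1) e'(1) inters_nonempty_subset[OF W that] by (intro Mdiff) auto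
 thus ?thesis unfolding stalk_coboundary_def Suc
  using e(2) e'(2) by (auto intro!: exI[of _ "%l. e l - e' l"] simp: dl_diff)
qed

lemma stalk_coboundary_shrink:
 assumes "stalk_coboundary n M i W f" "!!p. p : proj_space n ==> W' p <= W p"
 shows "stalk_coboundary n M i W' f"
proof (cases i)
 case (Suc j)
 thus ?thesis using assms(1) inters_mono[of n W' W, OF assms(2)] unfolding stalk_coboundary_def by (auto; blast)
qed (use assms(1) in \<open>simp add: stalk_coboundary_def\<close>)

lemma stalk_coboundary_0: "point_cover n W ==> stalk_coboundary n M i W (%l. 0)"
 unfolding stalk_coboundary_def using M0 inters_nonempty_subset[of n W] by (cases i) (auto intro!: exI[of _ "%l. 0"])

lemma cohomologous_mem:
 "((U, a), (V, b)) : cohomologous n F i \<longleftrightarrow>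
  point_cover n U & a : cocycles n F U i & point_cover n V & b : cocycles n F V i &
  (EX W. point_cover n W & (ALL p:proj_space n. W p <= U p \<inter> V p) &
   stalk_coboundary n M i W (%l. val U a l - val V b l))" unfolding cohomologous_def mem_Collect_eq prod.case
 by (intro conj_cong refl ex_cong1) (rule cohomologous_iff; blast)

lemma equiv_cohomologous:
 "equiv {(U, a). point_cover n U & a : cocycles n F U i} (cohomologous n F i)"
proof (rule equivI)
 show "cohomologous n F i <= {(U, a). point_cover n U & a : cocycles n F U i} \<times> {(U, a). point_cover n U & a : cocycles n F U i}"
  unfolding cohomologous_def by blast
 show "refl_on {(U, a). point_cover n U & a : cocycles n F U i} (cohomologous n F i)"
 proof (rule refl_onI)
  fix x assume "x : {(U, a). point_cover n U & a : cocycles n F U i}"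
  then obtain U a where x: "x = (U, a)" "point_cover n U" "a : cocycles n F U i" by blast
  show "(x, x) : cohomologous n F i" unfolding x(1) cohomologous_mem using x stalk_coboundary_0[OF x(2)] by auto
 qed
 show "sym (cohomologous n F i)"
 proof (rule symI)
  fix x y assume xy: "(x, y) : cohomologous n F i"
  obtain U a V b where x: "x = (U, a)" and y: "y = (V, b)" by (metis prod.exhaust)
  obtain W where W: "point_cover n W" "ALL p:proj_space n. W p <= U p \<inter> V p"
   "stalk_coboundary n M i W (%l. val U a l - val V b l)" using xy unfolding x y cohomologous_mem by blast
  have "stalk_coboundary n M i W (%l. val V b l - val U a l)"
   using stalk_coboundary_diff[OF W(1) stalk_coboundary_0[OF W(1)] W(3)] by simp
  thus "(y, x) : cohomologous n F i" using xy W(1,2) unfolding x y cohomologous_mem by blast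
 qed
 show "trans (cohomologous n F i)"
 proof (rule transI)
  fix x y w assume xy: "(x, y) : cohomologous n F i" and yw: "(y, w) : cohomologous n F i"
  obtain U a V b X c where x: "x = (U, a)" and y: "y = (V, b)" and w: "w = (X, c)" by (metis prod.exhaust)
  obtain W where W: "point_cover n W" "ALL p:proj_space n. W p <= U p \<inter> V p"
   "stalk_coboundary n M i W (%l. val U a l - val V b l)" using xy unfolding x y cohomologous_mem by blast
  obtain W' where W': "point_cover n W'" "ALL p:proj_space n. W' p <= V p \<inter> X p"
   "stalk_coboundary n M i W' (%l. val V b l - val X c l)" using yw unfolding y w cohomologous_mem by blast
  define Y where "Y p = W p \<inter> W' p" for p
  have Y: "point_cover n Y" using W(1) W'(1) unfolding point_cover_def Y_def by (auto intro: zariski_open_Int)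
  have "stalk_coboundary n M i Y (%l. val U a l - val V b l)" "stalk_coboundary n M i Y (%l. val V b l - val X c l)"
   by (rule stalk_coboundary_shrink[OF W(3)], simp add: Y_def) (rule stalk_coboundary_shrink[OF W'(3)], simp add: Y_def)
  hence "stalk_coboundary n M i Y (%l. (val U a l - val V b l) - (0 - (val V b l - val X c l)))"
   by (rule stalk_coboundary_diff[OF Y _ stalk_coboundary_diff[OF Y stalk_coboundary_0[OF Y]]])
  hence "stalk_coboundary n M i Y (%l. val U a l - val X c l)" by (simp add: algebra_simps)
  moreover have "ALL p:proj_space n. Y p <= U p \<inter> X p" using W(2) W'(2) unfolding Y_def by blast
  ultimately show "(x, w) : cohomologous n F i" using xy yw Y unfolding x y w cohomologous_mem by blast
 qed
qed

text \<open>There is a single class exactly when every cocycle is related to the zero cocycle of the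
  trivial cover, and in terms of values this means that it becomes a coboundary on a
  refinement.\<close>

theorem cohomology_vanishes_iff: "cohomology_vanishes n F i \<longleftrightarrow> stalk_vanishing n M i"
proof -
 let ?A = "{(U, a). point_cover n U & a : cocycles n F U i}" and ?R = "cohomologous n F i"
 define P where "P = (%_::point. proj_space n)"
 define z where "z = (\<lambda>l\<in>simplices n i. \<zero>\<^bsub>sec F (proj_space n)\<^esub>)"
 have P: "point_cover n P" unfolding point_cover_def P_def using zariski_open_proj by auto
 have iP: "inters P l = proj_space n" if "l : simplices n k" for l k
  using that by (auto simp: inters_def P_def simplices_def)
 have z0: "val P z l = 0" "z l : carrier (sec F (inters P l))" if l: "l : simplices n i" for l
  using zero[OF inters_open[OF P l]] l iP[OF l] by (simp_all add: val_def z_def)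
 have zc: "z : cocycles n F P i" unfolding cocycles_iff[OF P]
 proof (intro conjI ballI)
  show "z : cochains n F P i" using z0(2) unfolding cochains_def by (auto simp: z_def)
  fix l assume l: "l : simplices n (Suc i)"
  have "dl (val P z) l = dl (%l. 0) l" by (rule val_cong[OF _ l]) (use z0 in auto)
  thus "dl (val P z) l = 0" by simp
 qed
 have R: "((P, z), (U, a)) : ?R \<longleftrightarrow> (EX W. point_cover n W & (ALL p:proj_space n. W p <= U p) & stalk_coboundary n M i W (val U a))"
  if U: "point_cover n U" "a : cocycles n F U i" for U a
 proof -
  have "((P, z), (U, a)) : ?R \<longleftrightarrow> ((U, a), (P, z)) : ?R" using equiv_cohomologous[of i] unfolding equiv_def sym_def by blast
  also have "\<dots> \<longleftrightarrow> (EX W. point_cover n W & (ALL p:proj_space n. W p <= U p) & stalk_coboundary n M i W (%l. val U a l - val P z l))"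
  proof -
   have "(ALL p:proj_space n. W p <= U p \<inter> P p) \<longleftrightarrow> (ALL p:proj_space n. W p <= U p)" if "point_cover n W" for W
    using that zariski_open_subset unfolding point_cover_def P_def openin_zariski by (intro ball_cong refl) blast
   thus ?thesis unfolding cohomologous_mem using U P zc by (simp cong: conj_cong)
  qed
  also have "(%W. stalk_coboundary n M i W (%l. val U a l - val P z l)) = (%W. stalk_coboundary n M i W (val U a))"
   unfolding stalk_coboundary_def by (cases i) (simp_all add: z0)
  finally show ?thesis .
 qed
 have "cohomology_vanishes n F i \<longleftrightarrow> ?A // ?R = {?R `` {(P, z)}}"
  unfolding cohomology_vanishes_def cohomology_def by (simp add: P_def z_def)
 also have "\<dots> \<longleftrightarrow> (ALL x:?A. ((P, z), x) : ?R)"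
 proof
  assume eq: "?A // ?R = {?R `` {(P, z)}}"
  show "ALL x:?A. ((P, z), x) : ?R"
  proof
   fix x assume x: "x : ?A"
   hence "?R `` {x} = ?R `` {(P, z)}" using quotientI[OF x, of ?R] eq by blast
   thus "((P, z), x) : ?R" using equiv_class_self[OF equiv_cohomologous x] by blast
  qed
 next
  assume all: "ALL x:?A. ((P, z), x) : ?R"
  have "?R `` {x} = ?R `` {(P, z)}" if "x : ?A" for x using equiv_class_eq[OF equiv_cohomologous bspec[OF all that]] by simp
  moreover have "(P, z) : ?A" using P zc by simp
  ultimately show "?A // ?R = {?R `` {(P, z)}}" unfolding quotient_def by blast
 qed
 also have "\<dots> \<longleftrightarrow> (ALL U a. point_cover n U --> a : cocycles n F U i -->
   (EX W. point_cover n W & (ALL p:proj_space n. W p <= U p) & stalk_coboundary n M i W (val U a)))"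
  using R by auto
 also have "\<dots> \<longleftrightarrow> stalk_vanishing n M i" unfolding stalk_vanishing_alt
 proof (intro iffI allI impI)
  fix W a assume H: "ALL U a. point_cover n U --> a : cocycles n F U i -->
   (EX W. point_cover n W & (ALL p:proj_space n. W p <= U p) & stalk_coboundary n M i W (val U a))"
   and W: "point_cover n W" and a: "ALL l:simplices n i. ALL z:inters W l. a l : M z" and da: "ALL l:simplices n (Suc i). dl a l = 0"
  obtain c where c: "c : cochains n F W i" "ALL l:simplices n i. val W c l = a l"
   using cochain_exists[OF W, of i a] a by blast
  have "dl (val W c) l = 0" if l: "l : simplices n (Suc i)" for l using val_cong[OF _ l, of "val W c" a] c(2) da l by simp
  hence "c : cocycles n F W i" using c(1) cocycles_iff[OF W] by blast
  then obtain W' where W': "point_cover n W'" "ALL p:proj_space n. W' p <= W p" "stalk_coboundary n M i W' (val W c)"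
   using H W by blast
  have "stalk_coboundary n M i W' a" using W'(3) c(2) unfolding stalk_coboundary_def by (cases i) simp_all
  thus "EX W'. point_cover n W' & (ALL q:proj_space n. W' q <= W q) & stalk_coboundary n M i W' a"
   using W' by blast
 next
  fix U a assume H: "ALL W a. point_cover n W -->
   (ALL l:simplices n i. ALL z:inters W l. a l : M z) --> (ALL l:simplices n (Suc i). dl a l = 0) -->
   (EX W'. point_cover n W' & (ALL q:proj_space n. W' q <= W q) & stalk_coboundary n M i W' a)"
   and U: "point_cover n U" and a: "a : cocycles n F U i"
  thus "EX W. point_cover n W & (ALL p:proj_space n. W p <= U p) & stalk_coboundary n M i W (val U a)"
   using cocycles_iff[OF U, of a i] val_mem[OF U, of a i] by simp
 qed
 finally show ?thesis .
qed

end

section \<open>Linear models of sheaves\<close>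

lemma isO_loc: "isO n t U f x ==> q : U ==> x : loc n t q"
 and isO_eval: "isO n t U f x ==> q : U ==> v : q ==> f v = evk x v"
 unfolding isO_def by auto

lemma isO_add:
 assumes "zariski_open n U" "isO n t U f x" "isO n t U g y"
  "!!q v. q : U ==> v : q ==> h v = f v + g v"
 shows "isO n t U h (x + y)" unfolding isO_def
proof (intro ballI conjI)
 fix q assume q: "q : U"
 note l = isO_loc[OF assms(2) q] isO_loc[OF assms(3) q]
 show "x + y : loc n t q" by (rule loc_add[OF l])
 fix v assume v: "v : q"
 have "q : proj_space n" using zariski_open_subset[OF assms(1)] q by blast
 from evk_add[OF l this v] show "h v = evk (x + y) v"
  using assms(4)[OF q v] isO_eval[OF assms(2) q v] isO_eval[OF assms(3) q v] by simp
qed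

lemma isO_mult:
 assumes "zariski_open n U" "isO n s U f x" "isO n t U g y"
  "!!q v. q : U ==> v : q ==> h v = f v * g v"
 shows "isO n (s + t) U h (x * y)" unfolding isO_def
proof (intro ballI conjI)
 fix q assume q: "q : U"
 note l = isO_loc[OF assms(2) q] isO_loc[OF assms(3) q]
 show "x * y : loc n (s + t) q" by (rule loc_mult[OF l])
 fix v assume v: "v : q"
 have "q : proj_space n" using zariski_open_subset[OF assms(1)] q by blast
 from evk_mult[OF l this v] show "h v = evk (x * y) v"
  using assms(4)[OF q v] isO_eval[OF assms(2) q v] isO_eval[OF assms(3) q v] by simp
qed

section \<open>Regular functions and sections of twists as field elements\<close>

context
 fixes n :: nat and U :: "point set"
 assumes U: "zariski_open n U" "U ~= {}"
begin

lemma line_through_point: "q : U ==> v : q ==> line_through v = q"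
 using line_through_mem[of q n v] zariski_open_subset[OF U(1)] by blast

lemma O_carrierI:
 assumes "h : extensional (\<Union>U)" "isO n t U h x"
 shows "h : Sec (O_twist n t) U" "iO n t U h = x"
proof -
 have "h = (\<lambda>v\<in>\<Union>U. evk x v)" using assms isO_eval[OF assms(2)] by (intro ext) (auto simp: extensional_def)
 thus "h : Sec (O_twist n t) U" using isO_O_twist_carrier(1)[OF U(1), of x t] isO_loc[OF assms(2)] by simp
 show "iO n t U h = x" by (rule iO_eqI[OF U assms(2)])
qed

lemma O_extensional: "f : Sec (O_twist n t) U ==> f : extensional (\<Union>U)"
 by (simp add: O_twist_def)

lemma iO_loc: "f : Sec (O_twist n t) U ==> q : U ==> iO n t U f : loc n t q"
 using isO_loc[OF O_twist_carrier_isO[OF U]] by blast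

lemma iO_inj:
 assumes "f : Sec (O_twist n t) U" "g : Sec (O_twist n t) U" "iO n t U f = iO n t U g"
 shows "f = g"
proof
 fix v show "f v = g v"
 proof (cases "v : \<Union>U")
  case True
  thus ?thesis using isO_eval[OF O_twist_carrier_isO[OF U assms(1)]] isO_eval[OF O_twist_carrier_isO[OF U assms(2)]] assms(3)
   by auto
 next
  case False
  thus ?thesis using O_extensional[OF assms(1)] O_extensional[OF assms(2)] by (simp add: extensional_def)
 qed
qed

lemma iO_surj: "(!!q. q : U ==> x : loc n t q) ==> EX f:Sec (O_twist n t) U. iO n t U f = x"
 using isO_O_twist_carrier[OF U(1), of x t] iO_eqI[OF U] by blast

lemma iO_add:
 assumes "f : Sec (O_twist n t) U" "g : Sec (O_twist n t) U"
 shows "f \<oplus>\<^bsub>sec (O_twist n t) U\<^esub> g : Sec (O_twist n t) U"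
  "iO n t U (f \<oplus>\<^bsub>sec (O_twist n t) U\<^esub> g) = iO n t U f + iO n t U g"
proof -
 have "isO n t U (f \<oplus>\<^bsub>sec (O_twist n t) U\<^esub> g) (iO n t U f + iO n t U g)"
  by (rule isO_add[OF U(1) O_twist_carrier_isO[OF U assms(1)] O_twist_carrier_isO[OF U assms(2)]])
   (auto simp: O_twist_def)
 moreover have "f \<oplus>\<^bsub>sec (O_twist n t) U\<^esub> g : extensional (\<Union>U)" by (simp add: O_twist_def)
 ultimately show "f \<oplus>\<^bsub>sec (O_twist n t) U\<^esub> g : Sec (O_twist n t) U"
  "iO n t U (f \<oplus>\<^bsub>sec (O_twist n t) U\<^esub> g) = iO n t U f + iO n t U g" by (auto intro: O_carrierI)
qed

lemma iR_isO: "a : Reg n U ==> isO n 0 U (%v. a (line_through v)) (iR n U a)"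
 by (rule reg_ring_isO[OF U])

lemma iR_loc: "a : Reg n U ==> q : U ==> iR n U a : loc n 0 q"
 by (rule isO_loc[OF iR_isO])

lemma iO_smult:
 assumes "a : Reg n U" "f : Sec (O_twist n t) U"
 shows "a \<odot>\<^bsub>sec (O_twist n t) U\<^esub> f : Sec (O_twist n t) U"
  "iO n t U (a \<odot>\<^bsub>sec (O_twist n t) U\<^esub> f) = iR n U a * iO n t U f"
proof -
 have "isO n (0 + t) U (a \<odot>\<^bsub>sec (O_twist n t) U\<^esub> f) (iR n U a * iO n t U f)"
  by (rule isO_mult[OF U(1) iR_isO[OF assms(1)] O_twist_carrier_isO[OF U assms(2)]])
   (auto simp: O_twist_def)
 moreover have "a \<odot>\<^bsub>sec (O_twist n t) U\<^esub> f : extensional (\<Union>U)" by (simp add: O_twist_def)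
 ultimately show "a \<odot>\<^bsub>sec (O_twist n t) U\<^esub> f : Sec (O_twist n t) U"
  "iO n t U (a \<odot>\<^bsub>sec (O_twist n t) U\<^esub> f) = iR n U a * iO n t U f" by (auto intro: O_carrierI)
qed

lemma R_carrierI:
 assumes "h : extensional U" "isO n 0 U (%v. h (line_through v)) x"
 shows "h : Reg n U" "iR n U h = x"
proof -
 have "h = (\<lambda>q\<in>U. evk x (rp q))"
 proof
  fix q show "h q = (\<lambda>q\<in>U. evk x (rp q)) q"
  proof (cases "q : U")
   case True
   hence "rp q : q" using rp_mem zariski_open_subset[OF U(1)] by blast
   thus ?thesis using isO_eval[OF assms(2) True] line_through_point[OF True] True by auto
  qed (use assms(1) in \<open>simp add: extensional_def\<close>)
 qed
 thus "h : Reg n U" using isO_reg_ring_carrier(1)[OF U(1), of x] isO_loc[OF assms(2)] by simp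
 show "iR n U h = x" unfolding iR_def by (rule iO_eqI[OF U assms(2)])
qed

lemma iR_eval: "a : Reg n U ==> q : U ==> a q = evk (iR n U a) (rp q)"
 using isO_eval[OF iR_isO, of a q "rp q"] rp_mem[of q n] zariski_open_subset[OF U(1)] line_through_point[of q "rp q"] by auto

lemma R_extensional: "a : Reg n U ==> a : extensional U" by (simp add: reg_ring_def)

lemma iR_inj: "a : Reg n U ==> b : Reg n U ==> iR n U a = iR n U b ==> a = b"
 by (rule extensionalityI[of _ U]) (simp_all add: R_extensional iR_eval)

lemma iR_surj: "(!!q. q : U ==> x : loc n 0 q) ==> EX a:Reg n U. iR n U a = x"
 using isO_reg_ring_carrier[OF U(1), of x] R_carrierI(2)[of "\<lambda>q\<in>U. evk x (rp q)" x] by blast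

lemma iR_add:
 assumes "a : Reg n U" "b : Reg n U"
 shows "a \<oplus>\<^bsub>reg_ring n U\<^esub> b : Reg n U" "iR n U (a \<oplus>\<^bsub>reg_ring n U\<^esub> b) = iR n U a + iR n U b"
proof -
 have "isO n 0 U (%v. (a \<oplus>\<^bsub>reg_ring n U\<^esub> b) (line_through v)) (iR n U a + iR n U b)"
  by (rule isO_add[OF U(1) iR_isO[OF assms(1)] iR_isO[OF assms(2)]]) (simp add: reg_ring_def line_through_point)
 moreover have "a \<oplus>\<^bsub>reg_ring n U\<^esub> b : extensional U" by (simp add: reg_ring_def)
 ultimately show "a \<oplus>\<^bsub>reg_ring n U\<^esub> b : Reg n U" "iR n U (a \<oplus>\<^bsub>reg_ring n U\<^esub> b) = iR n U a + iR n U b"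
  by (auto intro: R_carrierI)
qed

lemma iR_mult:
 assumes "a : Reg n U" "b : Reg n U"
 shows "a \<otimes>\<^bsub>reg_ring n U\<^esub> b : Reg n U" "iR n U (a \<otimes>\<^bsub>reg_ring n U\<^esub> b) = iR n U a * iR n U b"
proof -
 have "isO n (0 + 0) U (%v. (a \<otimes>\<^bsub>reg_ring n U\<^esub> b) (line_through v)) (iR n U a * iR n U b)"
  by (rule isO_mult[OF U(1) iR_isO[OF assms(1)] iR_isO[OF assms(2)]]) (simp add: reg_ring_def line_through_point)
 moreover have "a \<otimes>\<^bsub>reg_ring n U\<^esub> b : extensional U" by (simp add: reg_ring_def)
 ultimately show "a \<otimes>\<^bsub>reg_ring n U\<^esub> b : Reg n U" "iR n U (a \<otimes>\<^bsub>reg_ring n U\<^esub> b) = iR n U a * iR n U b"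
  by (auto intro: R_carrierI)
qed

lemma iR_one: "\<one>\<^bsub>reg_ring n U\<^esub> : Reg n U" "iR n U \<one>\<^bsub>reg_ring n U\<^esub> = 1"
 and iR_zero: "\<zero>\<^bsub>reg_ring n U\<^esub> : Reg n U" "iR n U \<zero>\<^bsub>reg_ring n U\<^esub> = 0"
proof -
 have 1: "isO n 0 U (%v. \<one>\<^bsub>reg_ring n U\<^esub> (line_through v)) 1"
  unfolding isO_def by (simp add: reg_ring_def line_through_point loc_1)
 have 0: "isO n 0 U (%v. \<zero>\<^bsub>reg_ring n U\<^esub> (line_through v)) 0"
  unfolding isO_def using zariski_open_subset[OF U(1)] by (auto simp: reg_ring_def line_through_point)
 have "\<one>\<^bsub>reg_ring n U\<^esub> : extensional U" "\<zero>\<^bsub>reg_ring n U\<^esub> : extensional U" by (simp_all add: reg_ring_def)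
 thus "\<one>\<^bsub>reg_ring n U\<^esub> : Reg n U" "iR n U \<one>\<^bsub>reg_ring n U\<^esub> = 1"
  "\<zero>\<^bsub>reg_ring n U\<^esub> : Reg n U" "iR n U \<zero>\<^bsub>reg_ring n U\<^esub> = 0"
  using R_carrierI[OF _ 1] R_carrierI[OF _ 0] by auto
qed

end

lemma iO_restrict:
 assumes U: "zariski_open n U" and V: "zariski_open n V" "V ~= {}" "V <= U" and f: "f : Sec (O_twist n t) U"
 shows "restrict f (\<Union>V) : Sec (O_twist n t) V" "iO n t V (restrict f (\<Union>V)) = iO n t U f"
proof -
 have "U ~= {}" using V by auto
 note i = O_twist_carrier_isO[OF U this f]
 have "isO n t V (restrict f (\<Union>V)) (iO n t U f)" unfolding isO_def
 proof (intro ballI conjI)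
  fix q assume q: "q : V"
  hence qU: "q : U" using V(3) by blast
  show "iO n t U f : loc n t q" by (rule isO_loc[OF i qU])
  fix v assume v: "v : q"
  hence "v : \<Union>V" using q by blast
  thus "restrict f (\<Union>V) v = evk (iO n t U f) v" using isO_eval[OF i qU v] by simp
 qed
 thus "restrict f (\<Union>V) : Sec (O_twist n t) V" "iO n t V (restrict f (\<Union>V)) = iO n t U f"
  by (auto intro: O_carrierI[OF V(1,2)])
qed

lemma iR_restrict:
 assumes U: "zariski_open n U" and V: "zariski_open n V" "V ~= {}" "V <= U" and a: "a : Reg n U"
 shows "restrict a V : Reg n V" "iR n V (restrict a V) = iR n U a"
proof -
 have "U ~= {}" using V by auto
 note i = iR_isO[OF U this a]
 have "isO n 0 V (%v. restrict a V (line_through v)) (iR n U a)" unfolding isO_def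
 proof (intro ballI conjI)
  fix q assume q: "q : V"
  hence qU: "q : U" using V(3) by blast
  show "iR n U a : loc n 0 q" by (rule isO_loc[OF i qU])
  fix v assume v: "v : q"
  show "restrict a V (line_through v) = evk (iR n U a) v"  using isO_eval[OF i qU v] line_through_point[OF V(1,2) q v] q by simp
 qed
 thus "restrict a V : Reg n V" "iR n V (restrict a V) = iR n U a" by (auto intro: R_carrierI[OF V(1,2)])
qed

lemma reg_ring_empty: "Reg n {} = {%_. undefined}" by (auto simp: reg_ring_def regular_fun_def)

lemma cring_reg_ring:
 assumes U: "zariski_open n U" "U ~= {}"
 shows "cring (reg_ring n U)"
proof (rule cringI)
 note S = iR_add[OF U] iR_mult[OF U] iR_one[OF U] iR_zero[OF U]
 show "abelian_group (reg_ring n U)"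
 proof (rule abelian_groupI)
  fix x assume x: "x : Reg n U"
  have "EX y:Reg n U. iR n U y = - iR n U x"
   by (rule iR_surj[OF U]) (use iR_loc[OF U x] loc_uminus in blast)
  then obtain y where "y : Reg n U" "iR n U y = - iR n U x" by blast
  thus "EX y:Reg n U. y \<oplus>\<^bsub>reg_ring n U\<^esub> x = \<zero>\<^bsub>reg_ring n U\<^esub>"
   using x by (intro bexI[of _ y]) (auto intro!: iR_inj[OF U] simp: S)
 qed (auto intro!: iR_inj[OF U] simp: S algebra_simps)
 show "comm_monoid (reg_ring n U)" by (rule comm_monoidI) (auto intro!: iR_inj[OF U] simp: S algebra_simps)
qed (auto intro!: iR_inj[OF U] simp: iR_add[OF U] iR_mult[OF U] algebra_simps)

lemma cring_reg_ring_empty: "cring (reg_ring n {})"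
proof -
 define R where "R = reg_ring n {}"
 define u :: "point => complex" where "u = (%_. undefined)"
 have c: "carrier R = {u}" by (simp add: R_def u_def reg_ring_empty)
 have o: "x \<oplus>\<^bsub>R\<^esub> y = u" "x \<otimes>\<^bsub>R\<^esub> y = u" "\<zero>\<^bsub>R\<^esub> = u" "\<one>\<^bsub>R\<^esub> = u" for x y
  by (simp_all add: R_def u_def reg_ring_def restrict_def)
 have "cring R" by (intro cringI abelian_groupI comm_monoidI) (simp_all add: c o)
 thus ?thesis by (simp add: R_def)
qed

lemma zariski_open_empty: "zariski_open n {}" using openin_empty[of "zariski n"] by simp

text \<open>Adds to \<open>stalk_model\<close> the scalars and the empty open set, over which
  \<open>\<Phi>\<close> says nothing while the sheaf axioms force the zero module.\<close>

locale linear_model = stalk_model n F M \<Phi>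
 for n and F :: "'a presheaf" and M :: "point => rat2 set" and \<Phi> +
 assumes smult: "zariski_open n U ==> U ~= {} ==> a : Reg n U ==> s : Sec F U ==>
   a \<odot>\<^bsub>sec F U\<^esub> s : Sec F U & \<Phi> U (a \<odot>\<^bsub>sec F U\<^esub> s) = sm (iR n U a) (\<Phi> U s)"
  and empty: "carrier (sec F {}) = {\<zero>\<^bsub>sec F {}\<^esub>}" "\<zero>\<^bsub>sec F {}\<^esub> \<oplus>\<^bsub>sec F {}\<^esub> \<zero>\<^bsub>sec F {}\<^esub> = \<zero>\<^bsub>sec F {}\<^esub>"
   "a : Reg n {} ==> a \<odot>\<^bsub>sec F {}\<^esub> \<zero>\<^bsub>sec F {}\<^esub> = \<zero>\<^bsub>sec F {}\<^esub>"
  and empty_res: "zariski_open n U ==> s : Sec F U ==> res F U {} s = \<zero>\<^bsub>sec F {}\<^esub>"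
begin

lemma module_sec:
 assumes U: "zariski_open n U"
 shows "Module.module (reg_ring n U) (sec F U)"
proof (cases "U = {}")
 case True
 have ag: "abelian_group (sec F {})" by (rule abelian_groupI) (auto simp: empty)
 have "a = (%_. undefined)" if "a : Reg n {}" for a using that by (simp add: reg_ring_empty)
 show ?thesis unfolding True using cring.axioms(1)[OF cring_reg_ring_empty[of n]]
  by (intro moduleI cring_reg_ring_empty ag) (auto simp: empty ring.ring_simprules)
next
 case False
 note O = U False
 note cl = conjunct1[OF add[OF O]] conjunct1[OF smult[OF O]] iR_add(1)[OF O] iR_mult(1)[OF O] iR_one(1)[OF O]
  and v = conjunct2[OF add[OF O]] conjunct2[OF smult[OF O]] iR_add(2)[OF O] iR_mult(2)[OF O] iR_one(2)[OF O]
 show ?thesis by (intro moduleI cring_reg_ring[OF O] abelian[OF O])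
   (auto intro!: inj[OF O] simp: cl v K2.scale_left_distrib K2.scale_right_distrib)
qed

lemma res_closed: 
 assumes "zariski_open n U" "zariski_open n V" "V <= U" "s : Sec F U"
 shows "res F U V s : Sec F V"
 using res[OF assms(1,2) _ assms(3,4)] empty_res[OF assms(1,4)] empty(1) by (cases "V = {}") auto

lemma eq_onI:
 assumes "zariski_open n V" "s : Sec F V" "t : Sec F V" "V ~= {} ==> \<Phi> V s = \<Phi> V t"
 shows "s = t" using inj[OF assms(1) _ assms(2,3)] assms empty(1) by (cases "V = {}") auto

text \<open>Sections over non-empty members of a cover that agree on overlaps have one common value,
  since the overlaps are non-empty. This value lies in all stalks and so belongs to a section over
  the union.\<close>

theorem sheaf: "sheaf_of_modules n F"
proof -
 have presheaf: "presheaf_of_modules n F" unfolding presheaf_of_modules_def openin_zariski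
 proof (intro conjI allI impI ballI)
  fix U s assume U: "zariski_open n U" and s: "s : Sec F U"
  show "res F U U s = s" by (rule eq_onI[OF U]) (use res[OF U U _ _ s] res_closed[OF U U _ s] s in auto)
 next
  fix U V assume U: "zariski_open n U" "zariski_open n V" "V <= U"
  note rc = res_closed[OF U]
  interpret A: Module.module "reg_ring n U" "sec F U" by (rule module_sec[OF U(1)])
  interpret B: Module.module "reg_ring n V" "sec F V" by (rule module_sec[OF U(2)])
  fix s assume s: "s : Sec F U"
  show "res F U V s : Sec F V" by (rule rc[OF s])
  {
   fix t assume t: "t : Sec F U"
   show "res F U V (s \<oplus>\<^bsub>sec F U\<^esub> t) = res F U V s \<oplus>\<^bsub>sec F V\<^esub> res F U V t"
   proof (rule eq_onI[OF U(2)])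
    assume V: "V ~= {}"
    hence "U ~= {}" using U by auto
    thus "\<Phi> V (res F U V (s \<oplus>\<^bsub>sec F U\<^esub> t)) = \<Phi> V (res F U V s \<oplus>\<^bsub>sec F V\<^esub> res F U V t)"
     using res[OF U(1,2) V U(3)] s t add[OF U(1)] add[OF U(2) V] by simp
   qed (use s t rc in auto)
  }
  {
   fix a assume a: "a : Reg n U"
   have ra: "restrict a V : Reg n V"
    using iR_restrict(1)[OF U(1,2) _ U(3) a] by (cases "V = {}") (auto simp: reg_ring_empty restrict_def)
   show "res F U V (a \<odot>\<^bsub>sec F U\<^esub> s) = restrict a V \<odot>\<^bsub>sec F V\<^esub> res F U V s"
   proof (rule eq_onI[OF U(2)])
    assume V: "V ~= {}"
    hence "U ~= {}" using U by auto
    thus "\<Phi> V (res F U V (a \<odot>\<^bsub>sec F U\<^esub> s)) = \<Phi> V (restrict a V \<odot>\<^bsub>sec F V\<^esub> res F U V s)"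
     using res[OF U(1,2) V U(3)] s smult[OF U(1) _ a s] smult[OF U(2) V ra rc[OF s]] iR_restrict[OF U(1,2) V U(3) a] by simp
   qed (use s a ra rc in auto)
  }
  {
   fix W assume W: "zariski_open n W" "W <= V"
   have WU: "W <= U" using W U by auto
   show "res F V W (res F U V s) = res F U W s"
   proof (rule eq_onI[OF W(1)])
    assume "W ~= {}"
    moreover from this have "V ~= {}" using W by auto
    ultimately show "\<Phi> W (res F V W (res F U V s)) = \<Phi> W (res F U W s)"
     using res[OF U(2) W(1) _ W(2) rc[OF s]] res[OF U(1,2) _ U(3) s] res[OF U(1) W(1) _ WU s] by simp
   qed (use res_closed[OF U(2) W rc[OF s]] res_closed[OF U(1) W(1) WU s] in auto)
  }
 qed (rule module_sec)
 show ?thesis unfolding sheaf_of_modules_def openin_zariski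
 proof (intro conjI presheaf allI impI ballI)
  fix K s t assume K: "ALL U:K. zariski_open n U" and s: "s : carrier (sec F (\<Union>K))" and t: "t : carrier (sec F (\<Union>K))"
   and eq: "ALL U:K. res F (\<Union>K) U s = res F (\<Union>K) U t"
  have O: "zariski_open n (\<Union>K)" using openin_Union[of K "zariski n"] K by simp
  show "s = t"
  proof (rule eq_onI[OF O s t])
   assume "\<Union>K ~= {}"
   then obtain U where U: "U : K" "U ~= {}" by blast
   hence o: "zariski_open n U" "U <= \<Union>K" using K by auto
   show "\<Phi> (\<Union>K) s = \<Phi> (\<Union>K) t" using res[OF O o(1) U(2) o(2)] s t eq U(1) by metis
  qed
 next
  fix K s assume K: "ALL U:K. zariski_open n U" and s: "ALL U:K. s U : Sec F U"
   and eq: "ALL U:K. ALL V:K. res F U (U \<inter> V) (s U) = res F V (U \<inter> V) (s V)"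
  have O: "zariski_open n (\<Union>K)" using openin_Union[of K "zariski n"] K by simp
  show "EX t:carrier (sec F (\<Union>K)). ALL U:K. res F (\<Union>K) U t = s U"
  proof (cases "\<Union>K = {}")
   case True
   have "res F {} U \<zero>\<^bsub>sec F {}\<^esub> = s U" if U: "U : K" for U
   proof -
    have e: "U = {}" using True U by blast
    have "s U : Sec F U" using s U by blast
    thus ?thesis unfolding e using empty(1) empty_res[OF zariski_open_empty, of "\<zero>\<^bsub>sec F {}\<^esub>"] by simp
   qed
   thus ?thesis unfolding True using empty(1) by blast
  next
   case False
   then obtain U where U: "U : K" "U ~= {}" by blast
   have val: "\<Phi> V (s V) = \<Phi> U (s U)" if V: "V : K" "V ~= {}" for V
   proof -
    have o: "zariski_open n U" "zariski_open n V" using K U V by auto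
    have ne: "U \<inter> V ~= {}" by (rule zariski_irreducible[OF o U(2) V(2)])
    note r = res[OF o(1) zariski_open_Int[OF o] ne Int_lower1] res[OF o(2) zariski_open_Int[OF o] ne Int_lower2]
    show ?thesis using r(1)[of "s U"] r(2)[of "s V"] s eq U(1) V(1) by metis
   qed
   have "EX t:carrier (sec F (\<Union>K)). \<Phi> (\<Union>K) t = \<Phi> U (s U)"
   proof (rule surj[OF O False])
    fix z assume "z : \<Union>K"
    then obtain V where V: "V : K" "z : V" by blast
    thus "\<Phi> U (s U) : M z" using M_values[of V z "s V"] val[of V] K s by (metis empty_iff)
   qed
   then obtain t where t: "t : carrier (sec F (\<Union>K))" "\<Phi> (\<Union>K) t = \<Phi> U (s U)" by blast
   have "res F (\<Union>K) V t = s V" if V: "V : K" for V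
   proof (rule eq_onI)
    show o: "zariski_open n V" using K V by blast
    have sub: "V <= \<Union>K" using V by blast
    show "res F (\<Union>K) V t : Sec F V" by (rule res_closed[OF O o sub t(1)])
    show "s V : Sec F V" using s V by blast
    assume "V ~= {}"
    thus "\<Phi> V (res F (\<Union>K) V t) = \<Phi> V (s V)" using res[OF O o _ sub t(1)] val[OF V] t(2) by simp
   qed
   thus ?thesis using t(1) by blast
  qed
 qed
qed

end

text \<open>One linear map of values that matches the stalks gives the isomorphism over all open
  sets at once. Injectivity is asked on the stalks, so a coordinate functional qualifies when these
  lie in a line.\<close>

lemma linear_model_iso:
 assumes F: "linear_model n F M \<Phi>" and G: "linear_model n G N \<Gamma>"
  and T: "!!U x. zariski_open n U ==> U ~= {} ==> U <= X ==> (ALL z:U. x : M z) ==> ALL z:U. T x : N z"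
   "!!U y. zariski_open n U ==> U ~= {} ==> U <= X ==> (ALL z:U. y : N z) ==> EX x. (ALL z:U. x : M z) & T x = y"
   "!!z x y. z : X ==> x : M z ==> y : M z ==> T x = T y ==> x = y"
   "!!x y. T (x + y) = T x + T y" "!!a x. T (sm a x) = sm a (T x)"
 shows "isomorphic_on n X F G"
proof -
 interpret F: linear_model n F M \<Phi> by (rule F)
 interpret G: linear_model n G N \<Gamma> by (rule G)
 define \<phi> where "\<phi> U s = (if U = {} then \<zero>\<^bsub>sec G {}\<^esub> else inv_into (Sec G U) (\<Gamma> U) (T (\<Phi> U s)))" for U s
 have v: "\<phi> U s : Sec G U & (U ~= {} --> \<Gamma> U (\<phi> U s) = T (\<Phi> U s))"
  if U: "zariski_open n U" "U <= X" "s : Sec F U" for U s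
 proof (cases "U = {}")
  case True
  thus ?thesis using G.empty(1) by (simp add: \<phi>_def)
 next
  case False
  have "ALL z:U. \<Phi> U s : M z" using F.M_values[OF U(1)] U by blast
  hence "EX t:Sec G U. \<Gamma> U t = T (\<Phi> U s)" using G.surj[OF U(1) False] T(1)[OF U(1) False U(2)] by blast
  hence "T (\<Phi> U s) : \<Gamma> U ` Sec G U" by (metis imageI)
  from inv_into_into[OF this] f_inv_into_f[OF this] show ?thesis using False by (simp add: \<phi>_def)
 qed
 have "is_iso_on n X F G \<phi>" unfolding is_iso_on_def openin_zariski
 proof (intro allI impI conjI ballI)
  fix U assume U: "zariski_open n U" "U <= X"
  note vU = v[OF U]
  interpret A: Module.module "reg_ring n U" "sec F U" by (rule F.module_sec[OF U(1)])
  interpret B: Module.module "reg_ring n U" "sec G U" by (rule G.module_sec[OF U(1)])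
  show "bij_betw (\<phi> U) (Sec F U) (Sec G U)"
  proof (rule bij_betw_imageI)
   show "inj_on (\<phi> U) (Sec F U)"
   proof (rule inj_onI)
    fix s t assume s: "s : Sec F U" and t: "t : Sec F U" and eq: "\<phi> U s = \<phi> U t"
    show "s = t"
    proof (rule F.eq_onI[OF U(1) s t])
     assume ne: "U ~= {}"
     then obtain z where z: "z : U" by blast
     show "\<Phi> U s = \<Phi> U t" by (rule T(3)[of z]) (use z U F.M_values[OF U(1) z] s t vU[OF s] vU[OF t] eq ne in auto)
    qed
   qed
   show "\<phi> U ` Sec F U = Sec G U"
   proof (intro subset_antisym subsetI)
    fix t assume t: "t : Sec G U"
    show "t : \<phi> U ` Sec F U"
    proof (cases "U = {}")
     case True
     thus ?thesis using t G.empty(1) F.empty(1) by (auto simp: \<phi>_def)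
    next
     case False
     have "ALL z:U. \<Gamma> U t : N z" using G.M_values[OF U(1)] t by blast
     then obtain x where x: "ALL z:U. x : M z" "T x = \<Gamma> U t" using T(2)[OF U(1) False U(2)] by blast
     then obtain s where s: "s : Sec F U" "\<Phi> U s = x" using F.surj[OF U(1) False] by blast
     have "\<phi> U s = t" by (rule G.eq_onI[OF U(1)]) (use vU[OF s(1)] s x t in auto)
     thus ?thesis using s(1) by blast
    qed
   qed (use vU in auto)
  qed
  fix s assume s: "s : Sec F U"
  {
   fix t assume t: "t : Sec F U"
   have st: "s \<oplus>\<^bsub>sec F U\<^esub> t : Sec F U" using s t by simp
   show "\<phi> U (s \<oplus>\<^bsub>sec F U\<^esub> t) = \<phi> U s \<oplus>\<^bsub>sec G U\<^esub> \<phi> U t"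
    by (rule G.eq_onI[OF U(1)])
     (use vU[OF s] vU[OF t] vU[OF st] F.add[OF U(1) _ s t] G.add[OF U(1)] T(4) in auto)
  }
  {
   fix a assume a: "a : Reg n U"
   have st: "a \<odot>\<^bsub>sec F U\<^esub> s : Sec F U" using s a by simp
   show "\<phi> U (a \<odot>\<^bsub>sec F U\<^esub> s) = a \<odot>\<^bsub>sec G U\<^esub> \<phi> U s"
    by (rule G.eq_onI[OF U(1)])
     (use vU[OF s] vU[OF st] a F.smult[OF U(1) _ a s] G.smult[OF U(1) _ a] T(5) in auto)
  }
  {
   fix V assume V: "zariski_open n V" "V <= U"
   hence VX: "V <= X" using U by auto
   note r = F.res_closed[OF U(1) V s]
   show "\<phi> V (res F U V s) = res G U V (\<phi> U s)"
   proof (rule G.eq_onI[OF V(1)])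
    show "\<phi> V (res F U V s) : Sec G V" using v[OF V(1) VX r] by blast
    show "res G U V (\<phi> U s) : Sec G V" using G.res_closed[OF U(1) V] vU[OF s] by blast
    assume ne: "V ~= {}"
    hence "U ~= {}" using V by auto
    thus "\<Gamma> V (\<phi> V (res F U V s)) = \<Gamma> V (res G U V (\<phi> U s))"
     using ne v[OF V(1) VX r] vU[OF s] F.res[OF U(1) V(1) ne V(2) s] G.res[OF U(1) V(1) ne V(2)] by simp
   qed
  }
 qed
 thus ?thesis unfolding isomorphic_on_def by blast
qed

section \<open>Charts of a locally free sheaf\<close>

lemma free_sheaf_simps:
 "Sec (free_sheaf n r) U = {..<r} \<rightarrow>\<^sub>E Reg n U"
 "j < r ==> (s \<oplus>\<^bsub>sec (free_sheaf n r) U\<^esub> t) j = s j \<oplus>\<^bsub>reg_ring n U\<^esub> t j"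
 "j < r ==> (a \<odot>\<^bsub>sec (free_sheaf n r) U\<^esub> s) j = a \<otimes>\<^bsub>reg_ring n U\<^esub> s j"
 "j < r ==> \<zero>\<^bsub>sec (free_sheaf n r) U\<^esub> j = \<zero>\<^bsub>reg_ring n U\<^esub>"
 "j < r ==> res (free_sheaf n r) U V s j = restrict (s j) V"
 "s \<oplus>\<^bsub>sec (free_sheaf n r) U\<^esub> t : extensional {..<r}"
 "a \<odot>\<^bsub>sec (free_sheaf n r) U\<^esub> s : extensional {..<r}"
 "\<zero>\<^bsub>sec (free_sheaf n r) U\<^esub> : extensional {..<r}"
 "res (free_sheaf n r) U V s : extensional {..<r}" by (auto simp: free_sheaf_def)

text \<open>Rank one is placed in \<open>K \<times> 0\<close>, so that line bundles fit into models
  with values in \<open>K\<^sup>2\<close>.\<close>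

lemma free_sheaf_linear_model:
 "linear_model n (free_sheaf n 1) (%z. {x. fst x : loc n 0 z & snd x = 0}) (%U s. (iR n U (s 0), 0))"
proof
 let ?F = "free_sheaf n 1" and ?M = "%z. {x :: rat2. fst x : loc n 0 z & snd x = 0}"
 fix U assume U: "zariski_open n U" "U ~= {}"
 have c: "s : Sec ?F U \<longleftrightarrow> s 0 : Reg n U & s : extensional {..<1}" for s
  unfolding free_sheaf_simps by (auto simp: PiE_iff)
 show "bij_betw (%s. (iR n U (s 0), 0 :: rat)) (Sec ?F U) {x. ALL z:U. x : ?M z}"
 proof (rule bij_betw_imageI)
  show "inj_on (%s. (iR n U (s 0), 0 :: rat)) (Sec ?F U)"
  proof (rule inj_onI)
   fix s t assume st: "s : Sec ?F U" "t : Sec ?F U" and eq: "(iR n U (s 0), 0::rat) = (iR n U (t 0), 0)"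
   have "s 0 = t 0" by (rule iR_inj[OF U]) (use st eq c in auto)
   moreover have "s : extensional {..<1}" "t : extensional {..<1}" using st c by blast+
   ultimately show "s = t" by (intro extensionalityI[of s "{..<1}" t]) auto
  qed
  have "x : (%s. (iR n U (s 0), 0 :: rat)) ` Sec ?F U" if x: "x : {x. ALL z:U. x : ?M z}" for x
  proof -
   have "EX a:Reg n U. iR n U a = fst x" by (rule iR_surj[OF U]) (use x in auto)
   then obtain a where a: "a : Reg n U" "iR n U a = fst x" by blast
   show ?thesis
   proof (rule image_eqI[of _ _ "\<lambda>j\<in>{..<1::nat}. a"])
    show "x = (iR n U ((\<lambda>j\<in>{..<1::nat}. a) 0), 0 :: rat)" using a x U by (auto simp: prod_eq_iff)
    show "(\<lambda>j\<in>{..<1::nat}. a) : Sec ?F U" unfolding c using a by simp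
   qed
  qed
  thus "(%s. (iR n U (s 0), 0 :: rat)) ` Sec ?F U = {x. ALL z:U. x : ?M z}"
   using iR_loc[OF U conjunct1[OF iffD1[OF c]]] by auto
 qed
 show "\<zero>\<^bsub>sec ?F U\<^esub> : Sec ?F U & (iR n U (\<zero>\<^bsub>sec ?F U\<^esub> 0), 0) = (0 :: rat2)"
  unfolding c by (simp add: free_sheaf_simps iR_zero[OF U] zero_prod_def)
 {
  fix s t assume s: "s : Sec ?F U" and t: "t : Sec ?F U"
  show "s \<oplus>\<^bsub>sec ?F U\<^esub> t : Sec ?F U &
    (iR n U ((s \<oplus>\<^bsub>sec ?F U\<^esub> t) 0), 0) = (iR n U (s 0), 0) + (iR n U (t 0), 0 :: rat)"
   using s t unfolding c by (simp add: free_sheaf_simps iR_add[OF U])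
 }
 {
  fix a s assume a: "a : Reg n U" and s: "s : Sec ?F U"
  show "a \<odot>\<^bsub>sec ?F U\<^esub> s : Sec ?F U &
    (iR n U ((a \<odot>\<^bsub>sec ?F U\<^esub> s) 0), 0) = sm (iR n U a) (iR n U (s 0), 0)"
   using s a unfolding c by (simp add: free_sheaf_simps iR_mult[OF U] sm_def)
 }
next
 let ?F = "free_sheaf n 1" and ?M = "%z. {x :: rat2. fst x : loc n 0 z & snd x = 0}"
 fix U V s assume U: "zariski_open n U" and V: "zariski_open n V" "V ~= {}" "V <= U" and s: "s : Sec ?F U"
 have "s 0 : Reg n U" using s unfolding free_sheaf_simps by auto
 from iR_restrict[OF U V this] show "res ?F U V s : Sec ?F V & (iR n V (res ?F U V s 0), 0) = (iR n U (s 0), 0 :: rat)"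
  unfolding free_sheaf_simps(1) PiE_iff by (simp add: free_sheaf_simps)
next
 let ?F = "free_sheaf n 1"
 define u where "u = (\<lambda>j\<in>{..<1::nat}. (%_::point. undefined :: complex))"
 have c: "carrier (sec ?F {}) = {u}" unfolding free_sheaf_simps reg_ring_empty by (auto simp: u_def PiE_iff extensional_def)
 have x: "x = u" if "x : extensional {..<1}" "x 0 = (%_. undefined)" for x
  using that by (intro extensionalityI[of _ "{..<1}"]) (auto simp: u_def)
 have z: "\<zero>\<^bsub>sec ?F {}\<^esub> = u" by (rule x) (simp_all add: free_sheaf_simps, simp add: reg_ring_def restrict_def)
 show "carrier (sec ?F {}) = {\<zero>\<^bsub>sec ?F {}\<^esub>}" unfolding z c ..
 show "\<zero>\<^bsub>sec ?F {}\<^esub> \<oplus>\<^bsub>sec ?F {}\<^esub> \<zero>\<^bsub>sec ?F {}\<^esub> = \<zero>\<^bsub>sec ?F {}\<^esub>"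
  unfolding z by (rule x) (simp_all add: free_sheaf_simps, simp add: reg_ring_def restrict_def)
 show "a \<odot>\<^bsub>sec ?F {}\<^esub> \<zero>\<^bsub>sec ?F {}\<^esub> = \<zero>\<^bsub>sec ?F {}\<^esub>" for a
  unfolding z by (rule x) (simp_all add: free_sheaf_simps, simp add: reg_ring_def restrict_def)
 show "res ?F U {} s = \<zero>\<^bsub>sec ?F {}\<^esub>" for U s
  unfolding z by (rule x) (simp_all add: free_sheaf_simps restrict_def)
qed (auto simp: loc_diff)

lemma is_iso_onD:
 assumes "is_iso_on n X F G \<phi>" "zariski_open n U" "U <= X"
 shows "bij_betw (\<phi> U) (Sec F U) (Sec G U)"
  and "!!s t. s : Sec F U ==> t : Sec F U ==> \<phi> U (s \<oplus>\<^bsub>sec F U\<^esub> t) = \<phi> U s \<oplus>\<^bsub>sec G U\<^esub> \<phi> U t"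
  and "!!a s. a : Reg n U ==> s : Sec F U ==> \<phi> U (a \<odot>\<^bsub>sec F U\<^esub> s) = a \<odot>\<^bsub>sec G U\<^esub> \<phi> U s"
  and "!!V s. zariski_open n V ==> V <= U ==> s : Sec F U ==> \<phi> V (res F U V s) = res G U V (\<phi> U s)"
proof -
 note B = assms(1)[unfolded is_iso_on_def openin_zariski, rule_format, OF assms(2,3)]
 show "bij_betw (\<phi> U) (Sec F U) (Sec G U)" by (rule conjunct1[OF B])
 show "!!s t. s : Sec F U ==> t : Sec F U ==> \<phi> U (s \<oplus>\<^bsub>sec F U\<^esub> t) = \<phi> U s \<oplus>\<^bsub>sec G U\<^esub> \<phi> U t"
  by (rule conjunct1[OF conjunct2[OF B], rule_format])
 show "!!a s. a : Reg n U ==> s : Sec F U ==> \<phi> U (a \<odot>\<^bsub>sec F U\<^esub> s) = a \<odot>\<^bsub>sec G U\<^esub> \<phi> U s"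
  by (rule conjunct1[OF conjunct2[OF conjunct2[OF B]], rule_format])
 show "!!V s. zariski_open n V ==> V <= U ==> s : Sec F U ==> \<phi> V (res F U V s) = res G U V (\<phi> U s)"
  by (rule conjunct2[OF conjunct2[OF conjunct2[OF B]], rule_format])
qed

lemma free_coordinates:
 assumes \<phi>: "is_iso_on n X F (free_sheaf n r) \<phi>" and V: "zariski_open n V" "V ~= {}" "V <= X"
 shows "!!s j z. s : Sec F V ==> j < r ==> z : V ==> iR n V (\<phi> V s j) : loc n 0 z"
  and "!!s t. s : Sec F V ==> t : Sec F V ==>
   (!!j. j < r ==> iR n V (\<phi> V s j) = iR n V (\<phi> V t j)) ==> s = t"
  and "!!x. (!!j z. j < r ==> z : V ==> x j : loc n 0 z) ==>
   EX s:Sec F V. ALL j<r. iR n V (\<phi> V s j) = x j"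
  and "!!s t j. s : Sec F V ==> t : Sec F V ==> j < r ==>
   iR n V (\<phi> V (s \<oplus>\<^bsub>sec F V\<^esub> t) j) = iR n V (\<phi> V s j) + iR n V (\<phi> V t j)"
  and "!!a s j. a : Reg n V ==> s : Sec F V ==> j < r ==>
   iR n V (\<phi> V (a \<odot>\<^bsub>sec F V\<^esub> s) j) = iR n V a * iR n V (\<phi> V s j)"
  and "!!W s j. zariski_open n W ==> W ~= {} ==> W <= V ==> s : Sec F V ==> j < r ==>
   iR n W (\<phi> W (res F V W s) j) = iR n V (\<phi> V s j)"
proof -
 note D = is_iso_onD[OF \<phi> V(1,3)]
 have cl: "\<phi> V s j : Reg n V" "\<phi> V s : extensional {..<r}" if "s : Sec F V" "j < r" for s j
  using bij_betwE[OF D(1)] that unfolding free_sheaf_simps(1) PiE_iff by auto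
 have ext: "\<phi> V s : extensional {..<r}" if "s : Sec F V" for s
  using bij_betwE[OF D(1)] that unfolding free_sheaf_simps(1) PiE_iff by auto
 show "iR n V (\<phi> V s j) : loc n 0 z" if "s : Sec F V" "j < r" "z : V" for s j z
  by (rule iR_loc[OF V(1,2) cl(1)]) (use that in auto)
 show "s = t" if st: "s : Sec F V" "t : Sec F V"
  and eq: "!!j. j < r ==> iR n V (\<phi> V s j) = iR n V (\<phi> V t j)" for s t
 proof -
  have "\<phi> V s j = \<phi> V t j" if "j < r" for j
   by (rule iR_inj[OF V(1,2) cl(1)[OF st(1) that] cl(1)[OF st(2) that] eq[OF that]])
  hence "\<phi> V s = \<phi> V t" by (intro extensionalityI[OF ext[OF st(1)] ext[OF st(2)]]) simp
  thus ?thesis using inj_onD[OF bij_betw_imp_inj_on[OF D(1)]] st by blast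
 qed
 show "EX s:Sec F V. ALL j<r. iR n V (\<phi> V s j) = x j"
  if x: "!!j z. j < r ==> z : V ==> x j : loc n 0 z" for x
 proof -
  have "ALL j:{..<r}. EX a. a : Reg n V & iR n V a = x j"
   using iR_surj[OF V(1,2)] x by blast
  then obtain a where a: "ALL j:{..<r}. a j : Reg n V & iR n V (a j) = x j" by (rule bchoice[THEN exE])
  hence "(\<lambda>j\<in>{..<r}. a j) : Sec (free_sheaf n r) V" unfolding free_sheaf_simps(1) by auto
  then obtain s where "s : Sec F V" "\<phi> V s = (\<lambda>j\<in>{..<r}. a j)"
   unfolding bij_betw_imp_surj_on[OF D(1), symmetric] by auto
  thus ?thesis using a by (intro bexI[of _ s]) auto
 qed
 show "iR n V (\<phi> V (s \<oplus>\<^bsub>sec F V\<^esub> t) j) = iR n V (\<phi> V s j) + iR n V (\<phi> V t j)"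
  if "s : Sec F V" "t : Sec F V" "j < r" for s t j
  using D(2)[OF that(1,2)] that cl by (simp add: free_sheaf_simps iR_add[OF V(1,2)])
 show "iR n V (\<phi> V (a \<odot>\<^bsub>sec F V\<^esub> s) j) = iR n V a * iR n V (\<phi> V s j)"
  if "a : Reg n V" "s : Sec F V" "j < r" for a s j
  using D(3)[OF that(1,2)] that cl by (simp add: free_sheaf_simps iR_mult[OF V(1,2)])
 show "iR n W (\<phi> W (res F V W s) j) = iR n V (\<phi> V s j)"
  if "zariski_open n W" "W ~= {}" "W <= V" "s : Sec F V" "j < r" for W s j
  using D(4)[OF that(1,3,4)] that cl iR_restrict[OF V(1) that(1-3)] by (simp add: free_sheaf_simps)
qed

lemma presheafD:
 assumes "presheaf_of_modules n F" "zariski_open n U"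
 shows "Module.module (reg_ring n U) (sec F U)"
  and "!!s. s : Sec F U ==> res F U U s = s"
  and "!!V s. zariski_open n V ==> V <= U ==> s : Sec F U ==> res F U V s : Sec F V"
  and "!!V s t. zariski_open n V ==> V <= U ==> s : Sec F U ==> t : Sec F U ==>
   res F U V (s \<oplus>\<^bsub>sec F U\<^esub> t) = res F U V s \<oplus>\<^bsub>sec F V\<^esub> res F U V t"
  and "!!V a s. zariski_open n V ==> V <= U ==> a : Reg n U ==> s : Sec F U ==>
   res F U V (a \<odot>\<^bsub>sec F U\<^esub> s) = restrict a V \<odot>\<^bsub>sec F V\<^esub> res F U V s"
  and "!!V W s. zariski_open n V ==> V <= U ==> zariski_open n W ==> W <= V ==> s : Sec F U ==>
   res F V W (res F U V s) = res F U W s"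
proof -
 note P = assms(1)[unfolded presheaf_of_modules_def openin_zariski]
 note A = conjunct1[OF P, rule_format, OF assms(2)]
 note B = conjunct2[OF P, rule_format, OF assms(2)]
 show "Module.module (reg_ring n U) (sec F U)" by (rule conjunct1[OF A])
 show "!!s. s : Sec F U ==> res F U U s = s" by (rule conjunct2[OF A, rule_format])
 show "!!V s. zariski_open n V ==> V <= U ==> s : Sec F U ==> res F U V s : Sec F V"
  by (rule conjunct1[OF B, rule_format])
 show "!!V s t. zariski_open n V ==> V <= U ==> s : Sec F U ==> t : Sec F U ==>
   res F U V (s \<oplus>\<^bsub>sec F U\<^esub> t) = res F U V s \<oplus>\<^bsub>sec F V\<^esub> res F U V t"
  by (rule conjunct1[OF conjunct2[OF B], rule_format])
 show "!!V a s. zariski_open n V ==> V <= U ==> a : Reg n U ==> s : Sec F U ==>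
   res F U V (a \<odot>\<^bsub>sec F U\<^esub> s) = restrict a V \<odot>\<^bsub>sec F V\<^esub> res F U V s"
  by (rule conjunct1[OF conjunct2[OF conjunct2[OF B]], rule_format])
 show "!!V W s. zariski_open n V ==> V <= U ==> zariski_open n W ==> W <= V ==> s : Sec F U ==>
   res F V W (res F U V s) = res F U W s" by (rule conjunct2[OF conjunct2[OF conjunct2[OF B]], rule_format])
qed

lemma sheaf_separated:
 assumes "sheaf_of_modules n F" "!!U. U : K ==> zariski_open n U"
  "s : carrier (sec F (\<Union>K))" "t : carrier (sec F (\<Union>K))" "!!U. U : K ==> res F (\<Union>K) U s = res F (\<Union>K) U t"
 shows "s = t"
 using conjunct2[OF assms(1)[unfolded sheaf_of_modules_def openin_zariski], rule_format, of K, THEN conjunct1, rule_format, of s t] assms(2-)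
 by blast

lemma sheaf_glue:
 assumes "sheaf_of_modules n F" "!!U. U : K ==> zariski_open n U" "!!U. U : K ==> s U : Sec F U"
  "!!U V. U : K ==> V : K ==> res F U (U \<inter> V) (s U) = res F V (U \<inter> V) (s V)"
 shows "EX t:carrier (sec F (\<Union>K)). ALL U:K. res F (\<Union>K) U t = s U"
 using conjunct2[OF assms(1)[unfolded sheaf_of_modules_def openin_zariski], rule_format, of K, THEN conjunct2, rule_format, of s] assms(2-)
 by blast

text \<open>A sheaf with a system of charts: \<open>c q V\<close> identifies the sections over \<open>V \<subseteq> U q\<close> with pairs of rational
 functions that are regular on \<open>V\<close>.\<close>

locale charted_sheaf =
 fixes n :: nat and E :: "'a presheaf" and U :: "point => point set" and c :: "point => point set => 'a => rat2"
 assumes sheaf: "sheaf_of_modules n E"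
  and Uq: "q : proj_space n ==> zariski_open n (U q) & q : U q"
  and c_loc: "q : proj_space n ==> zariski_open n V ==> V ~= {} ==> V <= U q ==> s : Sec E V ==> z : V ==>
   fst (c q V s) : loc n 0 z & snd (c q V s) : loc n 0 z"
  and c_inj: "q : proj_space n ==> zariski_open n V ==> V ~= {} ==> V <= U q ==> s : Sec E V ==>
   t : Sec E V ==> c q V s = c q V t ==> s = t"
  and c_surj: "q : proj_space n ==> zariski_open n V ==> V ~= {} ==> V <= U q ==>
   (!!z. z : V ==> fst x : loc n 0 z & snd x : loc n 0 z) ==> EX s:Sec E V. c q V s = x"
  and c_add: "q : proj_space n ==> zariski_open n V ==> V ~= {} ==> V <= U q ==> s : Sec E V ==>
   t : Sec E V ==> c q V (s \<oplus>\<^bsub>sec E V\<^esub> t) = c q V s + c q V t"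
  and c_smult: "q : proj_space n ==> zariski_open n V ==> V ~= {} ==> V <= U q ==> s : Sec E V ==>
   a : Reg n V ==> c q V (a \<odot>\<^bsub>sec E V\<^esub> s) = sm (iR n V a) (c q V s)"
  and c_res: "q : proj_space n ==> zariski_open n V ==> V <= U q ==> s : Sec E V ==>
   zariski_open n W ==> W ~= {} ==> W <= V ==> c q W (res E V W s) = c q V s"
begin

lemma presheaf: "presheaf_of_modules n E" using sheaf unfolding sheaf_of_modules_def by blast

lemmas E = presheafD[OF presheaf]

lemma E_closed:
 assumes "zariski_open n V"
 shows "s : Sec E V ==> t : Sec E V ==> s \<oplus>\<^bsub>sec E V\<^esub> t : Sec E V"
  "a : Reg n V ==> s : Sec E V ==> a \<odot>\<^bsub>sec E V\<^esub> s : Sec E V"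
  "\<zero>\<^bsub>sec E V\<^esub> : Sec E V"
proof -
 interpret Module.module "reg_ring n V" "sec E V" by (rule E(1)[OF assms])
 show "s : Sec E V ==> t : Sec E V ==> s \<oplus>\<^bsub>sec E V\<^esub> t : Sec E V"
  "a : Reg n V ==> s : Sec E V ==> a \<odot>\<^bsub>sec E V\<^esub> s : Sec E V"
  "\<zero>\<^bsub>sec E V\<^esub> : Sec E V" by auto
qed

definition base :: point where "base = (SOME q. q : proj_space n)"

text \<open>The single chart at \<open>base\<close> trivialises \<open>E\<close> over the function
  field: every non-empty open set meets it, so every section has coordinates there.\<close>

definition psi :: "point set => 'a => rat2" where
 "psi V s = c base (V \<inter> U base) (res E V (V \<inter> U base) s)"

lemma base: "base : proj_space n" unfolding base_def using hom_nonzero_point[of n 0 1] by (auto intro: someI)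

lemma base_open:
 assumes "zariski_open n V" "V ~= {}"
 shows "zariski_open n (V \<inter> U base)" "V \<inter> U base ~= {}"
proof -
 have b: "zariski_open n (U base)" "U base ~= {}" using Uq[OF base] by auto
 show "zariski_open n (V \<inter> U base)" "V \<inter> U base ~= {}"
  using zariski_open_Int[OF assms(1) b(1)] zariski_irreducible[OF assms(1) b(1) assms(2) b(2)] by auto
qed

lemma psi_base:
 assumes "zariski_open n V" "V <= U base" "s : Sec E V"
 shows "psi V s = c base V s" using assms E(2)[OF assms(1,3)] by (simp add: psi_def Int_absorb2)

lemma psi_res:
 assumes V: "zariski_open n V" and W: "zariski_open n W" "W ~= {}" "W <= V" and s: "s : Sec E V"
 shows "psi W (res E V W s) = psi V s"
proof -
 have V0: "V ~= {}" using W by auto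
 note b = base_open[OF V V0] and b' = base_open[OF W(1,2)]
 have "res E W (W \<inter> U base) (res E V W s) = res E V (W \<inter> U base) s" by (rule E(6)[OF V W(1,3) b'(1) _ s]) auto
 also have "\<dots> = res E (V \<inter> U base) (W \<inter> U base) (res E V (V \<inter> U base) s)"
  by (rule E(6)[OF V b(1) _ b'(1) _ s, symmetric]) (use W(3) in auto)
 finally show ?thesis unfolding psi_def using c_res[OF base b(1) _ E(3)[OF V b(1) _ s] b'] W(3) by auto
qed

lemma psi_add:
 assumes V: "zariski_open n V" "V ~= {}" and s: "s : Sec E V" "t : Sec E V"
 shows "psi V (s \<oplus>\<^bsub>sec E V\<^esub> t) = psi V s + psi V t"
 unfolding psi_def using E(4)[OF V(1) base_open(1)[OF V] _ s] c_add[OF base base_open[OF V]] E(3)[OF V(1) base_open(1)[OF V]] s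
 by simp

lemma psi_smult:
 assumes V: "zariski_open n V" "V ~= {}" and s: "s : Sec E V" "a : Reg n V"
 shows "psi V (a \<odot>\<^bsub>sec E V\<^esub> s) = sm (iR n V a) (psi V s)"
 unfolding psi_def using E(5)[OF V(1) base_open(1)[OF V] _ s(2,1)] c_smult[OF base base_open[OF V]] E(3)[OF V(1) base_open(1)[OF V]] s
  iR_restrict[OF V(1) base_open[OF V] _ s(2)] by simp

text \<open>Locally a section is determined by its coordinates, and these by their restriction to
  the base chart, because the intersection is not empty.\<close>

lemma psi_inj:
 assumes V: "zariski_open n V" "V ~= {}" and s: "s : Sec E V" "t : Sec E V" and eq: "psi V s = psi V t"
 shows "s = t"
proof -
 define K where "K = {V \<inter> U q | q. q : V}"
 have VP: "q : proj_space n" if "q : V" for q using zariski_open_subset[OF V(1)] that by blast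
 have KV: "\<Union>K = V" unfolding K_def using Uq[OF VP] by blast
 have K: "zariski_open n W" if "W : K" for W using that zariski_open_Int[OF V(1)] Uq[OF VP] unfolding K_def by blast
 show ?thesis
 proof (rule sheaf_separated[OF sheaf, of K, unfolded KV, OF K s])
  fix W assume WK: "W : K"
  then obtain q where q: "q : V" "W = V \<inter> U q" unfolding K_def by blast
  have W: "zariski_open n W" "W ~= {}" "W <= V" "W <= U q" using K[OF WK] q Uq[OF VP[OF q(1)]] by auto
  note b = base_open[OF W(1,2)]
  note r = E(3)[OF V(1) W(1,3)]
  have "c base (W \<inter> U base) (res E W (W \<inter> U base) (res E V W s)) = c base (W \<inter> U base) (res E W (W \<inter> U base) (res E V W t))"
   using psi_res[OF V(1) W(1-3)] s eq by (simp add: psi_def[of W])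
  hence "res E W (W \<inter> U base) (res E V W s) = res E W (W \<inter> U base) (res E V W t)"
   by (intro c_inj[OF base b] E(3)[OF W(1) b(1)] r s) auto
  hence "c q W (res E V W s) = c q W (res E V W t)"
   using c_res[OF VP[OF q(1)] W(1,4) r[OF s(1)] b] c_res[OF VP[OF q(1)] W(1,4) r[OF s(2)] b] by simp
  thus "res E V W s = res E V W t" by (rule c_inj[OF VP[OF q(1)] W(1,2,4) r[OF s(1)] r[OF s(2)]])
 qed
qed

definition frame :: "rat2 => point => 'a" where
 "frame x q = (SOME s. s : carrier (sec E (U q)) & c q (U q) s = x)"

text \<open>The frame of the chart at \<open>q\<close> in the coordinates of the base chart:
  \<open>e1 q\<close> and \<open>e2 q\<close> are the columns of the transition matrix.\<close>

definition e1 :: "point => rat2" where "e1 q = psi (U q) (frame (1, 0) q)"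

definition e2 :: "point => rat2" where "e2 q = psi (U q) (frame (0, 1) q)"

lemma frame:
 assumes q: "q : proj_space n" and x: "x = (1, 0) | x = (0, 1)"
 shows "frame x q : carrier (sec E (U q))" "c q (U q) (frame x q) = x"
proof -
 have "EX s:carrier (sec E (U q)). c q (U q) s = x"
 proof (rule c_surj[OF q])
  fix z assume "z : U q"
  hence "z : proj_space n" using zariski_open_subset Uq[OF q] by blast
  thus "fst x : loc n 0 z & snd x : loc n 0 z" using x loc_1 loc_0 by auto
 qed (use Uq[OF q] in auto)
 hence "frame x q : carrier (sec E (U q)) & c q (U q) (frame x q) = x" unfolding frame_def by (rule bexE) (rule someI, blast)
 thus "frame x q : carrier (sec E (U q))" "c q (U q) (frame x q) = x" by auto
qed

lemma psi_frame:
 assumes q: "q : proj_space n" and V: "zariski_open n V" "V ~= {}" "V <= U q" and s: "s : Sec E V"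
 shows "psi V s = sm (fst (c q V s)) (e1 q) + sm (snd (c q V s)) (e2 q)"
proof -
 obtain a where a: "a : Reg n V" "iR n V a = fst (c q V s)"
  using iR_surj[OF V(1,2), of "fst (c q V s)"] c_loc[OF q V s] by blast
 obtain b where b: "b : Reg n V" "iR n V b = snd (c q V s)"
  using iR_surj[OF V(1,2), of "snd (c q V s)"] c_loc[OF q V s] by blast
 have Uo: "zariski_open n (U q)" using Uq[OF q] by blast
 note f1 = frame[OF q, of "(1, 0)", simplified] and f2 = frame[OF q, of "(0, 1)", simplified]
 define s1 where "s1 = res E (U q) V (frame (1, 0) q)"
 define s2 where "s2 = res E (U q) V (frame (0, 1) q)"
 have s1: "s1 : Sec E V" "c q V s1 = (1, 0)" "psi V s1 = e1 q"
  unfolding s1_def e1_def using E(3)[OF Uo V(1,3) f1(1)] c_res[OF q Uo _ f1(1) V] psi_res[OF Uo V f1(1)] f1(2) by auto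
 have s2: "s2 : Sec E V" "c q V s2 = (0, 1)" "psi V s2 = e2 q"
  unfolding s2_def e2_def using E(3)[OF Uo V(1,3) f2(1)] c_res[OF q Uo _ f2(1) V] psi_res[OF Uo V f2(1)] f2(2) by auto
 note cl = E_closed[OF V(1)]
 have "s = a \<odot>\<^bsub>sec E V\<^esub> s1 \<oplus>\<^bsub>sec E V\<^esub> b \<odot>\<^bsub>sec E V\<^esub> s2"
 proof (rule c_inj[OF q V s])
  show "a \<odot>\<^bsub>sec E V\<^esub> s1 \<oplus>\<^bsub>sec E V\<^esub> b \<odot>\<^bsub>sec E V\<^esub> s2 : Sec E V" using a(1) b(1) s1(1) s2(1) by (intro cl)
  have "c q V (a \<odot>\<^bsub>sec E V\<^esub> s1 \<oplus>\<^bsub>sec E V\<^esub> b \<odot>\<^bsub>sec E V\<^esub> s2) = sm (iR n V a) (1, 0) + sm (iR n V b) (0, 1)"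
   using c_add[OF q V cl(2)[OF a(1) s1(1)] cl(2)[OF b(1) s2(1)]] c_smult[OF q V s1(1) a(1)] c_smult[OF q V s2(1) b(1)] s1(2) s2(2)
   by simp
  thus "c q V s = c q V (a \<odot>\<^bsub>sec E V\<^esub> s1 \<oplus>\<^bsub>sec E V\<^esub> b \<odot>\<^bsub>sec E V\<^esub> s2)" using a(2) b(2) by (simp add: sm_def prod_eq_iff)
 qed
 thus ?thesis
  using psi_add[OF V(1,2) cl(2)[OF a(1) s1(1)] cl(2)[OF b(1) s2(1)]] psi_smult[OF V(1,2) s1(1) a(1)] psi_smult[OF V(1,2) s2(1) b(1)] s1(3) s2(3) a(2) b(2)
  by simp
qed

lemma psi_span:
 assumes q: "q : proj_space n" and V: "zariski_open n V" "z : V" "V <= U q" and s: "s : Sec E V"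
 shows "psi V s : span2 n (e1 q) 0 (e2 q) 0 z"
proof -
 have ne: "V ~= {}" using V by auto
 show ?thesis unfolding psi_frame[OF q V(1) ne V(3) s] using c_loc[OF q V(1) ne V(3) s V(2)] by (intro span2I) auto
qed

lemma psi_surj_local:
 assumes q: "q : proj_space n" and V: "zariski_open n V" "V ~= {}" "V <= U q"
  and ab: "!!z. z : V ==> a : loc n 0 z" "!!z. z : V ==> b : loc n 0 z"
 shows "EX s:Sec E V. c q V s = (a, b) & psi V s = sm a (e1 q) + sm b (e2 q)"
proof -
 have "EX s:Sec E V. c q V s = (a, b)" by (rule c_surj[OF q V]) (use ab in auto)
 then obtain s where "s : Sec E V" "c q V s = (a, b)" by blast
 thus ?thesis using psi_frame[OF q V] by auto
qed

text \<open>The determinant is non-zero because on the overlap the standard frame of the base chart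
  is a combination of \<open>e1 q\<close> and \<open>e2 q\<close>.\<close>

lemma frame_lattice: "lattice n U e1 e2"
proof
 fix q assume q: "q : proj_space n"
 show "zariski_open n (U q) & q : U q" by (rule Uq[OF q])
 have Uo: "zariski_open n (U q)" "U q ~= {}" using Uq[OF q] by auto
 note f1 = frame[OF q, of "(1, 0)", simplified] and f2 = frame[OF q, of "(0, 1)", simplified]
 note b = base_open[OF Uo]
 obtain z where z: "z : U q \<inter> U base" using b by blast
 have k: "fst (psi (U q) s) : krat n 0 & snd (psi (U q) s) : krat n 0" if "s : carrier (sec E (U q))" for s
  unfolding psi_def using c_loc[OF base b _ E(3)[OF Uo(1) b(1) _ that] z] loc_krat by auto
 show "fst (e1 q) : krat n 0 & snd (e1 q) : krat n 0 & fst (e2 q) : krat n 0 & snd (e2 q) : krat n 0"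
  unfolding e1_def e2_def using k f1 f2 by blast
 have P: "w : proj_space n" if "w : U q \<inter> U base" for w using zariski_open_subset[OF b(1)] that by blast
 have ex: "EX \<alpha> \<beta>. x = sm \<alpha> (e1 q) + sm \<beta> (e2 q)" if x: "x = (1, 0) | x = (0, 1)" for x
 proof -
  have "EX s:carrier (sec E (U q \<inter> U base)). c base (U q \<inter> U base) s = x"
   by (rule c_surj[OF base b]) (use x loc_1 loc_0 P in auto)
  then obtain s where s: "s : carrier (sec E (U q \<inter> U base))" "c base (U q \<inter> U base) s = x" by blast
  thus ?thesis using psi_frame[OF q b _ s(1)] psi_base[OF b(1) _ s(1)] by auto
 qed
 obtain \<alpha> \<beta> \<gamma> \<delta> where e: "(1, 0) = sm \<alpha> (e1 q) + sm \<beta> (e2 q)" "(0, 1) = sm \<gamma> (e1 q) + sm \<delta> (e2 q)"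
  using ex[of "(1, 0)"] ex[of "(0, 1)"] by auto
 have "det2 (sm \<alpha> (e1 q) + sm \<beta> (e2 q)) (sm \<gamma> (e1 q) + sm \<delta> (e2 q)) = (\<alpha> * \<delta> - \<beta> * \<gamma>) * det2 (e1 q) (e2 q)"
  by (simp add: det2_def sm_def algebra_simps)
 hence "1 = (\<alpha> * \<delta> - \<beta> * \<gamma>) * det2 (e1 q) (e2 q)" unfolding e[symmetric] by (simp add: det2_def)
 thus "det2 (e1 q) (e2 q) ~= 0" by auto
 fix z assume z: "z : U q"
 have zP: "z : proj_space n" using zariski_open_subset[OF Uo(1)] z by blast
 have Uz: "zariski_open n (U z)" "z : U z" using Uq[OF zP] by auto
 define W where "W = U q \<inter> U z"
 have W: "zariski_open n W" "W ~= {}" "W <= U q" "W <= U z" "z : W"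
  unfolding W_def using zariski_open_Int[OF Uo(1) Uz(1)] z Uz by auto
 note g1 = frame[OF zP, of "(1, 0)", simplified] and g2 = frame[OF zP, of "(0, 1)", simplified]
 have 1: "psi W (res E (U q) W (frame (1, 0) q)) = e1 q" "psi W (res E (U q) W (frame (0, 1) q)) = e2 q"
  "psi W (res E (U z) W (frame (1, 0) z)) = e1 z" "psi W (res E (U z) W (frame (0, 1) z)) = e2 z"
  unfolding e1_def e2_def using psi_res[OF Uo(1) W(1-3)] psi_res[OF Uz(1) W(1,2,4)] f1 f2 g1 g2 by auto
 note m = E(3)[OF Uo(1) W(1,3) f1(1)] E(3)[OF Uo(1) W(1,3) f2(1)] E(3)[OF Uz(1) W(1,4) g1(1)] E(3)[OF Uz(1) W(1,4) g2(1)]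
 show "e1 z : span2 n (e1 q) 0 (e2 q) 0 z & e2 z : span2 n (e1 q) 0 (e2 q) 0 z &
   e1 q : span2 n (e1 z) 0 (e2 z) 0 z & e2 q : span2 n (e1 z) 0 (e2 z) 0 z"
  using psi_span[OF q W(1,5,3) m(3)] psi_span[OF q W(1,5,3) m(4)] psi_span[OF zP W(1,5,4) m(1)] psi_span[OF zP W(1,5,4) m(2)]
  unfolding 1 by blast
qed

end

section \<open>Tensor products and twists\<close>

sublocale charted_sheaf < lattice n U e1 e2 by (rule frame_lattice)

context charted_sheaf
begin

lemma psi_lat:
 assumes V: "zariski_open n V" "z : V" and s: "s : Sec E V"
 shows "psi V s : lat 0 z"
proof -
 have z: "z : proj_space n" using zariski_open_subset V by blast
 have W: "zariski_open n (V \<inter> U z)" "z : V \<inter> U z" using zariski_open_Int[OF V(1)] Uq[OF z] V(2) by auto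
 hence "psi (V \<inter> U z) (res E V (V \<inter> U z) s) = psi V s" by (intro psi_res[OF V(1) _ _ _ s]) auto
 thus ?thesis using psi_span[OF z W _ E(3)[OF V(1) W(1) _ s]] unfolding lat_def by auto
qed

text \<open>Near each point the chart there provides a section with value \<open>x\<close>.
  Injectivity of \<open>psi\<close> makes these agree on overlaps, and the sheaf axiom glues
  them.\<close>

lemma psi_surj:
 assumes V: "zariski_open n V" "V ~= {}" and x: "!!z. z : V ==> x : lat 0 z"
 shows "EX s:Sec E V. psi V s = x"
proof -
 define K where "K = {W. zariski_open n W & W ~= {} & W <= V & (EX s:Sec E W. psi W s = x)}"
 have K: "zariski_open n W" "W ~= {}" "W <= V" if "W : K" for W using that unfolding K_def by auto
 have "ALL W:K. EX s. s : Sec E W & psi W s = x" unfolding K_def by blast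
 then obtain s where s0: "ALL W:K. s W : Sec E W & psi W (s W) = x" by (rule bchoice[THEN exE])
 note s = s0[rule_format, THEN conjunct1] s0[rule_format, THEN conjunct2]
 have "z : \<Union>K" if z: "z : V" for z
 proof -
  have zP: "z : proj_space n" using zariski_open_subset V z by blast
  obtain a b where ab: "x = sm a (e1 z) + sm b (e2 z)" "a : loc n 0 z" "b : loc n 0 z"
   using x[OF z] unfolding lat_def span2_def by blast
  obtain A where A: "zariski_open n A" "z : A" "ALL w:A. a : loc n 0 w" by (rule loc_open[OF ab(2) zP]) (rule that, auto)
  obtain B where B: "zariski_open n B" "z : B" "ALL w:B. b : loc n 0 w" by (rule loc_open[OF ab(3) zP]) (rule that, auto)
  define W where "W = V \<inter> U z \<inter> (A \<inter> B)"
  have W: "zariski_open n W" "z : W" "W <= U z" unfolding W_def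
   using zariski_open_Int[OF zariski_open_Int[OF V(1)] zariski_open_Int[OF A(1) B(1)]] Uq[OF zP] z A B by auto
  hence "W ~= {}" by auto
  from psi_surj_local[OF zP W(1) this W(3), of a b] A(3) B(3)
  obtain t where "t : Sec E W" "psi W t = x" unfolding ab(1) W_def by blast
  hence "W : K" using W unfolding K_def W_def by blast
  thus ?thesis using W(2) by blast
 qed
 hence KV: "\<Union>K = V" using K(3) by blast
 have "EX t:carrier (sec E (\<Union>K)). ALL W:K. res E (\<Union>K) W t = s W"
 proof (rule sheaf_glue[OF sheaf K(1) s(1)])
  fix W W' assume W: "W : K" and W': "W' : K"
  have O: "zariski_open n (W \<inter> W')" "W \<inter> W' ~= {}"
   using zariski_open_Int[OF K(1)[OF W] K(1)[OF W']] zariski_irreducible[OF K(1)[OF W] K(1)[OF W'] K(2)[OF W] K(2)[OF W']] by auto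
  show "res E W (W \<inter> W') (s W) = res E W' (W \<inter> W') (s W')"
   by (rule psi_inj[OF O E(3)[OF K(1)[OF W] O(1) _ s(1)[OF W]] E(3)[OF K(1)[OF W'] O(1) _ s(1)[OF W']]])
    (use psi_res[OF K(1)[OF W] O _ s(1)[OF W]] psi_res[OF K(1)[OF W'] O _ s(1)[OF W']] s(2)[OF W] s(2)[OF W'] in auto)
 qed
 then obtain t where t: "t : Sec E V" "!!W. W : K ==> res E V W t = s W" unfolding KV by blast
 obtain W where W: "W : K" using V(2) KV by blast
 have "psi V t = x" using psi_res[OF V(1) K(1)[OF W] K(2)[OF W] K(3)[OF W] t(1)] t(2)[OF W] s(2)[OF W] by simp
 thus ?thesis using t(1) by blast
qed

lemma E_empty: "carrier (sec E {}) = {\<zero>\<^bsub>sec E {}\<^esub>}"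
proof -
 have "s = t" if "s : carrier (sec E {})" "t : carrier (sec E {})" for s t
  by (rule sheaf_separated[OF sheaf, of "{}"]) (use that in auto)
 thus ?thesis using E_closed(3)[OF zariski_open_empty] by blast
qed

end

sublocale charted_sheaf < model: linear_model n E "lat 0" psi
proof
 fix V assume V: "zariski_open n V" "V ~= {}"
 show "bij_betw (psi V) (Sec E V) {x. ALL z:V. x : lat 0 z}"
 proof (rule bij_betw_imageI)
  show "inj_on (psi V) (Sec E V)" using psi_inj[OF V] by (rule inj_onI)
  show "psi V ` Sec E V = {x. ALL z:V. x : lat 0 z}"
  proof (intro subset_antisym subsetI)
   fix x assume "x : {x. ALL z:V. x : lat 0 z}"
   hence "EX s:Sec E V. psi V s = x" by (intro psi_surj[OF V]) simp
   thus "x : psi V ` Sec E V" by (elim bexE) (rule image_eqI[rotated], assumption, simp)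
  next
   fix x assume "x : psi V ` Sec E V"
   thus "x : {x. ALL z:V. x : lat 0 z}" by (elim imageE) (simp add: psi_lat[OF V(1)])
  qed
 qed
 interpret Module.module "reg_ring n V" "sec E V" by (rule E(1)[OF V(1)])
 show "\<zero>\<^bsub>sec E V\<^esub> : Sec E V & psi V \<zero>\<^bsub>sec E V\<^esub> = 0"
  using psi_add[OF V, of "\<zero>\<^bsub>sec E V\<^esub>" "\<zero>\<^bsub>sec E V\<^esub>"] by simp
 show "s \<oplus>\<^bsub>sec E V\<^esub> t : Sec E V & psi V (s \<oplus>\<^bsub>sec E V\<^esub> t) = psi V s + psi V t"
  if "s : Sec E V" "t : Sec E V" for s t using psi_add[OF V that] that by simp
 show "a \<odot>\<^bsub>sec E V\<^esub> s : Sec E V & psi V (a \<odot>\<^bsub>sec E V\<^esub> s) = sm (iR n V a) (psi V s)"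
  if "a : Reg n V" "s : Sec E V" for s a using psi_smult[OF V that(2,1)] that by simp
next
 interpret Module.module "reg_ring n {}" "sec E {}" by (rule E(1)[OF zariski_open_empty])
 show "carrier (sec E {}) = {\<zero>\<^bsub>sec E {}\<^esub>}" by (rule E_empty)
 show "\<zero>\<^bsub>sec E {}\<^esub> \<oplus>\<^bsub>sec E {}\<^esub> \<zero>\<^bsub>sec E {}\<^esub> = \<zero>\<^bsub>sec E {}\<^esub>" by simp
 show "a \<odot>\<^bsub>sec E {}\<^esub> \<zero>\<^bsub>sec E {}\<^esub> = \<zero>\<^bsub>sec E {}\<^esub>" if "a : Reg n {}" for a
  using smult_closed[OF that zero_closed] E_empty by blast
 show "res E V {} s = \<zero>\<^bsub>sec E {}\<^esub>" if "zariski_open n V" "s : Sec E V" for V s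
  using E(3)[OF that(1) zariski_open_empty _ that(2)] E_empty by blast
qed (use lat_0 lat_diff psi_res E(3) in auto)

section \<open>Tensor products of modules\<close>

definition op_closed :: "'r ring => ('r, 'a) module => bool" where
 "op_closed R M \<longleftrightarrow> (ALL x:carrier M. ALL y:carrier M. x \<oplus>\<^bsub>M\<^esub> y : carrier M) &
   (ALL a:carrier R. ALL x:carrier M. a \<odot>\<^bsub>M\<^esub> x : carrier M)"

lemma tensor_rel_gens:
 "x : carrier M ==> x' : carrier M ==> y : carrier N ==>
  frag_of (x \<oplus>\<^bsub>M\<^esub> x', y) - frag_of (x, y) - frag_of (x', y) : tensor_rel R M N"
 "x : carrier M ==> y : carrier N ==> y' : carrier N ==>
  frag_of (x, y \<oplus>\<^bsub>N\<^esub> y') - frag_of (x, y) - frag_of (x, y') : tensor_rel R M N"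
 "a : carrier R ==> x : carrier M ==> y : carrier N ==>
  frag_of (a \<odot>\<^bsub>M\<^esub> x, y) - frag_of (x, a \<odot>\<^bsub>N\<^esub> y) : tensor_rel R M N"
 unfolding tensor_rel_def by (rule generate.incl, blast)+

lemma keys_frag_diff:
 "p : S ==> q : S ==> Poly_Mapping.keys (frag_of p - frag_of q) <= S"
 "p : S ==> q : S ==> r : S ==> Poly_Mapping.keys (frag_of p - frag_of q - frag_of r) <= S"
 using keys_diff[of "frag_of p" "frag_of q"] keys_diff[of "frag_of p - frag_of q" "frag_of r"] by (auto simp: keys_frag_of)

text \<open>The bound on the keys is carried along because inversion in the free abelian group is
  negation only on its carrier; it also shows that relations stay in that carrier.\<close>

lemma tensor_rel_induct [consumes 3, case_names zero left right smult diff]: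
 assumes z: "z : tensor_rel R M N" and cl: "op_closed R M" "op_closed R N"
  and P: "P 0"
   "!!x x' y. x : carrier M ==> x' : carrier M ==> y : carrier N ==>
    P (frag_of (x \<oplus>\<^bsub>M\<^esub> x', y) - frag_of (x, y) - frag_of (x', y))"
   "!!x y y'. x : carrier M ==> y : carrier N ==> y' : carrier N ==>
    P (frag_of (x, y \<oplus>\<^bsub>N\<^esub> y') - frag_of (x, y) - frag_of (x, y'))"
   "!!a x y. a : carrier R ==> x : carrier M ==> y : carrier N ==>
    P (frag_of (a \<odot>\<^bsub>M\<^esub> x, y) - frag_of (x, a \<odot>\<^bsub>N\<^esub> y))"
   "!!a b. P a ==> P b ==> P (a - b)"
 shows "P z & Poly_Mapping.keys z <= carrier M \<times> carrier N"
proof -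
 let ?S = "carrier M \<times> carrier N"
 have gen: "P h & Poly_Mapping.keys h <= ?S" if "h : {frag_of (x \<oplus>\<^bsub>M\<^esub> x', y) - frag_of (x, y) - frag_of (x', y) | x x' y.
      x : carrier M & x' : carrier M & y : carrier N} \<union>
    {frag_of (x, y \<oplus>\<^bsub>N\<^esub> y') - frag_of (x, y) - frag_of (x, y') | x y y'.
      x : carrier M & y : carrier N & y' : carrier N} \<union>
    {frag_of (a \<odot>\<^bsub>M\<^esub> x, y) - frag_of (x, a \<odot>\<^bsub>N\<^esub> y) | a x y.
      a : carrier R & x : carrier M & y : carrier N}" for h using that
 proof (elim UnE CollectE exE conjE)
  fix x x' y assume h: "h = frag_of (x \<oplus>\<^bsub>M\<^esub> x', y) - frag_of (x, y) - frag_of (x', y)" "x : carrier M" "x' : carrier M" "y : carrier N"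
  show ?thesis unfolding h(1) using P(2)[OF h(2-4)] h cl by (intro conjI keys_frag_diff) (auto simp: op_closed_def)
 next
  fix x y y' assume h: "h = frag_of (x, y \<oplus>\<^bsub>N\<^esub> y') - frag_of (x, y) - frag_of (x, y')" "x : carrier M" "y : carrier N" "y' : carrier N"
  show ?thesis unfolding h(1) using P(3)[OF h(2-4)] h cl by (intro conjI keys_frag_diff) (auto simp: op_closed_def)
 next
  fix a x y assume h: "h = frag_of (a \<odot>\<^bsub>M\<^esub> x, y) - frag_of (x, a \<odot>\<^bsub>N\<^esub> y)" "a : carrier R" "x : carrier M" "y : carrier N"
  show ?thesis unfolding h(1) using P(4)[OF h(2-4)] h cl by (intro conjI keys_frag_diff) (auto simp: op_closed_def)
 qed
 show ?thesis using z unfolding tensor_rel_def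
 proof (induction rule: generate.induct)
  case one
  thus ?case using P(1) by simp
 next
  case (incl h)
  thus ?case by (rule gen)
 next
  case (inv h)
  thus ?case using gen[OF inv] P(5)[OF P(1), of h] by simp
 next
  case (eng a b)
  have "P (a - (0 - b))" by (rule P(5)[OF conjunct1[OF eng.IH(1)] P(5)[OF P(1) conjunct1[OF eng.IH(2)]]])
  thus ?case using eng keys_diff[of a "- b"] by (auto simp: keys_minus)
 qed
qed

lemma tensor_rel_group:
 assumes cl: "op_closed R M" "op_closed R N"
 shows "0 : tensor_rel R M N"
  and "!!a b. a : tensor_rel R M N ==> b : tensor_rel R M N ==> a + b : tensor_rel R M N"
  and "!!a b. a : tensor_rel R M N ==> b : tensor_rel R M N ==> a - b : tensor_rel R M N"
  and "!!z. z : tensor_rel R M N ==> Poly_Mapping.keys z <= carrier M \<times> carrier N"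
proof -
 show 0: "0 : tensor_rel R M N"
  using generate.one[of "free_Abelian_group (carrier M \<times> carrier N)"] unfolding tensor_rel_def by simp
 show add: "a + b : tensor_rel R M N" if "a : tensor_rel R M N" "b : tensor_rel R M N" for a b
  using generate.eng[OF that[unfolded tensor_rel_def]] unfolding tensor_rel_def by simp
 show keys: "Poly_Mapping.keys z <= carrier M \<times> carrier N" if "z : tensor_rel R M N" for z
  using tensor_rel_induct[OF that cl, of "%_. True"] by simp
 have neg: "- z : tensor_rel R M N" if "z : tensor_rel R M N" for z
 proof -
  have "subgroup (tensor_rel R M N) (free_Abelian_group (carrier M \<times> carrier N))" unfolding tensor_rel_def
   by (rule group.generate_is_subgroup[OF group_free_Abelian_group], rule subsetI,
    rule carrier_free_Abelian_group_iff[THEN iffD2], erule keys[unfolded tensor_rel_def, OF generate.incl])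
  from subgroup.m_inv_closed[OF this that] show ?thesis using keys[OF that] by simp
 qed
 show "a - b : tensor_rel R M N" if "a : tensor_rel R M N" "b : tensor_rel R M N" for a b
  using add[OF that(1) neg[OF that(2)]] by simp
qed

definition tcoset :: "'r ring => ('r, 'a) module => ('r, 'b) module => ('a \<times> 'b \<Rightarrow>\<^sub>0 int) => ('a \<times> 'b \<Rightarrow>\<^sub>0 int) set" where
 "tcoset R M N z = {h + z | h. h : tensor_rel R M N}"

lemma tcoset_eq: "tensor_rel R M N #>\<^bsub>free_Abelian_group (carrier M \<times> carrier N)\<^esub> z = tcoset R M N z"
 unfolding r_coset_def tcoset_def by auto

lemma tcoset_iff:
 assumes cl: "op_closed R M" "op_closed R N"
 shows "tcoset R M N z = tcoset R M N w \<longleftrightarrow> z - w : tensor_rel R M N"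
proof
 assume eq: "tcoset R M N z = tcoset R M N w"
 have "z : tcoset R M N z" using tensor_rel_group(1)[OF cl] unfolding tcoset_def by (auto intro!: exI[of _ 0])
 hence "z : tcoset R M N w" using eq by simp
 thus "z - w : tensor_rel R M N" unfolding tcoset_def by auto
next
 have *: "tcoset R M N z <= tcoset R M N w" if "z - w : tensor_rel R M N" for z w
 proof
  fix x assume "x : tcoset R M N z"
  then obtain h where h: "x = h + z" "h : tensor_rel R M N" unfolding tcoset_def by blast
  have "x = (h + (z - w)) + w" using h by simp
  thus "x : tcoset R M N w" using tensor_rel_group(2)[OF cl h(2) that] unfolding tcoset_def by blast
 qed
 assume zw: "z - w : tensor_rel R M N"
 have "0 - (z - w) : tensor_rel R M N" by (rule tensor_rel_group(3)[OF cl tensor_rel_group(1)[OF cl] zw])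
 thus "tcoset R M N z = tcoset R M N w" using *[OF zw] *[of w z] by simp
qed

lemma carrier_tensor_module:
 "carrier (tensor_module R M N) = tcoset R M N ` {z. Poly_Mapping.keys z <= carrier M \<times> carrier N}"
 unfolding tensor_module_def Let_def by (auto simp: carrier_FactGroup tcoset_eq)

lemma add_tensor_module:
 assumes cl: "op_closed R M" "op_closed R N"
 shows "tcoset R M N z \<oplus>\<^bsub>tensor_module R M N\<^esub> tcoset R M N w = tcoset R M N (z + w)"
proof -
 have "tcoset R M N z \<oplus>\<^bsub>tensor_module R M N\<^esub> tcoset R M N w = {x + y | x y. x : tcoset R M N z & y : tcoset R M N w}"
  unfolding tensor_module_def Let_def by (auto simp: FactGroup_def set_mult_def)
 also have "\<dots> = tcoset R M N (z + w)"
 proof (intro subset_antisym subsetI)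
  fix u assume "u : {x + y | x y. x : tcoset R M N z & y : tcoset R M N w}"
  then obtain h k where h: "u = (h + z) + (k + w)" "h : tensor_rel R M N" "k : tensor_rel R M N" unfolding tcoset_def by blast
  have "u = (h + k) + (z + w)" using h by simp
  thus "u : tcoset R M N (z + w)" using tensor_rel_group(2)[OF cl h(2,3)] unfolding tcoset_def by blast
 next
  fix u assume "u : tcoset R M N (z + w)"
  then obtain h where h: "u = h + (z + w)" "h : tensor_rel R M N" unfolding tcoset_def by blast
  have "u = (h + z) + (0 + w)" using h by simp
  thus "u : {x + y | x y. x : tcoset R M N z & y : tcoset R M N w}"
   using h(2) tensor_rel_group(1)[OF cl] unfolding tcoset_def by blast
 qed
 finally show ?thesis .
qed

lemma zero_tensor_module: "\<zero>\<^bsub>tensor_module R M N\<^esub> = tcoset R M N 0"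
 unfolding tensor_module_def Let_def by (auto simp: tcoset_def)

text \<open>\<open>f\<close> and \<open>g\<close> are semilinear along the map of rings
  \<open>r\<close>, so relations go to relations and all members of a coset have the same image. For
  restriction maps, \<open>r\<close> restricts regular functions.\<close>

lemma tensor_map_tcoset:
 assumes cl: "op_closed R M" "op_closed R N" and cl': "op_closed R' M'" "op_closed R' N'"
  and f: "!!x. x : carrier M' ==> f x : carrier M" "!!x y. x : carrier M' ==> y : carrier M' ==> f (x \<oplus>\<^bsub>M'\<^esub> y) = f x \<oplus>\<^bsub>M\<^esub> f y"
  and g: "!!x. x : carrier N' ==> g x : carrier N" "!!x y. x : carrier N' ==> y : carrier N' ==> g (x \<oplus>\<^bsub>N'\<^esub> y) = g x \<oplus>\<^bsub>N\<^esub> g y"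
  and r: "!!a. a : carrier R' ==> r a : carrier R"
   "!!a x. a : carrier R' ==> x : carrier M' ==> f (a \<odot>\<^bsub>M'\<^esub> x) = r a \<odot>\<^bsub>M\<^esub> f x"
   "!!a x. a : carrier R' ==> x : carrier N' ==> g (a \<odot>\<^bsub>N'\<^esub> x) = r a \<odot>\<^bsub>N\<^esub> g x"
 shows "tensor_map R M N f g (tcoset R' M' N' z) = tcoset R M N (frag_extend (%(x, y). frag_of (f x, g y)) z)"
proof -
 let ?x = "frag_extend (%(x, y). frag_of (f x, g y))"
 have H: "?x h : tensor_rel R M N" if h: "h : tensor_rel R' M' N'" for h
 proof -
  have "?x h : tensor_rel R M N & Poly_Mapping.keys h <= carrier M' \<times> carrier N'" using h cl'
  proof (induction rule: tensor_rel_induct)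
   case zero
   thus ?case using tensor_rel_group(1)[OF cl] by simp
  next
   case (left x x' y)
   thus ?case using tensor_rel_gens(1)[of "f x" M "f x'" "g y" N R] f g by (simp add: frag_extend_diff)
  next
   case (right x y y')
   thus ?case using tensor_rel_gens(2)[of "f x" M "g y" N "g y'" R] f g by (simp add: frag_extend_diff)
  next
   case (smult a x y)
   thus ?case using tensor_rel_gens(3)[of "r a" R "f x" M "g y" N] f g r by (simp add: frag_extend_diff)
  next
   case (diff a b)
   thus ?case using tensor_rel_group(3)[OF cl] by (simp add: frag_extend_diff)
  qed
  thus ?thesis ..
 qed
 have "tcoset R M N (?x w) = tcoset R M N (?x z)" if w: "w : tcoset R' M' N' z" for w
 proof -
  obtain h where "w = h + z" "h : tensor_rel R' M' N'" using w unfolding tcoset_def by blast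
  thus ?thesis unfolding tcoset_iff[OF cl] using H by (simp add: frag_extend_add)
 qed
 moreover have "z : tcoset R' M' N' z" using tensor_rel_group(1)[OF cl'] unfolding tcoset_def by (auto intro!: exI[of _ 0])
 ultimately show ?thesis unfolding tensor_map_def tcoset_eq by blast
qed

lemma op_closed_O_twist: "zariski_open n V ==> V ~= {} ==> op_closed (reg_ring n V) (sec (O_twist n t) V)"
 unfolding op_closed_def using iO_add(1) iO_smult(1) by blast

lemma O_twist_res: "res (O_twist n t) V W f = restrict f (\<Union>W)" by (simp add: O_twist_def)

section \<open>Values of sections of a twist\<close>

context charted_sheaf
begin

lemma op_closed_E: "zariski_open n V ==> op_closed (reg_ring n V) (sec E V)"
 unfolding op_closed_def using E_closed by blast

text \<open>The value of a formal sum of tensors: the pair of \<open>s\<close> and \<open>f\<close>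
  contributes the vector of \<open>s\<close> multiplied by the field element of
  \<open>f\<close>.\<close>

definition tval :: "int => point set => ('a \<times> ((nat => complex) => complex) \<Rightarrow>\<^sub>0 int) => rat2" where
 "tval t V z = (\<Sum>p\<in>Poly_Mapping.keys z. sm (of_int (Poly_Mapping.lookup z p) * iO n t V (snd p)) (psi V (fst p)))"

lemma tval_superset:
 assumes "finite S" "Poly_Mapping.keys z <= S"
 shows "tval t V z = (\<Sum>p\<in>S. sm (of_int (Poly_Mapping.lookup z p) * iO n t V (snd p)) (psi V (fst p)))"
 unfolding tval_def using assms by (intro sum.mono_neutral_left) (auto simp: in_keys_iff)

lemma tval_0 [simp]: "tval t V 0 = 0" by (simp add: tval_def)

lemma tval_frag_of [simp]: "tval t V (frag_of (s, f)) = sm (iO n t V f) (psi V s)" by (simp add: tval_def keys_frag_of)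

lemma tval_add [simp]: "tval t V (a + b) = tval t V a + tval t V b"
proof -
 define S where "S = Poly_Mapping.keys a \<union> Poly_Mapping.keys b"
 have S: "finite S" "Poly_Mapping.keys a <= S" "Poly_Mapping.keys b <= S" "Poly_Mapping.keys (a + b) <= S"
  unfolding S_def using keys_add[of a b] by auto
 show ?thesis unfolding tval_superset[OF S(1,2)] tval_superset[OF S(1,3)] tval_superset[OF S(1,4)] sum.distrib[symmetric]
  by (intro sum.cong refl) (simp add: lookup_add K2.scale_left_distrib algebra_simps)
qed

lemma tval_diff [simp]: "tval t V (a - b) = tval t V a - tval t V b" using tval_add[of t V "a - b" b] by (simp add: algebra_simps)

abbreviation Ot :: "int => point set => (point => complex, (nat => complex) => complex) module" where
 "Ot t V == sec (O_twist n t) V"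

abbreviation tc :: "int => point set => ('a \<times> ((nat => complex) => complex) \<Rightarrow>\<^sub>0 int) =>
  ('a \<times> ((nat => complex) => complex) \<Rightarrow>\<^sub>0 int) set" where
 "tc t V == tcoset (reg_ring n V) (sec E V) (Ot t V)"

abbreviation rel :: "int => point set => ('a \<times> ((nat => complex) => complex) \<Rightarrow>\<^sub>0 int) set" where
 "rel t V == tensor_rel (reg_ring n V) (sec E V) (Ot t V)"

lemma tval_rel:
 assumes V: "zariski_open n V" "V ~= {}" and z: "z : rel t V"
 shows "tval t V z = 0"
proof -
 have "tval t V z = 0 & Poly_Mapping.keys z <= Sec E V \<times> carrier (Ot t V)"
  using z op_closed_E[OF V(1)] op_closed_O_twist[OF V]
 proof (induction rule: tensor_rel_induct)
  case (left x x' y)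
  thus ?case using psi_add[OF V left(1,2)] by (simp add: K2.scale_right_distrib)
 next
  case (right x y y')
  thus ?case using iO_add(2)[OF V right(2,3)] by (simp add: K2.scale_left_distrib)
 next
  case (smult a x y)
  hence a: "a : Reg n V" "x : Sec E V" "y : carrier (Ot t V)" by auto
  show ?case using iO_smult(2)[OF V a(1,3)] psi_smult[OF V a(2,1)] by (simp add: sm_def mult_ac)
 qed simp_all
 thus ?thesis ..
qed

lemma tval_lat:
 assumes V: "zariski_open n V" "q : V" and z: "Poly_Mapping.keys z <= Sec E V \<times> carrier (Ot t V)"
 shows "tval t V z : lat t q"
proof -
 have V0: "V ~= {}" and q: "q : proj_space n" using V zariski_open_subset by auto
 show ?thesis using z
 proof (induction z rule: frag_induction)
  case zero
  show ?case using lat_0[OF q] by simp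
 next
  case (one x)
  have "sm (iO n t V (snd x)) (psi V (fst x)) : lat t q"
   by (rule lat_scale[OF iO_loc[OF V(1) V0 _ V(2)] psi_lat[OF V]]) (use one in auto)
  thus ?case using tval_frag_of[of t V "fst x" "snd x"] by simp
 next
  case (diff a b)
  thus ?case using lat_diff by simp
 qed
qed

definition TV :: "int => point set => ('a \<times> ((nat => complex) => complex) \<Rightarrow>\<^sub>0 int) set => rat2" where
 "TV t V C = tval t V (SOME z. z : C)"

lemma TV_tc:
 assumes V: "zariski_open n V" "V ~= {}"
 shows "TV t V (tc t V z) = tval t V z"
proof -
 have "z : tc t V z"
  using tensor_rel_group(1)[OF op_closed_E[OF V(1)] op_closed_O_twist[OF V]] unfolding tcoset_def by (auto intro!: exI[of _ 0])
 hence "(SOME w. w : tc t V z) : tc t V z" by (rule someI)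
 then obtain h where h: "(SOME w. w : tc t V z) = h + z" "h : rel t V" unfolding tcoset_def by blast
 show ?thesis unfolding TV_def h(1) using tval_rel[OF V h(2)] by simp
qed

abbreviation TP :: "int => ('a \<times> ((nat => complex) => complex) \<Rightarrow>\<^sub>0 int) set presheaf" where
 "TP t == tensor_presheaf n E (O_twist n t)"

lemma TP_carrier: "Sec (TP t) V = tc t V ` {z. Poly_Mapping.keys z <= Sec E V \<times> carrier (Ot t V)}"
 unfolding tensor_presheaf_def by (simp add: carrier_tensor_module)

lemma TV_lat:
 assumes V: "zariski_open n V" "q : V" and C: "C : Sec (TP t) V"
 shows "TV t V C : lat t q"
proof -
 obtain z where z: "C = tc t V z" "Poly_Mapping.keys z <= Sec E V \<times> carrier (Ot t V)" using C unfolding TP_carrier by blast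
 have "V ~= {}" using V by auto
 thus ?thesis unfolding z(1) using TV_tc[OF V(1)] tval_lat[OF V z(2)] by simp
qed

lemma TP_zero:
 assumes V: "zariski_open n V" "V ~= {}"
 shows "\<zero>\<^bsub>sec (TP t) V\<^esub> : Sec (TP t) V" "TV t V \<zero>\<^bsub>sec (TP t) V\<^esub> = 0"
proof -
 have z: "\<zero>\<^bsub>sec (TP t) V\<^esub> = tc t V 0" by (simp add: tensor_presheaf_def zero_tensor_module)
 show "\<zero>\<^bsub>sec (TP t) V\<^esub> : Sec (TP t) V" unfolding z TP_carrier by (rule imageI) simp
 show "TV t V \<zero>\<^bsub>sec (TP t) V\<^esub> = 0" unfolding z TV_tc[OF V] by simp
qed

lemma TP_add:
 assumes V: "zariski_open n V" "V ~= {}" and C: "C : Sec (TP t) V" "D : Sec (TP t) V"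
 shows "C \<oplus>\<^bsub>sec (TP t) V\<^esub> D : Sec (TP t) V" "TV t V (C \<oplus>\<^bsub>sec (TP t) V\<^esub> D) = TV t V C + TV t V D"
proof -
 obtain z where z: "C = tc t V z" "Poly_Mapping.keys z <= Sec E V \<times> carrier (Ot t V)" using C(1) unfolding TP_carrier by blast
 obtain w where w: "D = tc t V w" "Poly_Mapping.keys w <= Sec E V \<times> carrier (Ot t V)" using C(2) unfolding TP_carrier by blast
 have a: "C \<oplus>\<^bsub>sec (TP t) V\<^esub> D = tc t V (z + w)"
  unfolding z(1) w(1) using add_tensor_module[OF op_closed_E[OF V(1)] op_closed_O_twist[OF V]] by (simp add: tensor_presheaf_def)
 have "Poly_Mapping.keys (z + w) <= Sec E V \<times> carrier (Ot t V)" using keys_add[of z w] z(2) w(2) by blast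
 thus "C \<oplus>\<^bsub>sec (TP t) V\<^esub> D : Sec (TP t) V" unfolding a TP_carrier by blast
 show "TV t V (C \<oplus>\<^bsub>sec (TP t) V\<^esub> D) = TV t V C + TV t V D" unfolding a TV_tc[OF V] by (simp add: z(1) w(1) TV_tc[OF V])
qed

lemma TP_res:
 assumes V: "zariski_open n V" and W: "zariski_open n W" "W ~= {}" "W <= V" and C: "C : Sec (TP t) V"
 shows "res (TP t) V W C : Sec (TP t) W" "TV t W (res (TP t) V W C) = TV t V C"
proof -
 have V0: "V ~= {}" using W by auto
 obtain z where z: "C = tc t V z" "Poly_Mapping.keys z <= Sec E V \<times> carrier (Ot t V)" using C(1) unfolding TP_carrier by blast
 note oR = iO_restrict[OF V W] and rR = iR_restrict[OF V W]
 let ?x = "frag_extend (%(s, f). frag_of (res E V W s, res (O_twist n t) V W f))"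
 have r: "res (TP t) V W C = tc t W (?x z)" unfolding z(1) tensor_presheaf_def presheaf.simps
 proof (rule tensor_map_tcoset[OF op_closed_E[OF W(1)] op_closed_O_twist[OF W(1,2)] op_closed_E[OF V] op_closed_O_twist[OF V V0], where r = "%a. restrict a W"])
  show "res (O_twist n t) V W (x \<oplus>\<^bsub>Ot t V\<^esub> y) = res (O_twist n t) V W x \<oplus>\<^bsub>Ot t W\<^esub> res (O_twist n t) V W y"
   if xy: "x : carrier (Ot t V)" "y : carrier (Ot t V)" for x y unfolding O_twist_res
   by (rule iO_inj[OF W(1,2), where t = t])
    (simp_all add: oR[OF iO_add(1)[OF V V0 xy]] iO_add[OF V V0 xy] iO_add[OF W(1,2) oR(1)[OF xy(1)] oR(1)[OF xy(2)]] oR[OF xy(1)] oR[OF xy(2)])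
  show "res (O_twist n t) V W (a \<odot>\<^bsub>Ot t V\<^esub> x) = restrict a W \<odot>\<^bsub>Ot t W\<^esub> res (O_twist n t) V W x"
   if xy: "a : Reg n V" "x : carrier (Ot t V)" for a x unfolding O_twist_res
   by (rule iO_inj[OF W(1,2), where t = t])
    (simp_all add: oR[OF iO_smult(1)[OF V V0 xy]] iO_smult[OF V V0 xy] iO_smult[OF W(1,2) rR(1)[OF xy(1)] oR(1)[OF xy(2)]] rR[OF xy(1)] oR[OF xy(2)])
 qed (use E(3-5)[OF V W(1,3)] oR rR in \<open>auto simp: O_twist_res\<close>)
 have k: "Poly_Mapping.keys (?x z) <= Sec E W \<times> carrier (Ot t W) & tval t W (?x z) = tval t V z"
  using z(2)
 proof (induction z rule: frag_induction)
  case (one p)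
  thus ?case using psi_res[OF V W] E(3)[OF V W(1,3)] oR by (auto simp: keys_frag_of O_twist_res simp del: restrict_apply)
 next
  case (diff a b)
  thus ?case using keys_diff[of "?x a" "?x b"] by (auto simp: frag_extend_diff)
 qed simp
 show "res (TP t) V W C : Sec (TP t) W" unfolding r TP_carrier using k by blast
 show "TV t W (res (TP t) V W C) = TV t V C" unfolding r TV_tc[OF W(1,2)] using k by (simp add: z(1) TV_tc[OF V V0])
qed

lemma frame_exists:
 assumes q: "q : proj_space n" and V: "zariski_open n V" "V ~= {}" "V <= U q"
 shows "EX s1:Sec E V. EX s2:Sec E V. psi V s1 = e1 q & psi V s2 = e2 q"
proof -
 have P: "z : proj_space n" if "z : V" for z using zariski_open_subset[OF V(1)] that by blast
 have "EX s:Sec E V. c q V s = (1, 0) & psi V s = sm 1 (e1 q) + sm 0 (e2 q)"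
  by (rule psi_surj_local[OF q V]) (auto intro: loc_1 loc_0 P)
 moreover have "EX s:Sec E V. c q V s = (0, 1) & psi V s = sm 0 (e1 q) + sm 1 (e2 q)"
  by (rule psi_surj_local[OF q V]) (auto intro: loc_1 loc_0 P)
 ultimately show ?thesis by auto
qed

text \<open>Inside a chart \<open>s\<close> is a combination of \<open>s1\<close> and
  \<open>s2\<close>, and the scalars move across the tensor sign. Differences pass through
  \<open>g1 \<oplus> d1 = f1\<close>, since the relations speak of sums only.\<close>

lemma tensor_normal_form:
 assumes q: "q : proj_space n" and V: "zariski_open n V" "V ~= {}" "V <= U q"
  and s1: "s1 : Sec E V" "psi V s1 = e1 q" and s2: "s2 : Sec E V" "psi V s2 = e2 q"
  and z: "Poly_Mapping.keys z <= Sec E V \<times> carrier (Ot t V)"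
 shows "EX f1:carrier (Ot t V). EX f2:carrier (Ot t V). z - (frag_of (s1, f1) + frag_of (s2, f2)) : rel t V"
proof -
 note cl = op_closed_E[OF V(1)] op_closed_O_twist[OF V(1,2), of t]
 note H = tensor_rel_group(2,3)[OF cl]
 have P: "z : proj_space n" if "z : V" for z using zariski_open_subset[OF V(1)] that by blast
 have sub: "EX d:carrier (Ot t V). g \<oplus>\<^bsub>Ot t V\<^esub> d = f" if fg: "f : carrier (Ot t V)" "g : carrier (Ot t V)" for f g
 proof -
  have "EX d:carrier (Ot t V). iO n t V d = iO n t V f - iO n t V g"
   by (rule iO_surj[OF V(1,2)]) (rule loc_diff; rule iO_loc[OF V(1,2)]; use fg in auto)
  then obtain d where d: "d : carrier (Ot t V)" "iO n t V d = iO n t V f - iO n t V g" by blast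
  have "g \<oplus>\<^bsub>Ot t V\<^esub> d = f" by (rule iO_inj[OF V(1,2)]) (use iO_add[OF V(1,2) fg(2) d(1)] d fg in auto)
  thus ?thesis using d(1) by blast
 qed
 show ?thesis using z
 proof (induction z rule: frag_induction)
  case zero
  have "EX f:carrier (Ot t V). iO n t V f = 0" by (rule iO_surj[OF V(1,2)]) (use loc_0 P in auto)
  then obtain f where f: "f : carrier (Ot t V)" "iO n t V f = 0" by blast
  have ff: "f \<oplus>\<^bsub>Ot t V\<^esub> f = f" by (rule iO_inj[OF V(1,2)]) (use iO_add[OF V(1,2) f(1) f(1)] f in auto)
  have r: "frag_of (s, f) - frag_of (s, f) - frag_of (s, f) : rel t V" if "s : Sec E V" for s
   using tensor_rel_gens(2)[of s "sec E V" f "Ot t V" f "reg_ring n V"] that f(1) ff by simp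
  have "0 - (frag_of (s1, f) + frag_of (s2, f)) : rel t V" using H(1)[OF r[OF s1(1)] r[OF s2(1)]] by simp
  thus ?case using f(1) by blast
 next
  case (one x)
  obtain s f where x: "x = (s, f)" "s : Sec E V" "f : carrier (Ot t V)" using one by blast
  obtain a where a: "a : Reg n V" "iR n V a = fst (c q V s)"
   using iR_surj[OF V(1,2), of "fst (c q V s)"] c_loc[OF q V x(2)] by blast
  obtain b where b: "b : Reg n V" "iR n V b = snd (c q V s)"
   using iR_surj[OF V(1,2), of "snd (c q V s)"] c_loc[OF q V x(2)] by blast
  note as = E_closed(2)[OF V(1) a(1) s1(1)] and bs = E_closed(2)[OF V(1) b(1) s2(1)]
  have s: "s = a \<odot>\<^bsub>sec E V\<^esub> s1 \<oplus>\<^bsub>sec E V\<^esub> b \<odot>\<^bsub>sec E V\<^esub> s2"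
   by (rule psi_inj[OF V(1,2) x(2) E_closed(1)[OF V(1) as bs]])
    (use psi_frame[OF q V x(2)] psi_add[OF V(1,2) as bs] psi_smult[OF V(1,2) s1(1) a(1)] psi_smult[OF V(1,2) s2(1) b(1)]
      a b s1 s2 in simp)
  let ?af = "a \<odot>\<^bsub>Ot t V\<^esub> f" and ?bf = "b \<odot>\<^bsub>Ot t V\<^esub> f"
  have "(frag_of (s, f) - frag_of (a \<odot>\<^bsub>sec E V\<^esub> s1, f) - frag_of (b \<odot>\<^bsub>sec E V\<^esub> s2, f)) +
    (frag_of (a \<odot>\<^bsub>sec E V\<^esub> s1, f) - frag_of (s1, ?af)) + (frag_of (b \<odot>\<^bsub>sec E V\<^esub> s2, f) - frag_of (s2, ?bf)) : rel t V"
   unfolding s by (intro H(1) tensor_rel_gens as bs a b s1 s2 x)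
  hence "frag_of x - (frag_of (s1, ?af) + frag_of (s2, ?bf)) : rel t V" unfolding x(1) by (simp add: algebra_simps)
  thus ?case using iO_smult(1)[OF V(1,2) a(1) x(3)] iO_smult(1)[OF V(1,2) b(1) x(3)] by blast
 next
  case (diff a b)
  obtain f1 f2 where f: "f1 : carrier (Ot t V)" "f2 : carrier (Ot t V)" "a - (frag_of (s1, f1) + frag_of (s2, f2)) : rel t V"
   using diff.IH(1) by blast
  obtain g1 g2 where g: "g1 : carrier (Ot t V)" "g2 : carrier (Ot t V)" "b - (frag_of (s1, g1) + frag_of (s2, g2)) : rel t V"
   using diff.IH(2) by blast
  obtain d1 where d1: "d1 : carrier (Ot t V)" "g1 \<oplus>\<^bsub>Ot t V\<^esub> d1 = f1" using sub[OF f(1) g(1)] by blast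
  obtain d2 where d2: "d2 : carrier (Ot t V)" "g2 \<oplus>\<^bsub>Ot t V\<^esub> d2 = f2" using sub[OF f(2) g(2)] by blast
  have 1: "frag_of (s1, f1) - frag_of (s1, g1) - frag_of (s1, d1) : rel t V"
   using tensor_rel_gens(2)[OF s1(1) g(1) d1(1)] unfolding d1(2) .
  have 2: "frag_of (s2, f2) - frag_of (s2, g2) - frag_of (s2, d2) : rel t V"
   using tensor_rel_gens(2)[OF s2(1) g(2) d2(1)] unfolding d2(2) .
  have "(a - (frag_of (s1, f1) + frag_of (s2, f2))) - (b - (frag_of (s1, g1) + frag_of (s2, g2))) +
    (frag_of (s1, f1) - frag_of (s1, g1) - frag_of (s1, d1)) + (frag_of (s2, f2) - frag_of (s2, g2) - frag_of (s2, d2)) : rel t V"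
   by (intro H(1) H(2) f(3) g(3) 1 2)
  hence "(a - b) - (frag_of (s1, d1) + frag_of (s2, d2)) : rel t V" by (simp add: algebra_simps)
  thus ?case using d1(1) d2(1) by blast
 qed
qed

text \<open>Inside a chart the normal form is determined by the value, as \<open>e1 q\<close> and
  \<open>e2 q\<close> are independent. For the comparison of germs this suffices.\<close>

lemma TP_local_inj:
 assumes q: "q : proj_space n" and V: "zariski_open n V" "V ~= {}" "V <= U q"
  and C: "C : Sec (TP t) V" "D : Sec (TP t) V" and eq: "TV t V C = TV t V D"
 shows "C = D"
proof -
 note cl = op_closed_E[OF V(1)] op_closed_O_twist[OF V(1,2), of t]
 note H = tensor_rel_group(2,3)[OF cl]
 obtain z where z: "C = tc t V z" "Poly_Mapping.keys z <= Sec E V \<times> carrier (Ot t V)" using C(1) unfolding TP_carrier by blast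
 obtain w where w: "D = tc t V w" "Poly_Mapping.keys w <= Sec E V \<times> carrier (Ot t V)" using C(2) unfolding TP_carrier by blast
 obtain s1 s2 where s: "s1 : Sec E V" "psi V s1 = e1 q" "s2 : Sec E V" "psi V s2 = e2 q"
  using frame_exists[OF q V] by blast
 obtain f1 f2 where f: "f1 : carrier (Ot t V)" "f2 : carrier (Ot t V)" "z - (frag_of (s1, f1) + frag_of (s2, f2)) : rel t V"
  using tensor_normal_form[OF q V s z(2)] by blast
 obtain g1 g2 where g: "g1 : carrier (Ot t V)" "g2 : carrier (Ot t V)" "w - (frag_of (s1, g1) + frag_of (s2, g2)) : rel t V"
  using tensor_normal_form[OF q V s w(2)] by blast
 have vz: "tval t V z = sm (iO n t V f1) (e1 q) + sm (iO n t V f2) (e2 q)" using tval_rel[OF V(1,2) f(3)] s by simp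
 have vw: "tval t V w = sm (iO n t V g1) (e1 q) + sm (iO n t V g2) (e2 q)" using tval_rel[OF V(1,2) g(3)] s by simp
 have "sm (iO n t V f1) (e1 q) + sm (iO n t V f2) (e2 q) = sm (iO n t V g1) (e1 q) + sm (iO n t V g2) (e2 q)"
  using eq vz vw unfolding z(1) w(1) TV_tc[OF V(1,2)] by simp
 note bu = basis_unique[OF det[OF q] this]
 have fg: "f1 = g1" "f2 = g2" by (rule iO_inj[OF V(1,2) f(1) g(1) bu(1)]) (rule iO_inj[OF V(1,2) f(2) g(2) bu(2)])
 have "z - w : rel t V" using H(2)[OF f(3) g(3)] unfolding fg by simp
 thus ?thesis unfolding z(1) w(1) tcoset_iff[OF cl] .
qed

lemma TP_local_surj:
 assumes q: "q : proj_space n" and V: "zariski_open n V" "q : V" "V <= U q" and x: "!!z. z : V ==> x : lat t z"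
 shows "EX C:Sec (TP t) V. TV t V C = x"
proof -
 have V0: "V ~= {}" using V by auto
 obtain a b where ab: "x = sm a (e1 q) + sm b (e2 q)" using x[OF V(2)] unfolding lat_def span2_def by blast
 have l: "a : loc n t z & b : loc n t z" if z: "z : V" for z
 proof -
  obtain a' b' where ab': "x = sm a' (e1 q) + sm b' (e2 q)" "a' : loc n t z" "b' : loc n t z"
   using x[OF z] lat_eq[OF q, of z t] V(3) z unfolding span2_def by blast
  show ?thesis using basis_unique[OF det[OF q] ab[unfolded ab'(1), symmetric]] ab' by simp
 qed
 obtain f1 where f1: "f1 : carrier (Ot t V)" "iO n t V f1 = a" using iO_surj[OF V(1) V0, of a t] l by blast
 obtain f2 where f2: "f2 : carrier (Ot t V)" "iO n t V f2 = b" using iO_surj[OF V(1) V0, of b t] l by blast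
 obtain s1 s2 where s: "s1 : Sec E V" "psi V s1 = e1 q" "s2 : Sec E V" "psi V s2 = e2 q"
  using frame_exists[OF q V(1) V0 V(3)] by blast
 have "Poly_Mapping.keys (frag_of (s1, f1) + frag_of (s2, f2)) <= Sec E V \<times> carrier (Ot t V)"
  using keys_add[of "frag_of (s1, f1)" "frag_of (s2, f2)"] s f1 f2 by (auto simp: keys_frag_of)
 thus ?thesis unfolding TP_carrier using TV_tc[OF V(1) V0] ab f1 f2 s
  by (intro bexI[of _ "tc t V (frag_of (s1, f1) + frag_of (s2, f2))"]) auto
qed

text \<open>The germ with value \<open>x\<close>, as the set of all its representatives: local
  tensors near \<open>p\<close> with that value.\<close>

definition gm :: "int => point => rat2 => (point set \<times> ('a \<times> ((nat => complex) => complex) \<Rightarrow>\<^sub>0 int) set) set" where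
 "gm t p x = {(V, C). zariski_open n V & p : V & C : Sec (TP t) V & TV t V C = x}"

lemma germ_eq:
 assumes V: "zariski_open n V" "p : V" and C: "C : Sec (TP t) V"
 shows "germ n (TP t) p V C = gm t p (TV t V C)"
proof -
 have p: "p : proj_space n" using zariski_open_subset V by blast
 have "(EX W. zariski_open n W & p : W & W <= V \<inter> V' & res (TP t) V W C = res (TP t) V' W D) \<longleftrightarrow> TV t V' D = TV t V C"
  if V': "zariski_open n V'" "p : V'" and D: "D : carrier (sec (TP t) V')" for V' D
 proof
  assume "EX W. zariski_open n W & p : W & W <= V \<inter> V' & res (TP t) V W C = res (TP t) V' W D"
  then obtain W where W: "zariski_open n W" "p : W" "W <= V" "W <= V'" "res (TP t) V W C = res (TP t) V' W D" by blast
  hence "W ~= {}" by auto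
  from TP_res(2)[OF V(1) W(1) this W(3) C] TP_res(2)[OF V'(1) W(1) this W(4) D]
  show "TV t V' D = TV t V C" unfolding W(5) by simp
 next
  assume eq: "TV t V' D = TV t V C"
  define W where "W = V \<inter> V' \<inter> U p"
  have W: "zariski_open n W" "p : W" "W <= V" "W <= V'" "W <= U p" unfolding W_def
   using zariski_open_Int[OF zariski_open_Int[OF V(1) V'(1)]] Uq[OF p] V V' by auto
  hence W0: "W ~= {}" by auto
  have "res (TP t) V W C = res (TP t) V' W D"
   by (rule TP_local_inj[OF p W(1) W0 W(5) TP_res(1)[OF V(1) W(1) W0 W(3) C] TP_res(1)[OF V'(1) W(1) W0 W(4) D]])
    (simp add: TP_res(2)[OF V(1) W(1) W0 W(3) C] TP_res(2)[OF V'(1) W(1) W0 W(4) D] eq)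
  thus "EX W. zariski_open n W & p : W & W <= V \<inter> V' & res (TP t) V W C = res (TP t) V' W D"
   using W by blast
 qed
 thus ?thesis unfolding germ_def gm_def openin_zariski by blast
qed

lemma gm_nonempty:
 assumes p: "p : proj_space n" and V: "zariski_open n V" "p : V" and x: "x : lat t p"
 shows "EX W C. (W, C) : gm t p x & W <= V & (ALL z:W. x : lat t z)"
proof -
 obtain W where W: "zariski_open n W" "p : W" "W <= U p" "ALL z:W. x : lat t z" using lat_open[OF x p] by blast
 have I: "zariski_open n (V \<inter> W)" "p : V \<inter> W" "V \<inter> W <= U p" using zariski_open_Int[OF V(1) W(1)] V W by auto
 have "EX C:carrier (sec (TP t) (V \<inter> W)). TV t (V \<inter> W) C = x" by (rule TP_local_surj[OF p I]) (use W in auto)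
 then obtain C where "C : carrier (sec (TP t) (V \<inter> W))" "TV t (V \<inter> W) C = x" by blast
 hence "(V \<inter> W, C) : gm t p x" unfolding gm_def using I by blast
 thus ?thesis using W(4) by blast
qed

lemma gm_inj:
 assumes p: "p : proj_space n" and x: "x : lat t p" and eq: "gm t p x = gm t p y"
 shows "x = y"
proof -
 obtain W C where "(W, C) : gm t p x" using gm_nonempty[OF p zariski_open_proj p x] by blast
 moreover from this have "(W, C) : gm t p y" unfolding eq .
 ultimately show ?thesis unfolding gm_def by blast
qed

text \<open>A section of the sheafification has locally constant value, and irreducibility makes the
  value constant on \<open>X\<close>.\<close>

lemma twist_carrier:
 assumes U: "zariski_open n X" "X ~= {}"
 shows "\<sigma> : Sec (twist n E t) X \<longleftrightarrow> \<sigma> : extensional X & (EX x. ALL p:X. x : lat t p & \<sigma> p = gm t p x)"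
proof -
 have P: "z : proj_space n" if "z : X" for z using zariski_open_subset[OF U(1)] that by blast
 have "(ALL p:X. EX V. zariski_open n V & p : V & V <= X & (EX s:Sec (TP t) V. ALL q:V. \<sigma> q = germ n (TP t) q V s)) \<longleftrightarrow>
  (EX x. ALL p:X. x : lat t p & \<sigma> p = gm t p x)" (is "?A \<longleftrightarrow> ?B")
 proof
  assume A: ?A
  have A': "EX V x. zariski_open n V & p : V & V <= X & (ALL q:V. x : lat t q & \<sigma> q = gm t q x)" if p: "p : X" for p
  proof -
   obtain V s where V: "zariski_open n V" "p : V" "V <= X" "s : Sec (TP t) V" "ALL q:V. \<sigma> q = germ n (TP t) q V s"
    using A p by blast
   have "TV t V s : lat t q & \<sigma> q = gm t q (TV t V s)" if q: "q : V" for q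
    using TV_lat[OF V(1) q V(4)] germ_eq[OF V(1) q V(4)] V(5) q by simp
   thus ?thesis using V(1-3) by blast
  qed
  obtain p0 where p0: "p0 : X" using U by blast
  obtain V x where V: "zariski_open n V" "p0 : V" "V <= X" "ALL q:V. x : lat t q & \<sigma> q = gm t q x" using A'[OF p0] by blast
  have "x : lat t p & \<sigma> p = gm t p x" if p: "p : X" for p
  proof -
   obtain W y where W: "zariski_open n W" "p : W" "W <= X" "ALL q:W. y : lat t q & \<sigma> q = gm t q y" using A'[OF p] by blast
   have "V \<inter> W ~= {}" by (rule zariski_irreducible[OF V(1) W(1)]) (use V W in auto)
   then obtain r where r: "r : V" "r : W" by blast
   have "x = y" by (rule gm_inj[of r x t y]) (use r V W P in auto)
   thus ?thesis using W by blast
  qed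
  thus ?B by blast
 next
  assume ?B
  then obtain x where x: "!!p. p : X ==> x : lat t p" "!!p. p : X ==> \<sigma> p = gm t p x" by blast
  show ?A
  proof
   fix p assume p: "p : X"
   obtain W C where W: "(W, C) : gm t p x" "W <= X" using gm_nonempty[OF P[OF p] U(1) p x(1)[OF p]] by blast
   have W': "zariski_open n W" "p : W" "C : Sec (TP t) W" "TV t W C = x" using W(1) unfolding gm_def by auto
   have "\<sigma> q = germ n (TP t) q W C" if q: "q : W" for q
    using x(2)[of q] germ_eq[OF W'(1) q W'(3)] W'(4) W(2) q by auto
   thus "EX V. zariski_open n V & p : V & V <= X & (EX s:Sec (TP t) V. ALL q:V. \<sigma> q = germ n (TP t) q V s)"
    using W W' by blast
  qed
 qed
 thus ?thesis unfolding twist_def tensor_sheaf_def sheafify_def by simp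
qed

definition tw :: "int => point set => (point => (point set \<times> ('a \<times> ((nat => complex) => complex) \<Rightarrow>\<^sub>0 int) set) set) => rat2" where
 "tw t X \<sigma> = (THE x. ALL p:X. x : lat t p & \<sigma> p = gm t p x)"

lemma tw_eqI:
 assumes X: "zariski_open n X" "X ~= {}" and x: "!!p. p : X ==> x : lat t p" "!!p. p : X ==> \<sigma> p = gm t p x"
 shows "tw t X \<sigma> = x" unfolding tw_def
proof (rule the_equality)
 show "ALL p:X. x : lat t p & \<sigma> p = gm t p x" using x by blast
 fix y assume y: "ALL p:X. y : lat t p & \<sigma> p = gm t p y"
 obtain p where p: "p : X" using X by blast
 have "p : proj_space n" using zariski_open_subset[OF X(1)] p by blast
 thus "y = x" using gm_inj[of p y t x] y x(2)[OF p] p by auto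
qed

lemma tw_spec:
 assumes X: "zariski_open n X" "X ~= {}" and s: "\<sigma> : Sec (twist n E t) X" and p: "p : X"
 shows "tw t X \<sigma> : lat t p" "\<sigma> p = gm t p (tw t X \<sigma>)"
proof -
 obtain x where x: "!!p. p : X ==> x : lat t p" "!!p. p : X ==> \<sigma> p = gm t p x" using s unfolding twist_carrier[OF X] by blast
 show "tw t X \<sigma> : lat t p" "\<sigma> p = gm t p (tw t X \<sigma>)" unfolding tw_eqI[OF X x, simplified] using x p by auto
qed

lemma germ_add_gm:
 assumes p: "p : proj_space n" and x: "x : lat t p" "y : lat t p"
 shows "germ_add n (TP t) p (gm t p x) (gm t p y) = gm t p (x + y)"
proof -
 have eq: "germ n (TP t) p (V \<inter> W) (res (TP t) V (V \<inter> W) C \<oplus>\<^bsub>sec (TP t) (V \<inter> W)\<^esub> res (TP t) W (V \<inter> W) D) = gm t p (x + y)"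
  if C: "(V, C) : gm t p x" and D: "(W, D) : gm t p y" for V W C D
 proof -
  have c: "zariski_open n V" "p : V" "C : Sec (TP t) V" "TV t V C = x"
   and d: "zariski_open n W" "p : W" "D : Sec (TP t) W" "TV t W D = y" using C D unfolding gm_def by auto
  have O: "zariski_open n (V \<inter> W)" "V \<inter> W ~= {}" "p : V \<inter> W" using zariski_open_Int[OF c(1) d(1)] c d by auto
  note rc = TP_res[OF c(1) O(1,2) Int_lower1 c(3)] and rd = TP_res[OF d(1) O(1,2) Int_lower2 d(3)]
  note a = TP_add[OF O(1,2) rc(1) rd(1)]
  show ?thesis unfolding germ_eq[OF O(1,3) a(1)] a(2) rc(2) rd(2) c(4) d(4) ..
 qed
 obtain V C where "(V, C) : gm t p x" using gm_nonempty[OF p zariski_open_proj p x(1)] by blast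
 moreover obtain W D where "(W, D) : gm t p y" using gm_nonempty[OF p zariski_open_proj p x(2)] by blast
 ultimately show ?thesis unfolding germ_add_def using eq by fastforce
qed

theorem twist_model: "stalk_model n (twist n E t) (lat t) (tw t)"
proof
 fix X assume X: "zariski_open n X" "X ~= {}"
 have P: "z : proj_space n" if "z : X" for z using zariski_open_subset[OF X(1)] that by blast
 note spec = tw_spec[OF X]
 have mem: "(\<lambda>p\<in>X. gm t p x) : Sec (twist n E t) X" "tw t X (\<lambda>p\<in>X. gm t p x) = x"
  if "!!p. p : X ==> x : lat t p" for x
 proof -
  show "(\<lambda>p\<in>X. gm t p x) : Sec (twist n E t) X"
   unfolding twist_carrier[OF X] by (intro conjI exI[of _ x] ballI) (simp_all add: that)
  show "tw t X (\<lambda>p\<in>X. gm t p x) = x" by (rule tw_eqI[OF X]) (simp_all add: that)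
 qed
 have eq: "\<sigma> = (\<lambda>p\<in>X. gm t p (tw t X \<sigma>))" if s: "\<sigma> : Sec (twist n E t) X" for \<sigma>
  using spec(2)[OF s] s unfolding twist_carrier[OF X] by (intro extensionalityI[of _ X]) auto
 show "bij_betw (tw t X) (Sec (twist n E t) X) {x. ALL z:X. x : lat t z}"
  by (rule bij_betwI[of _ _ _ "%x. \<lambda>p\<in>X. gm t p x"]) (use spec mem eq in auto)
 have z: "\<zero>\<^bsub>sec (twist n E t) X\<^esub> = (\<lambda>p\<in>X. gm t p 0)"
  using germ_eq[OF X(1) _ TP_zero(1)[OF X]] TP_zero(2)[OF X]
  by (auto simp: twist_def tensor_sheaf_def sheafify_def restrict_def fun_eq_iff)
 show "\<zero>\<^bsub>sec (twist n E t) X\<^esub> : Sec (twist n E t) X & tw t X \<zero>\<^bsub>sec (twist n E t) X\<^esub> = 0"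
  unfolding z using mem[of 0] lat_0 P by blast
 fix \<sigma> \<tau> assume s: "\<sigma> : Sec (twist n E t) X" "\<tau> : Sec (twist n E t) X"
 have a: "\<sigma> \<oplus>\<^bsub>sec (twist n E t) X\<^esub> \<tau> = (\<lambda>p\<in>X. gm t p (tw t X \<sigma> + tw t X \<tau>))"
 proof -
  have "\<sigma> \<oplus>\<^bsub>sec (twist n E t) X\<^esub> \<tau> = (\<lambda>p\<in>X. germ_add n (TP t) p (\<sigma> p) (\<tau> p))"
   by (simp add: twist_def tensor_sheaf_def sheafify_def)
  also have "\<dots> = (\<lambda>p\<in>X. gm t p (tw t X \<sigma> + tw t X \<tau>))"
  proof (rule restrict_ext)
   fix p assume p: "p : X"
   show "germ_add n (TP t) p (\<sigma> p) (\<tau> p) = gm t p (tw t X \<sigma> + tw t X \<tau>)"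
    unfolding spec(2)[OF s(1) p] spec(2)[OF s(2) p] by (rule germ_add_gm[OF P[OF p] spec(1)[OF s(1) p] spec(1)[OF s(2) p]])
  qed
  finally show ?thesis .
 qed
 show "\<sigma> \<oplus>\<^bsub>sec (twist n E t) X\<^esub> \<tau> : Sec (twist n E t) X &
  tw t X (\<sigma> \<oplus>\<^bsub>sec (twist n E t) X\<^esub> \<tau>) = tw t X \<sigma> + tw t X \<tau>"
  unfolding a using mem[of "tw t X \<sigma> + tw t X \<tau>"] lat_add P spec(1) s by blast
next
 fix X Y \<sigma> assume X: "zariski_open n X" and Y: "zariski_open n Y" "Y ~= {}" "Y <= X" and s: "\<sigma> : Sec (twist n E t) X"
 have X0: "X ~= {}" using Y by auto
 have r: "res (twist n E t) X Y \<sigma> = restrict \<sigma> Y" by (simp add: twist_def tensor_sheaf_def sheafify_def)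
 have v: "tw t X \<sigma> : lat t p" "restrict \<sigma> Y p = gm t p (tw t X \<sigma>)" if "p : Y" for p
  using tw_spec[OF X X0 s, of p] Y(3) that by auto
 have "restrict \<sigma> Y : Sec (twist n E t) Y"
  unfolding twist_carrier[OF Y(1,2)] using v by (intro conjI restrict_extensional exI[of _ "tw t X \<sigma>"] ballI) blast+
 moreover have "tw t Y (restrict \<sigma> Y) = tw t X \<sigma>" by (rule tw_eqI[OF Y(1,2)]) (use v in blast)+
 ultimately show "res (twist n E t) X Y \<sigma> : Sec (twist n E t) Y & tw t Y (res (twist n E t) X Y \<sigma>) = tw t X \<sigma>"
  unfolding r by blast
qed (use lat_0 lat_diff in auto)

lemma twist_vanishing: "cohomology_vanishes n (twist n E t) i \<longleftrightarrow> stalk_vanishing n (lat t) i"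
 by (rule stalk_model.cohomology_vanishes_iff[OF twist_model])

end

section \<open>Split bundles\<close>

lemma is_iso_on_subset: "is_iso_on n X F G \<phi> ==> Y <= X ==> is_iso_on n Y F G \<phi>"
 unfolding is_iso_on_def by (meson subset_trans)

lemma charted_of_trivialisation:
 assumes sh: "sheaf_of_modules n E"
  and \<phi>: "!!q. q : proj_space n ==> zariski_open n (U q) & q : U q"
   "!!q. q : proj_space n ==> is_iso_on n (U q) E (free_sheaf n 2) (\<phi> q)"
 shows "charted_sheaf n E U (%q V s. (iR n V (\<phi> q V s 0), iR n V (\<phi> q V s 1)))"
proof (unfold_locales, rule sh, rule \<phi>(1), assumption)
 fix q V assume q: "q : proj_space n" and V: "zariski_open n V" "V ~= {}" "V <= U q"
 note C = free_coordinates[OF \<phi>(2)[OF q] V]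
 {
  fix s z assume "s : Sec E V" "z : V"
  thus "fst (iR n V (\<phi> q V s 0), iR n V (\<phi> q V s 1)) : loc n 0 z & snd (iR n V (\<phi> q V s 0), iR n V (\<phi> q V s 1)) : loc n 0 z"
   using C(1) by simp
 }
 {
  fix s t assume s: "s : Sec E V" "t : Sec E V"
   and eq: "(iR n V (\<phi> q V s 0), iR n V (\<phi> q V s 1)) = (iR n V (\<phi> q V t 0), iR n V (\<phi> q V t 1))"
  show "s = t"
  proof (rule C(2)[OF s])
   fix j :: nat assume "j < 2"
   hence "j = 0 | j = 1" by auto
   thus "iR n V (\<phi> q V s j) = iR n V (\<phi> q V t j)" using eq by auto
  qed
 }
 {
  fix x :: rat2 assume x: "!!z. z : V ==> fst x : loc n 0 z & snd x : loc n 0 z"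
  have "EX s:Sec E V. ALL j<2. iR n V (\<phi> q V s j) = (if j = 0 then fst x else snd x)"
   by (rule C(3)) (use x in auto)
  then obtain s where s: "s : Sec E V" "ALL j<2. iR n V (\<phi> q V s j) = (if j = 0 then fst x else snd x)" by blast
  have "(iR n V (\<phi> q V s 0), iR n V (\<phi> q V s 1)) = x"
   using s(2)[rule_format, of 0] s(2)[rule_format, of 1] by (simp add: prod_eq_iff)
  thus "EX s:Sec E V. (iR n V (\<phi> q V s 0), iR n V (\<phi> q V s 1)) = x" using s(1) by blast
 }
 {
  fix s t assume s: "s : Sec E V" "t : Sec E V"
  show "(iR n V (\<phi> q V (s \<oplus>\<^bsub>sec E V\<^esub> t) 0), iR n V (\<phi> q V (s \<oplus>\<^bsub>sec E V\<^esub> t) 1)) =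
   (iR n V (\<phi> q V s 0), iR n V (\<phi> q V s 1)) + (iR n V (\<phi> q V t 0), iR n V (\<phi> q V t 1))"
   using C(4)[OF s] by simp
 }
 {
  fix s a assume s: "s : Sec E V" "a : Reg n V"
  show "(iR n V (\<phi> q V (a \<odot>\<^bsub>sec E V\<^esub> s) 0), iR n V (\<phi> q V (a \<odot>\<^bsub>sec E V\<^esub> s) 1)) =
   sm (iR n V a) (iR n V (\<phi> q V s 0), iR n V (\<phi> q V s 1))" using C(5)[OF s(2,1)] by (simp add: sm_def)
 }
next
 fix q V s W assume q: "q : proj_space n" and V: "zariski_open n V" "V <= U q" and s: "s : Sec E V"
  and W: "zariski_open n W" "W ~= {}" "W <= V"
 have "V ~= {}" using W by auto
 from free_coordinates(6)[OF \<phi>(2)[OF q] V(1) this V(2) W s]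
 show "(iR n W (\<phi> q W (res E V W s) 0), iR n W (\<phi> q W (res E V W s) 1)) = (iR n V (\<phi> q V s 0), iR n V (\<phi> q V s 1))"
  by simp
qed

lemma direct_sum_simps:
 "Sec (direct_sum L M) V = Sec L V \<times> Sec M V"
 "fst (x \<oplus>\<^bsub>sec (direct_sum L M) V\<^esub> y) = fst x \<oplus>\<^bsub>sec L V\<^esub> fst y"
 "snd (x \<oplus>\<^bsub>sec (direct_sum L M) V\<^esub> y) = snd x \<oplus>\<^bsub>sec M V\<^esub> snd y"
 "fst (a \<odot>\<^bsub>sec (direct_sum L M) V\<^esub> x) = a \<odot>\<^bsub>sec L V\<^esub> fst x"
 "snd (a \<odot>\<^bsub>sec (direct_sum L M) V\<^esub> x) = a \<odot>\<^bsub>sec M V\<^esub> snd x"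
 "\<zero>\<^bsub>sec (direct_sum L M) V\<^esub> = (\<zero>\<^bsub>sec L V\<^esub>, \<zero>\<^bsub>sec M V\<^esub>)"
 "fst (res (direct_sum L M) V W x) = res L V W (fst x)"
 "snd (res (direct_sum L M) V W x) = res M V W (snd x)" by (simp_all add: direct_sum_def split_beta)

text \<open>These charts respect the decomposition, which will make all transition matrices
  diagonal.\<close>

lemma charted_of_direct_sum:
 assumes sh: "sheaf_of_modules n E" and \<theta>: "is_iso_on n (proj_space n) E (direct_sum L M) \<theta>"
  and U: "!!q. q : proj_space n ==> zariski_open n (U q) & q : U q"
   "!!q. q : proj_space n ==> is_iso_on n (U q) L (free_sheaf n 1) (\<alpha> q)"
   "!!q. q : proj_space n ==> is_iso_on n (U q) M (free_sheaf n 1) (\<beta> q)"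
 shows "charted_sheaf n E U (%q V s. (iR n V (\<alpha> q V (fst (\<theta> V s)) 0), iR n V (\<beta> q V (snd (\<theta> V s)) 0)))"
  (is "charted_sheaf n E U ?c")
proof (unfold_locales, rule sh, rule U(1), assumption)
 fix q V assume q: "q : proj_space n" and V: "zariski_open n V" "V ~= {}" "V <= U q"
 note A = free_coordinates[OF U(2)[OF q] V] and B = free_coordinates[OF U(3)[OF q] V]
 note T = is_iso_onD[OF \<theta> V(1) zariski_open_subset[OF V(1)]]
 have cl: "fst (\<theta> V s) : Sec L V" "snd (\<theta> V s) : Sec M V" if "s : Sec E V" for s
  using bij_betwE[OF T(1)] that unfolding direct_sum_simps by (auto simp: mem_Times_iff)
 {
  fix s z assume "s : Sec E V" "z : V"
  thus "fst (?c q V s) : loc n 0 z & snd (?c q V s) : loc n 0 z" using A(1) B(1) cl by simp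
 }
 {
  fix s t assume s: "s : Sec E V" "t : Sec E V" and eq: "?c q V s = ?c q V t"
  have "fst (\<theta> V s) = fst (\<theta> V t)" by (rule A(2)[OF cl(1)[OF s(1)] cl(1)[OF s(2)]]) (use eq in auto)
  moreover have "snd (\<theta> V s) = snd (\<theta> V t)" by (rule B(2)[OF cl(2)[OF s(1)] cl(2)[OF s(2)]]) (use eq in auto)
  ultimately have "\<theta> V s = \<theta> V t" by (simp add: prod_eq_iff)
  thus "s = t" using inj_onD[OF bij_betw_imp_inj_on[OF T(1)]] s by blast
 }
 {
  fix x :: rat2 assume x: "!!z. z : V ==> fst x : loc n 0 z & snd x : loc n 0 z"
  have "EX l:Sec L V. ALL j<1. iR n V (\<alpha> q V l j) = fst x" by (rule A(3)) (use x in auto)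
  then obtain l where l: "l : Sec L V" "iR n V (\<alpha> q V l 0) = fst x" by auto
  have "EX l:Sec M V. ALL j<1. iR n V (\<beta> q V l j) = snd x" by (rule B(3)) (use x in auto)
  then obtain m where m: "m : Sec M V" "iR n V (\<beta> q V m 0) = snd x" by auto
  have "(l, m) : \<theta> V ` Sec E V" unfolding bij_betw_imp_surj_on[OF T(1)] direct_sum_simps using l m by simp
  then obtain s where s: "s : Sec E V" "\<theta> V s = (l, m)" by auto
  have "?c q V s = x" using s(2) l(2) m(2) by (simp add: prod_eq_iff)
  thus "EX s:Sec E V. ?c q V s = x" using s(1) by blast
 }
 {
  fix s t assume s: "s : Sec E V" "t : Sec E V"
  show "?c q V (s \<oplus>\<^bsub>sec E V\<^esub> t) = ?c q V s + ?c q V t"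
   unfolding T(2)[OF s] direct_sum_simps using A(4) B(4) cl s by simp
 }
 {
  fix s a assume s: "s : Sec E V" "a : Reg n V"
  show "?c q V (a \<odot>\<^bsub>sec E V\<^esub> s) = sm (iR n V a) (?c q V s)"
   unfolding T(3)[OF s(2,1)] direct_sum_simps using A(5)[OF s(2)] B(5)[OF s(2)] cl s by (simp add: sm_def)
 }
next
 fix q V s W assume q: "q : proj_space n" and V: "zariski_open n V" "V <= U q" and s: "s : Sec E V"
  and W: "zariski_open n W" "W ~= {}" "W <= V"
 have V0: "V ~= {}" using W by auto
 note T = is_iso_onD[OF \<theta> V(1) zariski_open_subset[OF V(1)]]
 have cl: "fst (\<theta> V s) : Sec L V" "snd (\<theta> V s) : Sec M V"
  using bij_betwE[OF T(1)] s unfolding direct_sum_simps by (auto simp: mem_Times_iff)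
 show "?c q W (res E V W s) = ?c q V s" unfolding T(4)[OF W(1,3) s] direct_sum_simps
  using free_coordinates(6)[OF U(2)[OF q] V(1) V0 V(2) W cl(1)] free_coordinates(6)[OF U(3)[OF q] V(1) V0 V(2) W cl(2)] by simp
qed

text \<open>The two trivialisations are unrelated, but both recognise the zero section, here through
  \<open>m \<oplus> m = m\<close>.\<close>

lemma coordinate_zero_independent:
 assumes M: "presheaf_of_modules n M" and \<beta>: "is_iso_on n X M (free_sheaf n 1) \<beta>" "is_iso_on n Y M (free_sheaf n 1) \<gamma>"
  and W: "zariski_open n W" "W ~= {}" "W <= X" "W <= Y" and m: "m : Sec M W" and z: "iR n W (\<beta> W m 0) = 0"
 shows "iR n W (\<gamma> W m 0) = 0"
proof -
 interpret Module.module "reg_ring n W" "sec M W" by (rule presheafD(1)[OF M W(1)])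
 note B = free_coordinates[OF \<beta>(1) W(1-3)] and C = free_coordinates[OF \<beta>(2) W(1,2,4)]
 have "m \<oplus>\<^bsub>sec M W\<^esub> m = m" by (rule B(2)) (use m B(4)[OF m m, of 0] z in auto)
 hence "iR n W (\<gamma> W m 0) = iR n W (\<gamma> W m 0) + iR n W (\<gamma> W m 0)" using C(4)[OF m m, of 0] by simp
 thus ?thesis by (simp only: add_cancel_right_right)
qed

theorem split_imp_vanishing:
 assumes E: "sheaf_of_modules n E" and L: "line_bundle n L" and M: "line_bundle n M"
  and iso: "isomorphic_on n (proj_space n) E (direct_sum L M)" and i: "0 < i" "i < n"
 shows "cohomology_vanishes n (twist n E t) i"
proof -
 obtain \<theta> where \<theta>: "is_iso_on n (proj_space n) E (direct_sum L M) \<theta>" using iso unfolding isomorphic_on_def by blast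
 have pL: "presheaf_of_modules n L" and pM: "presheaf_of_modules n M"
  using L M unfolding vector_bundle_def sheaf_of_modules_def by blast+
 have "ALL q:proj_space n. EX X. zariski_open n (fst X) & q : fst X & is_iso_on n (fst X) L (free_sheaf n 1) (fst (snd X)) &
  is_iso_on n (fst X) M (free_sheaf n 1) (snd (snd X))"
 proof
  fix q assume q: "q : proj_space n"
  obtain A \<alpha> where A: "zariski_open n A" "q : A" "is_iso_on n A L (free_sheaf n 1) \<alpha>"
   using L q unfolding vector_bundle_def isomorphic_on_def by auto
  obtain B \<beta> where B: "zariski_open n B" "q : B" "is_iso_on n B M (free_sheaf n 1) \<beta>"
   using M q unfolding vector_bundle_def isomorphic_on_def by auto
  have "zariski_open n (A \<inter> B)" "is_iso_on n (A \<inter> B) L (free_sheaf n 1) \<alpha>" "is_iso_on n (A \<inter> B) M (free_sheaf n 1) \<beta>"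
   using zariski_open_Int[OF A(1) B(1)] is_iso_on_subset[OF A(3)] is_iso_on_subset[OF B(3)] by auto
  thus "EX X. zariski_open n (fst X) & q : fst X & is_iso_on n (fst X) L (free_sheaf n 1) (fst (snd X)) &
   is_iso_on n (fst X) M (free_sheaf n 1) (snd (snd X))"
   using A(2) B(2) by (intro exI[of _ "(A \<inter> B, \<alpha>, \<beta>)"]) simp
 qed
 then obtain X where X: "ALL q:proj_space n. zariski_open n (fst (X q)) & q : fst (X q) &
  is_iso_on n (fst (X q)) L (free_sheaf n 1) (fst (snd (X q))) & is_iso_on n (fst (X q)) M (free_sheaf n 1) (snd (snd (X q)))"
  by (rule bchoice[THEN exE])
 define U where "U q = fst (X q)" for q
 define \<alpha> where "\<alpha> q = fst (snd (X q))" for q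
 define \<beta> where "\<beta> q = snd (snd (X q))" for q
 have charts: "zariski_open n (U q) & q : U q" "is_iso_on n (U q) L (free_sheaf n 1) (\<alpha> q)" "is_iso_on n (U q) M (free_sheaf n 1) (\<beta> q)"
  if "q : proj_space n" for q using X that unfolding U_def \<alpha>_def \<beta>_def by auto
 interpret charted_sheaf n E U "%q V s. (iR n V (\<alpha> q V (fst (\<theta> V s)) 0), iR n V (\<beta> q V (snd (\<theta> V s)) 0))"
  by (rule charted_of_direct_sum[OF E \<theta> charts])
 \<comment> \<open>A frame vector of one summand has no component in the other over its own chart,
   hence none in the base chart.\<close>
 have diag: "snd (e1 q) = 0" "fst (e2 q) = 0" if q: "q : proj_space n" for q
 proof -
  have Uo: "zariski_open n (U q)" "U q ~= {}" using charts(1)[OF q] by auto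
  define W where "W = U q \<inter> U base"
  have W: "zariski_open n W" "W ~= {}" "W <= U q" "W <= U base" unfolding W_def using base_open[OF Uo] by auto
  note T = is_iso_onD[OF \<theta> W(1) zariski_open_subset[OF W(1)]]
  have cl: "fst (\<theta> W s) : Sec L W" "snd (\<theta> W s) : Sec M W" if "s : Sec E W" for s
   using bij_betwE[OF T(1)] that unfolding direct_sum_simps by (auto simp: mem_Times_iff)
  note f1 = frame[OF q, of "(1, 0)", simplified] and f2 = frame[OF q, of "(0, 1)", simplified]
  define s1 where "s1 = res E (U q) W (frame (1, 0) q)"
  define s2 where "s2 = res E (U q) W (frame (0, 1) q)"
  have c1: "s1 : Sec E W" "s2 : Sec E W"
   unfolding s1_def s2_def using presheafD(3)[OF presheaf Uo(1) W(1,3)] f1(1) f2(1) by auto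
  have "iR n W (\<beta> q W (snd (\<theta> W s1)) 0) = 0" using c_res[OF q Uo(1) _ f1(1) W(1-3)] f1(2) unfolding s1_def by simp
  hence "iR n W (\<beta> base W (snd (\<theta> W s1)) 0) = 0"
   by (rule coordinate_zero_independent[OF pM charts(3)[OF q] charts(3)[OF base] W cl(2)[OF c1(1)]])
  thus "snd (e1 q) = 0" unfolding e1_def psi_def W_def[symmetric] s1_def by simp
  have "iR n W (\<alpha> q W (fst (\<theta> W s2)) 0) = 0" using c_res[OF q Uo(1) _ f2(1) W(1-3)] f2(2) unfolding s2_def by simp
  hence "iR n W (\<alpha> base W (fst (\<theta> W s2)) 0) = 0"
   by (rule coordinate_zero_independent[OF pL charts(2)[OF q] charts(2)[OF base] W cl(1)[OF c1(2)]])
  thus "fst (e2 q) = 0" unfolding e2_def psi_def W_def[symmetric] s2_def by simp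
 qed
 have "stalk_vanishing n (lat t) i" by (rule diagonal_vanishing) (use diag i in auto)
 thus ?thesis using twist_vanishing by blast
qed

section \<open>Splitting from a global frame\<close>

context charted_sheaf
begin

text \<open>The multiples of a fixed vector form a subsheaf, so the summands keep the section type
  of \<open>E\<close>. The condition is void over the empty set, where \<open>psi\<close> carries no
  meaning.\<close>

definition line_sheaf :: "rat2 => 'a presheaf" where
 "line_sheaf w = \<lparr>sec = (%V. (sec E V)\<lparr>carrier := {s : Sec E V. V ~= {} --> (EX k. psi V s = sm k w)}\<rparr>), res = res E\<rparr>"

lemma line_sheaf_simps:
 "Sec (line_sheaf w) V = {s : Sec E V. V ~= {} --> (EX k. psi V s = sm k w)}"
 "s \<oplus>\<^bsub>sec (line_sheaf w) V\<^esub> t = s \<oplus>\<^bsub>sec E V\<^esub> t" "\<zero>\<^bsub>sec (line_sheaf w) V\<^esub> = \<zero>\<^bsub>sec E V\<^esub>"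
 "a \<odot>\<^bsub>sec (line_sheaf w) V\<^esub> s = a \<odot>\<^bsub>sec E V\<^esub> s" "res (line_sheaf w) = res E"
 by (simp_all add: line_sheaf_def)

lemma line_sheaf_model: "linear_model n (line_sheaf w) (%z. lat 0 z \<inter> {sm k w | k. True}) psi"
proof
 fix V assume V: "zariski_open n V" "V ~= {}"
 show "bij_betw (psi V) (Sec (line_sheaf w) V) {x. ALL z:V. x : lat 0 z \<inter> {sm k w | k. True}}"
 proof (rule bij_betw_imageI)
  show "inj_on (psi V) (Sec (line_sheaf w) V)"
   by (rule inj_onI) (use psi_inj[OF V] in \<open>auto simp: line_sheaf_simps\<close>)
  show "psi V ` Sec (line_sheaf w) V = {x. ALL z:V. x : lat 0 z \<inter> {sm k w | k. True}}"
  proof (intro subset_antisym subsetI)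
   fix x assume x: "x : {x. ALL z:V. x : lat 0 z \<inter> {sm k w | k. True}}"
   obtain s where s: "s : Sec E V" "psi V s = x" using psi_surj[OF V, of x] x by blast
   have "EX k. x = sm k w" using x V by blast
   thus "x : psi V ` Sec (line_sheaf w) V" unfolding line_sheaf_simps using s by (intro image_eqI[of _ _ s]) auto
  next
   fix x assume "x : psi V ` Sec (line_sheaf w) V"
   thus "x : {x. ALL z:V. x : lat 0 z \<inter> {sm k w | k. True}}"
    unfolding line_sheaf_simps using psi_lat[OF V(1)] V(2) by blast
  qed
 qed
 show "\<zero>\<^bsub>sec (line_sheaf w) V\<^esub> : Sec (line_sheaf w) V & psi V \<zero>\<^bsub>sec (line_sheaf w) V\<^esub> = 0"
  using model.zero[OF V] by (auto simp: line_sheaf_simps intro!: exI[of _ 0])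
 {
  fix s t assume s: "s : Sec (line_sheaf w) V" and t: "t : Sec (line_sheaf w) V"
  obtain k where k: "s : Sec E V" "psi V s = sm k w" using s V unfolding line_sheaf_simps by blast
  obtain l where l: "t : Sec E V" "psi V t = sm l w" using t V unfolding line_sheaf_simps by blast
  show "s \<oplus>\<^bsub>sec (line_sheaf w) V\<^esub> t : Sec (line_sheaf w) V &
    psi V (s \<oplus>\<^bsub>sec (line_sheaf w) V\<^esub> t) = psi V s + psi V t"
   using model.add[OF V k(1) l(1)] k(2) l(2) by (auto simp: line_sheaf_simps K2.scale_left_distrib intro!: exI[of _ "k + l"])
 }
 {
  fix a s assume a: "a : Reg n V" and s: "s : Sec (line_sheaf w) V"
  obtain k where k: "s : Sec E V" "psi V s = sm k w" using s V unfolding line_sheaf_simps by blast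
  show "a \<odot>\<^bsub>sec (line_sheaf w) V\<^esub> s : Sec (line_sheaf w) V &
    psi V (a \<odot>\<^bsub>sec (line_sheaf w) V\<^esub> s) = sm (iR n V a) (psi V s)"
   using model.smult[OF V a k(1)] k(2) by (auto simp: line_sheaf_simps intro!: exI[of _ "iR n V a * k"])
 }
next
 fix z x y assume z: "z : proj_space n" and "x : lat 0 z \<inter> {sm k w | k. True}" "y : lat 0 z \<inter> {sm k w | k. True}"
 then obtain k l where "x = sm k w" "y = sm l w" "x : lat 0 z" "y : lat 0 z" by blast
 hence "x - y = sm (k - l) w" "x - y : lat 0 z" using lat_diff by (simp_all add: K2.scale_left_diff_distrib)
 thus "x - y : lat 0 z \<inter> {sm k w | k. True}" by blast
next
 fix z assume "z : proj_space n"
 moreover have "0 = sm 0 w" by simp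
 ultimately show "0 : lat 0 z \<inter> {sm k w | k. True}" using lat_0 by blast
next
 fix V W s assume V: "zariski_open n V" and W: "zariski_open n W" "W ~= {}" "W <= V" and s: "s : Sec (line_sheaf w) V"
 have "V ~= {}" using W by auto
 hence "s : Sec E V" "EX k. psi V s = sm k w" using s unfolding line_sheaf_simps by auto
 thus "res (line_sheaf w) V W s : Sec (line_sheaf w) W & psi W (res (line_sheaf w) V W s) = psi V s"
  using model.res[OF V W] unfolding line_sheaf_simps by simp
qed (use model.empty model.empty_res in \<open>auto simp: line_sheaf_simps\<close>)

text \<open>Where \<open>v j\<close> does not vanish, its power with exponent \<open>b\<close> is a
  unit of degree \<open>b\<close> and trivialises the twist; the two \<open>nat\<close> exponents
  cover both signs of \<open>b\<close>.\<close>

lemma line_sheaf_line_bundle: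
 assumes w: "w ~= 0" and l: "!!z k. z : proj_space n ==> sm k w : lat 0 z \<longleftrightarrow> k : loc n (- b) z"
 shows "line_bundle n (line_sheaf w)" unfolding vector_bundle_def openin_zariski
proof (intro conjI ballI)
 show "sheaf_of_modules n (line_sheaf w)" by (rule linear_model.sheaf[OF line_sheaf_model])
 fix q assume q: "q : proj_space n"
 obtain j where j: "j <= n" "nz (mX j) q" using exists_coordinate[OF q] .
 define X where "X = ptD n (mX j)"
 have X: "zariski_open n X" "q : X" unfolding X_def using open_ptD[OF hom_simps(4)[OF j(1)]] j q by (auto simp: ptD_def)
 define u where "u = Fract (mX j ^ nat b) (mX j ^ nat (- b))"
 have u: "u : ulc n b z" if "z : X" for z unfolding u_def
  by (rule ulcI[OF hom_power[OF hom_simps(4)[OF j(1)]] hom_power[OF hom_simps(4)[OF j(1)]]])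
   (use that nz_power in \<open>auto simp: X_def ptD_def\<close>)
 have u0: "u ~= 0" using ulc_nonzero[OF u[OF X(2)]] .
 have P: "z : proj_space n" if "z : X" for z using zariski_open_subset[OF X(1)] that by blast
 have "isomorphic_on n X (line_sheaf w) (free_sheaf n 1)"
 proof (rule linear_model_iso[OF line_sheaf_model free_sheaf_linear_model, where T = "%v. (cf w v * u, 0)"])
  fix V x assume V: "zariski_open n V" "V ~= {}" "V <= X" and x: "ALL z:V. x : lat 0 z \<inter> {sm k w | k. True}"
  show "ALL z:V. (cf w x * u, 0) : {x. fst x : loc n 0 z & snd x = 0}"
  proof
   fix z assume z: "z : V"
   then obtain k where k: "x = sm k w" "sm k w : lat 0 z" using x by blast
   hence "k : loc n (- b) z" using l P V(3) z by blast
   from loc_mult[OF this ulc_loc[OF u]] show "(cf w x * u, 0) : {x. fst x : loc n 0 z & snd x = 0}"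
    using z V(3) cf_sm[OF w] k(1) by auto
  qed
 next
  fix V and y :: rat2 assume V: "zariski_open n V" "V ~= {}" "V <= X" and y: "ALL z:V. y : {x. fst x : loc n 0 z & snd x = 0}"
  have "sm (fst y * inverse u) w : lat 0 z" if z: "z : V" for z
  proof -
   have "fst y * inverse u : loc n (0 + - b) z" by (rule loc_mult[OF _ ulc_loc[OF ulc_inverse[OF u]]]) (use y z V in auto)
   thus ?thesis using l P V(3) z by auto
  qed
  moreover have "(cf w (sm (fst y * inverse u) w) * u, 0) = y" using y V(2) u0 cf_sm[OF w] by (auto simp: prod_eq_iff)
  ultimately show "EX x. (ALL z:V. x : lat 0 z \<inter> {sm k w | k. True}) & (cf w x * u, 0) = y" by blast
 next
  fix z x y assume "x : lat 0 z \<inter> {sm k w | k. True}" "y : lat 0 z \<inter> {sm k w | k. True}" and eq: "(cf w x * u, 0::rat) = (cf w y * u, 0)"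
  then obtain k k' where "x = sm k w" "y = sm k' w" by blast
  thus "x = y" using eq u0 cf_sm[OF w] by simp
 next
  show "(cf w (x + y) * u, 0) = (cf w x * u, 0) + (cf w y * u, 0 :: rat)" for x y
   by (simp add: cf_def add_divide_distrib algebra_simps)
  show "(cf w (sm a x) * u, 0) = sm a (cf w x * u, 0)" for a x by (simp add: cf_scale, simp add: sm_def)
 qed
 thus "EX U. zariski_open n U & q : U & isomorphic_on n U (line_sheaf w) (free_sheaf n 1)" using X by blast
qed

text \<open>The direct sum of the two line sheaves has the sum of the values as its model, with the
  same stalks as \<open>E\<close>; the isomorphism is the identity on values.\<close>

theorem splits_of_global_frame:
 assumes d: "det2 x y ~= 0" and lat: "!!z. z : proj_space n ==> lat 0 z = span2 n x (- a) y (- b) z"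
 shows "splits n E"
proof -
 have x0: "x ~= 0" and y0: "y ~= 0" using d by (auto simp: det2_def)
 have lx: "sm k x : lat 0 z \<longleftrightarrow> k : loc n (- a) z" and ly: "sm k y : lat 0 z \<longleftrightarrow> k : loc n (- b) z" if z: "z : proj_space n" for z k
 proof -
  have "k = k'" if "sm k x = sm k' x + sm l y" for k' l using basis_unique[OF d, of k 0 k' l] that by simp
  moreover have "k = l" if "sm k y = sm k' x + sm l y" for k' l using basis_unique[OF d, of 0 k k' l] that by simp
  moreover have "sm k x = sm k x + sm 0 y" "sm k y = sm 0 x + sm k y" by simp_all
  ultimately show "sm k x : lat 0 z \<longleftrightarrow> k : loc n (- a) z" "sm k y : lat 0 z \<longleftrightarrow> k : loc n (- b) z"
   unfolding lat[OF z] span2_def using loc_0[OF z] by blast+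
 qed
 interpret L: linear_model n "line_sheaf x" "%z. lat 0 z \<inter> {sm k x | k. True}" psi by (rule line_sheaf_model)
 interpret M: linear_model n "line_sheaf y" "%z. lat 0 z \<inter> {sm k y | k. True}" psi by (rule line_sheaf_model)
 let ?D = "direct_sum (line_sheaf x) (line_sheaf y)" and ?\<Gamma> = "%V st. psi V (fst st) + psi V (snd st)"
 have mult: "EX k. psi V s = sm k w" if "V ~= {}" "s : Sec (line_sheaf w) V" for V s w
  using that unfolding line_sheaf_simps by blast
 have "linear_model n ?D (lat 0) ?\<Gamma>"
 proof
  fix V assume V: "zariski_open n V" "V ~= {}"
  have P: "z : proj_space n" if "z : V" for z using zariski_open_subset[OF V(1)] that by blast
  show "bij_betw (?\<Gamma> V) (Sec ?D V) {x. ALL z:V. x : lat 0 z}"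
  proof (rule bij_betw_imageI)
   show "inj_on (?\<Gamma> V) (Sec ?D V)"
   proof (rule inj_onI)
    fix p p' assume p: "p : Sec ?D V" "p' : Sec ?D V" and eq: "?\<Gamma> V p = ?\<Gamma> V p'"
    have c: "fst p : Sec (line_sheaf x) V" "snd p : Sec (line_sheaf y) V"
     "fst p' : Sec (line_sheaf x) V" "snd p' : Sec (line_sheaf y) V"
     using p unfolding direct_sum_simps by (auto simp: mem_Times_iff)
    obtain k l k' l' where kl: "psi V (fst p) = sm k x" "psi V (snd p) = sm l y" "psi V (fst p') = sm k' x" "psi V (snd p') = sm l' y"
     using mult[OF V(2) c(1)] mult[OF V(2) c(2)] mult[OF V(2) c(3)] mult[OF V(2) c(4)] by (elim exE) (rule that)
    have "k = k'" "l = l'" using basis_unique[OF d] eq unfolding kl by blast+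
    hence "fst p = fst p'" "snd p = snd p'" using L.inj[OF V c(1,3)] M.inj[OF V c(2,4)] kl by simp_all
    thus "p = p'" by (simp add: prod_eq_iff)
   qed
   show "?\<Gamma> V ` Sec ?D V = {x. ALL z:V. x : lat 0 z}"
   proof (intro subset_antisym subsetI)
    fix v assume "v : ?\<Gamma> V ` Sec ?D V"
    then obtain p where p: "p : Sec ?D V" "v = ?\<Gamma> V p" by blast
    have c: "fst p : Sec (line_sheaf x) V" "snd p : Sec (line_sheaf y) V"
     using p unfolding direct_sum_simps by (auto simp: mem_Times_iff)
    show "v : {x. ALL z:V. x : lat 0 z}" unfolding p(2)
     using lat_add[OF P] L.M_values[OF V(1) _ c(1)] M.M_values[OF V(1) _ c(2)] by simp
   next
    fix v assume v: "v : {x. ALL z:V. x : lat 0 z}"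
    obtain z0 where z0: "z0 : V" using V by blast
    obtain k l where kl: "v = sm k x + sm l y" using v z0 lat[OF P[OF z0]] unfolding span2_def by blast
    have kz: "k : loc n (- a) z & l : loc n (- b) z" if z: "z : V" for z
    proof -
     obtain k' l' where kl': "v = sm k' x + sm l' y" "k' : loc n (- a) z" "l' : loc n (- b) z"
      using v z lat[OF P[OF z]] unfolding span2_def by blast
     show ?thesis using basis_unique[OF d kl[unfolded kl'(1), symmetric]] kl' by simp
    qed
    have "EX s:Sec (line_sheaf x) V. psi V s = sm k x" by (rule L.surj[OF V]) (use kz lx P in blast)
    then obtain s where s: "s : Sec (line_sheaf x) V" "psi V s = sm k x" by blast
    have "EX s:Sec (line_sheaf y) V. psi V s = sm l y" by (rule M.surj[OF V]) (use kz ly P in blast)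
    then obtain t where t: "t : Sec (line_sheaf y) V" "psi V t = sm l y" by blast
    have "v = ?\<Gamma> V (s, t)" "(s, t) : Sec ?D V" using s t kl by (simp_all add: direct_sum_simps)
    thus "v : ?\<Gamma> V ` Sec ?D V" by blast
   qed
  qed
  show "\<zero>\<^bsub>sec ?D V\<^esub> : Sec ?D V & ?\<Gamma> V \<zero>\<^bsub>sec ?D V\<^esub> = 0"
   using L.zero[OF V] M.zero[OF V] by (simp add: direct_sum_simps)
  show "p \<oplus>\<^bsub>sec ?D V\<^esub> p' : Sec ?D V & ?\<Gamma> V (p \<oplus>\<^bsub>sec ?D V\<^esub> p') = ?\<Gamma> V p + ?\<Gamma> V p'"
   if "p : Sec ?D V" "p' : Sec ?D V" for p p'
   using that L.add[OF V] M.add[OF V] unfolding direct_sum_simps mem_Times_iff by (simp add: algebra_simps)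
  show "r \<odot>\<^bsub>sec ?D V\<^esub> p : Sec ?D V & ?\<Gamma> V (r \<odot>\<^bsub>sec ?D V\<^esub> p) = sm (iR n V r) (?\<Gamma> V p)"
   if "r : Reg n V" "p : Sec ?D V" for r p
   using that L.smult[OF V] M.smult[OF V] unfolding direct_sum_simps mem_Times_iff by (simp add: K2.scale_right_distrib)
 next
  fix V W p assume "zariski_open n V" "zariski_open n W" "W ~= {}" "W <= V" "p : Sec ?D V"
  thus "res ?D V W p : Sec ?D W & ?\<Gamma> W (res ?D V W p) = ?\<Gamma> V p"
   using L.res[of V W] M.res[of V W] unfolding direct_sum_simps mem_Times_iff by simp
 next
  fix V p assume "zariski_open n V" "p : Sec ?D V"
  thus "res ?D V {} p = \<zero>\<^bsub>sec ?D {}\<^esub>"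
   using L.empty_res[of V] M.empty_res[of V] unfolding direct_sum_simps mem_Times_iff prod_eq_iff by simp
 qed (use lat_0 lat_diff L.empty M.empty in \<open>auto simp: direct_sum_simps prod_eq_iff\<close>)
 hence "isomorphic_on n (proj_space n) E ?D"
  by (rule linear_model_iso[OF model.linear_model_axioms, where T = "%v. v"]) auto
 moreover have "line_bundle n (line_sheaf x)" "line_bundle n (line_sheaf y)"
  using line_sheaf_line_bundle[OF x0 lx] line_sheaf_line_bundle[OF y0 ly] by auto
 ultimately show ?thesis unfolding splits_def by blast
qed

end

theorem proposition2p1:
  fixes n :: nat and m :: int and E :: "'a presheaf"
  assumes "vector_bundle n 2 E"
    and "cohomology_vanishes n (twist n E (m - 1)) 0"
    and "\<not> cohomology_vanishes n (twist n E m) 0"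
  shows "splits n E \<longleftrightarrow>
    (\<forall>i. 0 < i \<and> i < n \<longrightarrow> cohomology_vanishes n (twist n E (m - 1 - int i)) i)"
proof
 have E: "sheaf_of_modules n E" using assms(1) unfolding vector_bundle_def by blast
 {
  assume "splits n E"
  thus "ALL i. 0 < i & i < n --> cohomology_vanishes n (twist n E (m - 1 - int i)) i"
   unfolding splits_def using split_imp_vanishing[OF E] by blast
 }
 assume v: "ALL i. 0 < i & i < n --> cohomology_vanishes n (twist n E (m - 1 - int i)) i"
 have "ALL q:proj_space n. EX X. zariski_open n (fst X) & q : fst X & is_iso_on n (fst X) E (free_sheaf n 2) (snd X)"
  using assms(1) unfolding vector_bundle_def isomorphic_on_def openin_zariski by (metis fst_conv snd_conv)
 then obtain X where X: "ALL q:proj_space n. zariski_open n (fst (X q)) & q : fst (X q) & is_iso_on n (fst (X q)) E (free_sheaf n 2) (snd (X q))"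
  by (rule bchoice[THEN exE])
 interpret charted_sheaf n E "%q. fst (X q)" "%q V s. (iR n V (snd (X q) V s 0), iR n V (snd (X q) V s 1))"
  by (rule charted_of_trivialisation[OF E]) (use X in auto)
 have "EX x y a c. det2 x y ~= 0 & (ALL z:proj_space n. ALL t. lat t z = span2 n x (t - a) y (t - c) z)"
  by (rule splitting) (use assms(2,3) v in \<open>auto simp: twist_vanishing\<close>)
 \<comment> \<open>At twist zero the global frame describes \<open>E\<close> itself.\<close>
 then obtain x y a c where xy: "det2 x y ~= 0" "!!z. z : proj_space n ==> lat 0 z = span2 n x (0 - a) y (0 - c) z" by blast
 show "splits n E" by (rule splits_of_global_frame[OF xy(1)]) (use xy(2) in auto)
qed

end
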